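(* Let $X$ be a compact complex manifold, $D\subseteq X$ a simple normal crossings divisor with components $D_1,\dots,D_m$, sections $s_k$ of $\mathcal{O}(D_k)$ with $\operatorname{div}s_k=D_k$, smooth metrics with $\|s_k\|_k^2\le e^{-e}$, and $\Theta_N=\sum_{k=1}^m(\log\log\|s_k\|_k^{-2})^N$. Let $\omega$ be a smooth positive $(1,1)$-form on $X$ and $f:X\setminus D\to\mathbb{R}$ a pre-log-log function with singularities along $D$. Then there exist nonnegative pre-log-log functions $\varphi,\psi:X\setminus D\to\mathbb{R}_{\geq0}$ with singularities along $D$ and constants $A,B\geq0$, $N\in\mathbb{Z}_{\geq0}$ such that: (i) $f=\varphi-\psi$; (ii) on $X\setminus D$, $dd^c(-\varphi)+B\Theta_N(dd^c(-\Theta_1)+A\omega)\geq0$ and $dd^c(-\psi)+B\Theta_N(dd^c(-\Theta_1)+A\omega)\geq0$; if $f$ is P-singular, $N$ can be chosen to be $0$; (iii) if $f$ is P-singular, one can take $\varphi,\psi$ to be P-singular with $dd^c(-\varphi)+A\omega\geq0$ and $dd^c(-\psi)+A\omega\geq0$ on $X\setminus D$.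
   Context: $dd^c=\frac{i}{2\pi}\partial\bar\partial$. In an adapted chart $(V;z)$ ($|z_i|<1/e$, $D\cap V=\{z_1\cdots z_m=0\}$), put $d\zeta_k=dz_k/(z_k\log|z_k|^{-1})$ for $k\le m$, $d\zeta_k=dz_k$ for $k>m$. A form on $X\setminus D$ has log-log growth if it is locally a sum of products of $d\zeta_k,d\bar\zeta_k$ with smooth coefficients bounded on each $V'\Subset V$ by $C\prod_{k\le m}(\log\log|z_k|^{-1})^N$; Poincaré growth if the coefficients are locally bounded. A smooth function $f$ on $X\setminus D$ is pre-log-log if $f,\partial f,\bar\partial f,\partial\bar\partial f$ have log-log growth; P-singular if $df$ and $dd^cf$ have Poincaré growth. *)

theory Defs
  imports "HOL-Analysis.Analysis"
begin

section \<open>Smooth and holomorphic functions on open subsets of \<open>\<complex>\<^sup>n\<close>\<close>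

primrec Ck_on :: "nat \<Rightarrow> 'e::real_normed_vector set \<Rightarrow> ('e \<Rightarrow> 'f::real_normed_vector) \<Rightarrow> bool" where
  "Ck_on 0 S f \<longleftrightarrow> continuous_on S f"
| "Ck_on (Suc k) S f \<longleftrightarrow> (\<forall>x\<in>S. f differentiable (at x)) \<and>
     (\<forall>v. Ck_on k S (\<lambda>x. frechet_derivative f (at x) v))"

definition smooth_on :: "'e::real_normed_vector set \<Rightarrow> ('e \<Rightarrow> 'f::real_normed_vector) \<Rightarrow> bool" where
  "smooth_on S f \<longleftrightarrow> (\<forall>k. Ck_on k S f)"

definition holo_on :: "(complex^'n) set \<Rightarrow> (complex^'n \<Rightarrow> complex) \<Rightarrow> bool" where
  "holo_on S g \<longleftrightarrow> (\<forall>x\<in>S. \<exists>T. (g has_derivative T) (at x) \<and> (\<forall>c v. T (c *s v) = c * T v))"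

text \<open>Wirtinger derivatives \<open>\<partial>/\<partial>z\<^sub>i\<close> and \<open>\<partial>/\<partial>\<close>(conjugate of \<open>z\<^sub>i\<close>).\<close>

definition wirt :: "'n \<Rightarrow> (complex^'n \<Rightarrow> complex) \<Rightarrow> complex^'n \<Rightarrow> complex" where
  "wirt i g p = (frechet_derivative g (at p) (axis i 1)
                 - \<i> * frechet_derivative g (at p) (axis i \<i>)) / 2"

definition wirt_bar :: "'n \<Rightarrow> (complex^'n \<Rightarrow> complex) \<Rightarrow> complex^'n \<Rightarrow> complex" where
  "wirt_bar i g p = (frechet_derivative g (at p) (axis i 1)
                     + \<i> * frechet_derivative g (at p) (axis i \<i>)) / 2"


section \<open>Complex manifolds\<close>

text \<open>The manifold is the whole type \<open>'a\<close>; a chart is a pair of a domain and a coordinate map,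
  and the values of the coordinate map outside the domain are irrelevant.\<close>

type_synonym ('a, 'n) chart = "'a set \<times> ('a \<Rightarrow> complex^'n)"

definition in_coords :: "('a, 'n) chart \<Rightarrow> ('a \<Rightarrow> 'b) \<Rightarrow> complex^'n \<Rightarrow> 'b" where
  "in_coords c f = f \<circ> inv_into (fst c) (snd c)"

definition topological_chart :: "('a::topological_space, 'n::finite) chart \<Rightarrow> bool" where
  "topological_chart c \<longleftrightarrow> (case c of (V, z) \<Rightarrow>
     open V \<and> inj_on z V \<and> open (z ` V) \<and> homeomorphism V (z ` V) z (inv_into V z))"

definition holo_compatible :: "('a, 'n::finite) chart \<Rightarrow> ('a, 'n) chart \<Rightarrow> bool" where
  "holo_compatible c d \<longleftrightarrow> (case (c, d) of ((V, z), (W, w)) \<Rightarrow>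
     \<forall>i. holo_on (z ` (V \<inter> W)) (in_coords c (\<lambda>x. w x $ i)) \<and>
         holo_on (w ` (V \<inter> W)) (in_coords d (\<lambda>x. z x $ i)))"

definition complex_atlas :: "('a::topological_space, 'n::finite) chart set \<Rightarrow> bool" where
  "complex_atlas \<A> \<longleftrightarrow> (\<forall>c\<in>\<A>. topological_chart c) \<and> (\<forall>c\<in>\<A>. \<forall>d\<in>\<A>. holo_compatible c d) \<and>
     (\<Union>c\<in>\<A>. fst c) = UNIV"

text \<open>The maximal atlas, i.e. all holomorphic charts of the manifold.\<close>

definition holo_charts :: "('a::topological_space, 'n::finite) chart set \<Rightarrow> ('a, 'n) chart set" where
  "holo_charts \<A> = {c. topological_chart c \<and> (\<forall>d\<in>\<A>. holo_compatible c d)}"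

definition mfd_smooth_on ::
  "('a::topological_space, 'n::finite) chart set \<Rightarrow> 'a set \<Rightarrow> ('a \<Rightarrow> 'b::real_normed_vector) \<Rightarrow> bool" where
  "mfd_smooth_on \<A> U f \<longleftrightarrow>
     (\<forall>(V, z)\<in>holo_charts \<A>. smooth_on (z ` (V \<inter> U)) (in_coords (V, z) f))"

definition mfd_holo_on ::
  "('a::topological_space, 'n::finite) chart set \<Rightarrow> 'a set \<Rightarrow> ('a \<Rightarrow> complex) \<Rightarrow> bool" where
  "mfd_holo_on \<A> U f \<longleftrightarrow>
     (\<forall>(V, z)\<in>holo_charts \<A>. holo_on (z ` (V \<inter> U)) (in_coords (V, z) f))"


section \<open>Differential forms\<close>

text \<open>A form is given by its coefficients in each chart: a pair \<open>(a, b)\<close> stands for the 1-form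
  with \<open>dz\<^sub>i\<close>-coefficients \<open>a $ i\<close> and \<open>d\<close>(conjugate of \<open>z\<^sub>i\<close>)-coefficients \<open>b $ i\<close>; a matrix \<open>a\<close>
  stands for the (1,1)-form whose coefficient at \<open>dz\<^sub>i \<and> d\<close>(conjugate of \<open>z\<^sub>j\<close>) is \<open>a $ i $ j\<close>.\<close>

type_synonym ('a, 'n) form1 = "('a, 'n) chart \<Rightarrow> 'a \<Rightarrow> (complex^'n) \<times> (complex^'n)"
type_synonym ('a, 'n) form11 = "('a, 'n) chart \<Rightarrow> 'a \<Rightarrow> complex^'n^'n"

definition del :: "('a \<Rightarrow> complex) \<Rightarrow> ('a, 'n::finite) form1" where
  "del f c x = ((\<chi> i. wirt i (in_coords c f) (snd c x)), 0)"

definition delbar :: "('a \<Rightarrow> complex) \<Rightarrow> ('a, 'n::finite) form1" where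
  "delbar f c x = (0, (\<chi> i. wirt_bar i (in_coords c f) (snd c x)))"

definition ext_d :: "('a \<Rightarrow> complex) \<Rightarrow> ('a, 'n::finite) form1" where
  "ext_d f c x = del f c x + delbar f c x"

definition del_delbar :: "('a \<Rightarrow> complex) \<Rightarrow> ('a, 'n::finite) form11" where
  "del_delbar f c x = (\<chi> i j. wirt i (wirt_bar j (in_coords c f)) (snd c x))"

definition ddc :: "('a \<Rightarrow> real) \<Rightarrow> ('a, 'n::finite) form11" where
  "ddc f c x = (\<chi> i j. \<i> / (2 * of_real pi) * del_delbar (\<lambda>y. complex_of_real (f y)) c x $ i $ j)"

text \<open>A global smooth (1,1)-form: smooth coefficients, transforming by
  \<open>dw\<^sub>k = \<Sum>\<^sub>i (\<partial>w\<^sub>k/\<partial>z\<^sub>i) dz\<^sub>i\<close>.\<close>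

definition smooth_form11 ::
  "('a::topological_space, 'n::finite) chart set \<Rightarrow> ('a, 'n) form11 \<Rightarrow> bool" where
  "smooth_form11 \<A> \<omega> \<longleftrightarrow>
     (\<forall>(V, z)\<in>holo_charts \<A>. \<forall>i j. smooth_on (z ` V) (in_coords (V, z) (\<lambda>x. \<omega> (V, z) x $ i $ j))) \<and>
     (\<forall>(V, z)\<in>holo_charts \<A>. \<forall>(W, w)\<in>holo_charts \<A>. \<forall>x\<in>V \<inter> W. \<forall>i j.
        \<omega> (V, z) x $ i $ j =
          (\<Sum>k\<in>UNIV. \<Sum>l\<in>UNIV. \<omega> (W, w) x $ k $ l
             * wirt i (in_coords (V, z) (\<lambda>y. w y $ k)) (z x)
             * cnj (wirt j (in_coords (V, z) (\<lambda>y. w y $ l)) (z x))))"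

text \<open>The form \<open>\<i> \<Sum> h\<^sub>i\<^sub>j dz\<^sub>i \<and> d\<close>(conjugate of \<open>z\<^sub>j\<close>) is nonnegative (positive) iff the matrix
  \<open>h\<close> is positive semidefinite (definite) Hermitian; here \<open>h = a / \<i>\<close>. Membership of all values
  \<open>herm_value a \<xi>\<close> in the reals makes \<open>h\<close> Hermitian.\<close>

definition herm_value :: "complex^'n^'n \<Rightarrow> complex^'n \<Rightarrow> complex" where
  "herm_value a \<xi> = (\<Sum>i\<in>UNIV. \<Sum>j\<in>UNIV. (a $ i $ j / \<i>) * \<xi> $ i * cnj (\<xi> $ j))"

definition nonneg_form11_on ::
  "('a::topological_space, 'n::finite) chart set \<Rightarrow> 'a set \<Rightarrow> ('a, 'n) form11 \<Rightarrow> bool" where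
  "nonneg_form11_on \<A> S \<alpha> \<longleftrightarrow> (\<forall>(V, z)\<in>holo_charts \<A>. \<forall>x\<in>V \<inter> S. \<forall>\<xi>.
     herm_value (\<alpha> (V, z) x) \<xi> \<in> \<real> \<and> Re (herm_value (\<alpha> (V, z) x) \<xi>) \<ge> 0)"

definition positive_form11 ::
  "('a::topological_space, 'n::finite) chart set \<Rightarrow> ('a, 'n) form11 \<Rightarrow> bool" where
  "positive_form11 \<A> \<alpha> \<longleftrightarrow> (\<forall>(V, z)\<in>holo_charts \<A>. \<forall>x\<in>V. \<forall>\<xi>. \<xi> \<noteq> 0 \<longrightarrow>
     herm_value (\<alpha> (V, z) x) \<xi> \<in> \<real> \<and> Re (herm_value (\<alpha> (V, z) x) \<xi>) > 0)"


section \<open>Simple normal crossings divisors\<close>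

text \<open>Near every point the components through it are distinct coordinate hyperplanes (so each
  component is closed and smooth, and no two coincide). A smooth hypersurface is irreducible iff
  it is nonempty and connected.\<close>

definition snc_divisor ::
  "('a::topological_space, 'n::finite) chart set \<Rightarrow> nat \<Rightarrow> (nat \<Rightarrow> 'a set) \<Rightarrow> bool" where
  "snc_divisor \<A> m D \<longleftrightarrow>
     (\<forall>k\<in>{1..m}. D k \<noteq> {} \<and> connected (D k)) \<and>
     (\<forall>p. \<exists>(V, z)\<in>holo_charts \<A>. \<exists>\<iota>. p \<in> V \<and> inj_on \<iota> {k\<in>{1..m}. p \<in> D k} \<and>
        (\<forall>k\<in>{1..m}. D k \<inter> V = (if p \<in> D k then {x\<in>V. z x $ \<iota> k = 0} else {})))"

text \<open>The holomorphic function \<open>e\<close> on \<open>U\<close> has divisor \<open>E \<inter> U\<close> (with multiplicity one), where \<open>E\<close>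
  is a smooth hypersurface: wherever \<open>E\<close> is a coordinate hyperplane, \<open>e\<close> is the corresponding
  coordinate times a unit, and it has no zeros outside \<open>E\<close>.\<close>

definition has_divisor ::
  "('a::topological_space, 'n::finite) chart set \<Rightarrow> 'a set \<Rightarrow> ('a \<Rightarrow> complex) \<Rightarrow> 'a set \<Rightarrow> bool" where
  "has_divisor \<A> U e E \<longleftrightarrow> mfd_holo_on \<A> U e \<and> (\<forall>x\<in>U. e x = 0 \<longleftrightarrow> x \<in> E) \<and>
     (\<forall>(V, z)\<in>holo_charts \<A>. \<forall>i. V \<subseteq> U \<and> E \<inter> V = {x\<in>V. z x $ i = 0} \<longrightarrow>
        (\<exists>u. mfd_holo_on \<A> V u \<and> (\<forall>x\<in>V. u x \<noteq> 0 \<and> e x = u x * z x $ i)))"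


section \<open>Holomorphic line bundles, sections and metrics\<close>

text \<open>A line bundle is given by an open trivializing cover and a cocycle; a section (a Hermitian
  metric) is given by its expression on each member of the cover.\<close>

record 'a line_bundle =
  triv_cover :: "'a set set"
  cocycle :: "'a set \<Rightarrow> 'a set \<Rightarrow> 'a \<Rightarrow> complex"

definition holo_line_bundle ::
  "('a::topological_space, 'n::finite) chart set \<Rightarrow> 'a line_bundle \<Rightarrow> bool" where
  "holo_line_bundle \<A> L \<longleftrightarrow>
     (\<forall>U\<in>triv_cover L. open U) \<and> \<Union>(triv_cover L) = UNIV \<and>
     (\<forall>U\<in>triv_cover L. \<forall>W\<in>triv_cover L. mfd_holo_on \<A> (U \<inter> W) (cocycle L U W) \<and>
        (\<forall>x\<in>U \<inter> W. cocycle L U W x \<noteq> 0)) \<and>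
     (\<forall>U\<in>triv_cover L. \<forall>W\<in>triv_cover L. \<forall>T\<in>triv_cover L. \<forall>x\<in>U \<inter> W \<inter> T.
        cocycle L U W x * cocycle L W T x = cocycle L U T x)"

definition holo_section ::
  "('a::topological_space, 'n::finite) chart set \<Rightarrow> 'a line_bundle \<Rightarrow> ('a set \<Rightarrow> 'a \<Rightarrow> complex) \<Rightarrow> bool" where
  "holo_section \<A> L s \<longleftrightarrow> (\<forall>U\<in>triv_cover L. mfd_holo_on \<A> U (s U)) \<and>
     (\<forall>U\<in>triv_cover L. \<forall>W\<in>triv_cover L. \<forall>x\<in>U \<inter> W. s U x = cocycle L U W x * s W x)"

definition section_divisor ::
  "('a::topological_space, 'n::finite) chart set \<Rightarrow> 'a line_bundle \<Rightarrow> ('a set \<Rightarrow> 'a \<Rightarrow> complex) \<Rightarrow> 'a set \<Rightarrow> bool" where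
  "section_divisor \<A> L s E \<longleftrightarrow> (\<forall>U\<in>triv_cover L. has_divisor \<A> U (s U) E)"

text \<open>\<open>L\<close> is \<open>\<O>(E)\<close>: its cocycle is the quotient of local equations of \<open>E\<close>.\<close>

definition is_O_of ::
  "('a::topological_space, 'n::finite) chart set \<Rightarrow> 'a line_bundle \<Rightarrow> 'a set \<Rightarrow> bool" where
  "is_O_of \<A> L E \<longleftrightarrow> holo_line_bundle \<A> L \<and>
     (\<exists>e. (\<forall>U\<in>triv_cover L. has_divisor \<A> U (e U) E) \<and>
        (\<forall>U\<in>triv_cover L. \<forall>W\<in>triv_cover L. \<forall>x\<in>U \<inter> W. e U x = cocycle L U W x * e W x))"

definition smooth_metric ::
  "('a::topological_space, 'n::finite) chart set \<Rightarrow> 'a line_bundle \<Rightarrow> ('a set \<Rightarrow> 'a \<Rightarrow> real) \<Rightarrow> bool" where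
  "smooth_metric \<A> L h \<longleftrightarrow>
     (\<forall>U\<in>triv_cover L. mfd_smooth_on \<A> U (h U) \<and> (\<forall>x\<in>U. h U x > 0)) \<and>
     (\<forall>U\<in>triv_cover L. \<forall>W\<in>triv_cover L. \<forall>x\<in>U \<inter> W. h W x = (norm (cocycle L U W x))\<^sup>2 * h U x)"

definition section_norm_sq ::
  "'a line_bundle \<Rightarrow> ('a set \<Rightarrow> 'a \<Rightarrow> real) \<Rightarrow> ('a set \<Rightarrow> 'a \<Rightarrow> complex) \<Rightarrow> 'a \<Rightarrow> real" where
  "section_norm_sq L h s x = (let U = (SOME U. U \<in> triv_cover L \<and> x \<in> U) in h U x * (norm (s U x))\<^sup>2)"


section \<open>Log-log growth and Poincare growth\<close>

text \<open>The coordinates cutting out \<open>D\<close> are those with index in \<open>M\<close> (instead of the first ones).\<close>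

definition adapted_chart ::
  "('a::topological_space, 'n::finite) chart set \<Rightarrow> 'a set \<Rightarrow> ('a, 'n) chart \<Rightarrow> 'n set \<Rightarrow> bool" where
  "adapted_chart \<A> D c M \<longleftrightarrow> c \<in> holo_charts \<A> \<and>
     (\<forall>x\<in>fst c. \<forall>i. norm (snd c x $ i) < 1 / exp 1) \<and>
     D \<inter> fst c = {x\<in>fst c. \<exists>i\<in>M. snd c x $ i = 0}"

text \<open>\<open>dz\<^sub>i = log_frame M z i \<cdot> d\<zeta>\<^sub>i\<close>.\<close>

definition log_frame :: "'n set \<Rightarrow> complex^'n \<Rightarrow> 'n \<Rightarrow> complex" where
  "log_frame M z i = (if i \<in> M then z $ i * of_real (ln (1 / norm (z $ i))) else 1)"

text \<open>The coefficients of a form with respect to the frame of the \<open>d\<zeta>\<^sub>i\<close> and their conjugates.\<close>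

definition frame_coeffs1 ::
  "('a, 'n::finite) chart \<Rightarrow> 'n set \<Rightarrow> ('a, 'n) form1 \<Rightarrow> ('a \<Rightarrow> complex) set" where
  "frame_coeffs1 c M \<alpha> =
     {\<lambda>x. fst (\<alpha> c x) $ i * log_frame M (snd c x) i | i. True} \<union>
     {\<lambda>x. snd (\<alpha> c x) $ i * cnj (log_frame M (snd c x) i) | i. True}"

definition frame_coeffs11 ::
  "('a, 'n::finite) chart \<Rightarrow> 'n set \<Rightarrow> ('a, 'n) form11 \<Rightarrow> ('a \<Rightarrow> complex) set" where
  "frame_coeffs11 c M \<alpha> =
     {\<lambda>x. \<alpha> c x $ i $ j * log_frame M (snd c x) i * cnj (log_frame M (snd c x) j) | i j. True}"

definition loglog_coeff ::
  "('a::topological_space, 'n::finite) chart set \<Rightarrow> 'a set \<Rightarrow> ('a, 'n) chart \<Rightarrow> 'n set \<Rightarrow> ('a \<Rightarrow> complex) \<Rightarrow> bool" where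
  "loglog_coeff \<A> D c M g \<longleftrightarrow> mfd_smooth_on \<A> (fst c - D) g \<and>
     (\<forall>V'. compact (closure V') \<and> closure V' \<subseteq> fst c \<longrightarrow>
        (\<exists>(C::real) (N::nat). \<forall>x\<in>V' - D.
           norm (g x) \<le> C * (\<Prod>i\<in>M. ln (ln (1 / norm (snd c x $ i))) ^ N)))"

text \<open>Local boundedness is required near all points of the chart, including those of \<open>D\<close>.\<close>

definition poincare_coeff ::
  "('a::topological_space, 'n::finite) chart set \<Rightarrow> 'a set \<Rightarrow> ('a, 'n) chart \<Rightarrow> 'n set \<Rightarrow> ('a \<Rightarrow> complex) \<Rightarrow> bool" where
  "poincare_coeff \<A> D c M g \<longleftrightarrow> mfd_smooth_on \<A> (fst c - D) g \<and>
     (\<forall>p\<in>fst c. \<exists>W (C::real). open W \<and> p \<in> W \<and> W \<subseteq> fst c \<and> (\<forall>x\<in>W - D. norm (g x) \<le> C))"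

text \<open>The growth conditions are imposed in every adapted chart.\<close>

definition loglog_growth0 where
  "loglog_growth0 \<A> D f \<longleftrightarrow> (\<forall>c M. adapted_chart \<A> D c M \<longrightarrow> loglog_coeff \<A> D c M f)"

definition loglog_growth1 where
  "loglog_growth1 \<A> D \<alpha> \<longleftrightarrow>
     (\<forall>c M. adapted_chart \<A> D c M \<longrightarrow> (\<forall>g\<in>frame_coeffs1 c M \<alpha>. loglog_coeff \<A> D c M g))"

definition loglog_growth11 where
  "loglog_growth11 \<A> D \<alpha> \<longleftrightarrow>
     (\<forall>c M. adapted_chart \<A> D c M \<longrightarrow> (\<forall>g\<in>frame_coeffs11 c M \<alpha>. loglog_coeff \<A> D c M g))"

definition poincare_growth1 where
  "poincare_growth1 \<A> D \<alpha> \<longleftrightarrow>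
     (\<forall>c M. adapted_chart \<A> D c M \<longrightarrow> (\<forall>g\<in>frame_coeffs1 c M \<alpha>. poincare_coeff \<A> D c M g))"

definition poincare_growth11 where
  "poincare_growth11 \<A> D \<alpha> \<longleftrightarrow>
     (\<forall>c M. adapted_chart \<A> D c M \<longrightarrow> (\<forall>g\<in>frame_coeffs11 c M \<alpha>. poincare_coeff \<A> D c M g))"

text \<open>Functions on the complement of \<open>D\<close> are total functions whose values on \<open>D\<close> are ignored.\<close>

definition pre_log_log ::
  "('a::topological_space, 'n::finite) chart set \<Rightarrow> 'a set \<Rightarrow> ('a \<Rightarrow> real) \<Rightarrow> bool" where
  "pre_log_log \<A> D f \<longleftrightarrow> (let F = (\<lambda>x. complex_of_real (f x)) in
     mfd_smooth_on \<A> (- D) f \<and> loglog_growth0 \<A> D F \<and> loglog_growth1 \<A> D (del F) \<and>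
     loglog_growth1 \<A> D (delbar F) \<and> loglog_growth11 \<A> D (del_delbar F))"

definition P_singular ::
  "('a::topological_space, 'n::finite) chart set \<Rightarrow> 'a set \<Rightarrow> ('a \<Rightarrow> real) \<Rightarrow> bool" where
  "P_singular \<A> D f \<longleftrightarrow> mfd_smooth_on \<A> (- D) f \<and>
     poincare_growth1 \<A> D (ext_d (\<lambda>x. complex_of_real (f x))) \<and> poincare_growth11 \<A> D (ddc f)"

end

theory Submission
  imports Defs "HOL-Complex_Analysis.Conformal_Mappings"
begin

text \<open>Put \<open>u\<^sub>k = log log \<parallel>s\<^sub>k\<parallel>\<^sup>-\<^sup>2\<close>. By the identity theorem the component \<open>D\<^sub>k\<close> is, near each of its points,
  one of the coordinate hyperplanes of any adapted chart, so \<open>u\<^sub>k\<close> is \<open>log log \<bar>z\<^sub>i\<bar>\<^sup>-\<^sup>2\<close> up to a smooth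
  perturbation of the inner logarithm. Hence \<open>\<Theta>\<^sub>1\<close> is P-singular and pre-log-log, and \<open>dd\<^sup>c(-\<Theta>\<^sub>1) + A\<omega>\<close>
  dominates the Poincare metric for large \<open>A\<close>, locally and then, by compactness, globally.
  A pre-log-log \<open>f\<close> satisfies \<open>\<bar>f\<bar> \<le> C \<Theta>\<^sub>1\<^sup>N\<close>, and its \<open>dd\<^sup>c\<close> is bounded by \<open>C \<Theta>\<^sub>1\<^sup>N\<close> times the Poincare metric.
  So \<open>\<psi> = C \<Theta>\<^sub>1\<^sup>N\<close> and \<open>\<phi> = f + \<psi>\<close> work, the sum \<open>\<Theta>\<^sub>N\<close> being comparable with \<open>\<Theta>\<^sub>1\<^sup>N\<close>. If \<open>f\<close> is P-singular,
  integrating \<open>df\<close> radially towards the divisor gives \<open>\<bar>f\<bar> \<le> C \<Theta>\<^sub>1\<close>, and \<open>\<psi> = C \<Theta>\<^sub>1\<close> suffices.\<close>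

section \<open>Smooth and holomorphic functions\<close>

text \<open>The positivity comes from one identity. For a log norm \<open>l\<close>, the form
  \<open>dd^c(-log l)\<close> is a positive multiple of
  \<open>|del l|^2 / l^2 - del delbar l / l\<close>. Near the component, \<open>l\<close> is a
  smooth function minus \<open>log |z_i|^2\<close>. The latter is pluriharmonic, so
  \<open>del delbar l\<close> stays bounded, while \<open>del l\<close> is
  \<open>- dz_i / z_i\<close> plus a bounded form and \<open>l\<close> is comparable with
  \<open>log 1/|z_i|\<close>. The square is thus the Poincare length in direction i up to Euclidean
  terms, which \<open>A \<omega>\<close> absorbs. Two obstacles shape the rest. The growth
  conditions range over all adapted charts, and such a chart sees D only as a whole, so its
  hyperplanes must first be matched with components. Moreover they involve products of iterated
  logarithms that depend on the chart; these are replaced by weights \<open>N * \<Theta>1^N\<close>,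
  comparable with them near every point. All bounds carry a single natural number, so that finitely
  many of them can be merged by addition and compactness applies.\<close>

lemma Ck_on_subset: "Ck_on k S f \<Longrightarrow> T \<subseteq> S \<Longrightarrow> Ck_on k T f"
  by (induction k arbitrary: f) (auto intro: continuous_on_subset)

text \<open>Openness of \<open>S\<close> matters: the derivatives in \<open>Ck_on\<close> are taken
  in the whole space, so agreement on \<open>S\<close> determines them only if \<open>S\<close> is a
  neighbourhood of each of its points.\<close>

lemma Ck_on_cong:
  assumes "open S" "\<And>x. x \<in> S \<Longrightarrow> f x = g x"
  shows "Ck_on k S f = Ck_on k S g"
  using assms(2)
proof (induction k arbitrary: f g)
  case 0
  then show ?case by (auto cong: continuous_on_cong)
next
  case (Suc k)
  have d: "f differentiable at x \<longleftrightarrow> g differentiable at x" if "x \<in> S" for x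
    using Suc.prems assms(1) that
    by (metis (no_types, lifting) differentiable_def has_derivative_transform_within_open)
  have e: "frechet_derivative f (at x) = frechet_derivative g (at x)" if "x \<in> S" for x
  proof -
    have "(f has_derivative D) (at x) \<longleftrightarrow> (g has_derivative D) (at x)" for D
      using Suc.prems assms(1) that
      by (metis (no_types, lifting) has_derivative_transform_within_open)
    then show ?thesis by (simp add: frechet_derivative_def)
  qed
  have "Ck_on k S (\<lambda>x. frechet_derivative f (at x) v) = Ck_on k S (\<lambda>x. frechet_derivative g (at x) v)" for v
    by (rule Suc.IH) (simp add: e)
  then show ?case using d by auto
qed

lemma Ck_on_SucD: "Ck_on (Suc k) S f \<Longrightarrow> Ck_on k S f"
proof (induction k arbitrary: f)
  case 0
  then show ?case
    by (auto intro!: continuous_at_imp_continuous_on differentiable_imp_continuous_within)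
next
  case (Suc k)
  then show ?case by (metis Ck_on.simps(2))
qed

lemma Ck_on_local:
  assumes "\<And>x. x \<in> S \<Longrightarrow> \<exists>T. open T \<and> x \<in> T \<and> Ck_on k T f"
  shows "Ck_on k S f"
  using assms
proof (induction k arbitrary: f)
  case 0
  then show ?case
    by (auto intro!: continuous_at_imp_continuous_on) (metis continuous_on_eq_continuous_at)
next
  case (Suc k)
  have "Ck_on k S (\<lambda>x. frechet_derivative f (at x) v)" for v
    using Suc.IH Suc.prems by (metis Ck_on.simps(2))
  moreover have "f differentiable at x" if "x \<in> S" for x
    using Suc.prems[OF that] by auto
  ultimately show ?case by simp
qed

lemma frechet_derivativeI: "(f has_derivative D) (at x) \<Longrightarrow> frechet_derivative f (at x) v = D v"
  using frechet_derivative_at by fastforce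

lemma Ck_on_const [simp]: "Ck_on k S (\<lambda>x. c)"
  by (induction k arbitrary: c) auto

lemma Ck_on_linear:
  assumes "bounded_linear f" shows "Ck_on k S f"
proof (cases k)
  case 0
  then show ?thesis using assms by (simp add: linear_continuous_on)
next
  case (Suc j)
  have "frechet_derivative f (at x) v = f v" for x v
    by (rule frechet_derivativeI[OF bounded_linear_imp_has_derivative[OF assms]])
  then show ?thesis using Suc assms by (simp add: bounded_linear_imp_differentiable)
qed

lemma Ck_on_bounded_linear_compose:
  assumes "bounded_linear L" "open S" "Ck_on k S f"
  shows "Ck_on k S (\<lambda>x. L (f x))"
  using assms(3)
proof (induction k arbitrary: f)
  case 0
  then show ?case using assms(1) by (auto intro: bounded_linear.continuous_on)
next
  case (Suc k)
  have D: "((\<lambda>x. L (f x)) has_derivative (\<lambda>v. L (frechet_derivative f (at x) v))) (at x)" if "x \<in> S" for x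
    using Suc.prems that bounded_linear.has_derivative[OF assms(1)]
    by (auto simp: frechet_derivative_works)
  have "Ck_on k S (\<lambda>x. frechet_derivative (\<lambda>x. L (f x)) (at x) v)" for v
  proof (subst Ck_on_cong[OF assms(2)])
    show "frechet_derivative (\<lambda>x. L (f x)) (at x) v = L (frechet_derivative f (at x) v)" if "x \<in> S" for x
      using frechet_derivativeI[OF D[OF that]] .
    show "Ck_on k S (\<lambda>x. L (frechet_derivative f (at x) v))"
      using Suc by auto
  qed
  then show ?case using D by (auto simp: differentiable_def)
qed

lemma Ck_on_add:
  assumes "open S" "Ck_on k S f" "Ck_on k S g"
  shows "Ck_on k S (\<lambda>x. f x + g x)"
  using assms(2,3)
proof (induction k arbitrary: f g)
  case 0
  then show ?case by (auto intro: continuous_intros)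
next
  case (Suc k)
  have D: "((\<lambda>x. f x + g x) has_derivative (\<lambda>v. frechet_derivative f (at x) v + frechet_derivative g (at x) v)) (at x)" if "x \<in> S" for x
    using Suc.prems that by (auto intro!: has_derivative_add simp: frechet_derivative_works)
  have "Ck_on k S (\<lambda>x. frechet_derivative (\<lambda>x. f x + g x) (at x) v)" for v
  proof (subst Ck_on_cong[OF assms(1)])
    show "frechet_derivative (\<lambda>x. f x + g x) (at x) v = frechet_derivative f (at x) v + frechet_derivative g (at x) v" if "x \<in> S" for x
      using frechet_derivativeI[OF D[OF that]] .
    show "Ck_on k S (\<lambda>x. frechet_derivative f (at x) v + frechet_derivative g (at x) v)"
      using Suc by auto
  qed
  then show ?case using D by (auto simp: differentiable_def)
qed

lemma Ck_on_bilinear: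
  assumes "bounded_bilinear B" "open S" "Ck_on k S f" "Ck_on k S g"
  shows "Ck_on k S (\<lambda>x. B (f x) (g x))"
  using assms(3,4)
proof (induction k arbitrary: f g)
  case 0
  then show ?case using assms(1) by (auto intro: bounded_bilinear.continuous_on)
next
  case (Suc k)
  have D: "((\<lambda>x. B (f x) (g x)) has_derivative (\<lambda>v. B (f x) (frechet_derivative g (at x) v) + B (frechet_derivative f (at x) v) (g x))) (at x)" if "x \<in> S" for x
    using Suc.prems that by (auto intro!: bounded_bilinear.FDERIV[OF assms(1)] simp: frechet_derivative_works)
  have "Ck_on k S (\<lambda>x. frechet_derivative (\<lambda>x. B (f x) (g x)) (at x) v)" for v
  proof (subst Ck_on_cong[OF assms(2)])
    show "frechet_derivative (\<lambda>x. B (f x) (g x)) (at x) v = B (f x) (frechet_derivative g (at x) v) + B (frechet_derivative f (at x) v) (g x)" if "x \<in> S" for x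
      using frechet_derivativeI[OF D[OF that]] .
    \<comment> \<open>Each term of the product rule keeps one factor undifferentiated, and the
      induction hypothesis wants that factor at the lower order \<open>k\<close>.\<close>
    have "Ck_on k S f" "Ck_on k S g" using Suc.prems Ck_on_SucD by auto
    then show "Ck_on k S (\<lambda>x. B (f x) (frechet_derivative g (at x) v) + B (frechet_derivative f (at x) v) (g x))"
      using Suc by (auto intro!: Ck_on_add assms(2))
  qed
  then show ?case using D by (auto simp: differentiable_def)
qed

lemma Ck_on_sum:
  assumes "open S" "\<And>i. i \<in> I \<Longrightarrow> Ck_on k S (f i)"
  shows "Ck_on k S (\<lambda>x. \<Sum>i\<in>I. f i x)"
  using assms(2) by (induction I rule: infinite_finite_induct) (auto intro!: Ck_on_add assms(1))

text \<open>The chain rule differentiates \<open>f\<close> in a direction that moves with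
  \<open>x\<close>, whereas \<open>Ck_on\<close> controls derivatives in fixed directions only.
  Expanding the moving direction in the basis of the Euclidean codomain of \<open>g\<close> leaves
  products that the induction hypothesis covers.\<close>

lemma Ck_on_compose:
  fixes g :: "'e::real_normed_vector \<Rightarrow> 'f::euclidean_space"
  assumes "open S" "open T" "Ck_on k T f" "Ck_on k S g" "g ` S \<subseteq> T"
  shows "Ck_on k S (\<lambda>x. f (g x))"
  using assms(3,4)
proof (induction k arbitrary: f)
  case 0
  then show ?case using assms(5) by (auto intro: continuous_on_compose2)
next
  case (Suc k)
  let ?D = "\<lambda>x v. frechet_derivative g (at x) v"
  let ?E = "\<lambda>y v. frechet_derivative f (at y) v"
  have D: "((\<lambda>x. f (g x)) has_derivative (\<lambda>v. ?E (g x) (?D x v))) (at x)" if "x \<in> S" for x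
  proof -
    have "(g has_derivative ?D x) (at x)" "(f has_derivative ?E (g x)) (at (g x))"
      using Suc.prems that assms(5) by (auto simp: frechet_derivative_works[symmetric])
    then show ?thesis using diff_chain_at[of g "?D x" x f "?E (g x)"] by (simp add: o_def)
  qed
  have "Ck_on k S (\<lambda>x. frechet_derivative (\<lambda>x. f (g x)) (at x) v)" for v
  proof (subst Ck_on_cong[OF assms(1)])
    show "frechet_derivative (\<lambda>x. f (g x)) (at x) v = (\<Sum>b\<in>Basis. (?D x v \<bullet> b) *\<^sub>R ?E (g x) b)" if "x \<in> S" for x
    proof -
      have "f differentiable at (g x)" using Suc.prems that assms(5) by auto
      then have l: "linear (?E (g x))"
        by (simp add: bounded_linear.linear frechet_derivative_works has_derivative_bounded_linear)
      have "?E (g x) (?D x v) = ?E (g x) (\<Sum>b\<in>Basis. (?D x v \<bullet> b) *\<^sub>R b)" by (simp add: euclidean_representation)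
      also have "\<dots> = (\<Sum>b\<in>Basis. (?D x v \<bullet> b) *\<^sub>R ?E (g x) b)"
        using l by (simp add: linear_sum linear_scale)
      finally show ?thesis using frechet_derivativeI[OF D[OF that]] by simp
    qed
    have "Ck_on k S g" using Suc.prems(2) Ck_on_SucD by auto
    then show "Ck_on k S (\<lambda>x. \<Sum>b\<in>Basis. (?D x v \<bullet> b) *\<^sub>R ?E (g x) b)"
      using Suc by (auto intro!: Ck_on_sum assms(1) Ck_on_bilinear[OF bounded_bilinear_scaleR]
           Ck_on_bounded_linear_compose[OF bounded_linear_inner_left])
  qed
  then show ?case using D by (auto simp: differentiable_def)
qed

lemma smooth_on_subset: "smooth_on S f \<Longrightarrow> T \<subseteq> S \<Longrightarrow> smooth_on T f"
  unfolding smooth_on_def by (meson Ck_on_subset)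

lemma smooth_on_cong: "open S \<Longrightarrow> (\<And>x. x \<in> S \<Longrightarrow> f x = g x) \<Longrightarrow> smooth_on S f = smooth_on S g"
  unfolding smooth_on_def using Ck_on_cong[of S f g] by auto

lemma smooth_on_local:
  assumes "\<And>x. x \<in> S \<Longrightarrow> \<exists>T. open T \<and> x \<in> T \<and> smooth_on T f"
  shows "smooth_on S f"
  using assms unfolding smooth_on_def by (intro allI Ck_on_local) metis

lemma smooth_on_differentiable: "smooth_on S f \<Longrightarrow> x \<in> S \<Longrightarrow> f differentiable at x"
  unfolding smooth_on_def by (metis Ck_on.simps(2))

lemma smooth_on_frechet: "smooth_on S f \<Longrightarrow> smooth_on S (\<lambda>x. frechet_derivative f (at x) v)"
  unfolding smooth_on_def by (metis Ck_on.simps(2))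

lemma smooth_on_continuous_on: "smooth_on S f \<Longrightarrow> continuous_on S f"
  unfolding smooth_on_def by (metis Ck_on.simps(1))

lemma smooth_on_const [simp]: "smooth_on S (\<lambda>x. c)" by (simp add: smooth_on_def)

lemma smooth_on_linear: "bounded_linear f \<Longrightarrow> smooth_on S f" by (simp add: smooth_on_def Ck_on_linear)

lemma smooth_on_bounded_linear_compose:
  "bounded_linear L \<Longrightarrow> open S \<Longrightarrow> smooth_on S f \<Longrightarrow> smooth_on S (\<lambda>x. L (f x))"
  by (simp add: smooth_on_def Ck_on_bounded_linear_compose)

lemma smooth_on_add: "open S \<Longrightarrow> smooth_on S f \<Longrightarrow> smooth_on S g \<Longrightarrow> smooth_on S (\<lambda>x. f x + g x)"
  by (simp add: smooth_on_def Ck_on_add)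

lemma smooth_on_uminus: "open S \<Longrightarrow> smooth_on S f \<Longrightarrow> smooth_on S (\<lambda>x. - f x)"
  using smooth_on_bounded_linear_compose[OF bounded_linear_minus[OF bounded_linear_ident]] .

lemma smooth_on_diff: "open S \<Longrightarrow> smooth_on S f \<Longrightarrow> smooth_on S g \<Longrightarrow> smooth_on S (\<lambda>x. f x - g x)"
  using smooth_on_add[of S f "\<lambda>x. - g x"] smooth_on_uminus[of S g] by simp

lemma smooth_on_sum: "open S \<Longrightarrow> (\<And>i. i \<in> I \<Longrightarrow> smooth_on S (f i)) \<Longrightarrow> smooth_on S (\<lambda>x. \<Sum>i\<in>I. f i x)"
  by (simp add: smooth_on_def Ck_on_sum)

lemma smooth_on_bilinear:
  "bounded_bilinear B \<Longrightarrow> open S \<Longrightarrow> smooth_on S f \<Longrightarrow> smooth_on S g \<Longrightarrow> smooth_on S (\<lambda>x. B (f x) (g x))"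
  by (simp add: smooth_on_def Ck_on_bilinear)

lemma smooth_on_mult:
  fixes f g :: "'e::real_normed_vector \<Rightarrow> 'f::real_normed_algebra"
  shows "open S \<Longrightarrow> smooth_on S f \<Longrightarrow> smooth_on S g \<Longrightarrow> smooth_on S (\<lambda>x. f x * g x)"
  by (rule smooth_on_bilinear[OF bounded_bilinear_mult])

lemma smooth_on_compose:
  fixes g :: "'e::real_normed_vector \<Rightarrow> 'f::euclidean_space"
  shows "open S \<Longrightarrow> open T \<Longrightarrow> smooth_on T f \<Longrightarrow> smooth_on S g \<Longrightarrow> g ` S \<subseteq> T \<Longrightarrow> smooth_on S (\<lambda>x. f (g x))"
  unfolding smooth_on_def using Ck_on_compose by blast

text \<open>The derivative of the inverse is a polynomial in the inverse itself, so the induction on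
  \<open>k\<close> closes. Smoothness of \<open>ln\<close> then costs one differentiation.\<close>

lemma Ck_on_real_inverse: "Ck_on k {0<..} (inverse :: real \<Rightarrow> real)"
proof (induction k)
  case 0
  then show ?case by (auto intro!: continuous_intros)
next
  case (Suc k)
  have D: "(inverse has_derivative (\<lambda>v. - (inverse x * v * inverse x))) (at x)" if "x > 0" for x :: real
    using that by (auto intro!: derivative_eq_intros)
  have "Ck_on k {0<..} (\<lambda>x. frechet_derivative inverse (at x) v)" for v :: real
  proof (subst Ck_on_cong)
    show "frechet_derivative inverse (at x) v = (- v) * (inverse x * inverse x)" if "x \<in> {0<..}" for x
      using frechet_derivativeI[OF D, of x v] that by (simp add: mult_ac)
    show "Ck_on k {0<..} (\<lambda>x. (- v) * (inverse x * inverse x))"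
      by (intro Ck_on_bilinear[OF bounded_bilinear_mult] Ck_on_const Suc) auto
  qed auto
  then show ?case using D by (auto simp: differentiable_def)
qed

lemma smooth_on_ln: "smooth_on {0<..} (ln :: real \<Rightarrow> real)"
  unfolding smooth_on_def
proof
  fix k
  have D: "(ln has_derivative (\<lambda>v. v * inverse x)) (at x)" if "x > 0" for x :: real
    using that by (auto intro!: derivative_eq_intros)
  show "Ck_on k {0<..} (ln :: real \<Rightarrow> real)"
  proof (cases k)
    case 0
    then show ?thesis by (auto intro!: continuous_intros)
  next
    case (Suc j)
    have "Ck_on j {0<..} (\<lambda>x. frechet_derivative ln (at x) v)" for v :: real
    proof (subst Ck_on_cong)
      show "frechet_derivative ln (at x) v = v * inverse x" if "x \<in> {0<..}" for x
        using frechet_derivativeI[OF D, of x v] that by simp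
      show "Ck_on j {0<..} (\<lambda>x. v * inverse x)"
        by (intro Ck_on_bilinear[OF bounded_bilinear_mult] Ck_on_const Ck_on_real_inverse) auto
    qed auto
    then show ?thesis using D Suc by (auto simp: differentiable_def)
  qed
qed

lemma smooth_on_ln_compose:
  fixes g :: "'e::real_normed_vector \<Rightarrow> real"
  assumes "open S" "smooth_on S g" "\<And>x. x \<in> S \<Longrightarrow> g x > 0"
  shows "smooth_on S (\<lambda>x. ln (g x))"
  by (rule smooth_on_compose[OF assms(1) _ smooth_on_ln assms(2)]) (use assms(3) in auto)

lemma bounded_linear_axis: "bounded_linear (\<lambda>c::complex. axis i c :: complex^'n::finite)"
  by (rule linear_conv_bounded_linear[THEN iffD1], rule linearI) (auto simp: axis_def vec_eq_iff)

lemma smooth_on_vec: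
  fixes f :: "'e::real_normed_vector \<Rightarrow> complex^'n::finite"
  assumes "open S" "\<And>i. smooth_on S (\<lambda>x. f x $ i)"
  shows "smooth_on S f"
proof -
  have "f x = (\<Sum>i\<in>UNIV. axis i (f x $ i))" for x
    by (auto simp: vec_eq_iff axis_def sum.If_cases)
  moreover have "smooth_on S (\<lambda>x. \<Sum>i\<in>UNIV. axis i (f x $ i))"
    by (intro smooth_on_sum assms(1) smooth_on_bounded_linear_compose[OF bounded_linear_axis] assms(2))
  ultimately show ?thesis by (metis (no_types, lifting) assms(1) smooth_on_cong)
qed

lemma smooth_on_cmod_sq:
  fixes f :: "'e::real_normed_vector \<Rightarrow> complex"
  assumes "open S" "smooth_on S f"
  shows "smooth_on S (\<lambda>x. (norm (f x))\<^sup>2)"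
  unfolding power2_norm_eq_inner
  by (intro smooth_on_bilinear[OF bounded_bilinear_inner] assms)

section \<open>Holomorphic functions of several variables\<close>

lemma norm_cvec_scale: "norm (c *s v) = norm c * norm (v :: complex^'n)"
  by (simp add: norm_vec_def L2_set_def norm_mult power_mult_distrib flip: sum_distrib_left)
     (simp add: real_sqrt_mult)

lemma cvec_scale_of_real: "of_real c *s v = c *\<^sub>R (v :: complex^'n)"
  by (simp add: vec_eq_iff) (simp add: scaleR_conv_of_real)

lemma bounded_linear_scale_left: "bounded_linear (\<lambda>c. c *s (v :: complex^'n))"
  by (rule linear_conv_bounded_linear[THEN iffD1], rule linearI)
     (auto simp: vec_eq_iff algebra_simps)

text \<open>\<open>holo_on\<close> asks for some complex-linear derivative; uniqueness of
  derivatives identifies it with the \<open>frechet_derivative\<close> used everywhere else.\<close>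

lemma holo_onD:
  assumes "holo_on S g" "x \<in> S"
  shows "(g has_derivative frechet_derivative g (at x)) (at x)"
    and "frechet_derivative g (at x) (c *s v) = c * frechet_derivative g (at x) v"
proof -
  obtain T where T: "(g has_derivative T) (at x)" "\<forall>c v. T (c *s v) = c * T v"
    using assms unfolding holo_on_def by blast
  then have "T = frechet_derivative g (at x)" using frechet_derivative_at by blast
  then show "(g has_derivative frechet_derivative g (at x)) (at x)"
    and "frechet_derivative g (at x) (c *s v) = c * frechet_derivative g (at x) v" using T by auto
qed

lemma holo_on_linear_frechet: "holo_on S g \<Longrightarrow> x \<in> S \<Longrightarrow> linear (frechet_derivative g (at x))"
  using holo_onD(1) has_derivative_bounded_linear bounded_linear.linear by blast

lemma holo_on_continuous_on: "holo_on S g \<Longrightarrow> continuous_on S g"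
  by (meson continuous_at_imp_continuous_on has_derivative_continuous holo_onD(1))

lemma holo_on_subset: "holo_on S g \<Longrightarrow> T \<subseteq> S \<Longrightarrow> holo_on T g"
  unfolding holo_on_def by blast

lemma holo_on_line:
  assumes "holo_on S g" "x + \<zeta> *s v \<in> S"
  shows "((\<lambda>\<zeta>. g (x + \<zeta> *s v)) has_field_derivative frechet_derivative g (at (x + \<zeta> *s v)) v) (at \<zeta>)"
proof -
  have 1: "((\<lambda>\<zeta>. x + \<zeta> *s v) has_derivative (\<lambda>c. c *s v)) (at \<zeta>)"
    by (auto intro!: derivative_eq_intros bounded_linear_imp_has_derivative bounded_linear_scale_left)
  have "((\<lambda>\<zeta>. g (x + \<zeta> *s v)) has_derivative (\<lambda>c. frechet_derivative g (at (x + \<zeta> *s v)) (c *s v))) (at \<zeta>)"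
    using diff_chain_at[OF 1 holo_onD(1)[OF assms]] by (simp add: o_def)
  then show ?thesis
    by (simp add: has_field_derivative_def holo_onD(2)[OF assms] mult_commute_abs)
qed

text \<open>Restriction to the complex line through \<open>x\<close> in direction \<open>w\<close>
  reduces the remainder to one variable, where Cauchy's inequality bounds the second derivative. The
  constant depends only on \<open>M\<close> and \<open>r\<close>, so the estimate is uniform in the
  centre; the differentiability of the derivative rests on this uniformity.\<close>

lemma holo_taylor:
  fixes g :: "complex^'n::finite \<Rightarrow> complex"
  assumes "holo_on S g" "cball x (2*r) \<subseteq> S" "\<And>y. y \<in> cball x (2*r) \<Longrightarrow> norm (g y) \<le> M"
    and "r > 0" "norm w \<le> r"
  shows "norm (g (x + w) - g x - frechet_derivative g (at x) w) \<le> 2 * M * (norm w)\<^sup>2 / r\<^sup>2"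
proof (cases "w = 0")
  case True
  have "x \<in> S" using assms(2,4) by auto
  then have "frechet_derivative g (at x) 0 = 0"
    using holo_on_linear_frechet[OF assms(1)] linear_0 by blast
  then show ?thesis using True by simp
next
  case False
  \<comment> \<open>The parameter disc of radius \<open>R\<close> is the one mapped into
    \<open>cball x (2*r)\<close>. Since \<open>norm w \<le> r\<close>, it has
    \<open>R \<ge> 2\<close>, so discs of radius \<open>R - 1 \<ge> R/2\<close> about points of the
    unit disc stay inside it.\<close>
  define R where "R = 2 * r / norm w"
  have R2: "R \<ge> 2" using False assms(5) by (simp add: R_def field_simps)
  have mem: "x + \<zeta> *s w \<in> cball x (2*r)" if "norm \<zeta> \<le> R" for \<zeta>
    using that False by (simp add: dist_norm norm_cvec_scale R_def field_simps)
  define \<phi> where "\<phi> = (\<lambda>\<zeta>. g (x + \<zeta> *s w))"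
  have der: "(\<phi> has_field_derivative frechet_derivative g (at (x + \<zeta> *s w)) w) (at \<zeta>)" if "norm \<zeta> \<le> R" for \<zeta>
    unfolding \<phi>_def using holo_on_line[OF assms(1)] mem[OF that] assms(2) by blast
  have hol: "\<phi> holomorphic_on ball 0 R"
    unfolding holomorphic_on_open[OF open_ball] using der by (metis dist_0_norm less_imp_le mem_ball)
  have cont: "continuous_on (cball 0 R) \<phi>"
    using der by (intro continuous_at_imp_continuous_on) (metis DERIV_isCont mem_cball_0)
  have hol1: "deriv \<phi> holomorphic_on ball 0 R" by (intro holomorphic_deriv hol) auto
  have B: "norm (deriv (deriv \<phi>) \<zeta>) \<le> 8 * M / R\<^sup>2" if "\<zeta> \<in> cball 0 1" for \<zeta>
  proof -
    have sub: "cball \<zeta> (R - 1) \<subseteq> cball 0 R"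
      using that by (auto simp: cball_subset_cball_iff)
    have subb: "ball \<zeta> (R - 1) \<subseteq> ball 0 R"
      using that by (auto simp: ball_subset_ball_iff)
    have "norm ((deriv ^^ 2) \<phi> \<zeta>) \<le> fact 2 * M / (R - 1)^2"
    proof (rule Cauchy_inequality)
      show "\<phi> holomorphic_on ball \<zeta> (R - 1)" using hol subb by (rule holomorphic_on_subset)
      show "continuous_on (cball \<zeta> (R - 1)) \<phi>" using cont sub by (rule continuous_on_subset)
      show "norm (\<phi> y) \<le> M" if "norm (\<zeta> - y) = R - 1" for y
      proof -
        have "y \<in> cball \<zeta> (R-1)" using that by (simp add: dist_norm)
        then have "norm y \<le> R" using sub by auto
        then show ?thesis unfolding \<phi>_def by (intro assms(3) mem)
      qed
    qed (use R2 in auto)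
    also have "\<dots> \<le> fact 2 * M / (R/2)^2"
    proof (rule divide_left_mono)
      have "0 \<le> M" using assms(3)[of x] assms(4) by (auto intro: order_trans[OF norm_ge_zero])
      then show "0 \<le> fact 2 * M" by simp
    qed (use R2 in \<open>auto intro!: power_mono\<close>)
    finally show ?thesis by (simp add: numeral_2_eq_2 power2_eq_square)
  qed
  define f where "f = (\<lambda>i. (deriv ^^ i) \<phi>)"
  have "norm (f 0 1 - (\<Sum>i\<le>1. f i 0 * (1 - 0) ^ i / fact i)) \<le> 8 * M / R\<^sup>2 * norm (1 - 0 :: complex) ^ Suc 1 / fact 1"
  proof (rule complex_Taylor[where S="cball 0 1"])
    show "(f i has_field_derivative f (Suc i) y) (at y within cball 0 1)" if "y \<in> cball 0 1" "i \<le> 1" for i y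
    proof -
      have "(deriv ^^ i) \<phi> holomorphic_on ball 0 R" by (intro holomorphic_higher_deriv hol) auto
      then have "(f i has_field_derivative f (Suc i) y) (at y)"
        using that R2 unfolding f_def by (auto intro!: holomorphic_derivI[where S="ball 0 R"])
      then show ?thesis by (rule has_field_derivative_at_within)
    qed
    show "norm (f (Suc 1) y) \<le> 8 * M / R\<^sup>2" if "y \<in> cball 0 1" for y using B[OF that] by (simp add: f_def)
  qed auto
  moreover have "deriv \<phi> 0 = frechet_derivative g (at x) w"
    using DERIV_imp_deriv[OF der[of 0]] R2 by simp
  moreover have "8 * M / R\<^sup>2 = 2 * M * (norm w)\<^sup>2 / r\<^sup>2"
    using False assms(4) by (simp add: R_def power_divide power_mult_distrib)
  ultimately show ?thesis by (simp add: f_def \<phi>_def diff_diff_eq)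
qed

text \<open>The derivative of \<open>\<lambda>x. D\<^sub>v g x\<close> in direction \<open>w\<close> is the complex derivative of
  \<open>\<lambda>\<zeta>. D\<^sub>w g (x + \<zeta> v)\<close>; Cauchy's inequality in \<open>\<zeta>\<close> carries the quadratic remainder estimate
  of \<open>g\<close> over to \<open>D\<^sub>v g\<close>.\<close>

lemma holo_on_frechet:
  fixes g :: "complex^'n::finite \<Rightarrow> complex"
  assumes "open S" "holo_on S g"
  shows "holo_on S (\<lambda>x. frechet_derivative g (at x) v)"
  unfolding holo_on_def
proof (intro ballI)
  fix x assume "x \<in> S"
  let ?D = "\<lambda>y. frechet_derivative g (at y)"
  show "\<exists>T. ((\<lambda>x. ?D x v) has_derivative T) (at x) \<and> (\<forall>c w. T (c *s w) = c * T w)"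
  proof (cases "v = 0")
    case True
    have "\<forall>y\<in>S. ?D y v = 0" using True holo_on_linear_frechet[OF assms(2)] linear_0 by blast
    then have "((\<lambda>x. ?D x v) has_derivative (\<lambda>_. 0)) (at x)"
      by (intro has_derivative_transform_within_open[OF has_derivative_const[of 0] assms(1) \<open>x \<in> S\<close>]) auto
    then show ?thesis by auto
  next
    case False
    obtain r where r: "r > 0" "cball x (4*r) \<subseteq> S"
    proof -
      obtain e where "e > 0" "cball x e \<subseteq> S" using assms(1) \<open>x \<in> S\<close> open_contains_cball by blast
      then show ?thesis using that[of "e/4"] by auto
    qed
    have "compact (g ` cball x (4*r))"
      using continuous_on_subset[OF holo_on_continuous_on[OF assms(2)] r(2)]
      by (intro compact_continuous_image) auto
    then obtain M where M: "\<And>y. y \<in> cball x (4*r) \<Longrightarrow> norm (g y) \<le> M"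
      using compact_imp_bounded bounded_iff by (metis imageI)
    define \<delta> where "\<delta> = r / norm v"
    have d0: "\<delta> > 0" using False r by (simp add: \<delta>_def)
    have zv: "norm (\<zeta> *s v) \<le> r" if "norm \<zeta> \<le> \<delta>" for \<zeta>
      using that False by (simp add: norm_cvec_scale \<delta>_def field_simps)
    define C where "C = 2 * M / r\<^sup>2"
    have tay: "norm (g (x + \<zeta> *s v + w) - g (x + \<zeta> *s v) - ?D (x + \<zeta> *s v) w) \<le> C * (norm w)\<^sup>2"
      if "norm \<zeta> \<le> \<delta>" "norm w \<le> r" for \<zeta> w
    proof -
      have sub: "cball (x + \<zeta> *s v) (2*r) \<subseteq> cball x (4*r)"
      proof
        fix y assume "y \<in> cball (x + \<zeta> *s v) (2*r)"
        moreover have "dist x y \<le> dist x (x + \<zeta> *s v) + dist (x + \<zeta> *s v) y" by (rule dist_triangle)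
        moreover have "dist x (x + \<zeta> *s v) \<le> r" using zv[OF that(1)] by (simp add: dist_norm)
        ultimately show "y \<in> cball x (4*r)" using r(1) by simp
      qed
      have "norm (g (x + \<zeta> *s v + w) - g (x + \<zeta> *s v) - ?D (x + \<zeta> *s v) w) \<le> 2 * M * (norm w)\<^sup>2 / r\<^sup>2"
        using sub r M that(2) by (intro holo_taylor[OF assms(2)]) auto
      then show ?thesis by (simp add: C_def)
    qed
    have inS: "x + \<zeta> *s v + w \<in> S" if "norm \<zeta> \<le> \<delta>" "norm w \<le> r" for \<zeta> w
    proof -
      have "norm (\<zeta> *s v + w) \<le> 4 * r" using zv[OF that(1)] that(2) r norm_triangle_ineq[of "\<zeta> *s v" w] by linarith
      then have "x + \<zeta> *s v + w \<in> cball x (4*r)"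
        by (metis add.assoc add_diff_cancel_left' dist_norm mem_cball norm_minus_commute)
      then show ?thesis using r by blast
    qed
    have inS0: "x + \<zeta> *s v \<in> S" if "norm \<zeta> \<le> \<delta>" for \<zeta>
      using inS[OF that, of 0] r by simp
    have lin: "linear (?D (x + \<zeta> *s v))" if "norm \<zeta> \<le> \<delta>" for \<zeta>
      using holo_on_linear_frechet[OF assms(2)] inS0[OF that] by blast
    have slice: "(\<lambda>\<zeta>. g (x + \<zeta> *s v + w)) holomorphic_on ball 0 \<delta>" if "norm w \<le> r" for w
    proof -
      have sw: "(\<lambda>\<zeta>. g (x + \<zeta> *s v + w)) = (\<lambda>\<zeta>. g ((x + w) + \<zeta> *s v))" by (simp add: add_ac)
      have "((\<lambda>\<zeta>. g ((x + w) + \<zeta> *s v)) has_field_derivative ?D ((x+w) + \<zeta> *s v) v) (at \<zeta>)" if "\<zeta> \<in> ball 0 \<delta>" for \<zeta>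
        using inS[of \<zeta> w] that \<open>norm w \<le> r\<close> by (intro holo_on_line[OF assms(2)]) (simp add: add_ac)
      then show ?thesis unfolding sw holomorphic_on_open[OF open_ball] by blast
    qed
    define H where "H = (\<lambda>w \<zeta>. ?D (x + \<zeta> *s v) w)"
    have Hsmall: "H w holomorphic_on ball 0 \<delta>" if "norm w \<le> r" for w
    \<comment> \<open>The difference quotients with step \<open>1 / real (Suc n)\<close> are
      holomorphic in \<zeta>, and \<open>tay\<close> makes their distance to \<open>H w\<close>
      proportional to that step, uniformly on the disc.\<close>
    proof (rule holomorphic_uniform_sequence)
      let ?h = "\<lambda>n. 1 / real (Suc n)"
      let ?f = "\<lambda>n \<zeta>. (g (x + \<zeta> *s v + ?h n *\<^sub>R w) - g (x + \<zeta> *s v)) / of_real (?h n)"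
      have hw: "norm (?h n *\<^sub>R w) \<le> r" for n
      proof -
        have "norm (?h n *\<^sub>R w) \<le> 1 * norm w" unfolding norm_scaleR by (intro mult_right_mono) auto
        then show ?thesis using that by simp
      qed
      show "?f n holomorphic_on ball 0 \<delta>" for n
      proof (intro holomorphic_on_divide holomorphic_on_diff holomorphic_on_const)
        show "(\<lambda>\<zeta>. g (x + \<zeta> *s v + ?h n *\<^sub>R w)) holomorphic_on ball 0 \<delta>" by (rule slice[OF hw])
        show "(\<lambda>\<zeta>. g (x + \<zeta> *s v)) holomorphic_on ball 0 \<delta>" using slice[of 0] r by simp
        show "of_real (?h n) \<noteq> (0::complex)" for n unfolding of_real_eq_0_iff by simp
      qed
      have est: "norm (?f n \<zeta> - H w \<zeta>) \<le> ?h n * (C * (norm w)\<^sup>2)" if "norm \<zeta> \<le> \<delta>" for n \<zeta>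
      proof -
        define k where "k = ?h n"
        have k: "k > 0" by (simp add: k_def)
        let ?e = "g (x + \<zeta> *s v + k *\<^sub>R w) - g (x + \<zeta> *s v)"
        have "?e / of_real k - H w \<zeta> = (?e - ?D (x + \<zeta> *s v) (k *\<^sub>R w)) / of_real k"
          unfolding linear_scale[OF lin[OF that]] H_def using k by (simp add: diff_divide_distrib scaleR_conv_of_real)
        then have "norm (?e / of_real k - H w \<zeta>) = norm (?e - ?D (x + \<zeta> *s v) (k *\<^sub>R w)) / k"
          using k by (simp add: norm_divide)
        also have "\<dots> \<le> (C * (norm (k *\<^sub>R w))\<^sup>2) / k"
          using k by (intro divide_right_mono tay that hw[of n, folded k_def]) auto
        also have "\<dots> = k * (C * (norm w)\<^sup>2)" using k by (simp add: power2_eq_square)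
        finally show ?thesis unfolding k_def .
      qed
      have lim0: "(\<lambda>n. ?h n * (C * (norm w)\<^sup>2)) \<longlonglongrightarrow> 0"
        using tendsto_mult_left_zero[OF LIMSEQ_inverse_real_of_nat] unfolding inverse_eq_divide .
      show "\<exists>d>0. cball y d \<subseteq> ball 0 \<delta> \<and> uniform_limit (cball y d) ?f (H w) sequentially" if "y \<in> ball 0 \<delta>" for y :: complex
      proof -
        have "\<exists>d>0. cball y d \<subseteq> ball 0 \<delta>"
          using bspec[OF open_contains_cball[THEN iffD1, OF open_ball] that] .
        then obtain d where d: "d > 0" "cball y d \<subseteq> ball 0 \<delta>" by (elim exE conjE)
        have "uniform_limit (cball y d) ?f (H w) sequentially"
        proof (rule uniform_limitI)
          fix e :: real assume "e > 0"
          then have "\<forall>\<^sub>F n in sequentially. ?h n * (C * (norm w)\<^sup>2) < e"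
            by (rule order_tendstoD(2)[OF lim0])
          then show "\<forall>\<^sub>F n in sequentially. \<forall>z\<in>cball y d. dist (?f n z) (H w z) < e"
          proof eventually_elim
            case (elim n)
            show ?case
            proof
              fix z assume "z \<in> cball y d"
              then have "norm z \<le> \<delta>" using d(2) by (auto simp: subset_iff less_imp_le)
              from est[OF this, of n] elim show "dist (?f n z) (H w z) < e"
                unfolding dist_norm by linarith
            qed
          qed
        qed
        then show ?thesis using d by blast
      qed
    qed auto
    have Hhom: "H (c *s w) \<zeta> = c * H w \<zeta>" if "\<zeta> \<in> ball 0 \<delta>" for c w \<zeta>
      unfolding H_def using that by (intro holo_onD(2)[OF assms(2)] inS0) auto
    have Hadd: "H (w + w') \<zeta> = H w \<zeta> + H w' \<zeta>" if "\<zeta> \<in> ball 0 \<delta>" for w w' \<zeta>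
      unfolding H_def using that by (intro linear_add lin) auto
    have Hhol: "H w holomorphic_on ball 0 \<delta>" for w
    proof (cases "w = 0")
      case True
      then show ?thesis using Hsmall[of 0] r by simp
    next
      case False
      \<comment> \<open>Small directions suffice: \<open>?c\<close> rescales \<open>w\<close> to
        length \<open>r\<close>, and \<open>H\<close> is homogeneous in its direction.\<close>
      let ?c = "of_real (r / norm w) :: complex"
      have "?c \<noteq> 0" using False r by auto
      then have "w = (1 / ?c) *s (?c *s w)" by (simp add: vec_eq_iff)
      then have "H w \<zeta> = (1 / ?c) * H (?c *s w) \<zeta>" if "\<zeta> \<in> ball 0 \<delta>" for \<zeta>
        using Hhom[OF that] by metis
      moreover have "(\<lambda>\<zeta>. (1 / ?c) * H (?c *s w) \<zeta>) holomorphic_on ball 0 \<delta>"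
        using r False by (intro holomorphic_intros Hsmall) (simp add: norm_cvec_scale norm_divide)
      ultimately show ?thesis by (metis (no_types, lifting) holomorphic_cong)
    qed
    define B where "B = (\<lambda>w. deriv (H w) 0)"
    have Hd: "(H w has_field_derivative B w) (at 0)" for w
      unfolding B_def using holomorphic_derivI[OF Hhol open_ball, of 0 w] d0 by simp
    have Bhom: "B (c *s w) = c * B w" for c w
    proof -
      have "((\<lambda>\<zeta>. c * H w \<zeta>) has_field_derivative c * B w) (at 0)" by (intro DERIV_cmult Hd)
      then have "(H (c *s w) has_field_derivative c * B w) (at 0)"
        by (rule has_field_derivative_transform_within_open[where S="ball 0 \<delta>"]) (use d0 Hhom in auto)
      then show ?thesis using Hd DERIV_unique by blast
    qed
    have Badd: "B (w + w') = B w + B w'" for w w'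
    proof -
      have "((\<lambda>\<zeta>. H w \<zeta> + H w' \<zeta>) has_field_derivative B w + B w') (at 0)" by (intro DERIV_add Hd)
      then have "(H (w + w') has_field_derivative B w + B w') (at 0)"
        by (rule has_field_derivative_transform_within_open[where S="ball 0 \<delta>"]) (use d0 Hadd in auto)
      then show ?thesis using Hd DERIV_unique by blast
    qed
    have Blin: "linear B"
    proof (rule linearI)
      show "B (c *\<^sub>R w) = c *\<^sub>R B w" for c w
        using Bhom[of "of_real c" w] unfolding cvec_scale_of_real by (simp only: scaleR_conv_of_real)
    qed (rule Badd)
    have est: "norm (?D (x + w) v - ?D x v - B w) \<le> (2 * C / \<delta>) * (norm w)\<^sup>2" if w: "norm w \<le> r" for w
    proof -
      \<comment> \<open>As \<zeta> varies, \<open>?q\<close> is the first-order remainder of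
        \<open>g\<close> at the moving base point, bounded by \<open>C\<close> times the square of
        \<open>norm w\<close>. Its derivative at 0 is exactly the error to be estimated, and
        Cauchy's inequality on radius \<open>\<delta>/2\<close> costs the factor
        \<open>2 / \<delta>\<close>.\<close>
      let ?q = "\<lambda>\<zeta>. g (x + \<zeta> *s v + w) - g (x + \<zeta> *s v) - H w \<zeta>"
      have qhol: "?q holomorphic_on ball 0 \<delta>"
        using slice[OF w] slice[of 0] r Hhol[of w] by (intro holomorphic_intros) auto
      have "norm ((deriv ^^ 1) ?q 0) \<le> fact 1 * (C * (norm w)\<^sup>2) / (\<delta>/2)^1"
      proof (rule Cauchy_inequality)
        show "?q holomorphic_on ball 0 (\<delta>/2)" by (rule holomorphic_on_subset[OF qhol]) (use d0 in auto)
        show "continuous_on (cball 0 (\<delta>/2)) ?q"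
          by (rule holomorphic_on_imp_continuous_on, rule holomorphic_on_subset[OF qhol]) (use d0 in auto)
        show "norm (?q \<zeta>) \<le> C * (norm w)\<^sup>2" if "norm (0 - \<zeta>) = \<delta>/2" for \<zeta>
          unfolding H_def using that d0 by (intro tay w) auto
      qed (use d0 in auto)
      moreover have "(?q has_field_derivative (?D (x + w) v - ?D x v - B w)) (at 0)"
      proof -
        have "((\<lambda>\<zeta>. g ((x + w) + \<zeta> *s v)) has_field_derivative ?D ((x+w) + 0 *s v) v) (at 0)"
          using inS[of 0 w] d0 w by (intro holo_on_line[OF assms(2)]) simp
        moreover have "((\<lambda>\<zeta>. g (x + \<zeta> *s v)) has_field_derivative ?D (x + 0 *s v) v) (at 0)"
          using \<open>x \<in> S\<close> by (intro holo_on_line[OF assms(2)]) simp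
        ultimately show ?thesis by (auto intro!: DERIV_diff Hd simp: add_ac)
      qed
      ultimately show ?thesis by (simp add: DERIV_imp_deriv field_simps)
    qed
    have "((\<lambda>y. ?D y v) has_derivative B) (at x)"
      unfolding has_derivative_at_alt
    proof (intro conjI allI impI)
      show "bounded_linear B" using Blin linear_conv_bounded_linear by blast
      fix e :: real assume "e > 0"
      \<comment> \<open>Absolute value plus one gives a positive constant without a discussion of
        the sign of \<open>C\<close>.\<close>
      define K where "K = \<bar>2 * C / \<delta>\<bar> + 1"
      have K: "K > 0" "2 * C / \<delta> \<le> K" unfolding K_def by linarith+
      show "\<exists>d>0. \<forall>y. norm (y - x) < d \<longrightarrow> norm (?D y v - ?D x v - B (y - x)) \<le> e * norm (y - x)"
      proof (intro exI[of _ "min r (e/K)"] conjI allI impI)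
        fix y assume y: "norm (y - x) < min r (e/K)"
        have "norm (?D (x + (y - x)) v - ?D x v - B (y - x)) \<le> (2 * C / \<delta>) * (norm (y - x))\<^sup>2"
          using y by (intro est) auto
        also have "\<dots> \<le> K * norm (y - x) * norm (y - x)"
          using K(2) unfolding power2_eq_square mult.assoc by (intro mult_right_mono) auto
        also have "\<dots> \<le> e * norm (y - x)"
          using y K by (intro mult_right_mono) (auto simp: field_simps less_imp_le)
        finally show "norm (?D y v - ?D x v - B (y - x)) \<le> e * norm (y - x)" by simp
      qed (use r \<open>e > 0\<close> K in auto)
    qed
    then show ?thesis using Bhom by blast
  qed
qed

text \<open>Directional derivatives of a holomorphic function are holomorphic again, so an induction
  on the order suffices.\<close>

lemma holo_on_imp_smooth_on:
  fixes g :: "complex^'n::finite \<Rightarrow> complex"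
  assumes "open S" "holo_on S g"
  shows "smooth_on S g"
proof -
  have "Ck_on k S g" for k
    using assms(2)
  proof (induction k arbitrary: g)
    case 0
    then show ?case by (simp add: holo_on_continuous_on)
  next
    case (Suc k)
    then show ?case using holo_on_frechet[OF assms(1)] holo_onD(1)
      by (metis Ck_on.simps(2) differentiable_def)
  qed
  then show ?thesis by (simp add: smooth_on_def)
qed

text \<open>A substitute for the fact that a product of nonzero holomorphic functions is nonzero, on
  a set \<open>E\<close> containing the complex line through any two of its points. A point good for
  \<open>I\<close> and a point good for \<open>j\<close> are joined by such a line. Along it the
  functions for \<open>I\<close> stay nonzero near the first point, and by the identity theorem the
  one for \<open>j\<close> cannot vanish on a neighbourhood of that point. It will show that a
  hyperplane covered by finitely many zero sets lies in one of them.\<close>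

lemma holo_finite_zero_product:
  fixes F :: "'i \<Rightarrow> complex^'n::finite \<Rightarrow> complex"
  assumes "open B" "convex B" "finite I" "\<And>i. i \<in> I \<Longrightarrow> holo_on B (F i)"
    and lines: "\<And>x y c. x \<in> E \<Longrightarrow> y \<in> E \<Longrightarrow> x + c *s (y - x) \<in> E"
    and "B \<inter> E \<noteq> {}"
    and ex: "\<And>i. i \<in> I \<Longrightarrow> \<exists>y\<in>B \<inter> E. F i y \<noteq> 0"
  shows "\<exists>y\<in>B \<inter> E. \<forall>i\<in>I. F i y \<noteq> 0"
  using assms(3,4) ex
proof (induction I)
  case empty
  then show ?case using assms(6) by auto
next
  case (insert j I)
  obtain y where y: "y \<in> B" "y \<in> E" "\<And>i. i \<in> I \<Longrightarrow> F i y \<noteq> 0"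
  proof -
    have "\<exists>y\<in>B \<inter> E. \<forall>i\<in>I. F i y \<noteq> 0"
      by (rule insert.IH) (use insert.prems in auto)
    then show ?thesis using that by auto
  qed
  obtain y' where y': "y' \<in> B" "y' \<in> E" "F j y' \<noteq> 0" using insert.prems(2)[of j] by auto
  define l where "l = (\<lambda>t. y + t *s (y' - y))"
  have lcont: "continuous_on UNIV l"
    unfolding l_def by (intro continuous_intros linear_continuous_on bounded_linear_scale_left)
  \<comment> \<open>Convexity of \<open>B\<close> makes the set of admissible parameters convex,
    hence connected, as the identity theorem requires.\<close>
  define T where "T = l -` B"
  have "open T" unfolding T_def using lcont assms(1) by (simp add: open_vimage)
  have "convex T"
  proof (rule convexI)
    fix s t :: complex and u v :: real
    assume "s \<in> T" "t \<in> T" and uv: "u \<ge> 0" "v \<ge> 0" "u + v = 1"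
    have "l (u *\<^sub>R s + v *\<^sub>R t) = u *\<^sub>R l s + v *\<^sub>R l t"
    proof -
      have v: "v = 1 - u" using uv by simp
      show ?thesis unfolding l_def v by (simp add: vec_eq_iff) (simp add: algebra_simps scaleR_conv_of_real)
    qed
    then show "u *\<^sub>R s + v *\<^sub>R t \<in> T"
      using \<open>s \<in> T\<close> \<open>t \<in> T\<close> uv assms(2) unfolding T_def by (simp add: convexD)
  qed
  have l0: "l 0 = y" and l1: "l 1 = y'" by (auto simp: l_def)
  have 0: "0 \<in> T" "1 \<in> T" using l0 l1 y y' by (auto simp: T_def)
  have hol: "(\<lambda>t. F j (l t)) holomorphic_on T"
  proof -
    have "((\<lambda>t. F j (y + t *s (y' - y))) has_field_derivative frechet_derivative (F j) (at (y + t *s (y' - y))) (y' - y)) (at t)"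
      if "t \<in> T" for t
      using that insert.prems(1)[of j] by (intro holo_on_line[where S=B]) (auto simp: T_def l_def)
    then show ?thesis unfolding l_def using \<open>open T\<close> by (auto simp: holomorphic_on_open)
  qed
  have near: "\<forall>\<^sub>F t in at 0. \<forall>i\<in>I. F i (l t) \<noteq> 0"
  proof (rule eventually_ball_finite[OF insert.hyps(1)], rule ballI)
    fix i assume "i \<in> I"
    have "continuous_on B (F i)" using insert.prems(1)[of i] \<open>i \<in> I\<close> holo_on_continuous_on by blast
    then have "isCont (F i) (l 0)"
      using y(1) assms(1) l0 by (simp add: continuous_on_eq_continuous_at)
    moreover have "isCont l 0" using lcont by (simp add: continuous_on_eq_continuous_at)
    ultimately have "isCont (\<lambda>t. F i (l t)) 0" by (rule isCont_o2[rotated])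
    then have tend: "((\<lambda>t. F i (l t)) \<longlongrightarrow> F i (l 0)) (at 0)" by (simp only: isCont_def)
    have "F i (l 0) \<noteq> 0" unfolding l0 using y(3) \<open>i \<in> I\<close> by blast
    with tend show "\<forall>\<^sub>F t in at 0. F i (l t) \<noteq> 0" by (rule tendsto_imp_eventually_ne)
  qed
  have "\<forall>\<^sub>F t in at 0. t \<in> T" by (rule eventually_at_in_open'[OF \<open>open T\<close> 0(1)])
  then have ev: "\<forall>\<^sub>F t in at 0. t \<in> T \<and> (\<forall>i\<in>I. F i (l t) \<noteq> 0)" using near by (rule eventually_conj)
  have "\<exists>t. t \<in> T \<and> (\<forall>i\<in>I. F i (l t) \<noteq> 0) \<and> F j (l t) \<noteq> 0"
  proof (rule ccontr)
    assume no: "\<not> ?thesis"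
    obtain d where "d > 0" and d': "\<forall>t\<in>UNIV. t \<noteq> 0 \<and> dist t 0 < d \<longrightarrow> t \<in> T \<and> (\<forall>i\<in>I. F i (l t) \<noteq> 0)"
      using ev[unfolded eventually_at] by (elim exE conjE)
    then have d: "d > 0" "\<And>t. t \<noteq> 0 \<Longrightarrow> dist t 0 < d \<Longrightarrow> t \<in> T \<and> (\<forall>i\<in>I. F i (l t) \<noteq> 0)" by simp_all
    have "F j (l 1) = 0"
    \<comment> \<open>If all parameters close to 0 were zeros of \<open>F j\<close>, then
      \<open>F j\<close> would vanish along the line up to parameter 1, that is at
      \<open>y'\<close>.\<close>
    proof (rule analytic_continuation[OF hol \<open>open T\<close> convex_connected[OF \<open>convex T\<close>], where U="ball 0 d - {0}"])
      show "ball 0 d - {0} \<subseteq> T"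
      proof
        fix t :: complex assume "t \<in> ball 0 d - {0}"
        then have "t \<noteq> 0" "dist t 0 < d" by (auto simp: dist_commute)
        then show "t \<in> T" using d(2) by blast
      qed
      show "0 islimpt ball (0::complex) d - {0}"
      proof -
        have "0 islimpt ball (0::complex) d" using d(1) by (simp add: islimpt_ball)
        then show ?thesis using islimpt_punctured by blast
      qed
      show "F j (l z) = 0" if "z \<in> ball 0 d - {0}" for z
      proof -
        have "z \<noteq> 0" "dist z 0 < d" using that by (auto simp: dist_commute)
        then show ?thesis using no d(2)[of z] by blast
      qed
      show "0 \<in> T" "1 \<in> T" by (fact 0)+
    qed
    then show False using y'(3) l1 by simp
  qed
  then obtain t where t: "t \<in> T" "\<forall>i\<in>I. F i (l t) \<noteq> 0" "F j (l t) \<noteq> 0" by (elim exE conjE)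
  have "l t \<in> E" unfolding l_def by (intro lines y y')
  moreover have "l t \<in> B" using t(1) by (simp add: T_def)
  ultimately show ?case using t(2,3) by (intro bexI[of _ "l t"]) auto
qed

section \<open>Wirtinger calculus\<close>

lemma differentiable_frechet:
  "f differentiable at p \<Longrightarrow> (f has_derivative frechet_derivative f (at p)) (at p)"
  by (simp add: frechet_derivative_works)

lemma wirtI: "(g has_derivative D) (at p) \<Longrightarrow> wirt i g p = (D (axis i 1) - \<i> * D (axis i \<i>)) / 2"
  by (simp add: wirt_def frechet_derivativeI)

lemma wirt_barI: "(g has_derivative D) (at p) \<Longrightarrow> wirt_bar i g p = (D (axis i 1) + \<i> * D (axis i \<i>)) / 2"
  by (simp add: wirt_bar_def frechet_derivativeI)

text \<open>Both sides are the same choice from the same set of derivatives, so equality holds even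
  at points where neither function is differentiable.\<close>

lemma frechet_derivative_cong_open:
  assumes "open S" "p \<in> S" "\<And>y. y \<in> S \<Longrightarrow> f y = g y"
  shows "frechet_derivative f (at p) = frechet_derivative g (at p)"
proof -
  have "(f has_derivative D) (at p) \<longleftrightarrow> (g has_derivative D) (at p)" for D
    using has_derivative_transform_within_open[of f D p UNIV S g]
      has_derivative_transform_within_open[of g D p UNIV S f] assms by auto
  then show ?thesis by (simp add: frechet_derivative_def)
qed

lemma wirt_cong_open:
  assumes "open S" "p \<in> S" "\<And>y. y \<in> S \<Longrightarrow> f y = g y"
  shows "wirt i f p = wirt i g p" "wirt_bar i f p = wirt_bar i g p"
  unfolding wirt_def wirt_bar_def using frechet_derivative_cong_open[OF assms] by auto

lemma wirt_const [simp]: "wirt i (\<lambda>y. c) p = 0" "wirt_bar i (\<lambda>y. c) p = 0"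
  by (simp_all add: wirt_def wirt_bar_def)

lemma wirt_add:
  assumes "f differentiable at p" "g differentiable at p"
  shows "wirt i (\<lambda>y. f y + g y) p = wirt i f p + wirt i g p"
    and "wirt_bar i (\<lambda>y. f y + g y) p = wirt_bar i f p + wirt_bar i g p"
proof -
  note d = has_derivative_add[OF assms[THEN differentiable_frechet]]
  show "wirt i (\<lambda>y. f y + g y) p = wirt i f p + wirt i g p"
    unfolding wirtI[OF d] by (simp add: wirt_def field_simps)
  show "wirt_bar i (\<lambda>y. f y + g y) p = wirt_bar i f p + wirt_bar i g p"
    unfolding wirt_barI[OF d] by (simp add: wirt_bar_def field_simps)
qed

lemma wirt_mult:
  assumes "f differentiable at p" "g differentiable at p"
  shows "wirt i (\<lambda>y. f y * g y) p = f p * wirt i g p + wirt i f p * g p"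
    and "wirt_bar i (\<lambda>y. f y * g y) p = f p * wirt_bar i g p + wirt_bar i f p * g p"
proof -
  note d = has_derivative_mult[OF assms[THEN differentiable_frechet]]
  show "wirt i (\<lambda>y. f y * g y) p = f p * wirt i g p + wirt i f p * g p"
    unfolding wirtI[OF d] by (simp add: wirt_def field_simps)
  show "wirt_bar i (\<lambda>y. f y * g y) p = f p * wirt_bar i g p + wirt_bar i f p * g p"
    unfolding wirt_barI[OF d] by (simp add: wirt_bar_def field_simps)
qed

lemma wirt_cmult:
  assumes "f differentiable at p"
  shows "wirt i (\<lambda>y. c * f y) p = c * wirt i f p" "wirt_bar i (\<lambda>y. c * f y) p = c * wirt_bar i f p"
  using wirt_mult[of "\<lambda>y. c" p f i] assms by simp_all

lemma differentiable_sum_set: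
  assumes "\<And>k. k \<in> I \<Longrightarrow> f k differentiable net"
  shows "(\<lambda>y. \<Sum>k\<in>I. f k y) differentiable net"
  using assms by (induction I rule: infinite_finite_induct) auto

lemma wirt_sum:
  assumes "\<And>k. k \<in> I \<Longrightarrow> f k differentiable at p"
  shows "wirt i (\<lambda>y. \<Sum>k\<in>I. f k y) p = (\<Sum>k\<in>I. wirt i (f k) p)"
    and "wirt_bar i (\<lambda>y. \<Sum>k\<in>I. f k y) p = (\<Sum>k\<in>I. wirt_bar i (f k) p)"
proof -
  have "wirt i (\<lambda>y. \<Sum>k\<in>I. f k y) p = (\<Sum>k\<in>I. wirt i (f k) p) \<and>
    wirt_bar i (\<lambda>y. \<Sum>k\<in>I. f k y) p = (\<Sum>k\<in>I. wirt_bar i (f k) p)"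
    using assms
    by (induction I rule: infinite_finite_induct)
      (simp_all add: wirt_add differentiable_sum_set)
  then show "wirt i (\<lambda>y. \<Sum>k\<in>I. f k y) p = (\<Sum>k\<in>I. wirt i (f k) p)"
    "wirt_bar i (\<lambda>y. \<Sum>k\<in>I. f k y) p = (\<Sum>k\<in>I. wirt_bar i (f k) p)" by auto
qed

lemma differentiable_cnj:
  "f differentiable at p \<Longrightarrow> (\<lambda>y. cnj (f y)) differentiable at p"
  unfolding differentiable_def using bounded_linear.has_derivative[OF bounded_linear_cnj] by blast

lemma wirt_cnj:
  assumes "f differentiable at p"
  shows "wirt i (\<lambda>y. cnj (f y)) p = cnj (wirt_bar i f p)"
    and "wirt_bar i (\<lambda>y. cnj (f y)) p = cnj (wirt i f p)"
  using wirtI[OF bounded_linear.has_derivative[OF bounded_linear_cnj differentiable_frechet[OF assms]]]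
    wirt_barI[OF bounded_linear.has_derivative[OF bounded_linear_cnj differentiable_frechet[OF assms]]]
  by (simp_all add: wirt_def wirt_bar_def)

lemma differentiable_of_real:
  "t differentiable at p \<Longrightarrow> (\<lambda>y. complex_of_real (t y)) differentiable at p"
  unfolding differentiable_def using bounded_linear.has_derivative[OF bounded_linear_of_real] by blast

lemma wirt_of_real:
  assumes "t differentiable at p"
  shows "wirt i (\<lambda>y. complex_of_real (t y)) p =
      (of_real (frechet_derivative t (at p) (axis i 1)) - \<i> * of_real (frechet_derivative t (at p) (axis i \<i>))) / 2"
    and "wirt_bar i (\<lambda>y. complex_of_real (t y)) p =
      (of_real (frechet_derivative t (at p) (axis i 1)) + \<i> * of_real (frechet_derivative t (at p) (axis i \<i>))) / 2"
  using wirtI[OF bounded_linear.has_derivative[OF bounded_linear_of_real differentiable_frechet[OF assms]]]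
    wirt_barI[OF bounded_linear.has_derivative[OF bounded_linear_of_real differentiable_frechet[OF assms]]]
  by auto

lemma wirt_bar_of_real:
  assumes "t differentiable at p"
  shows "wirt_bar i (\<lambda>y. complex_of_real (t y)) p = cnj (wirt i (\<lambda>y. complex_of_real (t y)) p)"
  unfolding wirt_of_real[OF assms] by simp

lemma real_chain_differentiable:
  assumes "t differentiable at p" "(\<phi> has_real_derivative d) (at (t p))"
  shows "((\<lambda>y. \<phi> (t y)) has_derivative (\<lambda>v. d * frechet_derivative t (at p) v)) (at p)"
  using diff_chain_at[OF differentiable_frechet[OF assms(1)] assms(2)[unfolded has_field_derivative_def]]
  by (simp add: o_def)

lemma wirt_real_chain:
  assumes "t differentiable at p" "(\<phi> has_real_derivative d) (at (t p))"
  shows "wirt i (\<lambda>y. complex_of_real (\<phi> (t y))) p = of_real d * wirt i (\<lambda>y. complex_of_real (t y)) p"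
    and "wirt_bar i (\<lambda>y. complex_of_real (\<phi> (t y))) p = of_real d * wirt_bar i (\<lambda>y. complex_of_real (t y)) p"
proof -
  note d = real_chain_differentiable[OF assms]
  then have "(\<lambda>y. \<phi> (t y)) differentiable at p" by (auto simp: differentiable_def)
  then show "wirt i (\<lambda>y. complex_of_real (\<phi> (t y))) p = of_real d * wirt i (\<lambda>y. complex_of_real (t y)) p"
    and "wirt_bar i (\<lambda>y. complex_of_real (\<phi> (t y))) p = of_real d * wirt_bar i (\<lambda>y. complex_of_real (t y)) p"
    by (simp_all add: wirt_of_real assms(1) frechet_derivativeI[OF d] field_simps)
qed

lemma axis_i: "axis k \<i> = (\<i> *s axis k 1 :: complex^'n)"
  by (simp add: vec_eq_iff axis_def)

lemma holo_wirt:
  fixes g :: "complex^'n::finite \<Rightarrow> complex"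
  assumes "holo_on S g" "p \<in> S"
  shows "wirt i g p = frechet_derivative g (at p) (axis i 1)" "wirt_bar i g p = 0"
  unfolding wirt_def wirt_bar_def axis_i holo_onD(2)[OF assms] by simp_all

lemma holo_on_cong:
  assumes "open S" "\<And>x. x \<in> S \<Longrightarrow> f x = g x" "holo_on S f"
  shows "holo_on S g"
  unfolding holo_on_def
proof
  fix x assume x: "x \<in> S"
  have "(g has_derivative frechet_derivative f (at x)) (at x)"
    by (rule has_derivative_transform_within_open[OF holo_onD(1)[OF assms(3) x] assms(1) x]) (rule assms(2))
  then show "\<exists>T. (g has_derivative T) (at x) \<and> (\<forall>c v. T (c *s v) = c * T v)"
    using holo_onD(2)[OF assms(3) x] by blast
qed

lemma holo_on_wirt:
  fixes g :: "complex^'n::finite \<Rightarrow> complex"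
  assumes "open S" "holo_on S g"
  shows "holo_on S (wirt i g)"
proof -
  have "holo_on S (\<lambda>x. frechet_derivative g (at x) (axis i 1))" by (rule holo_on_frechet[OF assms])
  then show ?thesis by (rule holo_on_cong[OF assms(1), rotated]) (simp add: holo_wirt(1)[OF assms(2)])
qed

lemma holo_differentiable: "holo_on S g \<Longrightarrow> p \<in> S \<Longrightarrow> g differentiable at p"
  using holo_onD(1) differentiable_def by blast

text \<open>In complex coordinates the real differential splits into its (1,0) and (0,1) parts. The
  chain rule and the radial estimate near the divisor both start from this splitting.\<close>

lemma wirt_expand:
  fixes F :: "complex^'n::finite \<Rightarrow> complex"
  assumes "F differentiable at p"
  shows "frechet_derivative F (at p) w = (\<Sum>k\<in>UNIV. wirt k F p * w $ k + wirt_bar k F p * cnj (w $ k))"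
proof -
  have l: "linear (frechet_derivative F (at p))"
    using differentiable_frechet[OF assms] has_derivative_bounded_linear bounded_linear.linear by blast
  have w: "w = (\<Sum>k\<in>UNIV. Re (w $ k) *\<^sub>R axis k 1 + Im (w $ k) *\<^sub>R axis k \<i>)"
    by (simp add: vec_eq_iff axis_def sum.distrib if_distrib[where f="\<lambda>x. _ *\<^sub>R x"] cong: if_cong)
       (simp add: complex_eq_iff)
  have "frechet_derivative F (at p) w = (\<Sum>k\<in>UNIV. Re (w $ k) *\<^sub>R frechet_derivative F (at p) (axis k 1)
       + Im (w $ k) *\<^sub>R frechet_derivative F (at p) (axis k \<i>))"
    by (subst w) (simp add: linear_sum[OF l] linear_add[OF l] linear_scale[OF l])
  also have "\<dots> = (\<Sum>k\<in>UNIV. wirt k F p * w $ k + wirt_bar k F p * cnj (w $ k))"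
  proof (rule sum.cong[OF refl])
    fix k
    show "Re (w $ k) *\<^sub>R frechet_derivative F (at p) (axis k 1) + Im (w $ k) *\<^sub>R frechet_derivative F (at p) (axis k \<i>)
      = wirt k F p * w $ k + wirt_bar k F p * cnj (w $ k)"
      by (simp add: wirt_def wirt_bar_def complex_eq_iff field_simps)
  qed
  finally show ?thesis .
qed

lemma has_derivative_cvec:
  fixes T :: "'e::real_normed_vector \<Rightarrow> complex^'n::finite"
  assumes "\<And>k. (\<lambda>y. T y $ k) differentiable at p"
  shows "(T has_derivative (\<lambda>v. \<chi> k. frechet_derivative (\<lambda>y. T y $ k) (at p) v)) (at p)"
proof -
  have "((\<lambda>y. \<Sum>k\<in>UNIV. axis k (T y $ k)) has_derivative
      (\<lambda>v. \<Sum>k\<in>UNIV. axis k (frechet_derivative (\<lambda>y. T y $ k) (at p) v))) (at p)"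
    by (intro has_derivative_sum bounded_linear.has_derivative[OF bounded_linear_axis] differentiable_frechet assms)
  moreover have "(\<Sum>k\<in>UNIV. axis k (x k)) = (\<chi> k. x k)" for x :: "'n \<Rightarrow> complex"
    by (simp add: vec_eq_iff axis_def)
  ultimately show ?thesis by (simp add: vec_lambda_eta)
qed

text \<open>The components of \<open>T\<close> are holomorphic, so their conjugate derivatives
  vanish and the two types of derivative do not mix.\<close>

lemma wirt_chain:
  fixes F :: "complex^'n::finite \<Rightarrow> complex" and T :: "complex^'n \<Rightarrow> complex^'n"
  assumes "F differentiable at (T p)" "\<And>k. holo_on S (\<lambda>y. T y $ k)" "p \<in> S"
  shows "wirt j (\<lambda>y. F (T y)) p = (\<Sum>k\<in>UNIV. wirt k F (T p) * wirt j (\<lambda>y. T y $ k) p)"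
    and "wirt_bar j (\<lambda>y. F (T y)) p = (\<Sum>k\<in>UNIV. wirt_bar k F (T p) * cnj (wirt j (\<lambda>y. T y $ k) p))"
    and "(\<lambda>y. F (T y)) differentiable at p"
proof -
  have dT: "(T has_derivative (\<lambda>v. \<chi> k. frechet_derivative (\<lambda>y. T y $ k) (at p) v)) (at p)"
    by (rule has_derivative_cvec) (rule holo_differentiable[OF assms(2,3)])
  have D: "((\<lambda>y. F (T y)) has_derivative (\<lambda>v. frechet_derivative F (at (T p)) (\<chi> k. frechet_derivative (\<lambda>y. T y $ k) (at p) v))) (at p)"
    using diff_chain_at[OF dT differentiable_frechet[OF assms(1)]] by (simp add: o_def)
  then show "(\<lambda>y. F (T y)) differentiable at p" by (auto simp: differentiable_def)
  have w: "frechet_derivative (\<lambda>y. T y $ k) (at p) (axis j 1) = wirt j (\<lambda>y. T y $ k) p"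
    "frechet_derivative (\<lambda>y. T y $ k) (at p) (axis j \<i>) = \<i> * wirt j (\<lambda>y. T y $ k) p" for k
    using holo_wirt(1)[OF assms(2,3)] unfolding axis_i holo_onD(2)[OF assms(2,3)] by simp_all
  show "wirt j (\<lambda>y. F (T y)) p = (\<Sum>k\<in>UNIV. wirt k F (T p) * wirt j (\<lambda>y. T y $ k) p)"
    unfolding wirtI[OF D] wirt_expand[OF assms(1)] w
    by (simp add: w sum_distrib_left sum_divide_distrib flip: sum_subtractf) (simp add: field_simps)
  show "wirt_bar j (\<lambda>y. F (T y)) p = (\<Sum>k\<in>UNIV. wirt_bar k F (T p) * cnj (wirt j (\<lambda>y. T y $ k) p))"
    unfolding wirt_barI[OF D] wirt_expand[OF assms(1)] w
    by (simp add: w sum_distrib_left sum_divide_distrib flip: sum.distrib) (simp add: field_simps)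
qed

lemma smooth_on_wirt:
  fixes F :: "complex^'n::finite \<Rightarrow> complex"
  assumes "open S" "smooth_on S F"
  shows "smooth_on S (wirt i F)" "smooth_on S (wirt_bar i F)"
proof -
  have "smooth_on S (\<lambda>p. (1/2) * (frechet_derivative F (at p) (axis i 1) - \<i> * frechet_derivative F (at p) (axis i \<i>)))"
    by (intro smooth_on_mult smooth_on_diff smooth_on_const smooth_on_frechet assms)
  then show "smooth_on S (wirt i F)" unfolding wirt_def[abs_def] by simp
  have "smooth_on S (\<lambda>p. (1/2) * (frechet_derivative F (at p) (axis i 1) + \<i> * frechet_derivative F (at p) (axis i \<i>)))"
    by (intro smooth_on_mult smooth_on_add smooth_on_const smooth_on_frechet assms)
  then show "smooth_on S (wirt_bar i F)" unfolding wirt_bar_def[abs_def] by simp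
qed

text \<open>No second derivatives of \<open>T\<close> survive: the factor produced by the inner
  derivative is the conjugate of a holomorphic function, which the outer \<open>wirt i\<close>
  kills. This is why del delbar transforms as a (1,1)-form.\<close>

lemma wirt_wirt_bar_chain:
  fixes F :: "complex^'n::finite \<Rightarrow> complex" and T :: "complex^'n \<Rightarrow> complex^'n"
  assumes "open S" "open U" "T ` S \<subseteq> U" "smooth_on U F" "\<And>k. holo_on S (\<lambda>y. T y $ k)" "p \<in> S"
  shows "wirt i (wirt_bar j (\<lambda>y. F (T y))) p =
    (\<Sum>k\<in>UNIV. \<Sum>l\<in>UNIV. wirt k (wirt_bar l F) (T p) * wirt i (\<lambda>y. T y $ k) p * cnj (wirt j (\<lambda>y. T y $ l) p))"
proof -
  have dF: "F differentiable at (T y)" "wirt_bar l F differentiable at (T y)" if "y \<in> S" for y l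
    using assms that smooth_on_differentiable smooth_on_wirt(2)[OF assms(2,4)] by blast+
  have hw: "holo_on S (wirt j (\<lambda>y. T y $ l))" for l by (rule holo_on_wirt[OF assms(1,5)])
  have dw: "wirt j (\<lambda>y. T y $ l) differentiable at p" for l by (rule holo_differentiable[OF hw assms(6)])
  note ch = wirt_chain[OF dF(2)[OF assms(6)] assms(5,6)]
  have "wirt i (wirt_bar j (\<lambda>y. F (T y))) p =
    wirt i (\<lambda>y. \<Sum>l\<in>UNIV. wirt_bar l F (T y) * cnj (wirt j (\<lambda>y. T y $ l) y)) p"
    by (rule wirt_cong_open(1)[OF assms(1,6)]) (rule wirt_chain(2)[OF dF(1) assms(5)])
  also have "\<dots> = (\<Sum>l\<in>UNIV. wirt i (\<lambda>y. wirt_bar l F (T y) * cnj (wirt j (\<lambda>y. T y $ l) y)) p)"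
    by (rule wirt_sum(1)) (intro differentiable_mult ch(3) differentiable_cnj dw)
  also have "\<dots> = (\<Sum>l\<in>UNIV. (\<Sum>k\<in>UNIV. wirt k (wirt_bar l F) (T p) * wirt i (\<lambda>y. T y $ k) p) * cnj (wirt j (\<lambda>y. T y $ l) p))"
    by (simp add: wirt_mult(1)[OF ch(3) differentiable_cnj[OF dw]] wirt_cnj(1)[OF dw] holo_wirt(2)[OF hw assms(6)] ch(1))
  also have "\<dots> = (\<Sum>k\<in>UNIV. \<Sum>l\<in>UNIV. wirt k (wirt_bar l F) (T p) * wirt i (\<lambda>y. T y $ k) p * cnj (wirt j (\<lambda>y. T y $ l) p))"
    by (subst sum.swap) (simp add: sum_distrib_right)
  finally show ?thesis .
qed

section \<open>Symmetry of mixed second derivatives and the Hermitian Levi matrix\<close>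

lemma real_derivative_line:
  fixes F :: "'e::real_normed_vector \<Rightarrow> real"
  assumes "F differentiable at (q + s *\<^sub>R v)"
  shows "((\<lambda>s. F (q + s *\<^sub>R v)) has_real_derivative frechet_derivative F (at (q + s *\<^sub>R v)) v) (at s)"
proof -
  note D = differentiable_frechet[OF assms]
  have "((\<lambda>s. q + s *\<^sub>R v) has_derivative (\<lambda>h. h *\<^sub>R v)) (at s)" by (auto intro!: derivative_eq_intros)
  from diff_chain_at[OF this D] linear_scale[OF bounded_linear.linear[OF has_derivative_bounded_linear[OF D]]]
  show ?thesis by (simp add: o_def has_field_derivative_def mult_commute_abs)
qed

text \<open>Two mean value theorems: one in direction \<open>v\<close> for the difference between
  \<open>F\<close> and its translate by \<open>h *\<^sub>R w\<close>, then one in direction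
  \<open>w\<close> for the resulting difference of \<open>v\<close>-derivatives.\<close>

lemma mixed_difference_mvt:
  fixes F :: "'e::real_normed_vector \<Rightarrow> real"
  assumes "smooth_on S F" "h > 0"
    and "\<And>s t. 0 \<le> s \<Longrightarrow> s \<le> h \<Longrightarrow> 0 \<le> t \<Longrightarrow> t \<le> h \<Longrightarrow> p + s *\<^sub>R v + t *\<^sub>R w \<in> S"
  obtains s t where "0 < s" "s < h" "0 < t" "t < h"
    and "F (p + h *\<^sub>R v + h *\<^sub>R w) - F (p + h *\<^sub>R v) - F (p + h *\<^sub>R w) + F p =
      h * (h * frechet_derivative (\<lambda>y. frechet_derivative F (at y) v) (at (p + s *\<^sub>R v + t *\<^sub>R w)) w)"
proof -
  let ?G = "\<lambda>y. frechet_derivative F (at y) v"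
  have dF: "F differentiable at y" if "y \<in> S" for y using that assms(1) smooth_on_differentiable by blast
  have dG: "?G differentiable at y" if "y \<in> S" for y using that smooth_on_frechet[OF assms(1)] smooth_on_differentiable by blast
  have "\<exists>s>0. s < h \<and> (\<lambda>s. F ((p + h *\<^sub>R w) + s *\<^sub>R v) - F (p + s *\<^sub>R v)) h - (\<lambda>s. F ((p + h *\<^sub>R w) + s *\<^sub>R v) - F (p + s *\<^sub>R v)) 0
      = (h - 0) * (?G ((p + h *\<^sub>R w) + s *\<^sub>R v) - ?G (p + s *\<^sub>R v))"
  proof (rule MVT2[OF assms(2)])
    fix s assume s: "0 \<le> s" "s \<le> h"
    have "(p + h *\<^sub>R w) + s *\<^sub>R v \<in> S" "p + s *\<^sub>R v \<in> S"
      using assms(3)[OF s, of h] assms(3)[OF s, of 0] assms(2) by (simp_all add: add_ac)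
    then show "((\<lambda>s. F ((p + h *\<^sub>R w) + s *\<^sub>R v) - F (p + s *\<^sub>R v)) has_real_derivative ?G ((p + h *\<^sub>R w) + s *\<^sub>R v) - ?G (p + s *\<^sub>R v)) (at s)"
      by (intro DERIV_diff real_derivative_line dF)
  qed
  then obtain s where s: "0 < s" "s < h" and
    1: "F ((p + h *\<^sub>R w) + h *\<^sub>R v) - F (p + h *\<^sub>R v) - (F ((p + h *\<^sub>R w) + 0 *\<^sub>R v) - F (p + 0 *\<^sub>R v))
      = (h - 0) * (?G ((p + h *\<^sub>R w) + s *\<^sub>R v) - ?G (p + s *\<^sub>R v))" by auto
  have "\<exists>t>0. t < h \<and> (\<lambda>t. ?G ((p + s *\<^sub>R v) + t *\<^sub>R w)) h - (\<lambda>t. ?G ((p + s *\<^sub>R v) + t *\<^sub>R w)) 0 =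
     (h - 0) * frechet_derivative ?G (at ((p + s *\<^sub>R v) + t *\<^sub>R w)) w"
  proof (rule MVT2[OF assms(2)])
    fix t assume t: "0 \<le> t" "t \<le> h"
    have "p + s *\<^sub>R v + t *\<^sub>R w \<in> S" using assms(3)[OF _ _ t] s by simp
    then show "((\<lambda>t. ?G ((p + s *\<^sub>R v) + t *\<^sub>R w)) has_real_derivative frechet_derivative ?G (at ((p + s *\<^sub>R v) + t *\<^sub>R w)) w) (at t)"
      by (intro real_derivative_line dG)
  qed
  then obtain t where t: "0 < t" "t < h" and
    2: "?G ((p + s *\<^sub>R v) + h *\<^sub>R w) - ?G ((p + s *\<^sub>R v) + 0 *\<^sub>R w) = (h - 0) * frechet_derivative ?G (at ((p + s *\<^sub>R v) + t *\<^sub>R w)) w" by auto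
  have 3: "(p + h *\<^sub>R w) + s *\<^sub>R v = (p + s *\<^sub>R v) + h *\<^sub>R w" "(p + h *\<^sub>R w) + h *\<^sub>R v = p + h *\<^sub>R v + h *\<^sub>R w" by (simp_all add: add_ac)
  show ?thesis
    by (rule that[OF s t]) (use 1 2 in \<open>simp add: 3\<close>)
qed

text \<open>The second difference is symmetric in the two directions. Hence the two mixed
  derivatives attain a common value at points arbitrarily near \<open>p\<close>, and continuity does
  the rest.\<close>

lemma frechet_derivative_commute:
  fixes F :: "'e::real_normed_vector \<Rightarrow> real"
  assumes "open S" "smooth_on S F" "p \<in> S"
  shows "frechet_derivative (\<lambda>y. frechet_derivative F (at y) v) (at p) w =
    frechet_derivative (\<lambda>y. frechet_derivative F (at y) w) (at p) v"
proof -
  let ?a = "\<lambda>v w q. frechet_derivative (\<lambda>y. frechet_derivative F (at y) v) (at q) w"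
  obtain r where r: "r > 0" "ball p r \<subseteq> S" using assms(1,3) open_contains_ball by blast
  \<comment> \<open>The summand 1 makes \<open>K * h\<close> a strict bound on the size of the
    parallelogram, even if \<open>v\<close> and \<open>w\<close> vanish.\<close>
  define K where "K = norm v + norm w + 1"
  have K: "K > 0" unfolding K_def by (simp add: add_nonneg_pos)
  have near: "dist p (p + s *\<^sub>R v + t *\<^sub>R w) < K * h" if "0 \<le> s" "s \<le> h" "0 \<le> t" "t \<le> h" "h > 0" for s t h
  proof -
    have "norm (s *\<^sub>R v + t *\<^sub>R w) \<le> s * norm v + t * norm w" using that norm_triangle_ineq[of "s *\<^sub>R v" "t *\<^sub>R w"] by simp
    also have "\<dots> \<le> h * norm v + h * norm w" using that by (intro add_mono mult_right_mono) auto
    also have "\<dots> < K * h" using that by (simp add: K_def algebra_simps)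
    finally show ?thesis by (metis add.assoc add_diff_cancel_left' dist_commute dist_norm)
  qed
  have cont: "isCont (?a v w) p" for v w
    using smooth_on_continuous_on[OF smooth_on_frechet[OF smooth_on_frechet[OF assms(2)]]] assms(1,3)
    by (simp add: continuous_on_eq_continuous_at)
  show ?thesis
  proof (rule ccontr)
    assume ne: "\<not> ?thesis"
    \<comment> \<open>Half the supposed gap: no number lies strictly within this distance of both
      mixed derivatives at \<open>p\<close>.\<close>
    define e where "e = \<bar>?a v w p - ?a w v p\<bar> / 2"
    have "e > 0" using ne by (simp add: e_def)
    have "\<exists>d>0. \<forall>q. dist p q < d \<longrightarrow> \<bar>?a v w q - ?a v w p\<bar> < e" for v w
      using cont[of v w] \<open>e > 0\<close> unfolding continuous_at_eps_delta by (simp add: dist_real_def dist_commute)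
    then obtain d1 d2 where d: "d1 > 0" "d2 > 0" "\<And>q. dist p q < d1 \<Longrightarrow> \<bar>?a v w q - ?a v w p\<bar> < e"
      "\<And>q. dist p q < d2 \<Longrightarrow> \<bar>?a w v q - ?a w v p\<bar> < e" by metis
    define h where "h = min r (min d1 d2) / K"
    have h: "h > 0" "K * h \<le> r" "K * h \<le> d1" "K * h \<le> d2" using r d K by (auto simp: h_def)
    have inS: "p + s *\<^sub>R v + t *\<^sub>R w \<in> S" if "0 \<le> s" "s \<le> h" "0 \<le> t" "t \<le> h" for s t
      using near[OF that h(1)] h(2) r(2) by auto
    have inS': "p + s *\<^sub>R w + t *\<^sub>R v \<in> S" if "0 \<le> s" "s \<le> h" "0 \<le> t" "t \<le> h" for s t
      using inS[of t s] that by (simp add: add_ac)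
    obtain s t where st: "0 < s" "s < h" "0 < t" "t < h"
      and 1: "F (p + h *\<^sub>R v + h *\<^sub>R w) - F (p + h *\<^sub>R v) - F (p + h *\<^sub>R w) + F p = h * (h * ?a v w (p + s *\<^sub>R v + t *\<^sub>R w))"
      by (rule mixed_difference_mvt[OF assms(2) h(1) inS])
    obtain s' t' where st': "0 < s'" "s' < h" "0 < t'" "t' < h"
      and 2: "F (p + h *\<^sub>R w + h *\<^sub>R v) - F (p + h *\<^sub>R w) - F (p + h *\<^sub>R v) + F p = h * (h * ?a w v (p + s' *\<^sub>R w + t' *\<^sub>R v))"
      by (rule mixed_difference_mvt[OF assms(2) h(1) inS'])
    have "p + h *\<^sub>R w + h *\<^sub>R v = p + h *\<^sub>R v + h *\<^sub>R w" by (simp add: add_ac)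
    then have e3: "F (p + h *\<^sub>R w + h *\<^sub>R v) = F (p + h *\<^sub>R v + h *\<^sub>R w)" by (rule arg_cong)
    have 3: "F (p + h *\<^sub>R w + h *\<^sub>R v) - F (p + h *\<^sub>R w) - F (p + h *\<^sub>R v) + F p =
      F (p + h *\<^sub>R v + h *\<^sub>R w) - F (p + h *\<^sub>R v) - F (p + h *\<^sub>R w) + F p"
      using e3 by linarith
    have "h * (h * ?a v w (p + s *\<^sub>R v + t *\<^sub>R w)) = h * (h * ?a w v (p + s' *\<^sub>R w + t' *\<^sub>R v))"
      by (rule trans[OF 1[symmetric] trans[OF 3[symmetric] 2]])
    then have eq: "?a v w (p + s *\<^sub>R v + t *\<^sub>R w) = ?a w v (p + s' *\<^sub>R w + t' *\<^sub>R v)" using h(1) by simp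
    have "\<bar>?a v w (p + s *\<^sub>R v + t *\<^sub>R w) - ?a v w p\<bar> < e"
      using near[of s h t] st h by (intro d(3)) simp
    moreover have "\<bar>?a w v (p + s' *\<^sub>R w + t' *\<^sub>R v) - ?a w v p\<bar> < e"
    proof (rule d(4))
      have "p + s' *\<^sub>R w + t' *\<^sub>R v = p + t' *\<^sub>R v + s' *\<^sub>R w" by (simp add: add_ac)
      moreover have "dist p (p + t' *\<^sub>R v + s' *\<^sub>R w) < K * h" using near[of t' h s'] st' h by simp
      ultimately show "dist p (p + s' *\<^sub>R w + t' *\<^sub>R v) < d2" using h(4) by (metis order_less_le_trans)
    qed
    moreover have False if "\<bar>x - A\<bar> < \<bar>A - B\<bar> / 2" "\<bar>x - B\<bar> < \<bar>A - B\<bar> / 2" for x A B :: real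
      using that by (simp add: abs_if split: if_splits)
    ultimately show False unfolding eq e_def by blast
  qed
qed

text \<open>In real directions the entry consists of four second derivatives. Exchanging
  \<open>i\<close> and \<open>j\<close> swaps the order of differentiation, which is harmless, and
  flips the sign of the imaginary part.\<close>

lemma wirt_wirt_bar_hermitian:
  fixes F :: "complex^'n::finite \<Rightarrow> real"
  assumes "open S" "smooth_on S F" "p \<in> S"
  shows "cnj (wirt i (wirt_bar j (\<lambda>y. complex_of_real (F y))) p) = wirt j (wirt_bar i (\<lambda>y. complex_of_real (F y))) p"
proof -
  let ?D = "\<lambda>v y. frechet_derivative F (at y) v"
  have dD: "?D v differentiable at p" for v
    by (rule smooth_on_differentiable[OF smooth_on_frechet[OF assms(2)] assms(3)])
  have d1: "(\<lambda>y. complex_of_real (?D v y)) differentiable at p" for v by (rule differentiable_of_real[OF dD])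
  have form: "wirt i (wirt_bar j (\<lambda>y. complex_of_real (F y))) p =
    (of_real (frechet_derivative (?D (axis j 1)) (at p) (axis i 1)) + of_real (frechet_derivative (?D (axis j \<i>)) (at p) (axis i \<i>))
     + \<i> * (of_real (frechet_derivative (?D (axis j \<i>)) (at p) (axis i 1)) - of_real (frechet_derivative (?D (axis j 1)) (at p) (axis i \<i>)))) / 4" for i j
  proof -
    have "wirt i (wirt_bar j (\<lambda>y. complex_of_real (F y))) p = wirt i (\<lambda>y. (1/2) * (of_real (?D (axis j 1) y) + \<i> * of_real (?D (axis j \<i>) y))) p"
      by (rule wirt_cong_open(1)[OF assms(1,3)]) (simp add: wirt_of_real(2) smooth_on_differentiable[OF assms(2)])
    also have "\<dots> = (1/2) * (wirt i (\<lambda>y. of_real (?D (axis j 1) y)) p + \<i> * wirt i (\<lambda>y. of_real (?D (axis j \<i>) y)) p)"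
      by (simp only: wirt_cmult(1)[OF differentiable_add[OF d1 differentiable_mult[OF differentiable_const d1]]]
          wirt_add(1)[OF d1 differentiable_mult[OF differentiable_const d1]] wirt_cmult(1)[OF d1])
    also have "\<dots> = (of_real (frechet_derivative (?D (axis j 1)) (at p) (axis i 1)) + of_real (frechet_derivative (?D (axis j \<i>)) (at p) (axis i \<i>))
     + \<i> * (of_real (frechet_derivative (?D (axis j \<i>)) (at p) (axis i 1)) - of_real (frechet_derivative (?D (axis j 1)) (at p) (axis i \<i>)))) / 4"
      unfolding wirt_of_real(1)[OF dD] by (simp add: complex_eq_iff)
    finally show ?thesis .
  qed
  have aux: "cnj ((of_real a + of_real b + \<i> * (of_real c - of_real d)) / 4)
      = (of_real a + of_real b + \<i> * (of_real d - of_real c)) / 4" for a b c d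
    by (simp add: complex_eq_iff)
  have comm: "frechet_derivative (?D v) (at p) w = frechet_derivative (?D w) (at p) v" for v w
    by (rule frechet_derivative_commute[OF assms])
  show ?thesis unfolding form aux
    unfolding comm[of "axis j 1" "axis i 1"] comm[of "axis j \<i>" "axis i 1"]
      comm[of "axis j 1" "axis i \<i>"] comm[of "axis j \<i>" "axis i \<i>"] ..
qed

lemma wirt_coord:
  fixes p :: "complex^'n::finite"
  shows "wirt j (\<lambda>y. y $ i) p = (if j = i then 1 else 0)" "wirt_bar j (\<lambda>y. y $ i) p = 0"
    and "(\<lambda>y::complex^'n. y $ i) differentiable at p"
proof -
  have d: "((\<lambda>y. y $ i) has_derivative (\<lambda>v. v $ i)) (at p)"
    by (rule bounded_linear_imp_has_derivative) (rule bounded_linear_vec_nth)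
  show "wirt j (\<lambda>y. y $ i) p = (if j = i then 1 else 0)" "wirt_bar j (\<lambda>y. y $ i) p = 0"
    unfolding wirtI[OF d] wirt_barI[OF d] by (auto simp: axis_def)
  show "(\<lambda>y::complex^'n. y $ i) differentiable at p" using d by (auto simp: differentiable_def)
qed

lemma smooth_on_coord: "smooth_on S (\<lambda>y::complex^'n::finite. y $ i)"
  by (rule smooth_on_linear) (rule bounded_linear_vec_nth)

lemma open_coord_nonzero: "open {y::complex^'n::finite. y $ i \<noteq> 0}"
  by (intro open_Collect_neq continuous_intros)

lemma smooth_on_ln_coord: "smooth_on {y::complex^'n::finite. y $ i \<noteq> 0} (\<lambda>y. ln ((norm (y $ i))\<^sup>2))"
  by (intro smooth_on_ln_compose smooth_on_cmod_sq smooth_on_coord open_coord_nonzero) auto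

text \<open>The last equation is the pluriharmonicity of \<open>log |z_i|^2\<close> off the
  hyperplane: its conjugate derivative is the conjugate of the holomorphic \<open>1 / z_i\<close>.
  This is what keeps the second derivatives of the log norms bounded at the divisor.\<close>

lemma wirt_ln_coord:
  fixes p :: "complex^'n::finite"
  assumes "p $ i \<noteq> 0"
  shows "wirt j (\<lambda>y. complex_of_real (ln ((norm (y $ i))\<^sup>2))) p = (if j = i then 1 / p $ i else 0)"
    and "wirt_bar j (\<lambda>y. complex_of_real (ln ((norm (y $ i))\<^sup>2))) p = (if j = i then cnj (inverse (p $ i)) else 0)"
    and "wirt k (wirt_bar j (\<lambda>y. complex_of_real (ln ((norm (y $ i))\<^sup>2)))) p = 0"
proof -
  have 1: "wirt j (\<lambda>y. complex_of_real (ln ((norm (y $ i))\<^sup>2))) p = (if j = i then 1 / p $ i else 0)"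
    if "p $ i \<noteq> 0" for p :: "complex^'n"
  proof -
    have dt: "(\<lambda>y. (norm (y $ i))\<^sup>2) differentiable at p"
      by (rule smooth_on_differentiable[of UNIV]) (auto intro: smooth_on_cmod_sq smooth_on_coord)
    have dl: "(ln has_real_derivative 1 / (norm (p $ i))\<^sup>2) (at ((norm (p $ i))\<^sup>2))"
      using that by (auto intro!: derivative_eq_intros)
    have "wirt j (\<lambda>y. complex_of_real ((norm (y $ i))\<^sup>2)) p = wirt j (\<lambda>y. y $ i * cnj (y $ i)) p"
      by (simp only: complex_norm_square)
    also have "\<dots> = (if j = i then cnj (p $ i) else 0)"
      by (simp add: wirt_mult(1) wirt_coord differentiable_cnj wirt_cnj)
    finally show ?thesis
      unfolding wirt_real_chain(1)[OF dt dl] of_real_divide complex_norm_square using that by simp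
  qed
  then show "wirt j (\<lambda>y. complex_of_real (ln ((norm (y $ i))\<^sup>2))) p = (if j = i then 1 / p $ i else 0)"
    using assms by blast
  have 2: "wirt_bar j (\<lambda>y. complex_of_real (ln ((norm (y $ i))\<^sup>2))) p = (if j = i then cnj (inverse (p $ i)) else 0)"
    if "p $ i \<noteq> 0" for p :: "complex^'n"
    by (subst wirt_bar_of_real)
       (use that in \<open>auto simp: 1 inverse_eq_divide intro: smooth_on_differentiable[OF smooth_on_ln_coord]\<close>)
  then show "wirt_bar j (\<lambda>y. complex_of_real (ln ((norm (y $ i))\<^sup>2))) p = (if j = i then cnj (inverse (p $ i)) else 0)"
    using assms by blast
  have hol: "holo_on {y::complex^'n. y $ i \<noteq> 0} (\<lambda>y. inverse (y $ i))"
    unfolding holo_on_def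
  proof
    fix x :: "complex^'n" assume "x \<in> {y. y $ i \<noteq> 0}"
    then have "((\<lambda>y. inverse (y $ i)) has_derivative (\<lambda>v. - (inverse (x $ i) * v $ i * inverse (x $ i)))) (at x)"
      by (intro Deriv.has_derivative_inverse bounded_linear_imp_has_derivative bounded_linear_vec_nth) auto
    then show "\<exists>T. ((\<lambda>y. inverse (y $ i)) has_derivative T) (at x) \<and> (\<forall>c v. T (c *s v) = c * T v)" by fastforce
  qed
  have pin: "p \<in> {y. y $ i \<noteq> 0}" using assms by simp
  have "wirt k (wirt_bar j (\<lambda>y. complex_of_real (ln ((norm (y $ i))\<^sup>2)))) p = wirt k (\<lambda>y. if j = i then cnj (inverse (y $ i)) else 0) p"
    by (rule wirt_cong_open(1)[OF open_coord_nonzero[of i]]) (use assms 2 in auto)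
  also have "\<dots> = 0"
    using wirt_cnj(1)[OF holo_differentiable[OF hol pin], of k] holo_wirt(2)[OF hol pin, of k] by (cases "j = i") auto
  finally show "wirt k (wirt_bar j (\<lambda>y. complex_of_real (ln ((norm (y $ i))\<^sup>2)))) p = 0" .
qed

section \<open>Charts\<close>

lemma in_coords_of_real: "in_coords c (\<lambda>x. of_real (f x)) = (\<lambda>y. of_real (in_coords c f y))"
  by (simp add: in_coords_def o_def)

lemma holo_charts_topological: "c \<in> holo_charts \<A> \<Longrightarrow> topological_chart c"
  by (simp add: holo_charts_def)

lemma chart_props:
  assumes "(V, z) \<in> holo_charts \<A>"
  shows "open V" "inj_on z V" "open (z ` V)" "continuous_on V z" "continuous_on (z ` V) (inv_into V z)"
  using holo_charts_topological[OF assms] by (auto simp: topological_chart_def homeomorphism_def)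

lemma in_coords_at [simp]: "(V, z) \<in> holo_charts \<A> \<Longrightarrow> x \<in> V \<Longrightarrow> in_coords (V, z) f (z x) = f x"
  using chart_props(2) by (fastforce simp: in_coords_def)

lemma open_chart_image:
  assumes "(V, z) \<in> holo_charts \<A>" "open U"
  shows "open (z ` (V \<inter> U))"
proof -
  note ch = chart_props[OF assms(1)]
  have "z ` (V \<inter> U) = z ` V \<inter> inv_into V z -` U" using ch(2) by force
  then show ?thesis using continuous_open_preimage[OF ch(5,3) assms(2)] by simp
qed

lemma open_chart_image_subset:
  "(V, z) \<in> holo_charts \<A> \<Longrightarrow> open U \<Longrightarrow> U \<subseteq> V \<Longrightarrow> open (z ` U)"
  using open_chart_image[of V z \<A> U] by (simp add: Int_absorb1)

lemma open_chart_preimage: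
  assumes "(V, z) \<in> holo_charts \<A>" "open U"
  shows "open (V \<inter> z -` U)"
  using continuous_open_preimage[OF chart_props(4,1)[OF assms(1)] assms(2)] .

lemma holo_on_compose:
  fixes F :: "complex^'n::finite \<Rightarrow> complex" and T :: "complex^'n \<Rightarrow> complex^'n"
  assumes "holo_on U F" "\<And>k. holo_on S (\<lambda>y. T y $ k)" "T ` S \<subseteq> U"
  shows "holo_on S (\<lambda>y. F (T y))"
  unfolding holo_on_def
proof
  fix p assume p: "p \<in> S"
  have Tp: "T p \<in> U" using assms(3) p by blast
  have dT: "(T has_derivative (\<lambda>v. \<chi> k. frechet_derivative (\<lambda>y. T y $ k) (at p) v)) (at p)"
    by (rule has_derivative_cvec) (rule holo_differentiable[OF assms(2) p])
  have D: "((\<lambda>y. F (T y)) has_derivative (\<lambda>v. frechet_derivative F (at (T p)) (\<chi> k. frechet_derivative (\<lambda>y. T y $ k) (at p) v))) (at p)"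
    using diff_chain_at[OF dT holo_onD(1)[OF assms(1) Tp]] by (simp add: o_def)
  have "(\<chi> k. frechet_derivative (\<lambda>y. T y $ k) (at p) (c *s v)) = c *s (\<chi> k. frechet_derivative (\<lambda>y. T y $ k) (at p) v)" for c v
    by (simp add: vec_eq_iff holo_onD(2)[OF assms(2) p])
  then show "\<exists>L. ((\<lambda>y. F (T y)) has_derivative L) (at p) \<and> (\<forall>c v. L (c *s v) = c * L v)"
    using D holo_onD(2)[OF assms(1) Tp] by (intro exI conjI) (assumption, simp)
qed

lemma holo_on_Union: "(\<And>S. S \<in> \<S> \<Longrightarrow> holo_on S g) \<Longrightarrow> holo_on (\<Union>\<S>) g"
  unfolding holo_on_def by blast

text \<open>Members of \<open>holo_charts\<close> are by definition compatible with the given atlas,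
  not with each other. Locally the transition factors through an atlas chart, and these cover the
  manifold.\<close>

lemma holo_transition:
  assumes "complex_atlas \<A>" "(V, z) \<in> holo_charts \<A>" "(W, w) \<in> holo_charts \<A>"
  shows "holo_on (z ` (V \<inter> W)) (in_coords (V, z) (\<lambda>x. w x $ i))"
proof -
  have loc: "holo_on (z ` (V \<inter> W \<inter> U)) (in_coords (V, z) (\<lambda>x. w x $ i))" if e: "(U, t) \<in> \<A>" for U t
  proof -
    have eH: "(U, t) \<in> holo_charts \<A>" using assms(1) e by (auto simp: complex_atlas_def holo_charts_def)
    have 1: "holo_on (z ` (V \<inter> U)) (in_coords (V, z) (\<lambda>x. t x $ k))" for k
      using assms(2) e by (auto simp: holo_charts_def holo_compatible_def)
    have 2: "holo_on (t ` (W \<inter> U)) (in_coords (U, t) (\<lambda>x. w x $ i))"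
      using assms(3) e by (auto simp: holo_charts_def holo_compatible_def)
    have op: "open (z ` (V \<inter> W \<inter> U))"
      using open_chart_image[OF assms(2), of "W \<inter> U"] chart_props(1)[OF assms(3)] chart_props(1)[OF eH] by (simp add: Int_assoc open_Int)
    have "holo_on (z ` (V \<inter> W \<inter> U)) (\<lambda>y. in_coords (U, t) (\<lambda>x. w x $ i) (in_coords (V, z) t y))"
    proof (rule holo_on_compose[OF 2])
      show "holo_on (z ` (V \<inter> W \<inter> U)) (\<lambda>y. in_coords (V, z) t y $ k)" for k
        using holo_on_subset[OF 1, of "z ` (V \<inter> W \<inter> U)" k] by (auto simp: in_coords_def o_def)
      show "in_coords (V, z) t ` z ` (V \<inter> W \<inter> U) \<subseteq> t ` (W \<inter> U)" using assms(2) by auto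
    qed
    then show ?thesis
      by (rule holo_on_cong[OF op, rotated]) (use assms(2) eH in auto)
  qed
  have "z ` (V \<inter> W) = (\<Union>(U, t)\<in>\<A>. z ` (V \<inter> W \<inter> U))"
  proof -
    have "(\<Union>c\<in>\<A>. fst c) = UNIV" using assms(1) by (simp add: complex_atlas_def)
    then show ?thesis by (fastforce simp: image_iff)
  qed
  moreover have "holo_on (\<Union>((\<lambda>(U, t). z ` (V \<inter> W \<inter> U)) ` \<A>)) (in_coords (V, z) (\<lambda>x. w x $ i))"
    by (rule holo_on_Union) (use loc in auto)
  ultimately show ?thesis by simp
qed

lemma inv_into_subset:
  assumes "inj_on z V" "U \<subseteq> V" "y \<in> z ` U"
  shows "inv_into U z y = inv_into V z y"
proof -
  obtain x where "x \<in> U" "y = z x" using assms(3) by blast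
  then show ?thesis using assms(1,2) inj_on_subset[OF assms(1,2)] by (metis inv_into_f_f subsetD)
qed

lemma homeomorphism_inv_into:
  assumes "inj_on z V" "continuous_on V z" "continuous_on (z ` V) (inv_into V z)"
  shows "homeomorphism V (z ` V) z (inv_into V z)"
  unfolding homeomorphism_def
proof (intro conjI ballI)
  show "inv_into V z (z x) = x" if "x \<in> V" for x by (rule inv_into_f_f[OF assms(1) that])
  show "z (inv_into V z y) = y" if "y \<in> z ` V" for y by (rule f_inv_into_f[OF that])
  show "inv_into V z ` z ` V = V" by (rule inv_into_image_cancel[OF assms(1) order_refl])
qed (use assms in auto)

text \<open>Smaller charts are needed twice: a divisor is described in charts contained in a
  trivializing set, and the coordinates of an adapted chart must stay below
  \<open>1/e\<close>.\<close>

lemma holo_charts_restrict: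
  assumes "(V, z) \<in> holo_charts \<A>" "complex_atlas \<A>" "open U" "U \<subseteq> V"
  shows "(U, z) \<in> holo_charts \<A>"
proof -
  note ch = chart_props[OF assms(1)]
  \<comment> \<open>\<open>in_coords\<close> inverts the coordinate map on the chart's own domain,
    so shrinking the domain formally changes the inverse; on the smaller image the two inverses
    agree.\<close>
  have inv: "inv_into U z y = inv_into V z y" if "y \<in> z ` U" for y
    by (rule inv_into_subset[OF ch(2) assms(4) that])
  have opU: "open (z ` U)" by (rule open_chart_image_subset[OF assms(1,3,4)])
  have inj: "inj_on z U" by (rule inj_on_subset[OF ch(2) assms(4)])
  have "continuous_on (z ` U) (inv_into V z)"
    by (rule continuous_on_subset[OF ch(5)]) (use assms(4) in blast)
  then have "continuous_on (z ` U) (inv_into U z)"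
    by (rule continuous_on_cong[OF refl inv, THEN iffD2, rotated])
  then have "homeomorphism U (z ` U) z (inv_into U z)"
    by (rule homeomorphism_inv_into[OF inj continuous_on_subset[OF ch(4) assms(4)]])
  then have top: "topological_chart (U, z)" using assms(3) inj opU by (simp add: topological_chart_def)
  have "holo_compatible (U, z) (W, w)" if d: "(W, w) \<in> \<A>" for W w
  proof -
    have dH: "(W, w) \<in> holo_charts \<A>" using assms(2) d by (auto simp: complex_atlas_def holo_charts_def)
    have c: "holo_compatible (V, z) (W, w)" using assms(1) d by (auto simp: holo_charts_def)
    have oW: "open (U \<inter> W)" using assms(3) chart_props(1)[OF dH] by (rule open_Int)
    have op: "open (z ` (U \<inter> W))"
      by (rule open_chart_image_subset[OF assms(1) oW]) (use assms(4) in blast)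
    have sub: "U \<inter> W \<subseteq> V \<inter> W" using assms(4) by blast
    have c1: "holo_on (z ` (V \<inter> W)) (in_coords (V, z) (\<lambda>x. w x $ i))"
      and c2: "holo_on (w ` (V \<inter> W)) (in_coords (W, w) (\<lambda>x. z x $ i))" for i
      using c by (simp_all add: holo_compatible_def)
    have "in_coords (V, z) (\<lambda>x. w x $ i) y = in_coords (U, z) (\<lambda>x. w x $ i) y" if y: "y \<in> z ` (U \<inter> W)" for i y
    proof -
      have "y \<in> z ` U" using y by blast
      from inv[OF this] show ?thesis by (simp add: in_coords_def)
    qed
    from holo_on_cong[OF op this holo_on_subset[OF c1 image_mono[OF sub]]]
    have "holo_on (z ` (U \<inter> W)) (in_coords (U, z) (\<lambda>x. w x $ i))" for i .
    moreover have "holo_on (w ` (U \<inter> W)) (in_coords (W, w) (\<lambda>x. z x $ i))" for i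
      by (rule holo_on_subset[OF c2 image_mono[OF sub]])
    ultimately show ?thesis by (simp add: holo_compatible_def)
  qed
  then show ?thesis using top by (auto simp: holo_charts_def)
qed

text \<open>Serves to move a given point to the origin of its chart.\<close>

lemma holo_charts_translate:
  assumes "(V, z) \<in> holo_charts \<A>" "complex_atlas \<A>"
  shows "(V, \<lambda>x. z x - a) \<in> holo_charts \<A>"
proof -
  note ch = chart_props[OF assms(1)]
  let ?z = "\<lambda>x. z x - a"
  have im: "?z ` U = (\<lambda>y. y - a) ` z ` U" for U by (simp add: image_image)
  have tr: "open ((\<lambda>y. y - a) ` S) \<longleftrightarrow> open S" for S :: "(complex^'b) set"
    using open_translation_subtract[of S a] open_translation_subtract[of "(\<lambda>y. y - a) ` S" "- a"] by (auto simp: image_image)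
  have inj: "inj_on ?z V" using ch(2) by (auto simp: inj_on_def)
  have inv: "inv_into V ?z y = inv_into V z (y + a)" if y: "y \<in> ?z ` V" for y
  proof -
    obtain x where "x \<in> V" "y = z x - a" using y by blast
    then show ?thesis using inv_into_f_f[OF inj, of x] inv_into_f_f[OF ch(2), of x] by simp
  qed
  have mem: "y + a \<in> z ` U \<longleftrightarrow> y \<in> ?z ` U" for y U by (auto simp: image_iff algebra_simps)
  have "continuous_on (?z ` V) (\<lambda>y. inv_into V z (y + a))"
    by (rule continuous_on_compose2[OF ch(5)]) (auto intro!: continuous_intros)
  then have "continuous_on (?z ` V) (inv_into V ?z)"
    by (rule continuous_on_cong[OF refl inv, THEN iffD2, rotated])
  then have "homeomorphism V (?z ` V) ?z (inv_into V ?z)"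
    by (rule homeomorphism_inv_into[OF inj continuous_on_diff[OF ch(4) continuous_on_const]])
  then have top: "topological_chart (V, ?z)" using ch(1,3) inj im tr by (simp add: topological_chart_def)
  have "holo_compatible (V, ?z) (W, w)" if d: "(W, w) \<in> \<A>" for W w
  proof -
    have dH: "(W, w) \<in> holo_charts \<A>" using assms(2) d by (auto simp: complex_atlas_def holo_charts_def)
    have c: "holo_compatible (V, z) (W, w)" using assms(1) d by (auto simp: holo_charts_def)
    have op: "open (?z ` (V \<inter> W))"
      unfolding im tr using open_chart_image[OF assms(1)] chart_props(1)[OF dH] by simp
    have tcomp: "holo_on (?z ` (V \<inter> W)) (\<lambda>y. (y + a) $ k)" for k
      unfolding holo_on_def
    proof
      fix x
      have "((\<lambda>y. (y + a) $ k) has_derivative (\<lambda>v. v $ k)) (at x)"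
        by (auto intro!: derivative_eq_intros bounded_linear_imp_has_derivative bounded_linear_vec_nth)
      then show "\<exists>T. ((\<lambda>y. (y + a) $ k) has_derivative T) (at x) \<and> (\<forall>c v. T (c *s v) = c * T v)" by fastforce
    qed
    have c1: "holo_on (z ` (V \<inter> W)) (in_coords (V, z) (\<lambda>x. w x $ i))"
      and c2: "holo_on (w ` (V \<inter> W)) (in_coords (W, w) (\<lambda>x. z x $ i))" for i
      using c by (simp_all add: holo_compatible_def)
    have "(\<lambda>y. y + a) ` ?z ` (V \<inter> W) \<subseteq> z ` (V \<inter> W)" by (simp add: image_image)
    from holo_on_compose[OF c1 tcomp this]
    have "holo_on (?z ` (V \<inter> W)) (\<lambda>y. in_coords (V, z) (\<lambda>x. w x $ i) (y + a))" for i .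
    moreover have "in_coords (V, z) (\<lambda>x. w x $ i) (y + a) = in_coords (V, ?z) (\<lambda>x. w x $ i) y" if "y \<in> ?z ` (V \<inter> W)" for i y
    proof -
      have "y \<in> ?z ` V" using that by blast
      from inv[OF this] show ?thesis by (simp add: in_coords_def)
    qed
    ultimately have "holo_on (?z ` (V \<inter> W)) (in_coords (V, ?z) (\<lambda>x. w x $ i))" for i
      by (rule holo_on_cong[OF op, rotated])
    moreover have "holo_on (w ` (V \<inter> W)) (in_coords (W, w) (\<lambda>x. ?z x $ i))" for i
      unfolding holo_on_def
    proof
      fix y assume y: "y \<in> w ` (V \<inter> W)"
      have e: "in_coords (W, w) (\<lambda>x. ?z x $ i) = (\<lambda>y. in_coords (W, w) (\<lambda>x. z x $ i) y - a $ i)"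
        by (simp add: in_coords_def o_def)
      show "\<exists>T. (in_coords (W, w) (\<lambda>x. ?z x $ i) has_derivative T) (at y) \<and> (\<forall>c v. T (c *s v) = c * T v)"
      proof (intro exI conjI allI)
        show "(in_coords (W, w) (\<lambda>x. ?z x $ i) has_derivative frechet_derivative (in_coords (W, w) (\<lambda>x. z x $ i)) (at y)) (at y)"
          unfolding e using has_derivative_diff[OF holo_onD(1)[OF c2[of i] y] has_derivative_const[of "a $ i"]] by simp
      qed (rule holo_onD(2)[OF c2 y])
    qed
    ultimately show ?thesis by (simp add: holo_compatible_def)
  qed
  then show ?thesis using top by (auto simp: holo_charts_def)
qed

lemma smooth_transition:
  assumes "complex_atlas \<A>" "(V, z) \<in> holo_charts \<A>" "(W, w) \<in> holo_charts \<A>"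
  shows "smooth_on (z ` (V \<inter> W)) (in_coords (V, z) w)"
proof (rule smooth_on_vec)
  show "open (z ` (V \<inter> W))" by (rule open_chart_image[OF assms(2) chart_props(1)[OF assms(3)]])
  then show "smooth_on (z ` (V \<inter> W)) (\<lambda>x. in_coords (V, z) w x $ i)" for i
    using holo_on_imp_smooth_on[OF _ holo_transition[OF assms, of i]] by (simp add: in_coords_def o_def)
qed

section \<open>Smooth functions on open sets of the manifold\<close>

lemma mfd_smooth_onD:
  "mfd_smooth_on \<A> U f \<Longrightarrow> (V, z) \<in> holo_charts \<A> \<Longrightarrow> smooth_on (z ` (V \<inter> U)) (in_coords (V, z) f)"
  by (auto simp: mfd_smooth_on_def)

lemma mfd_smooth_on_subset: "mfd_smooth_on \<A> U f \<Longrightarrow> U' \<subseteq> U \<Longrightarrow> mfd_smooth_on \<A> U' f"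
  unfolding mfd_smooth_on_def by (fastforce intro: smooth_on_subset)

lemma mfd_smooth_on_local:
  assumes "\<And>p. p \<in> U \<Longrightarrow> \<exists>W. open W \<and> p \<in> W \<and> mfd_smooth_on \<A> W f"
  shows "mfd_smooth_on \<A> U f"
  unfolding mfd_smooth_on_def
proof (intro ballI, clarify)
  fix V z assume c: "(V, z) \<in> holo_charts \<A>"
  show "smooth_on (z ` (V \<inter> U)) (in_coords (V, z) f)"
  proof (rule smooth_on_local)
    fix y assume "y \<in> z ` (V \<inter> U)"
    then obtain x where x: "x \<in> V" "x \<in> U" "y = z x" by blast
    obtain W where "open W" "x \<in> W" "mfd_smooth_on \<A> W f" using assms[OF x(2)] by blast
    then show "\<exists>T. open T \<and> y \<in> T \<and> smooth_on T (in_coords (V, z) f)"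
      using open_chart_image[OF c] mfd_smooth_onD[OF _ c] x by blast
  qed
qed

text \<open>One chart is enough because the transition maps are smooth.\<close>

lemma mfd_smooth_on_chartI:
  assumes "complex_atlas \<A>" "(V, z) \<in> holo_charts \<A>" "open U" "U \<subseteq> V" "smooth_on (z ` U) G"
    and "\<And>x. x \<in> U \<Longrightarrow> g x = G (z x)"
  shows "mfd_smooth_on \<A> U g"
  unfolding mfd_smooth_on_def
proof (intro ballI, clarify)
  fix W w assume d: "(W, w) \<in> holo_charts \<A>"
  have op: "open (w ` (W \<inter> U))" by (rule open_chart_image[OF d assms(3)])
  have "smooth_on (w ` (W \<inter> U)) (\<lambda>y. G (in_coords (W, w) z y))"
  proof (rule smooth_on_compose[OF op _ assms(5)])
    show "open (z ` U)" by (rule open_chart_image_subset[OF assms(2,3,4)])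
    show "smooth_on (w ` (W \<inter> U)) (in_coords (W, w) z)"
      by (rule smooth_on_subset[OF smooth_transition[OF assms(1) d assms(2)]]) (use assms(4) in auto)
    show "in_coords (W, w) z ` w ` (W \<inter> U) \<subseteq> z ` U" using d by auto
  qed
  moreover have "smooth_on (w ` (W \<inter> U)) (\<lambda>y. G (in_coords (W, w) z y)) = smooth_on (w ` (W \<inter> U)) (in_coords (W, w) g)"
    by (rule smooth_on_cong[OF op]) (use d assms(6) in auto)
  ultimately show "smooth_on (w ` (W \<inter> U)) (in_coords (W, w) g)" by simp
qed

lemma mfd_smooth_on_cong:
  assumes "open U" "\<And>x. x \<in> U \<Longrightarrow> f x = g x" "mfd_smooth_on \<A> U f"
  shows "mfd_smooth_on \<A> U g"
  unfolding mfd_smooth_on_def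
proof (intro ballI, clarify)
  fix W w assume d: "(W, w) \<in> holo_charts \<A>"
  have "smooth_on (w ` (W \<inter> U)) (in_coords (W, w) f) = smooth_on (w ` (W \<inter> U)) (in_coords (W, w) g)"
    by (rule smooth_on_cong[OF open_chart_image[OF d assms(1)]]) (use d assms(2) in auto)
  then show "smooth_on (w ` (W \<inter> U)) (in_coords (W, w) g)" using mfd_smooth_onD[OF assms(3) d] by simp
qed

lemma mfd_smooth_on_const [simp]: "mfd_smooth_on \<A> U (\<lambda>x. c)"
  by (auto simp: mfd_smooth_on_def in_coords_def o_def)

lemma mfd_smooth_on_add:
  "open U \<Longrightarrow> mfd_smooth_on \<A> U f \<Longrightarrow> mfd_smooth_on \<A> U g \<Longrightarrow> mfd_smooth_on \<A> U (\<lambda>x. f x + g x)"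
  unfolding mfd_smooth_on_def using open_chart_image
  by (fastforce simp: in_coords_def o_def intro!: smooth_on_add)

lemma mfd_smooth_on_mult:
  fixes f g :: "'a::topological_space \<Rightarrow> 'b::real_normed_algebra"
  shows "open U \<Longrightarrow> mfd_smooth_on \<A> U f \<Longrightarrow> mfd_smooth_on \<A> U g \<Longrightarrow> mfd_smooth_on \<A> U (\<lambda>x. f x * g x)"
  unfolding mfd_smooth_on_def using open_chart_image
  by (fastforce simp: in_coords_def o_def intro!: smooth_on_mult)

lemma mfd_smooth_on_linear:
  assumes "open U" "bounded_linear L" "mfd_smooth_on \<A> U f"
  shows "mfd_smooth_on \<A> U (\<lambda>x. L (f x))"
  unfolding mfd_smooth_on_def
proof (intro ballI, clarify)
  fix W w assume d: "(W, w) \<in> holo_charts \<A>"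
  have "smooth_on (w ` (W \<inter> U)) (\<lambda>y. L (in_coords (W, w) f y))"
    by (rule smooth_on_bounded_linear_compose[OF assms(2) open_chart_image[OF d assms(1)] mfd_smooth_onD[OF assms(3) d]])
  then show "smooth_on (w ` (W \<inter> U)) (in_coords (W, w) (\<lambda>x. L (f x)))" by (simp add: in_coords_def o_def)
qed

lemma mfd_smooth_on_sum:
  "open U \<Longrightarrow> (\<And>k. k \<in> K \<Longrightarrow> mfd_smooth_on \<A> U (f k)) \<Longrightarrow> mfd_smooth_on \<A> U (\<lambda>x. \<Sum>k\<in>K. f k x)"
  by (induction K rule: infinite_finite_induct) (auto intro!: mfd_smooth_on_add)

lemma mfd_smooth_on_ln:
  assumes "open U" "mfd_smooth_on \<A> U f" "\<And>x. x \<in> U \<Longrightarrow> f x > (0::real)"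
  shows "mfd_smooth_on \<A> U (\<lambda>x. ln (f x))"
  unfolding mfd_smooth_on_def
proof (intro ballI, clarify)
  fix W w assume d: "(W, w) \<in> holo_charts \<A>"
  have "smooth_on (w ` (W \<inter> U)) (\<lambda>y. ln (in_coords (W, w) f y))"
    using open_chart_image[OF d assms(1)] mfd_smooth_onD[OF assms(2) d] d assms(3)
    by (intro smooth_on_ln_compose) auto
  then show "smooth_on (w ` (W \<inter> U)) (in_coords (W, w) (\<lambda>x. ln (f x)))" by (simp add: in_coords_def o_def)
qed

lemma mfd_smooth_on_cmod_sq:
  assumes "open U" "mfd_smooth_on \<A> U f"
  shows "mfd_smooth_on \<A> U (\<lambda>x. (norm (f x :: complex))\<^sup>2)"
  unfolding mfd_smooth_on_def
proof (intro ballI, clarify)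
  fix W w assume d: "(W, w) \<in> holo_charts \<A>"
  have "smooth_on (w ` (W \<inter> U)) (\<lambda>y. (norm (in_coords (W, w) f y))\<^sup>2)"
    using open_chart_image[OF d assms(1)] mfd_smooth_onD[OF assms(2) d] by (intro smooth_on_cmod_sq) auto
  then show "smooth_on (w ` (W \<inter> U)) (in_coords (W, w) (\<lambda>x. (norm (f x))\<^sup>2))" by (simp add: in_coords_def o_def)
qed

lemma mfd_holo_imp_smooth:
  assumes "open U" "mfd_holo_on \<A> U f"
  shows "mfd_smooth_on \<A> U f"
  unfolding mfd_smooth_on_def
proof (intro ballI, clarify)
  fix W w assume d: "(W, w) \<in> holo_charts \<A>"
  show "smooth_on (w ` (W \<inter> U)) (in_coords (W, w) f)"
    using assms(2) d open_chart_image[OF d assms(1)] by (intro holo_on_imp_smooth_on) (auto simp: mfd_holo_on_def)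
qed

lemma mfd_smooth_on_pullback:
  assumes "complex_atlas \<A>" "(V, z) \<in> holo_charts \<A>" "open U" "smooth_on (z ` (V \<inter> U)) G"
  shows "mfd_smooth_on \<A> (V \<inter> U) (\<lambda>x. G (z x))"
  by (rule mfd_smooth_on_chartI[OF assms(1,2) _ _ assms(4)]) (use chart_props(1)[OF assms(2)] assms(3) in auto)

section \<open>Values of (1,1)-forms on vectors and their change of chart\<close>

lemma herm_value_add: "herm_value (a + b) \<xi> = herm_value a \<xi> + herm_value b \<xi>"
  unfolding herm_value_def vector_add_component add_divide_distrib distrib_right sum.distrib ..

lemma herm_value_scaleR: "herm_value (r *\<^sub>R a) \<xi> = of_real r * herm_value a \<xi>"
  by (simp add: herm_value_def sum_distrib_left scaleR_conv_of_real[where 'a=complex] mult_ac)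

text \<open>The Jacobian matrix of the change from \<open>c\<close> to \<open>d\<close>, applied to
  \<xi>: it rewrites the coordinates of one and the same tangent vector.\<close>

definition jac :: "('a, 'n::finite) chart \<Rightarrow> ('a, 'n) chart \<Rightarrow> 'a \<Rightarrow> complex^'n \<Rightarrow> complex^'n" where
  "jac c d x \<xi> = (\<chi> k. \<Sum>i\<in>UNIV. wirt i (in_coords c (\<lambda>y. snd d y $ k)) (snd c x) * \<xi> $ i)"

text \<open>The transformation rule for the coefficients says that the value of a form does not
  depend on the chart in which the vector is written. After the order of summation is exchanged, the
  inner sums factor into the two coordinates of the rewritten vector.\<close>

lemma herm_value_jac:
  fixes \<alpha> :: "('a, 'n::finite) form11"
  assumes "\<And>i j. \<alpha> c x $ i $ j = (\<Sum>k\<in>UNIV. \<Sum>l\<in>UNIV. \<alpha> d x $ k $ l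
             * wirt i (in_coords c (\<lambda>y. snd d y $ k)) (snd c x)
             * cnj (wirt j (in_coords c (\<lambda>y. snd d y $ l)) (snd c x)))"
  shows "herm_value (\<alpha> c x) \<xi> = herm_value (\<alpha> d x) (jac c d x \<xi>)"
proof -
  define P where "P = (\<lambda>i k. wirt i (in_coords c (\<lambda>y. snd d y $ k)) (snd c x))"
  have expand: "(\<Sum>k\<in>UNIV. \<Sum>l\<in>UNIV. M k l * p k * cnj (q l)) / w * s * t
      = (\<Sum>k\<in>UNIV. \<Sum>l\<in>UNIV. (M k l / w) * (p k * s) * (cnj (q l) * t))"
    for M and p q :: "'n \<Rightarrow> complex" and w s t :: complex
    by (simp only: sum_divide_distrib sum_distrib_right) (simp add: mult_ac)
  have collect: "(\<Sum>i\<in>UNIV. \<Sum>j\<in>UNIV. w * p i * q j) = w * (\<Sum>i\<in>UNIV. p i) * (\<Sum>j\<in>UNIV. q j)"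
    for p q :: "'n \<Rightarrow> complex" and w :: complex
    unfolding sum_distrib_left[of w] sum_product ..
  have swap: "(\<Sum>i\<in>UNIV. \<Sum>j\<in>UNIV. \<Sum>k\<in>UNIV. \<Sum>l\<in>UNIV. X i j k l) = (\<Sum>k\<in>UNIV. \<Sum>l\<in>UNIV. \<Sum>i\<in>UNIV. \<Sum>j\<in>UNIV. X i j k l)"
    for X :: "'n \<Rightarrow> 'n \<Rightarrow> 'n \<Rightarrow> 'n \<Rightarrow> complex"
  proof -
    have "(\<Sum>i\<in>UNIV. \<Sum>j\<in>UNIV. \<Sum>k\<in>UNIV. \<Sum>l\<in>UNIV. X i j k l) = (\<Sum>i\<in>UNIV. \<Sum>k\<in>UNIV. \<Sum>j\<in>UNIV. \<Sum>l\<in>UNIV. X i j k l)"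
      by (rule sum.cong[OF refl], rule sum.swap)
    also have "\<dots> = (\<Sum>k\<in>UNIV. \<Sum>i\<in>UNIV. \<Sum>j\<in>UNIV. \<Sum>l\<in>UNIV. X i j k l)" by (rule sum.swap)
    also have "\<dots> = (\<Sum>k\<in>UNIV. \<Sum>i\<in>UNIV. \<Sum>l\<in>UNIV. \<Sum>j\<in>UNIV. X i j k l)"
      by (rule sum.cong[OF refl], rule sum.cong[OF refl], rule sum.swap)
    also have "\<dots> = (\<Sum>k\<in>UNIV. \<Sum>l\<in>UNIV. \<Sum>i\<in>UNIV. \<Sum>j\<in>UNIV. X i j k l)"
      by (rule sum.cong[OF refl], rule sum.swap)
    finally show ?thesis .
  qed
  have "herm_value (\<alpha> c x) \<xi> = (\<Sum>i\<in>UNIV. \<Sum>j\<in>UNIV. \<Sum>k\<in>UNIV. \<Sum>l\<in>UNIV. (\<alpha> d x $ k $ l / \<i>) * (P i k * \<xi> $ i) * (cnj (P j l) * cnj (\<xi> $ j)))"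
    unfolding herm_value_def assms expand P_def ..
  also have "\<dots> = (\<Sum>k\<in>UNIV. \<Sum>l\<in>UNIV. \<Sum>i\<in>UNIV. \<Sum>j\<in>UNIV. (\<alpha> d x $ k $ l / \<i>) * (P i k * \<xi> $ i) * (cnj (P j l) * cnj (\<xi> $ j)))"
    by (rule swap)
  also have "\<dots> = herm_value (\<alpha> d x) (jac c d x \<xi>)"
    unfolding herm_value_def jac_def collect P_def vec_lambda_beta cnj_sum complex_cnj_mult ..
  finally show ?thesis .
qed

text \<open>Lets an estimate of \<open>ddc f\<close>, proved in one chart near a point, be used in
  every holomorphic chart there.\<close>

lemma herm_value_ddc_jac:
  assumes "complex_atlas \<A>" "(V, z) \<in> holo_charts \<A>" "(W, w) \<in> holo_charts \<A>"
    and "open U" "mfd_smooth_on \<A> U f" "x \<in> V" "x \<in> W" "x \<in> U"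
  shows "herm_value (ddc f (V, z) x) \<xi> = herm_value (ddc f (W, w) x) (jac (V, z) (W, w) x \<xi>)"
proof (rule herm_value_jac)
  let ?F = "\<lambda>y. complex_of_real (f y)"
  let ?S = "z ` (V \<inter> (W \<inter> U))" let ?T = "in_coords (V, z) w"
  have oW: "open W" by (rule chart_props(1)[OF assms(3)])
  have S: "open ?S" using oW assms(4) by (intro open_chart_image[OF assms(2)]) auto
  have O: "open (w ` (W \<inter> U))" by (rule open_chart_image[OF assms(3,4)])
  have zx: "z x \<in> ?S" using assms by auto
  have sF: "smooth_on (w ` (W \<inter> U)) (in_coords (W, w) ?F)"
    using smooth_on_bounded_linear_compose[OF bounded_linear_of_real O mfd_smooth_onD[OF assms(5,3)]]
    by (simp add: in_coords_of_real)
  have hT: "holo_on ?S (\<lambda>y. ?T y $ k)" for k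
    using holo_on_subset[OF holo_transition[OF assms(1-3), of k], of ?S] by (auto simp: in_coords_def o_def)
  have Tk: "(\<lambda>y. ?T y $ k) = in_coords (V, z) (\<lambda>y. w y $ k)" for k by (simp add: in_coords_def o_def)
  have cg: "in_coords (V, z) ?F y = in_coords (W, w) ?F (?T y)" if "y \<in> ?S" for y
    using that assms(2,3) by auto
  have Tx: "?T (z x) = w x" using assms(2,6) by simp
  have im: "?T ` ?S \<subseteq> w ` (W \<inter> U)" using assms(2) by auto
  have main: "del_delbar ?F (V, z) x $ i $ j = (\<Sum>k\<in>UNIV. \<Sum>l\<in>UNIV. del_delbar ?F (W, w) x $ k $ l
      * wirt i (in_coords (V, z) (\<lambda>y. w y $ k)) (z x) * cnj (wirt j (in_coords (V, z) (\<lambda>y. w y $ l)) (z x)))" for i j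
  proof -
    have "wirt_bar j (in_coords (V, z) ?F) y = wirt_bar j (\<lambda>y. in_coords (W, w) ?F (?T y)) y" if "y \<in> ?S" for y
      by (rule wirt_cong_open(2)[OF S that cg])
    then have "wirt i (wirt_bar j (in_coords (V, z) ?F)) (z x) = wirt i (wirt_bar j (\<lambda>y. in_coords (W, w) ?F (?T y))) (z x)"
      by (rule wirt_cong_open(1)[OF S zx])
    also have "\<dots> = (\<Sum>k\<in>UNIV. \<Sum>l\<in>UNIV. wirt k (wirt_bar l (in_coords (W, w) ?F)) (?T (z x)) * wirt i (\<lambda>y. ?T y $ k) (z x) * cnj (wirt j (\<lambda>y. ?T y $ l) (z x)))"
      by (rule wirt_wirt_bar_chain[OF S O im sF hT zx])
    finally show ?thesis unfolding Tx Tk by (simp add: del_delbar_def)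
  qed
  show "ddc f (V, z) x $ i $ j = (\<Sum>k\<in>UNIV. \<Sum>l\<in>UNIV. ddc f (W, w) x $ k $ l
             * wirt i (in_coords (V, z) (\<lambda>y. snd (W, w) y $ k)) (snd (V, z) x)
             * cnj (wirt j (in_coords (V, z) (\<lambda>y. snd (W, w) y $ l)) (snd (V, z) x)))" for i j
    by (simp add: ddc_def main sum_distrib_left mult.assoc)
qed

text \<open>\<open>levi f c x \<xi> / 2\<pi>\<close> is the value of \<open>dd\<^sup>c f\<close> on the vector with coordinates \<open>\<xi>\<close>.\<close>

definition levi :: "('a \<Rightarrow> real) \<Rightarrow> ('a, 'n::finite) chart \<Rightarrow> 'a \<Rightarrow> complex^'n \<Rightarrow> real" where
  "levi f c x \<xi> = Re (\<Sum>i\<in>UNIV. \<Sum>j\<in>UNIV. wirt i (wirt_bar j (\<lambda>y. complex_of_real (in_coords c f y))) (snd c x) * \<xi> $ i * cnj (\<xi> $ j))"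

text \<open>Hermitian symmetry of the second derivatives makes the double sum equal to its
  conjugate, hence real. The factor \<open>\<i>\<close> of \<open>ddc\<close> cancels against the
  one divided out in \<open>herm_value\<close>, which leaves \<open>1 / (2 * pi)\<close>.\<close>

lemma herm_value_ddc:
  assumes "(V, z) \<in> holo_charts \<A>" "open U" "mfd_smooth_on \<A> U f" "x \<in> V" "x \<in> U"
  shows "herm_value (ddc f (V, z) x) \<xi> = of_real (levi f (V, z) x \<xi> / (2 * pi))"
proof -
  let ?a = "\<lambda>i j. wirt i (wirt_bar j (\<lambda>y. complex_of_real (in_coords (V, z) f y))) (z x)"
  have H: "cnj (?a i j) = ?a j i" for i j
    using assms by (intro wirt_wirt_bar_hermitian[OF open_chart_image[OF assms(1,2)] mfd_smooth_onD[OF assms(3,1)]]) auto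
  let ?s = "\<Sum>i\<in>UNIV. \<Sum>j\<in>UNIV. ?a i j * \<xi> $ i * cnj (\<xi> $ j)"
  have "cnj ?s = (\<Sum>i\<in>UNIV. \<Sum>j\<in>UNIV. ?a j i * \<xi> $ j * cnj (\<xi> $ i))"
    by (simp add: cnj_sum H mult_ac)
  also have "\<dots> = ?s" by (rule sum.swap)
  finally have "?s \<in> \<real>" by (simp add: Reals_cnj_iff)
  then have s: "?s = of_real (levi f (V, z) x \<xi>)" unfolding levi_def snd_conv by (rule of_real_Re[symmetric])
  have "herm_value (ddc f (V, z) x) \<xi> = (\<Sum>i\<in>UNIV. \<Sum>j\<in>UNIV. (1 / (2 * of_real pi)) * (?a i j * \<xi> $ i * cnj (\<xi> $ j)))"
    unfolding herm_value_def ddc_def del_delbar_def in_coords_of_real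
    by (simp add: field_simps)
  also have "\<dots> = (1 / (2 * of_real pi)) * ?s" by (simp add: sum_distrib_left)
  finally show ?thesis unfolding s by simp
qed

section \<open>Germs of coordinate hyperplanes\<close>

lemma norm_axis_complex: "norm (axis j c :: complex^'n::finite) = norm c"
proof -
  have "(\<Sum>i\<in>UNIV. (norm ((axis j c :: complex^'n) $ i))\<^sup>2) = (\<Sum>i\<in>UNIV. if i = j then (norm c)\<^sup>2 else 0)"
    by (rule sum.cong) (auto simp: axis_def)
  then show ?thesis by (simp add: norm_vec_def L2_set_def)
qed

text \<open>If the indices differed, a small move in the \<open>j\<close>-th coordinate would stay
  on \<open>z_i = 0\<close> and leave \<open>z_j = 0\<close>.\<close>

lemma coordinate_hyperplanes_distinct:
  assumes "(V, z) \<in> holo_charts \<A>" "open W" "p \<in> W" "W \<subseteq> V" "z p $ i = 0"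
    and sub: "\<And>x. x \<in> W \<Longrightarrow> z x $ i = 0 \<Longrightarrow> z x $ j = 0"
  shows "i = j"
proof (rule ccontr)
  assume "i \<noteq> j"
  have "open (z ` W)" by (rule open_chart_image_subset[OF assms(1,2,4)])
  moreover have "z p \<in> z ` W" using assms(3) by blast
  ultimately obtain e where e: "e > 0" "cball (z p) e \<subseteq> z ` W" using open_contains_cball_eq by blast
  have "dist (z p) (z p + axis j (of_real e)) = e"
    using e(1) by (simp add: dist_norm norm_axis_complex)
  then have "z p + axis j (of_real e) \<in> cball (z p) e" by simp
  then have "z p + axis j (of_real e) \<in> z ` W" using e(2) by blast
  then obtain x where x: "x \<in> W" "z x = z p + axis j (of_real e)" by force
  have "z x $ i = 0" using x(2) \<open>i \<noteq> j\<close> assms(5) by (simp add: axis_def)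
  then have "z x $ j = 0" by (rule sub[OF x(1)])
  moreover have "z p $ j = 0" by (rule sub[OF assms(3,5)])
  ultimately show False using x(2) e(1) by (simp add: axis_def)
qed

text \<open>An irreducible germ inside a finite union lies in one of its members. Here the germ is a
  hyperplane of the chart \<open>w\<close>, the members are hyperplanes of \<open>z\<close>, and
  \<open>holo_finite_zero_product\<close> on a small ball excludes that every \<open>z_i\<close> is
  somewhere nonzero on the germ.\<close>

lemma hyperplane_germ_in_union:
  assumes at: "complex_atlas \<A>" and c: "(V, z) \<in> holo_charts \<A>" and d: "(Y, w) \<in> holo_charts \<A>"
    and I: "finite I" and W: "open W" "p \<in> W" "W \<subseteq> V \<inter> Y" and "w p $ j = 0"
    and un: "\<And>x. x \<in> W \<Longrightarrow> w x $ j = 0 \<Longrightarrow> \<exists>i\<in>I. z x $ i = 0"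
  shows "\<exists>i\<in>I. \<exists>W'. open W' \<and> p \<in> W' \<and> W' \<subseteq> W \<and> (\<forall>x\<in>W'. w x $ j = 0 \<longrightarrow> z x $ i = 0)"
proof -
  have "open (w ` W)" by (rule open_chart_image_subset[OF d W(1)]) (use W(3) in blast)
  then obtain r where r: "r > 0" "ball (w p) r \<subseteq> w ` W" using W(2) open_contains_ball by blast
  define F where "F = (\<lambda>i. in_coords (Y, w) (\<lambda>x. z x $ i))"
  have Fx: "F i (w x) = z x $ i" if "x \<in> W" for i x
    unfolding F_def using in_coords_at[OF d, of x] W(3) that by blast
  have hol: "holo_on (ball (w p) r) (F i)" for i
  proof -
    have "ball (w p) r \<subseteq> w ` (Y \<inter> V)" using r(2) W(3) by blast
    then show ?thesis unfolding F_def by (rule holo_on_subset[OF holo_transition[OF at d c]])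
  qed
  let ?E = "{y::complex^'b. y $ j = 0}"
  have "\<exists>i\<in>I. \<forall>y\<in>ball (w p) r \<inter> ?E. F i y = 0"
  proof (rule ccontr)
    assume no: "\<not> ?thesis"
    have "\<exists>y\<in>ball (w p) r \<inter> ?E. \<forall>i\<in>I. F i y \<noteq> 0"
    proof (rule holo_finite_zero_product[OF open_ball convex_ball I hol])
      have "w p \<in> ball (w p) r \<inter> ?E" using r(1) assms(8) by simp
      then show "ball (w p) r \<inter> ?E \<noteq> {}" by blast
      show "\<exists>y\<in>ball (w p) r \<inter> ?E. F i y \<noteq> 0" if "i \<in> I" for i using no that by blast
    qed simp
    then obtain y where y: "y \<in> ball (w p) r" "y $ j = 0" "\<forall>i\<in>I. F i y \<noteq> 0" by blast
    obtain x where x: "x \<in> W" "y = w x" using y(1) r(2) by blast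
    then show False using un[OF x(1)] y(2,3) Fx[OF x(1)] by auto
  qed
  then obtain i where i: "i \<in> I" "\<forall>y\<in>ball (w p) r \<inter> ?E. F i y = 0" by blast
  let ?W = "W \<inter> (Y \<inter> w -` ball (w p) r)"
  have "open ?W" using W(1) open_chart_preimage[OF d open_ball] by (rule open_Int)
  moreover have "p \<in> ?W" using W r(1) by auto
  moreover have "z x $ i = 0" if "x \<in> ?W" "w x $ j = 0" for x
    using i(2) Fx[of x i] that by force
  ultimately show ?thesis using i(1) by (intro bexI[of _ i] exI[of _ ?W]) auto
qed

section \<open>Norms of the sections near the divisor\<close>

locale snc_pair =
  fixes \<A> :: "('a::t2_space, 'n::finite) chart set"
    and m :: nat and Dc :: "nat \<Rightarrow> 'a set" and D :: "'a set"
    and L :: "nat \<Rightarrow> 'a line_bundle"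
    and s :: "nat \<Rightarrow> 'a set \<Rightarrow> 'a \<Rightarrow> complex"
    and h :: "nat \<Rightarrow> 'a set \<Rightarrow> 'a \<Rightarrow> real"
  assumes compact_X: "compact (UNIV :: 'a set)" and atlas: "complex_atlas \<A>"
    and m1: "m \<ge> 1" and snc: "snc_divisor \<A> m Dc" and D_eq: "D = (\<Union>k\<in>{1..m}. Dc k)"
    and lbdl: "\<And>k. k \<in> {1..m} \<Longrightarrow> holo_line_bundle \<A> (L k)"
    and sect: "\<And>k. k \<in> {1..m} \<Longrightarrow> holo_section \<A> (L k) (s k)"
    and divisor: "\<And>k. k \<in> {1..m} \<Longrightarrow> section_divisor \<A> (L k) (s k) (Dc k)"
    and metric: "\<And>k. k \<in> {1..m} \<Longrightarrow> smooth_metric \<A> (L k) (h k)"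
    and small: "\<And>k x. k \<in> {1..m} \<Longrightarrow> section_norm_sq (L k) (h k) (s k) x \<le> exp (- exp 1)"
begin

abbreviation nsq :: "nat \<Rightarrow> 'a \<Rightarrow> real" where
  "nsq k \<equiv> section_norm_sq (L k) (h k) (s k)"

definition lg :: "nat \<Rightarrow> 'a \<Rightarrow> real" where
  "lg k x = ln (1 / nsq k x)"

definition \<Theta>1 :: "'a \<Rightarrow> real" where
  "\<Theta>1 x = (\<Sum>k=1..m. ln (lg k x))"

text \<open>\<open>section_norm_sq\<close> evaluates in an arbitrarily chosen trivializing set. The
  cocycle acts on the section and on the metric in opposite ways, so every other set gives the same
  value.\<close>

lemma nsq_eq:
  assumes "k \<in> {1..m}" "U \<in> triv_cover (L k)" "x \<in> U"
  shows "nsq k x = h k U x * (norm (s k U x))\<^sup>2"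
proof -
  define W where "W = (SOME U. U \<in> triv_cover (L k) \<and> x \<in> U)"
  have W: "W \<in> triv_cover (L k) \<and> x \<in> W"
    unfolding W_def by (rule someI[of "\<lambda>U. U \<in> triv_cover (L k) \<and> x \<in> U" U]) (use assms in blast)
  have xUW: "x \<in> U \<inter> W" using W assms(3) by blast
  have s: "s k U x = cocycle (L k) U W x * s k W x"
    using sect[OF assms(1), unfolded holo_section_def, THEN conjunct2] assms(2) W xUW by blast
  have h: "h k W x = (norm (cocycle (L k) U W x))\<^sup>2 * h k U x"
    using metric[OF assms(1), unfolded smooth_metric_def, THEN conjunct2] assms(2) W xUW by blast
  show ?thesis unfolding section_norm_sq_def W_def[symmetric] Let_def h s by (simp add: norm_mult power_mult_distrib)
qed

lemma cover_at:
  assumes "k \<in> {1..m}"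
  obtains U where "U \<in> triv_cover (L k)" "x \<in> U" "open U"
proof -
  have "x \<in> \<Union>(triv_cover (L k))" and op: "\<forall>U\<in>triv_cover (L k). open U"
    using lbdl[OF assms] unfolding holo_line_bundle_def by simp_all
  then obtain U where U: "U \<in> triv_cover (L k)" "x \<in> U" by (elim UnionE)
  with op have "open U" by (elim bspec)
  with U show ?thesis by (rule that)
qed

lemma snc_chart:
  obtains V z \<iota> where "(V, z) \<in> holo_charts \<A>" "p \<in> V" "inj_on \<iota> {k\<in>{1..m}. p \<in> Dc k}"
    "\<And>k. k \<in> {1..m} \<Longrightarrow> p \<in> Dc k \<Longrightarrow> Dc k \<inter> V = {x\<in>V. z x $ \<iota> k = 0}"
    "\<And>k. k \<in> {1..m} \<Longrightarrow> p \<notin> Dc k \<Longrightarrow> Dc k \<inter> V = {}"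
proof -
  have "\<exists>(V, z)\<in>holo_charts \<A>. \<exists>\<iota>. p \<in> V \<and> inj_on \<iota> {k\<in>{1..m}. p \<in> Dc k} \<and>
        (\<forall>k\<in>{1..m}. Dc k \<inter> V = (if p \<in> Dc k then {x\<in>V. z x $ \<iota> k = 0} else {}))"
    using snc[unfolded snc_divisor_def, THEN conjunct2] by (rule spec)
  then obtain c \<iota> where c: "c \<in> holo_charts \<A>" "p \<in> fst c" "inj_on \<iota> {k\<in>{1..m}. p \<in> Dc k}"
    "\<forall>k\<in>{1..m}. Dc k \<inter> fst c = (if p \<in> Dc k then {x\<in>fst c. snd c x $ \<iota> k = 0} else {})"
    unfolding case_prod_beta by (elim bexE exE conjE)
  show ?thesis
  proof (rule that[of "fst c" "snd c" \<iota>])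
    show "Dc k \<inter> fst c = {x\<in>fst c. snd c x $ \<iota> k = 0}" if "k \<in> {1..m}" "p \<in> Dc k" for k
      using bspec[OF c(4) that(1)] that(2) by (simp only: if_True)
    show "Dc k \<inter> fst c = {}" if "k \<in> {1..m}" "p \<notin> Dc k" for k
      using bspec[OF c(4) that(1)] that(2) by (simp only: if_False)
  qed (use c in simp_all)
qed

lemma metric_pos: "k \<in> {1..m} \<Longrightarrow> U \<in> triv_cover (L k) \<Longrightarrow> x \<in> U \<Longrightarrow> h k U x > 0"
  using metric unfolding smooth_metric_def by blast

lemma section_zero: "k \<in> {1..m} \<Longrightarrow> U \<in> triv_cover (L k) \<Longrightarrow> x \<in> U \<Longrightarrow> s k U x = 0 \<longleftrightarrow> x \<in> Dc k"
  using divisor unfolding section_divisor_def has_divisor_def by blast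

lemma nsq_pos:
  assumes "k \<in> {1..m}" "x \<notin> Dc k"
  shows "nsq k x > 0"
proof -
  obtain U where U: "U \<in> triv_cover (L k)" "x \<in> U" using cover_at[OF assms(1)] by blast
  show ?thesis unfolding nsq_eq[OF assms(1) U]
    using metric_pos[OF assms(1) U] section_zero[OF assms(1) U] assms(2) by simp
qed

text \<open>The normalisation by \<open>exp (- exp 1)\<close> is made for this: the logarithm is at
  least e, so the iterated logarithm is at least 1, and the powers of \<Theta>1 increase with the
  exponent.\<close>

lemma lg_ge:
  assumes "k \<in> {1..m}" "x \<notin> Dc k"
  shows "lg k x \<ge> exp 1"
proof -
  have "ln (nsq k x) \<le> ln (exp (- exp 1))"
    by (rule ln_mono[OF small[OF assms(1)] nsq_pos[OF assms]])
  then show ?thesis unfolding lg_def using nsq_pos[OF assms] by (simp add: ln_div)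
qed

lemma lg_ge_1: "k \<in> {1..m} \<Longrightarrow> x \<notin> Dc k \<Longrightarrow> lg k x \<ge> 1"
  using lg_ge[of k x] by (rule order_trans[rotated]) auto

lemma ln_lg_ge_1:
  assumes "k \<in> {1..m}" "x \<notin> Dc k"
  shows "ln (lg k x) \<ge> 1"
proof -
  have "ln (exp 1) \<le> ln (lg k x)" by (rule ln_mono[OF lg_ge[OF assms]]) simp
  then show ?thesis by simp
qed

lemma notin_D: "x \<notin> D \<Longrightarrow> k \<in> {1..m} \<Longrightarrow> x \<notin> Dc k"
  unfolding D_eq by blast

lemma ln_lg_le_\<Theta>1: "x \<notin> D \<Longrightarrow> k \<in> {1..m} \<Longrightarrow> ln (lg k x) \<le> \<Theta>1 x"
  unfolding \<Theta>1_def by (rule member_le_sum) (use notin_D ln_lg_ge_1 in \<open>force+\<close>)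

lemma \<Theta>1_ge_1: "x \<notin> D \<Longrightarrow> \<Theta>1 x \<ge> 1"
  using ln_lg_le_\<Theta>1[of x 1] ln_lg_ge_1[of 1 x] notin_D[of x 1] m1 by fastforce

text \<open>An snc chart at a point outside the component misses the component altogether.\<close>

lemma open_minus_Dc:
  assumes "k \<in> {1..m}" shows "open (- Dc k)"
  unfolding open_subopen[of "- Dc k"]
proof
  fix p assume "p \<in> - Dc k"
  obtain V z where c: "(V, z) \<in> holo_charts \<A>" "p \<in> V"
    and DV: "p \<notin> Dc k \<Longrightarrow> Dc k \<inter> V = {}"
    using snc_chart[of p] assms by metis
  have "Dc k \<inter> V = {}" using DV \<open>p \<in> - Dc k\<close> by simp
  then show "\<exists>T. open T \<and> p \<in> T \<and> T \<subseteq> - Dc k"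
    using c(2) chart_props(1)[OF c(1)] by (intro exI[of _ V]) blast
qed

lemma open_minus_D: "open (- D)"
proof -
  have "- D = (\<Inter>k\<in>{1..m}. - Dc k)" unfolding D_eq by blast
  then show ?thesis using open_minus_Dc by (simp add: open_INT)
qed

lemma lg_smooth:
  assumes k: "k \<in> {1..m}"
  shows "mfd_smooth_on \<A> (- Dc k) (lg k)"
proof (rule mfd_smooth_on_local)
  fix p assume p: "p \<in> - Dc k"
  obtain U where U: "U \<in> triv_cover (L k)" "p \<in> U" "open U" using cover_at[OF k] by blast
  let ?W = "U \<inter> - Dc k"
  have oW: "open ?W" using U(3) open_minus_Dc[OF k] by (rule open_Int)
  have hs: "mfd_smooth_on \<A> U (h k U)" using metric[OF k] U(1) by (auto simp: smooth_metric_def)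
  have ss: "mfd_smooth_on \<A> U (s k U)" using sect[OF k] U by (auto simp: holo_section_def intro: mfd_holo_imp_smooth)
  have "mfd_smooth_on \<A> ?W (\<lambda>x. - ln (h k U x * (norm (s k U x))\<^sup>2))"
  proof (intro mfd_smooth_on_linear[OF oW bounded_linear_minus[OF bounded_linear_ident]] mfd_smooth_on_ln[OF oW] mfd_smooth_on_mult[OF oW] mfd_smooth_on_cmod_sq[OF oW])
    show "mfd_smooth_on \<A> ?W (h k U)" by (rule mfd_smooth_on_subset[OF hs]) blast
    show "mfd_smooth_on \<A> ?W (s k U)" by (rule mfd_smooth_on_subset[OF ss]) blast
    show "0 < h k U x * (norm (s k U x))\<^sup>2" if "x \<in> ?W" for x
      using nsq_pos[OF k, of x] nsq_eq[OF k U(1), of x] that by simp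
  qed
  then have "mfd_smooth_on \<A> ?W (lg k)"
  proof (rule mfd_smooth_on_cong[OF oW, rotated])
    fix x assume x: "x \<in> ?W"
    then have "nsq k x > 0" by (intro nsq_pos[OF k]) blast
    then have "lg k x = - ln (nsq k x)" by (simp add: lg_def ln_div)
    then show "- ln (h k U x * (norm (s k U x))\<^sup>2) = lg k x" using nsq_eq[OF k U(1), of x] x by simp
  qed
  then show "\<exists>W. open W \<and> p \<in> W \<and> mfd_smooth_on \<A> W (lg k)" using oW U(2) p by blast
qed

lemma ln_lg_smooth:
  assumes "k \<in> {1..m}"
  shows "mfd_smooth_on \<A> (- Dc k) (\<lambda>x. ln (lg k x))"
  by (rule mfd_smooth_on_ln[OF open_minus_Dc[OF assms] lg_smooth[OF assms]])
     (use lg_ge_1[OF assms] in \<open>force intro: less_le_trans[OF zero_less_one]\<close>)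

lemma minus_D_subset: "k \<in> {1..m} \<Longrightarrow> - D \<subseteq> - Dc k"
  unfolding D_eq by blast

lemma \<Theta>1_smooth: "mfd_smooth_on \<A> (- D) \<Theta>1"
  unfolding \<Theta>1_def[abs_def]
  by (rule mfd_smooth_on_sum[OF open_minus_D], rule mfd_smooth_on_subset[OF ln_lg_smooth minus_D_subset])

text \<open>An adapted chart describes \<open>D\<close> only as a whole, so its hyperplanes are
  matched with the components through an snc chart at \<open>p\<close>. Every component germ lies in
  some \<open>z_i = 0\<close>, and every such hyperplane germ lies in some component. Going there
  and back gives an inclusion between two hyperplanes of a single chart, which forces the indices,
  and then the germs, to be equal.\<close>

lemma adapted_germs:
  assumes ad: "adapted_chart \<A> D (V, z) M" and p: "p \<in> V"
  shows "\<And>k. k \<in> {1..m} \<Longrightarrow> p \<in> Dc k \<Longrightarrow>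
      \<exists>i\<in>M. z p $ i = 0 \<and> (\<exists>W. open W \<and> p \<in> W \<and> W \<subseteq> V \<and> (\<forall>x\<in>W. x \<in> Dc k \<longleftrightarrow> z x $ i = 0))"
    and "\<And>i. i \<in> M \<Longrightarrow> z p $ i = 0 \<Longrightarrow>
      \<exists>k\<in>{1..m}. p \<in> Dc k \<and> (\<exists>W. open W \<and> p \<in> W \<and> W \<subseteq> V \<and> (\<forall>x\<in>W. x \<in> Dc k \<longleftrightarrow> z x $ i = 0))"
proof -
  have c: "(V, z) \<in> holo_charts \<A>" and DV: "D \<inter> V = {x\<in>V. \<exists>i\<in>M. z x $ i = 0}"
    using ad by (auto simp: adapted_chart_def)
  define K where "K = {k\<in>{1..m}. p \<in> Dc k}"
  obtain Y w \<iota> where d: "(Y, w) \<in> holo_charts \<A>" and pY: "p \<in> Y" and inj: "inj_on \<iota> K"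
    and DY: "\<And>k. k \<in> {1..m} \<Longrightarrow> p \<in> Dc k \<Longrightarrow> Dc k \<inter> Y = {x\<in>Y. w x $ \<iota> k = 0}"
    and DY0: "\<And>k. k \<in> {1..m} \<Longrightarrow> p \<notin> Dc k \<Longrightarrow> Dc k \<inter> Y = {}"
    unfolding K_def by (rule snc_chart[of p]) blast
  have Kx: "x \<in> Dc k \<longleftrightarrow> w x $ \<iota> k = 0" if "k \<in> K" "x \<in> Y" for k x
  proof -
    have "Dc k \<inter> Y = {x\<in>Y. w x $ \<iota> k = 0}" using DY that(1) unfolding K_def by blast
    then show ?thesis using that(2) by blast
  qed
  have oO: "open (V \<inter> Y)" "p \<in> V \<inter> Y" using chart_props(1)[OF c] chart_props(1)[OF d] p pY by auto
  have step1: "\<exists>i\<in>M. \<exists>W. open W \<and> p \<in> W \<and> W \<subseteq> V \<inter> Y \<and> (\<forall>x\<in>W. w x $ \<iota> k = 0 \<longrightarrow> z x $ i = 0)" if k: "k \<in> K" for k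
  proof (rule hyperplane_germ_in_union[OF atlas c d finite oO order_refl])
    show "w p $ \<iota> k = 0" using Kx[OF k pY] k by (simp add: K_def)
    fix x assume x: "x \<in> V \<inter> Y" "w x $ \<iota> k = 0"
    then have "x \<in> Dc k" using Kx[OF k] by blast
    then have "x \<in> D \<inter> V" using k x unfolding D_eq K_def by blast
    then show "\<exists>i\<in>M. z x $ i = 0" unfolding DV by blast
  qed
  have step2: "\<exists>k\<in>K. \<exists>W. open W \<and> p \<in> W \<and> W \<subseteq> Y \<inter> V \<and> (\<forall>x\<in>W. z x $ i = 0 \<longrightarrow> w x $ \<iota> k = 0)"
    if i: "i \<in> M" "z p $ i = 0" for i
  proof -
    have "\<exists>j\<in>\<iota> ` K. \<exists>W. open W \<and> p \<in> W \<and> W \<subseteq> Y \<inter> V \<and> (\<forall>x\<in>W. z x $ i = 0 \<longrightarrow> w x $ j = 0)"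
    proof (rule hyperplane_germ_in_union[OF atlas d c _ _ _ order_refl i(2)])
      show "finite (\<iota> ` K)" unfolding K_def by simp
      show "open (Y \<inter> V)" "p \<in> Y \<inter> V" using oO by (simp_all add: Int_commute)
      fix x assume x: "x \<in> Y \<inter> V" "z x $ i = 0"
      then have "x \<in> D" using DV i(1) by blast
      then obtain k where k: "k \<in> {1..m}" "x \<in> Dc k" unfolding D_eq by blast
      \<comment> \<open>The snc chart at \<open>p\<close> meets only components that pass through
        \<open>p\<close>.\<close>
      have "p \<in> Dc k" using DY0[OF k(1)] k(2) x(1) by blast
      then have "k \<in> K" using k(1) unfolding K_def by blast
      then show "\<exists>j\<in>\<iota> ` K. w x $ j = 0" using Kx[of k x] x(1) k(2) by blast
    qed
    then show ?thesis by blast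
  qed
  show "\<exists>i\<in>M. z p $ i = 0 \<and> (\<exists>W. open W \<and> p \<in> W \<and> W \<subseteq> V \<and> (\<forall>x\<in>W. x \<in> Dc k \<longleftrightarrow> z x $ i = 0))"
    if "k \<in> {1..m}" "p \<in> Dc k" for k
  proof -
    have k: "k \<in> K" using that by (simp add: K_def)
    obtain i W where i: "i \<in> M" and W: "open W" "p \<in> W" "W \<subseteq> V \<inter> Y" "\<forall>x\<in>W. w x $ \<iota> k = 0 \<longrightarrow> z x $ i = 0"
      using step1[OF k] by blast
    have zi: "z p $ i = 0" using W Kx[OF k pY] that by blast
    obtain k' W' where k': "k' \<in> K" and W': "open W'" "p \<in> W'" "W' \<subseteq> Y \<inter> V" "\<forall>x\<in>W'. z x $ i = 0 \<longrightarrow> w x $ \<iota> k' = 0"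
      using step2[OF i zi] by blast
    \<comment> \<open>The zero set of coordinate \<open>\<iota> k\<close> lies in that of
      \<open>z_i\<close>, which lies in that of \<open>\<iota> k'\<close>; the outer two belong to
      the same chart \<open>w\<close>.\<close>
    have "\<iota> k = \<iota> k'"
      by (rule coordinate_hyperplanes_distinct[OF d open_Int[OF W(1) W'(1)]]) (use W W' Kx[OF k pY] that in auto)
    then have "\<forall>x\<in>W \<inter> W'. x \<in> Dc k \<longleftrightarrow> z x $ i = 0" using Kx[OF k] W W' by (metis Int_iff subsetD)
    then show ?thesis using i zi W W' by (intro bexI[of _ i] conjI exI[of _ "W \<inter> W'"]) auto
  qed
  show "\<exists>k\<in>{1..m}. p \<in> Dc k \<and> (\<exists>W. open W \<and> p \<in> W \<and> W \<subseteq> V \<and> (\<forall>x\<in>W. x \<in> Dc k \<longleftrightarrow> z x $ i = 0))"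
    if i: "i \<in> M" "z p $ i = 0" for i
  proof -
    obtain k W where k: "k \<in> K" and W: "open W" "p \<in> W" "W \<subseteq> Y \<inter> V" "\<forall>x\<in>W. z x $ i = 0 \<longrightarrow> w x $ \<iota> k = 0"
      using step2[OF i] by blast
    obtain i' W' where i': "i' \<in> M" and W': "open W'" "p \<in> W'" "W' \<subseteq> V \<inter> Y" "\<forall>x\<in>W'. w x $ \<iota> k = 0 \<longrightarrow> z x $ i' = 0"
      using step1[OF k] by blast
    have "i = i'"
      by (rule coordinate_hyperplanes_distinct[OF c open_Int[OF W(1) W'(1)]]) (use W W' i in auto)
    then have "\<forall>x\<in>W \<inter> W'. x \<in> Dc k \<longleftrightarrow> z x $ i = 0" using Kx[OF k] W W' by (metis Int_iff subsetD)
    moreover have "k \<in> {1..m}" "p \<in> Dc k" using k by (simp_all add: K_def)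
    ultimately show ?thesis using W W' by (intro bexI[of _ k] conjI exI[of _ "W \<inter> W'"]) auto
  qed
qed

text \<open>Locally the section is a holomorphic unit times the coordinate; the metric and the unit
  are collected in the smooth function \<open>G\<close>.\<close>

lemma lg_normal_form:
  assumes c: "(V, z) \<in> holo_charts \<A>" and k: "k \<in> {1..m}"
    and W0: "open W0" "p \<in> W0" "W0 \<subseteq> V" "\<forall>x\<in>W0. x \<in> Dc k \<longleftrightarrow> z x $ i = 0"
  obtains W G where "open W" "p \<in> W" "W \<subseteq> W0" "smooth_on (z ` W) G"
    "\<And>x. x \<in> W \<Longrightarrow> x \<notin> Dc k \<Longrightarrow> lg k x = G (z x) - ln ((norm (z x $ i))\<^sup>2)"
proof -
  obtain U where U: "U \<in> triv_cover (L k)" "p \<in> U" "open U" using cover_at[OF k] by blast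
  define W where "W = W0 \<inter> U"
  have W: "open W" "p \<in> W" "W \<subseteq> W0" "W \<subseteq> V" "W \<subseteq> U" unfolding W_def using W0 U by auto
  \<comment> \<open>\<open>has_divisor\<close> yields the unit in charts contained in the
    trivializing set, hence the restriction to \<open>W\<close>.\<close>
  have cW: "(W, z) \<in> holo_charts \<A>" by (rule holo_charts_restrict[OF c atlas W(1,4)])
  have hd: "has_divisor \<A> U (s k U) (Dc k)" using divisor[OF k] U(1) by (simp add: section_divisor_def)
  have "Dc k \<inter> W = {x\<in>W. z x $ i = 0}" using W0(4) W(3) by blast
  then obtain u where u: "mfd_holo_on \<A> W u" "\<forall>x\<in>W. u x \<noteq> 0 \<and> s k U x = u x * z x $ i"
    using hd cW W(5) unfolding has_divisor_def by blast
  have hs: "mfd_smooth_on \<A> W (h k U)"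
    using metric[OF k] U(1) W(5) by (auto simp: smooth_metric_def intro: mfd_smooth_on_subset)
  define g where "g = (\<lambda>x. - ln (h k U x * (norm (u x))\<^sup>2))"
  have pos: "h k U x > 0" "norm (u x) > 0" if "x \<in> W" for x
    using metric_pos[OF k U(1)] u(2) W(5) that by auto
  have "mfd_smooth_on \<A> W g"
    unfolding g_def
    by (intro mfd_smooth_on_linear[OF W(1) bounded_linear_minus[OF bounded_linear_ident]] mfd_smooth_on_ln[OF W(1)]
        mfd_smooth_on_mult[OF W(1)] mfd_smooth_on_cmod_sq[OF W(1)] hs mfd_holo_imp_smooth[OF W(1) u(1)])
       (use pos in auto)
  from mfd_smooth_onD[OF this c] have sm: "smooth_on (z ` W) (in_coords (V, z) g)" using W(4) by (simp add: Int_absorb1)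
  show ?thesis
  proof (rule that[OF W(1-3) sm])
    fix x assume x: "x \<in> W" "x \<notin> Dc k"
    have zi: "norm (z x $ i) > 0" using W0(4) x W(3) by auto
    have "nsq k x = (h k U x * (norm (u x))\<^sup>2) * (norm (z x $ i))\<^sup>2"
      using nsq_eq[OF k U(1), of x] u(2) x W(5) by (auto simp: norm_mult power_mult_distrib)
    then show "lg k x = in_coords (V, z) g (z x) - ln ((norm (z x $ i))\<^sup>2)"
      using in_coords_at[OF c, of x g] x W(4) pos[OF x(1)] zi
      by (simp add: lg_def g_def ln_div ln_mult_pos subsetD)
  qed
qed

end

section \<open>Complex first and second derivatives of real functions\<close>

text \<open>For a real function the conjugate derivatives are the conjugates of these, so
  \<open>cj1\<close> and \<open>cj2\<close> carry all of del, delbar and del delbar.\<close>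

definition cj1 :: "(complex^'n::finite \<Rightarrow> real) \<Rightarrow> complex^'n \<Rightarrow> 'n \<Rightarrow> complex" where
  "cj1 F p i = wirt i (\<lambda>y. complex_of_real (F y)) p"

definition cj2 :: "(complex^'n::finite \<Rightarrow> real) \<Rightarrow> complex^'n \<Rightarrow> 'n \<Rightarrow> 'n \<Rightarrow> complex" where
  "cj2 F p i j = wirt i (wirt_bar j (\<lambda>y. complex_of_real (F y))) p"

lemma wirt_wirt_bar_cong:
  assumes "open S" "p \<in> S" "\<And>q. q \<in> S \<Longrightarrow> wirt_bar j f q = g q"
  shows "wirt i (wirt_bar j f) p = wirt i g p"
  by (rule wirt_cong_open(1)[OF assms])

lemma cj_cong:
  assumes "open S" "p \<in> S" "\<And>y. y \<in> S \<Longrightarrow> F y = G y"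
  shows "cj1 F p = cj1 G p" "cj2 F p = cj2 G p"
proof -
  have "wirt i (\<lambda>y. complex_of_real (F y)) q = wirt i (\<lambda>y. complex_of_real (G y)) q"
    and e: "wirt_bar i (\<lambda>y. complex_of_real (F y)) q = wirt_bar i (\<lambda>y. complex_of_real (G y)) q" if "q \<in> S" for i q
    by (rule wirt_cong_open[OF assms(1) that], simp add: assms(3))+
  then show "cj1 F p = cj1 G p" using assms(2) by (simp add: cj1_def fun_eq_iff)
  show "cj2 F p = cj2 G p" unfolding cj2_def fun_eq_iff
    by (intro allI wirt_wirt_bar_cong[OF assms(1,2)] e)
qed

lemma smooth_on_of_real: "open S \<Longrightarrow> smooth_on S F \<Longrightarrow> smooth_on S (\<lambda>y. complex_of_real (F y))"
  by (rule smooth_on_bounded_linear_compose[OF bounded_linear_of_real])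

lemma wirt_bar_eq_cj1:
  "F differentiable at p \<Longrightarrow> wirt_bar i (\<lambda>y. complex_of_real (F y)) p = cnj (cj1 F p i)"
  unfolding cj1_def by (rule wirt_bar_of_real)

lemma cj_add:
  assumes S: "open S" "smooth_on S F" "smooth_on S G" "p \<in> S"
  shows "cj1 (\<lambda>y. F y + G y) p i = cj1 F p i + cj1 G p i"
    and "cj2 (\<lambda>y. F y + G y) p i j = cj2 F p i j + cj2 G p i j"
proof -
  note sF = smooth_on_of_real[OF S(1,2)] and sG = smooth_on_of_real[OF S(1,3)]
  have d: "(\<lambda>y. complex_of_real (F y)) differentiable at q" "(\<lambda>y. complex_of_real (G y)) differentiable at q" if "q \<in> S" for q
    by (rule smooth_on_differentiable[OF sF that], rule smooth_on_differentiable[OF sG that])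
  have e: "wirt_bar j (\<lambda>y. complex_of_real (F y + G y)) q = wirt_bar j (\<lambda>y. complex_of_real (F y)) q + wirt_bar j (\<lambda>y. complex_of_real (G y)) q"
    if "q \<in> S" for q
    unfolding of_real_add by (rule wirt_add(2)[OF d[OF that]])
  have e2: "wirt i (wirt_bar j (\<lambda>y. complex_of_real (F y + G y))) p =
      wirt i (\<lambda>q. wirt_bar j (\<lambda>y. complex_of_real (F y)) q + wirt_bar j (\<lambda>y. complex_of_real (G y)) q) p"
    by (rule wirt_wirt_bar_cong[OF S(1,4)]) (rule e)
  show "cj1 (\<lambda>y. F y + G y) p i = cj1 F p i + cj1 G p i"
    unfolding cj1_def of_real_add by (rule wirt_add(1)[OF d[OF S(4)]])
  show "cj2 (\<lambda>y. F y + G y) p i j = cj2 F p i j + cj2 G p i j"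
    unfolding cj2_def e2
    by (rule wirt_add(1)) (rule smooth_on_differentiable[OF smooth_on_wirt(2)[OF S(1) sF] S(4)],
        rule smooth_on_differentiable[OF smooth_on_wirt(2)[OF S(1) sG] S(4)])
qed

lemma cj_mult:
  assumes S: "open S" "smooth_on S F" "smooth_on S G" "p \<in> S"
  shows "cj1 (\<lambda>y. F y * G y) p i = of_real (F p) * cj1 G p i + cj1 F p i * of_real (G p)"
    and "cj2 (\<lambda>y. F y * G y) p i j = of_real (F p) * cj2 G p i j + cj1 F p i * cnj (cj1 G p j)
      + (cnj (cj1 F p j) * cj1 G p i + cj2 F p i j * of_real (G p))"
proof -
  note sF = smooth_on_of_real[OF S(1,2)] and sG = smooth_on_of_real[OF S(1,3)]
  let ?F = "\<lambda>y. complex_of_real (F y)" and ?G = "\<lambda>y. complex_of_real (G y)"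
  have d: "?F differentiable at q" "?G differentiable at q" if "q \<in> S" for q
    by (rule smooth_on_differentiable[OF sF that], rule smooth_on_differentiable[OF sG that])
  have dw: "wirt_bar j ?F differentiable at p" "wirt_bar j ?G differentiable at p"
    by (rule smooth_on_differentiable[OF smooth_on_wirt(2)[OF S(1) sF] S(4)],
        rule smooth_on_differentiable[OF smooth_on_wirt(2)[OF S(1) sG] S(4)])
  have b: "wirt_bar j ?F p = cnj (cj1 F p j)" "wirt_bar j ?G p = cnj (cj1 G p j)"
    by (rule wirt_bar_eq_cj1, rule smooth_on_differentiable[OF S(2,4)], rule wirt_bar_eq_cj1, rule smooth_on_differentiable[OF S(3,4)])
  have e: "wirt_bar j (\<lambda>y. complex_of_real (F y * G y)) q = ?F q * wirt_bar j ?G q + wirt_bar j ?F q * ?G q" if "q \<in> S" for q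
    unfolding of_real_mult by (rule wirt_mult(2)[OF d[OF that]])
  have e2: "wirt i (wirt_bar j (\<lambda>y. complex_of_real (F y * G y))) p = wirt i (\<lambda>q. ?F q * wirt_bar j ?G q + wirt_bar j ?F q * ?G q) p"
    by (rule wirt_wirt_bar_cong[OF S(1,4)]) (rule e)
  show "cj1 (\<lambda>y. F y * G y) p i = of_real (F p) * cj1 G p i + cj1 F p i * of_real (G p)"
    unfolding cj1_def of_real_mult by (rule wirt_mult(1)[OF d[OF S(4)]])
  show "cj2 (\<lambda>y. F y * G y) p i j = of_real (F p) * cj2 G p i j + cj1 F p i * cnj (cj1 G p j)
      + (cnj (cj1 F p j) * cj1 G p i + cj2 F p i j * of_real (G p))"
    unfolding cj2_def e2
      wirt_add(1)[OF differentiable_mult[OF d(1)[OF S(4)] dw(2)] differentiable_mult[OF dw(1) d(2)[OF S(4)]]]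
      wirt_mult(1)[OF d(1)[OF S(4)] dw(2)] wirt_mult(1)[OF dw(1) d(2)[OF S(4)]] b
    by (simp add: cj1_def)
qed

lemma cj_const: "cj1 (\<lambda>y. c) p i = 0" "cj2 (\<lambda>y. c) p i j = 0"
proof -
  have "wirt_bar j (\<lambda>y. complex_of_real c) = (\<lambda>q. 0)" by (simp add: fun_eq_iff)
  then show "cj1 (\<lambda>y. c) p i = 0" "cj2 (\<lambda>y. c) p i j = 0" unfolding cj1_def cj2_def by simp_all
qed

lemma cj_cmult:
  assumes S: "open S" "smooth_on S F" "p \<in> S"
  shows "cj1 (\<lambda>y. c * F y) p i = of_real c * cj1 F p i"
    and "cj2 (\<lambda>y. c * F y) p i j = of_real c * cj2 F p i j"
  using cj_mult[OF S(1) smooth_on_const S(2,3), of c] by (simp_all add: cj_const)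

lemma cj_uminus:
  assumes S: "open S" "smooth_on S F" "p \<in> S"
  shows "cj1 (\<lambda>y. - F y) p i = - cj1 F p i" "cj2 (\<lambda>y. - F y) p i j = - cj2 F p i j"
  using cj_cmult[OF S, of "-1"] by simp_all

text \<open>The rank-one term enters with a negative sign; for \<open>- ln\<close> it becomes the
  square that produces the Poincare metric.\<close>

lemma cj_ln:
  assumes S: "open S" "smooth_on S F" "p \<in> S" and pos: "\<And>y. y \<in> S \<Longrightarrow> F y > 0"
  shows "cj1 (\<lambda>y. ln (F y)) p i = cj1 F p i / of_real (F p)"
    and "cj2 (\<lambda>y. ln (F y)) p i j = cj2 F p i j / of_real (F p) - cj1 F p i * cnj (cj1 F p j) / (of_real (F p))\<^sup>2"
proof -
  have d: "F differentiable at q" if "q \<in> S" for q by (rule smooth_on_differentiable[OF S(2) that])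
  have l: "(ln has_real_derivative inverse (F q)) (at (F q))" if "q \<in> S" for q
    by (rule DERIV_ln[OF pos[OF that]])
  have iv: "(inverse has_real_derivative - (inverse (F p) * inverse (F p))) (at (F p))"
    using DERIV_inverse[of "F p"] pos[OF S(3)] by (simp add: power2_eq_square)
  show "cj1 (\<lambda>y. ln (F y)) p i = cj1 F p i / of_real (F p)"
    unfolding cj1_def wirt_real_chain(1)[OF d[OF S(3)] l[OF S(3)]] by (simp add: field_simps)
  let ?F = "\<lambda>y. complex_of_real (F y)"
  have e: "wirt_bar j (\<lambda>y. complex_of_real (ln (F y))) q = of_real (inverse (F q)) * wirt_bar j ?F q" if "q \<in> S" for q
    by (rule wirt_real_chain(2)[OF d[OF that] l[OF that]])
  have e2: "wirt i (wirt_bar j (\<lambda>y. complex_of_real (ln (F y)))) p = wirt i (\<lambda>q. of_real (inverse (F q)) * wirt_bar j ?F q) p"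
    by (rule wirt_wirt_bar_cong[OF S(1,3)]) (rule e)
  have di: "(\<lambda>y. complex_of_real (inverse (F y))) differentiable at p"
    using real_chain_differentiable[OF d[OF S(3)] iv] by (intro differentiable_of_real) (auto simp: differentiable_def)
  have dw: "wirt_bar j ?F differentiable at p"
    by (rule smooth_on_differentiable[OF smooth_on_wirt(2)[OF S(1) smooth_on_of_real[OF S(1,2)]] S(3)])
  show "cj2 (\<lambda>y. ln (F y)) p i j = cj2 F p i j / of_real (F p) - cj1 F p i * cnj (cj1 F p j) / (of_real (F p))\<^sup>2"
    unfolding cj2_def e2 wirt_mult(1)[OF di dw]
      wirt_real_chain(1)[OF d[OF S(3)] iv] wirt_bar_eq_cj1[OF d[OF S(3)]] cj1_def
    using pos[OF S(3)] by (simp add: field_simps power2_eq_square)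
qed

lemma levi_cj2: "levi f (V, z) x \<xi> = Re (\<Sum>i\<in>UNIV. \<Sum>j\<in>UNIV. cj2 (in_coords (V, z) f) (z x) i j * \<xi> $ i * cnj (\<xi> $ j))"
  by (simp add: levi_def cj2_def)

text \<open>The bounded quantities are the coefficients in the frame of the d\<zeta>_i, obtained by
  multiplying with \<open>log_frame\<close>. The value of \<open>f\<close> itself is left out, so
  that the same predicate serves log-log growth and Poincare growth.\<close>

definition jets_le :: "('a, 'n::finite) chart \<Rightarrow> 'n set \<Rightarrow> ('a \<Rightarrow> real) \<Rightarrow> 'a \<Rightarrow> real \<Rightarrow> bool" where
  "jets_le c M f x b \<longleftrightarrow>
    (\<forall>i. norm (cj1 (in_coords c f) (snd c x) i) * norm (log_frame M (snd c x) i) \<le> b) \<and>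
    (\<forall>i j. norm (cj2 (in_coords c f) (snd c x) i j) * (norm (log_frame M (snd c x) i) * norm (log_frame M (snd c x) j)) \<le> b)"

lemma jets_le_mono: "jets_le c M f x b \<Longrightarrow> b \<le> b' \<Longrightarrow> jets_le c M f x b'"
  unfolding jets_le_def by (meson order_trans)

section \<open>Local bounds with natural-number constants\<close>

lemma eventually_bounded_smooth:
  fixes G :: "complex^'n::finite \<Rightarrow> 'b::real_normed_vector" and V :: "'a::t2_space set"
  assumes "(V, z) \<in> holo_charts \<A>" "open W" "p \<in> W" "W \<subseteq> V" "smooth_on (z ` W) G"
  shows "\<exists>N::nat. \<forall>\<^sub>F x in nhds p. norm (G (z x)) \<le> real N"
proof -
  have "continuous_on W (\<lambda>x. G (z x))"
    by (rule continuous_on_compose2[OF smooth_on_continuous_on[OF assms(5)] continuous_on_subset[OF chart_props(4)[OF assms(1)] assms(4)] order_refl])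
  then have "isCont (\<lambda>x. norm (G (z x))) p"
    using assms(2,3) by (intro continuous_norm) (simp add: continuous_on_eq_continuous_at)
  then have "((\<lambda>x. norm (G (z x))) \<longlongrightarrow> norm (G (z p))) (at p)"
    by (simp add: isCont_def)
  moreover obtain N :: nat where N: "norm (G (z p)) < real N" using reals_Archimedean2 by blast
  ultimately have "\<forall>\<^sub>F x in at p. norm (G (z x)) < real N" by (rule order_tendstoD(2))
  with N have "\<forall>\<^sub>F x in nhds p. norm (G (z x)) < real N" by (simp add: eventually_nhds_conv_at)
  then have "\<forall>\<^sub>F x in nhds p. norm (G (z x)) \<le> real N" by (rule eventually_mono) simp
  then show ?thesis by blast
qed

text \<open>A bound that weakens as its natural parameter grows can be shared: the sum of finitely
  many parameters dominates each of them.\<close>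

lemma eventually_finite_nat:
  assumes "finite I" "\<And>i. i \<in> I \<Longrightarrow> \<exists>N::nat. \<forall>\<^sub>F x in Fl. Q i N x"
    and mono: "\<And>i N N' x. N \<le> N' \<Longrightarrow> Q i N x \<Longrightarrow> Q i N' x"
  shows "\<exists>N. \<forall>\<^sub>F x in Fl. \<forall>i\<in>I. Q i N x"
proof -
  obtain f where f: "\<And>i. i \<in> I \<Longrightarrow> \<forall>\<^sub>F x in Fl. Q i (f i) x" using assms(2) by metis
  have le: "f i \<le> sum f I" if "i \<in> I" for i using assms(1) that by (simp add: member_le_sum)
  have "\<forall>\<^sub>F x in Fl. Q i (sum f I) x" if "i \<in> I" for i
    by (rule eventually_mono[OF f[OF that]]) (rule mono[OF le[OF that]])
  then have "\<forall>\<^sub>F x in Fl. \<forall>i\<in>I. Q i (sum f I) x" using assms(1) by (simp add: eventually_ball_finite)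
  then show ?thesis by blast
qed

text \<open>The passage from estimates near each point to one estimate on a compact set, again by
  adding the constants of a finite subcover.\<close>

lemma eventually_compact_nat:
  fixes K :: "'a::topological_space set"
  assumes "compact K" "\<And>p. p \<in> K \<Longrightarrow> \<exists>N::nat. \<forall>\<^sub>F x in nhds p. Q N x"
    and mono: "\<And>N N' x. N \<le> N' \<Longrightarrow> Q N x \<Longrightarrow> Q N' x"
  shows "\<exists>N. \<forall>x\<in>K. Q N x"
proof -
  have "\<exists>N::nat. \<exists>S. open S \<and> p \<in> S \<and> (\<forall>x\<in>S. Q N x)" if "p \<in> K" for p
    using assms(2)[OF that] unfolding eventually_nhds by blast
  then obtain f S where fS: "\<And>p. p \<in> K \<Longrightarrow> open (S p)" "\<And>p. p \<in> K \<Longrightarrow> p \<in> S p" "\<And>p x. p \<in> K \<Longrightarrow> x \<in> S p \<Longrightarrow> Q (f p) x"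
    by metis
  have "K \<subseteq> (\<Union>p\<in>K. S p)" using fS(2) by blast
  with assms(1) fS(1) obtain C where C: "C \<subseteq> K" "finite C" "K \<subseteq> (\<Union>p\<in>C. S p)"
    by (rule compactE_image)
  have "Q (sum f C) x" if x: "x \<in> K" for x
  proof -
    obtain p where p: "p \<in> C" "x \<in> S p" using C(3) x by blast
    have "f p \<le> sum f C" using C(2) p(1) by (simp add: member_le_sum)
    moreover have "Q (f p) x" using fS(3) p C(1) by blast
    ultimately show ?thesis by (rule mono)
  qed
  then show ?thesis by blast
qed

text \<open>Merges constant and exponent into one parameter, the form that
  \<open>eventually_finite_nat\<close> and \<open>eventually_compact_nat\<close> can handle. It
  works because the base is at least 1.\<close>

lemma power_bound_nat: "\<exists>N::nat. \<forall>t::real. t \<ge> 1 \<longrightarrow> C * t ^ k \<le> real N * t ^ N"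
proof -
  obtain N0 :: nat where N0: "C \<le> real N0" using real_arch_simple by blast
  have "C * t ^ k \<le> real (N0 + k) * t ^ (N0 + k)" if "t \<ge> 1" for t :: real
  proof (rule mult_mono)
    show "t ^ k \<le> t ^ (N0 + k)" using that by (intro power_increasing) auto
  qed (use N0 that in auto)
  then show ?thesis by blast
qed

text \<open>The condition \<open>|z_i| < 1/e\<close> keeps the logarithm above 1, so the frame
  function can be divided by. The upper bound 1 is \<open>ln t \<le> t\<close> at
  \<open>t = 1 / |z_i|\<close>.\<close>

lemma norm_log_frame:
  assumes "norm (z $ i) < 1 / exp 1" "i \<in> M \<Longrightarrow> z $ i \<noteq> 0"
  shows "norm (log_frame M z i) \<le> 1" "norm (log_frame M z i) > 0"
    and "i \<in> M \<Longrightarrow> norm (log_frame M z i) = norm (z $ i) * ln (1 / norm (z $ i))"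
    and "i \<in> M \<Longrightarrow> ln (1 / norm (z $ i)) > 1"
proof -
  have l: "ln (1 / norm (z $ i)) > 1" if "i \<in> M"
  proof -
    have n: "norm (z $ i) > 0" using assms(2)[OF that] by simp
    have "exp 1 < 1 / norm (z $ i)" using assms(1) n by (simp add: field_simps)
    then have "ln (exp 1) < ln (1 / norm (z $ i))" using ln_less_cancel_iff[of "exp 1" "1 / norm (z $ i)"] n by simp
    then show ?thesis by simp
  qed
  then show "i \<in> M \<Longrightarrow> ln (1 / norm (z $ i)) > 1" .
  show e: "norm (log_frame M z i) = norm (z $ i) * ln (1 / norm (z $ i))" if "i \<in> M"
    using l[OF that] that by (simp add: log_frame_def norm_mult)
  show "norm (log_frame M z i) > 0"
  proof (cases "i \<in> M")
    case True
    have "norm (z $ i) > 0" using assms(2)[OF True] by simp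
    moreover have "ln (1 / norm (z $ i)) > 0" using l[OF True] by linarith
    ultimately show ?thesis unfolding e[OF True] by (rule mult_pos_pos)
  qed (simp add: log_frame_def)
  show "norm (log_frame M z i) \<le> 1"
  proof (cases "i \<in> M")
    case True
    then have n: "norm (z $ i) > 0" using assms(2) by simp
    have "ln (1 / norm (z $ i)) \<le> 1 / norm (z $ i)" using ln_bound[of "1 / norm (z $ i)"] n by simp
    then have "norm (z $ i) * ln (1 / norm (z $ i)) \<le> norm (z $ i) * (1 / norm (z $ i))" using n by (intro mult_left_mono) auto
    then show ?thesis using e[OF True] n by simp
  qed (simp add: log_frame_def)
qed

context snc_pair
begin

lemma adapted_props:
  assumes "adapted_chart \<A> D (V, z) M" "x \<in> V" "x \<notin> D"
  shows "norm (z x $ i) < 1 / exp 1" "i \<in> M \<Longrightarrow> z x $ i \<noteq> 0"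
proof -
  have a: "\<forall>x\<in>V. \<forall>i. norm (z x $ i) < 1 / exp 1" "D \<inter> V = {x\<in>V. \<exists>i\<in>M. z x $ i = 0}"
    using assms(1) by (simp_all add: adapted_chart_def)
  show "norm (z x $ i) < 1 / exp 1" using a(1) assms(2) by blast
  show "i \<in> M \<Longrightarrow> z x $ i \<noteq> 0" using a(2) assms(2,3) by blast
qed

lemma adapted_holo: "adapted_chart \<A> D (V, z) M \<Longrightarrow> (V, z) \<in> holo_charts \<A>"
  by (simp add: adapted_chart_def)

lemma smooth_coords:
  "mfd_smooth_on \<A> (- D) f \<Longrightarrow> (V, z) \<in> holo_charts \<A> \<Longrightarrow> smooth_on (z ` (V \<inter> - D)) (in_coords (V, z) f)"
  by (rule mfd_smooth_onD)

lemma open_coords: "(V, z) \<in> holo_charts \<A> \<Longrightarrow> open (z ` (V \<inter> - D))"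
  by (rule open_chart_image[OF _ open_minus_D])

lemma eventually_in_open: "open W \<Longrightarrow> p \<in> W \<Longrightarrow> \<forall>\<^sub>F x in nhds p. x \<in> W"
  by (rule eventually_nhds_in_open)

section \<open>Log norms near a point of an adapted chart\<close>

lemma eventually_bounded_jets:
  assumes "(V, z) \<in> holo_charts \<A>" "open W" "p \<in> W" "W \<subseteq> V" "smooth_on (z ` W) G"
  shows "\<exists>N::nat. \<forall>\<^sub>F x in nhds p. \<bar>G (z x)\<bar> \<le> real N \<and> (\<forall>i. norm (cj1 G (z x) i) \<le> real N) \<and> (\<forall>i j. norm (cj2 G (z x) i j) \<le> real N)"
proof -
  have op: "open (z ` W)" by (rule open_chart_image_subset[OF assms(1,2,4)])
  note sG = smooth_on_of_real[OF op assms(5)]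
  have 1: "\<exists>N::nat. \<forall>\<^sub>F x in nhds p. \<forall>i\<in>UNIV. norm (cj1 G (z x) i) \<le> real N"
    unfolding cj1_def
    by (rule eventually_finite_nat) (auto intro: eventually_bounded_smooth[OF assms(1-4) smooth_on_wirt(1)[OF op sG]])
  have 2: "\<exists>N::nat. \<forall>\<^sub>F x in nhds p. \<forall>ij\<in>UNIV. norm (cj2 G (z x) (fst ij) (snd ij)) \<le> real N"
    unfolding cj2_def
    by (rule eventually_finite_nat)
       (auto intro: eventually_bounded_smooth[OF assms(1-4) smooth_on_wirt(1)[OF op smooth_on_wirt(2)[OF op sG]]])
  obtain N0 :: nat where "\<forall>\<^sub>F x in nhds p. norm (G (z x)) \<le> real N0" using eventually_bounded_smooth[OF assms] by blast
  moreover obtain N1 :: nat where "\<forall>\<^sub>F x in nhds p. \<forall>i\<in>UNIV. norm (cj1 G (z x) i) \<le> real N1" using 1 by blast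
  moreover obtain N2 :: nat where "\<forall>\<^sub>F x in nhds p. \<forall>ij\<in>UNIV. norm (cj2 G (z x) (fst ij) (snd ij)) \<le> real N2" using 2 by blast
  ultimately have "\<forall>\<^sub>F x in nhds p. \<bar>G (z x)\<bar> \<le> real (N0 + N1 + N2) \<and> (\<forall>i. norm (cj1 G (z x) i) \<le> real (N0 + N1 + N2))
      \<and> (\<forall>i j. norm (cj2 G (z x) i j) \<le> real (N0 + N1 + N2))"
  proof eventually_elim
    case (elim x)
    have "norm (cj1 G (z x) i) \<le> real (N0 + N1 + N2)" for i
      using bspec[OF elim(2) UNIV_I, of i] by simp
    moreover have "norm (cj2 G (z x) i j) \<le> real (N0 + N1 + N2)" for i j
      using bspec[OF elim(3) UNIV_I, of "(i, j)"] by simp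
    ultimately show ?case using elim(1) by simp
  qed
  then show ?thesis by (rule exI)
qed

lemma lg_near_off:
  assumes ad: "adapted_chart \<A> D (V, z) M" and p: "p \<in> V" and k: "k \<in> {1..m}" and pk: "p \<notin> Dc k"
  shows "\<exists>N::nat. \<forall>\<^sub>F x in nhds p. lg k x \<le> real N \<and> (\<forall>j. norm (cj1 (in_coords (V, z) (lg k)) (z x) j) \<le> real N)
     \<and> (\<forall>i j. norm (cj2 (in_coords (V, z) (lg k)) (z x) i j) \<le> real N)"
proof -
  note c = adapted_holo[OF ad]
  let ?W = "V \<inter> - Dc k"
  have W: "open ?W" "p \<in> ?W" using chart_props(1)[OF c] open_minus_Dc[OF k] p pk by auto
  have ev: "\<forall>\<^sub>F x in nhds p. x \<in> ?W" by (rule eventually_in_open[OF W])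
  obtain N :: nat where "\<forall>\<^sub>F x in nhds p. \<bar>in_coords (V, z) (lg k) (z x)\<bar> \<le> real N \<and> (\<forall>i. norm (cj1 (in_coords (V, z) (lg k)) (z x) i) \<le> real N)
      \<and> (\<forall>i j. norm (cj2 (in_coords (V, z) (lg k)) (z x) i j) \<le> real N)"
    using eventually_bounded_jets[OF c W Int_lower1 mfd_smooth_onD[OF lg_smooth[OF k] c]] by blast
  with ev have "\<forall>\<^sub>F x in nhds p. lg k x \<le> real N \<and> (\<forall>j. norm (cj1 (in_coords (V, z) (lg k)) (z x) j) \<le> real N)
     \<and> (\<forall>i j. norm (cj2 (in_coords (V, z) (lg k)) (z x) i j) \<le> real N)"
  proof eventually_elim
    case (elim x)
    then have "in_coords (V, z) (lg k) (z x) = lg k x" using in_coords_at[OF c] by blast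
    then show ?case using elim(2) by (metis abs_le_D1)
  qed
  then show ?thesis by (rule exI)
qed

text \<open>In the normal form the singular part is \<open>- log |z_i|^2\<close>. It accounts for
  the value \<open>2 log 1/|z_i|\<close> and the derivative \<open>- 1 / z_i\<close>, contributes
  nothing to the second derivatives by pluriharmonicity, and what remains comes from a smooth
  function.\<close>

lemma lg_near_on:
  assumes ad: "adapted_chart \<A> D (V, z) M" and p: "p \<in> V" and k: "k \<in> {1..m}"
    and W0: "open W0" "p \<in> W0" "W0 \<subseteq> V" "\<forall>x\<in>W0. x \<in> Dc k \<longleftrightarrow> z x $ i = 0"
  shows "\<exists>N::nat. \<forall>\<^sub>F x in nhds p. x \<notin> Dc k \<longrightarrow> z x $ i \<noteq> 0 \<and> \<bar>lg k x - 2 * ln (1 / norm (z x $ i))\<bar> \<le> real N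
     \<and> (\<forall>j. norm (cj1 (in_coords (V, z) (lg k)) (z x) j + (if j = i then 1 / z x $ i else 0)) \<le> real N)
     \<and> (\<forall>a b. norm (cj2 (in_coords (V, z) (lg k)) (z x) a b) \<le> real N)"
proof -
  note c = adapted_holo[OF ad]
  obtain W G where W: "open W" "p \<in> W" "W \<subseteq> W0" and sG: "smooth_on (z ` W) G"
    and nf: "\<And>x. x \<in> W \<Longrightarrow> x \<notin> Dc k \<Longrightarrow> lg k x = G (z x) - ln ((norm (z x $ i))\<^sup>2)"
    by (rule lg_normal_form[OF c k W0]) blast
  have WV: "W \<subseteq> V" using W(3) W0(3) by blast
  obtain N :: nat where N: "\<forall>\<^sub>F x in nhds p. \<bar>G (z x)\<bar> \<le> real N \<and> (\<forall>i. norm (cj1 G (z x) i) \<le> real N) \<and> (\<forall>i j. norm (cj2 G (z x) i j) \<le> real N)"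
    using eventually_bounded_jets[OF c W(1,2) WV sG] by blast
  have ev: "\<forall>\<^sub>F x in nhds p. x \<in> W" by (rule eventually_in_open[OF W(1,2)])
  let ?S = "z ` (W \<inter> - Dc k)"
  have oS: "open ?S"
    by (rule open_chart_image_subset[OF c open_Int[OF W(1) open_minus_Dc[OF k]]]) (use WV in blast)
  have nz: "z x $ i \<noteq> 0" if "x \<in> W" "x \<notin> Dc k" for x using W0(4) W(3) that by blast
  have sGS: "smooth_on ?S G" by (rule smooth_on_subset[OF sG]) blast
  have sL: "smooth_on ?S (\<lambda>y. ln ((norm (y $ i))\<^sup>2))" by (rule smooth_on_subset[OF smooth_on_ln_coord]) (use nz in auto)
  have "\<forall>\<^sub>F x in nhds p. x \<notin> Dc k \<longrightarrow> z x $ i \<noteq> 0 \<and> \<bar>lg k x - 2 * ln (1 / norm (z x $ i))\<bar> \<le> real N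
     \<and> (\<forall>j. norm (cj1 (in_coords (V, z) (lg k)) (z x) j + (if j = i then 1 / z x $ i else 0)) \<le> real N)
     \<and> (\<forall>a b. norm (cj2 (in_coords (V, z) (lg k)) (z x) a b) \<le> real N)"
    using N ev
  proof eventually_elim
    case (elim x)
    show ?case
    proof (intro impI)
      assume xk: "x \<notin> Dc k"
      have zx: "z x \<in> ?S" using elim(2) xk by blast
      have zi: "z x $ i \<noteq> 0" by (rule nz[OF elim(2) xk])
      have eq: "in_coords (V, z) (lg k) y = G y + - ln ((norm (y $ i))\<^sup>2)" if "y \<in> ?S" for y
      proof -
        from that obtain x where "y = z x" "x \<in> W \<inter> - Dc k" by (rule imageE)
        then have x: "x \<in> W" "x \<notin> Dc k" "y = z x" by simp_all
        have "x \<in> V" using x(1) WV by blast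
        then show ?thesis using in_coords_at[OF c, of x "lg k"] nf[OF x(1,2)] x(3) by simp
      qed
      have cc: "cj1 (in_coords (V, z) (lg k)) (z x) = cj1 (\<lambda>y. G y + - ln ((norm (y $ i))\<^sup>2)) (z x)"
        "cj2 (in_coords (V, z) (lg k)) (z x) = cj2 (\<lambda>y. G y + - ln ((norm (y $ i))\<^sup>2)) (z x)"
        by (rule cj_cong[OF oS zx], erule eq)+
      have c1: "cj1 (in_coords (V, z) (lg k)) (z x) j = cj1 G (z x) j - (if j = i then 1 / z x $ i else 0)" for j
        unfolding cc(1) cj_add(1)[OF oS sGS smooth_on_uminus[OF oS sL] zx] cj_uminus(1)[OF oS sL zx]
        by (simp add: cj1_def wirt_ln_coord(1)[OF zi])
      have c2: "cj2 (in_coords (V, z) (lg k)) (z x) a b = cj2 G (z x) a b" for a b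
        unfolding cc(2) cj_add(2)[OF oS sGS smooth_on_uminus[OF oS sL] zx] cj_uminus(2)[OF oS sL zx]
        by (simp add: cj2_def wirt_ln_coord(3)[OF zi])
      have "lg k x - 2 * ln (1 / norm (z x $ i)) = G (z x)"
        using nf[OF elim(2) xk] zi by (simp add: ln_div ln_realpow)
      then show "z x $ i \<noteq> 0 \<and> \<bar>lg k x - 2 * ln (1 / norm (z x $ i))\<bar> \<le> real N
         \<and> (\<forall>j. norm (cj1 (in_coords (V, z) (lg k)) (z x) j + (if j = i then 1 / z x $ i else 0)) \<le> real N)
         \<and> (\<forall>a b. norm (cj2 (in_coords (V, z) (lg k)) (z x) a b) \<le> real N)"
        unfolding c1 c2 using elim(1) zi by simp
    qed
  qed
  then show ?thesis by (rule exI)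
qed

end

text \<open>The scaled factors \<open>N * a j\<close> are all at least 1, so omitting some of them
  from the product can only decrease it.\<close>

lemma prod_scaled_bounds:
  fixes a :: "'i \<Rightarrow> real"
  assumes "finite M" "N \<ge> 1" "\<And>j. j \<in> M \<Longrightarrow> 0 \<le> a j" "\<And>j. j \<in> M \<Longrightarrow> 1 \<le> N * a j"
  shows "1 \<le> N ^ card M * (\<Prod>j\<in>M. a j)" and "i \<in> M \<Longrightarrow> a i \<le> N ^ card M * (\<Prod>j\<in>M. a j)"
proof -
  have e: "N ^ card M * (\<Prod>j\<in>M. a j) = (\<Prod>j\<in>M. N * a j)" by (simp add: prod.distrib)
  show "1 \<le> N ^ card M * (\<Prod>j\<in>M. a j)" unfolding e by (rule prod_ge_1) (rule assms(4))
  show "a i \<le> N ^ card M * (\<Prod>j\<in>M. a j)" if i: "i \<in> M"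
  proof -
    have "(\<Prod>j\<in>M - {i}. N * a j) \<ge> 1" by (rule prod_ge_1) (use assms(4) in blast)
    then have "(N * a i) * 1 \<le> (N * a i) * (\<Prod>j\<in>M - {i}. N * a j)"
      using assms(4)[OF i] by (intro mult_left_mono) auto
    moreover have "a i \<le> N * a i" using mult_right_mono[OF assms(2) assms(3)[OF i]] by simp
    moreover have "(\<Prod>j\<in>M. N * a j) = (N * a i) * (\<Prod>j\<in>M - {i}. N * a j)" by (rule prod.remove[OF assms(1) i])
    ultimately show ?thesis unfolding e by linarith
  qed
qed

section \<open>Comparison of \<Theta>1 with the products of iterated logarithms\<close>

context snc_pair
begin

text \<open>A chart-free replacement for the products of iterated logarithms in the definition of
  log-log growth, with one parameter for both constant and exponent.\<close>

definition bd :: "nat \<Rightarrow> 'a \<Rightarrow> real" where "bd N x = real N * \<Theta>1 x ^ N"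

lemma bd_nonneg: "x \<notin> D \<Longrightarrow> bd N x \<ge> 0"
  using \<Theta>1_ge_1[of x] by (simp add: bd_def)

lemma bd_mono: "x \<notin> D \<Longrightarrow> N \<le> N' \<Longrightarrow> bd N x \<le> bd N' x"
  unfolding bd_def using \<Theta>1_ge_1[of x] by (intro mult_mono power_increasing) auto

lemma bd_dominates: "\<exists>N'. \<forall>x. x \<notin> D \<longrightarrow> C * \<Theta>1 x ^ k \<le> bd N' x"
  using power_bound_nat[of C k] \<Theta>1_ge_1 unfolding bd_def by blast

abbreviation ll :: "('a \<Rightarrow> complex^'n) \<Rightarrow> 'n \<Rightarrow> 'a \<Rightarrow> real" where
  "ll z i x \<equiv> ln (ln (1 / norm (z x $ i)))"

lemma eventually_in_chart: "adapted_chart \<A> D (V, z) M \<Longrightarrow> p \<in> V \<Longrightarrow> \<forall>\<^sub>F x in nhds p. x \<in> V"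
  by (rule eventually_in_open[OF chart_props(1)[OF adapted_holo]])

text \<open>The iterated logarithm tends to 0 as \<open>|z_i|\<close> approaches \<open>1/e\<close>,
  but the strict inequality at \<open>p\<close> leaves room for a positive lower bound
  nearby.\<close>

lemma ll_lower:
  assumes ad: "adapted_chart \<A> D (V, z) M" and p: "p \<in> V"
  shows "\<exists>N::nat. \<forall>\<^sub>F x in nhds p. \<forall>i\<in>M. x \<notin> D \<longrightarrow> 0 \<le> ll z i x \<and> 1 \<le> real N * ll z i x"
proof (rule eventually_finite_nat)
  fix i assume i: "i \<in> M"
  note c = adapted_holo[OF ad]
  have "norm (z p $ i) < 1 / exp 1" using ad p by (auto simp: adapted_chart_def)
  then obtain r where r: "norm (z p $ i) < r" "r < 1 / exp 1" using dense by blast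
  have r0: "r > 0" using r(1) norm_ge_zero[of "z p $ i"] by linarith
  have "exp 1 < 1 / r" using r(2) r0 by (simp add: field_simps)
  then have "ln (exp 1) < ln (1 / r)" using r0 by (subst ln_less_cancel_iff) auto
  then have lr: "ln (1 / r) > 1" by simp
  then have e: "ln (ln (1 / r)) > 0" by simp
  obtain N :: nat where N: "1 / ln (ln (1 / r)) < real N" using reals_Archimedean2 by blast
  have "isCont (\<lambda>x. norm (z x $ i)) p"
    using chart_props(1,4)[OF c] p by (intro continuous_intros) (simp add: continuous_on_eq_continuous_at)
  then have "((\<lambda>x. norm (z x $ i)) \<longlongrightarrow> norm (z p $ i)) (at p)" by (simp add: isCont_def)
  then have "\<forall>\<^sub>F x in at p. norm (z x $ i) < r" using r(1) by (rule order_tendstoD(2))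
  then have "\<forall>\<^sub>F x in nhds p. norm (z x $ i) < r" using r(1) by (simp add: eventually_nhds_conv_at)
  with eventually_in_chart[OF ad p]
  have "\<forall>\<^sub>F x in nhds p. x \<notin> D \<longrightarrow> 0 \<le> ll z i x \<and> 1 \<le> real N * ll z i x"
  proof eventually_elim
    case (elim x)
    show ?case
    proof
      assume x: "x \<notin> D"
      have n: "norm (z x $ i) > 0" using adapted_props(2)[OF ad elim(1) x i] by simp
      have "1 / r \<le> 1 / norm (z x $ i)" using elim(2) n r0 by (intro divide_left_mono mult_pos_pos) auto
      then have "ln (1 / r) \<le> ln (1 / norm (z x $ i))" using r0 n by (subst ln_le_cancel_iff) auto
      then have l: "ln (ln (1 / r)) \<le> ll z i x" using lr by (subst ln_le_cancel_iff) auto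
      have "1 \<le> real N * ln (ln (1 / r))" using N e by (simp add: field_simps)
      also have "\<dots> \<le> real N * ll z i x" using l by (intro mult_left_mono) auto
      finally show "0 \<le> ll z i x \<and> 1 \<le> real N * ll z i x" using l e by linarith
    qed
  qed
  then show "\<exists>N::nat. \<forall>\<^sub>F x in nhds p. x \<notin> D \<longrightarrow> 0 \<le> ll z i x \<and> 1 \<le> real N * ll z i x" by (rule exI)
next
  fix i N N' x
  assume "N \<le> N'" and *: "x \<notin> D \<longrightarrow> 0 \<le> ll z i x \<and> 1 \<le> real N * ll z i x"
  show "x \<notin> D \<longrightarrow> 0 \<le> ll z i x \<and> 1 \<le> real N' * ll z i x"
  proof
    assume "x \<notin> D"
    then have 1: "0 \<le> ll z i x" "1 \<le> real N * ll z i x" using * by auto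
    moreover have "real N * ll z i x \<le> real N' * ll z i x" using \<open>N \<le> N'\<close> 1 by (intro mult_right_mono) auto
    ultimately show "0 \<le> ll z i x \<and> 1 \<le> real N' * ll z i x" by linarith
  qed
qed simp

lemma ln_le_scaled:
  assumes "0 < (a::real)" "0 < b" "C > 0" "a \<le> C * b"
  shows "ln a \<le> C + ln b"
proof -
  have "ln a \<le> ln (C * b)" using assms by (subst ln_le_cancel_iff) auto
  also have "\<dots> = ln C + ln b" using assms by (simp add: ln_mult)
  also have "ln C \<le> C" using ln_bound[OF assms(3)] .
  finally show ?thesis by simp
qed

text \<open>If \<open>z_i\<close> vanishes at \<open>p\<close>, its hyperplane is a component there
  and \<open>log 1/|z_i|\<close> is at most a multiple of the log norm. Otherwise
  \<open>|z_i|\<close> stays away from 0 and a constant suffices, because \<Theta>1 is at least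
  1.\<close>

lemma ll_upper:
  assumes ad: "adapted_chart \<A> D (V, z) M" and p: "p \<in> V"
  shows "\<exists>N::nat. \<forall>\<^sub>F x in nhds p. \<forall>i\<in>M. x \<notin> D \<longrightarrow> ll z i x \<le> real N * \<Theta>1 x"
proof (rule eventually_finite_nat)
  fix i assume i: "i \<in> M"
  note c = adapted_holo[OF ad]
  show "\<exists>N::nat. \<forall>\<^sub>F x in nhds p. x \<notin> D \<longrightarrow> ll z i x \<le> real N * \<Theta>1 x"
  proof (cases "z p $ i = 0")
    case True
    obtain k W0 where k: "k \<in> {1..m}" and W0: "open W0" "p \<in> W0" "W0 \<subseteq> V" "\<forall>x\<in>W0. x \<in> Dc k \<longleftrightarrow> z x $ i = 0"
      using adapted_germs(2)[OF ad p i True] by blast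
    obtain N :: nat where N: "\<forall>\<^sub>F x in nhds p. x \<notin> Dc k \<longrightarrow> z x $ i \<noteq> 0 \<and> \<bar>lg k x - 2 * ln (1 / norm (z x $ i))\<bar> \<le> real N
       \<and> (\<forall>j. norm (cj1 (in_coords (V, z) (lg k)) (z x) j + (if j = i then 1 / z x $ i else 0)) \<le> real N)
       \<and> (\<forall>a b. norm (cj2 (in_coords (V, z) (lg k)) (z x) a b) \<le> real N)"
      using lg_near_on[OF ad p k W0] by blast
    have "\<forall>\<^sub>F x in nhds p. x \<notin> D \<longrightarrow> ll z i x \<le> real (N + 2) * \<Theta>1 x"
      using N eventually_in_chart[OF ad p]
    proof eventually_elim
      case (elim x)
      show ?case
      proof
        assume x: "x \<notin> D"
        have xk: "x \<notin> Dc k" by (rule notin_D[OF x k])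
        have l: "ln (1 / norm (z x $ i)) > 1" by (rule norm_log_frame(4)[OF adapted_props[OF ad elim(2) x] i])
        have g: "lg k x \<ge> 1" by (rule lg_ge_1[OF k xk])
        have "2 * ln (1 / norm (z x $ i)) \<le> lg k x + real N" using elim(1) xk by (auto simp: abs_le_iff)
        moreover have "real N \<le> real N * lg k x" using mult_left_mono[OF g, of "real N"] by simp
        moreover have "(real N + 1) * lg k x = real N * lg k x + lg k x" by (simp add: algebra_simps)
        ultimately have "ln (1 / norm (z x $ i)) \<le> (real N + 1) * lg k x" using l by linarith
        then have "ll z i x \<le> (real N + 1) + ln (lg k x)" using l g by (intro ln_le_scaled) auto
        also have "\<dots> \<le> (real N + 1) * \<Theta>1 x + \<Theta>1 x"
        proof (rule add_mono[OF _ ln_lg_le_\<Theta>1[OF x k]])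
          have "(real N + 1) * 1 \<le> (real N + 1) * \<Theta>1 x" using \<Theta>1_ge_1[OF x] by (intro mult_left_mono) auto
          then show "real N + 1 \<le> (real N + 1) * \<Theta>1 x" by simp
        qed
        also have "\<dots> = real (N + 2) * \<Theta>1 x" by (simp add: algebra_simps)
        finally show "ll z i x \<le> real (N + 2) * \<Theta>1 x" .
      qed
    qed
    then show ?thesis by (rule exI)
  next
    case False
    define r where "r = norm (z p $ i) / 2"
    have r0: "r > 0" "r < norm (z p $ i)" using False by (simp_all add: r_def)
    obtain N :: nat where N: "ln (1 / r) \<le> real N" using real_arch_simple by blast
    have "isCont (\<lambda>x. norm (z x $ i)) p"
      using chart_props(1,4)[OF c] p by (intro continuous_intros) (simp add: continuous_on_eq_continuous_at)
    then have "((\<lambda>x. norm (z x $ i)) \<longlongrightarrow> norm (z p $ i)) (at p)" by (simp add: isCont_def)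
    then have "\<forall>\<^sub>F x in at p. r < norm (z x $ i)" using r0(2) by (rule order_tendstoD(1))
    then have "\<forall>\<^sub>F x in nhds p. r < norm (z x $ i)" using r0(2) by (simp add: eventually_nhds_conv_at)
    with eventually_in_chart[OF ad p]
    have "\<forall>\<^sub>F x in nhds p. x \<notin> D \<longrightarrow> ll z i x \<le> real N * \<Theta>1 x"
    proof eventually_elim
      case (elim x)
      show ?case
      proof
        assume x: "x \<notin> D"
        have l: "ln (1 / norm (z x $ i)) > 1" by (rule norm_log_frame(4)[OF adapted_props[OF ad elim(1) x] i])
        have "1 / norm (z x $ i) \<le> 1 / r" using elim(2) r0(1) order.strict_trans[OF r0(1) elim(2)] by (intro divide_left_mono mult_pos_pos) auto
        then have "ln (1 / norm (z x $ i)) \<le> ln (1 / r)" using elim(2) r0 by (subst ln_le_cancel_iff) auto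
        moreover have "ll z i x \<le> ln (1 / norm (z x $ i))" using l by (intro ln_bound) auto
        moreover have "real N * 1 \<le> real N * \<Theta>1 x" using \<Theta>1_ge_1[OF x] by (intro mult_left_mono) auto
        ultimately show "ll z i x \<le> real N * \<Theta>1 x" using N by linarith
      qed
    qed
    then show ?thesis by (rule exI)
  qed
next
  fix i N N' x
  assume "N \<le> N'" and *: "x \<notin> D \<longrightarrow> ll z i x \<le> real N * \<Theta>1 x"
  show "x \<notin> D \<longrightarrow> ll z i x \<le> real N' * \<Theta>1 x"
  proof
    assume x: "x \<notin> D"
    have "real N * \<Theta>1 x \<le> real N' * \<Theta>1 x" using \<open>N \<le> N'\<close> \<Theta>1_ge_1[OF x] by (intro mult_right_mono) auto
    then show "ll z i x \<le> real N' * \<Theta>1 x" using * x by linarith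
  qed
qed simp

text \<open>The opposite comparison to \<open>ll_upper\<close>. Away from the component the log norm
  is bounded; near it the log norm is at most a multiple of one \<open>log 1/|z_i|\<close>. The
  local lower bounds on the factors let the full product absorb either estimate.\<close>

lemma ln_lg_upper:
  assumes ad: "adapted_chart \<A> D (V, z) M" and p: "p \<in> V" and k: "k \<in> {1..m}"
  shows "\<exists>N::nat. \<forall>\<^sub>F x in nhds p. x \<notin> D \<longrightarrow> ln (lg k x) \<le> real N * (\<Prod>i\<in>M. ll z i x) \<and> 0 \<le> (\<Prod>i\<in>M. ll z i x)"
proof -
  obtain N0 :: nat where N0: "\<forall>\<^sub>F x in nhds p. \<forall>i\<in>M. x \<notin> D \<longrightarrow> 0 \<le> ll z i x \<and> 1 \<le> real N0 * ll z i x"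
    using ll_lower[OF ad p] by blast
  \<comment> \<open>One more than \<open>N0\<close>, so that the scaling constant itself is at least
    1, as \<open>prod_scaled_bounds\<close> demands.\<close>
  define N1 where "N1 = N0 + 1"
  have N1: "\<forall>\<^sub>F x in nhds p. x \<notin> D \<longrightarrow> 0 \<le> (\<Prod>i\<in>M. ll z i x) \<and> 1 \<le> real (N1 ^ card M) * (\<Prod>i\<in>M. ll z i x)
      \<and> (\<forall>i\<in>M. ll z i x \<le> real (N1 ^ card M) * (\<Prod>i\<in>M. ll z i x))"
    using N0
  proof eventually_elim
    case (elim x)
    show ?case
    proof
      assume "x \<notin> D"
      then have a: "\<And>i. i \<in> M \<Longrightarrow> 0 \<le> ll z i x" "\<And>i. i \<in> M \<Longrightarrow> 1 \<le> real N0 * ll z i x" using elim by auto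
      have b: "\<And>i. i \<in> M \<Longrightarrow> 1 \<le> real N1 * ll z i x"
      proof -
        fix i assume i: "i \<in> M"
        have "real N1 * ll z i x = real N0 * ll z i x + ll z i x" by (simp add: N1_def algebra_simps)
        then show "1 \<le> real N1 * ll z i x" using a[OF i] by linarith
      qed
      have n1: "1 \<le> real N1" by (simp add: N1_def)
      have "0 \<le> (\<Prod>i\<in>M. ll z i x)" by (rule prod_nonneg) (rule a(1))
      then show "0 \<le> (\<Prod>i\<in>M. ll z i x) \<and> 1 \<le> real (N1 ^ card M) * (\<Prod>i\<in>M. ll z i x)
        \<and> (\<forall>i\<in>M. ll z i x \<le> real (N1 ^ card M) * (\<Prod>i\<in>M. ll z i x))"
        using prod_scaled_bounds(1)[of M "real N1" "\<lambda>i. ll z i x", OF finite n1 a(1) b]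
          prod_scaled_bounds(2)[of M "real N1" "\<lambda>i. ll z i x", OF finite n1 a(1) b] by simp
    qed
  qed
  show ?thesis
  proof (cases "p \<in> Dc k")
    case False
    obtain N :: nat where N: "\<forall>\<^sub>F x in nhds p. lg k x \<le> real N \<and> (\<forall>j. norm (cj1 (in_coords (V, z) (lg k)) (z x) j) \<le> real N)
      \<and> (\<forall>i j. norm (cj2 (in_coords (V, z) (lg k)) (z x) i j) \<le> real N)"
      using lg_near_off[OF ad p k False] by blast
    have "\<forall>\<^sub>F x in nhds p. x \<notin> D \<longrightarrow> ln (lg k x) \<le> real (N * N1 ^ card M) * (\<Prod>i\<in>M. ll z i x) \<and> 0 \<le> (\<Prod>i\<in>M. ll z i x)"
      using N N1
    proof eventually_elim
      case (elim x)
      show ?case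
      proof
        assume x: "x \<notin> D"
        then have P: "0 \<le> (\<Prod>i\<in>M. ll z i x)" "1 \<le> real (N1 ^ card M) * (\<Prod>i\<in>M. ll z i x)" using elim(2) by auto
        have "ln (lg k x) \<le> lg k x" using lg_ge_1[OF k notin_D[OF x k]] by (intro ln_bound) auto
        also have "\<dots> \<le> real N * 1" using elim(1) by simp
        also have "\<dots> \<le> real N * (real (N1 ^ card M) * (\<Prod>i\<in>M. ll z i x))" using P(2) by (intro mult_left_mono) auto
        finally show "ln (lg k x) \<le> real (N * N1 ^ card M) * (\<Prod>i\<in>M. ll z i x) \<and> 0 \<le> (\<Prod>i\<in>M. ll z i x)"
          using P(1) by (simp add: mult.assoc)
      qed
    qed
    then show ?thesis by (rule exI)
  next
    case True
    obtain i W0 where i: "i \<in> M" and W0: "open W0" "p \<in> W0" "W0 \<subseteq> V" "\<forall>x\<in>W0. x \<in> Dc k \<longleftrightarrow> z x $ i = 0"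
      using adapted_germs(1)[OF ad p k True] by blast
    obtain N :: nat where N: "\<forall>\<^sub>F x in nhds p. x \<notin> Dc k \<longrightarrow> z x $ i \<noteq> 0 \<and> \<bar>lg k x - 2 * ln (1 / norm (z x $ i))\<bar> \<le> real N
       \<and> (\<forall>j. norm (cj1 (in_coords (V, z) (lg k)) (z x) j + (if j = i then 1 / z x $ i else 0)) \<le> real N)
       \<and> (\<forall>a b. norm (cj2 (in_coords (V, z) (lg k)) (z x) a b) \<le> real N)"
      using lg_near_on[OF ad p k W0] by blast
    have "\<forall>\<^sub>F x in nhds p. x \<notin> D \<longrightarrow> ln (lg k x) \<le> real ((N + 3) * N1 ^ card M) * (\<Prod>i\<in>M. ll z i x) \<and> 0 \<le> (\<Prod>i\<in>M. ll z i x)"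
      using N N1 eventually_in_chart[OF ad p]
    proof eventually_elim
      case (elim x)
      show ?case
      proof
        assume x: "x \<notin> D"
        let ?P = "\<Prod>i\<in>M. ll z i x"
        have P: "0 \<le> ?P" "1 \<le> real (N1 ^ card M) * ?P" "ll z i x \<le> real (N1 ^ card M) * ?P"
          using elim(2) x i by auto
        have xk: "x \<notin> Dc k" by (rule notin_D[OF x k])
        have l: "ln (1 / norm (z x $ i)) > 1" by (rule norm_log_frame(4)[OF adapted_props[OF ad elim(3) x] i])
        have g: "lg k x \<ge> 1" by (rule lg_ge_1[OF k xk])
        have "lg k x \<le> 2 * ln (1 / norm (z x $ i)) + real N" using elim(1) xk by (auto simp: abs_le_iff)
        moreover have "real N * 1 \<le> real N * ln (1 / norm (z x $ i))" using l by (intro mult_left_mono) auto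
        moreover have "(real N + 2) * ln (1 / norm (z x $ i)) = real N * ln (1 / norm (z x $ i)) + 2 * ln (1 / norm (z x $ i))"
          by (simp add: algebra_simps)
        ultimately have "lg k x \<le> (real N + 2) * ln (1 / norm (z x $ i))" by linarith
        then have "ln (lg k x) \<le> (real N + 2) + ll z i x" using l g by (intro ln_le_scaled) auto
        also have "\<dots> \<le> (real N + 2) * (real (N1 ^ card M) * ?P) + real (N1 ^ card M) * ?P"
        proof (rule add_mono[OF _ P(3)])
          have "(real N + 2) * 1 \<le> (real N + 2) * (real (N1 ^ card M) * ?P)" using P(2) by (intro mult_left_mono) auto
          then show "real N + 2 \<le> (real N + 2) * (real (N1 ^ card M) * ?P)" by simp
        qed
        also have "\<dots> = real ((N + 3) * N1 ^ card M) * ?P" by (simp add: algebra_simps)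
        finally show "ln (lg k x) \<le> real ((N + 3) * N1 ^ card M) * ?P \<and> 0 \<le> ?P" using P(1) by blast
      qed
    qed
    then show ?thesis by (rule exI)
  qed
qed

lemma \<Theta>1_upper:
  assumes ad: "adapted_chart \<A> D (V, z) M" and p: "p \<in> V"
  shows "\<exists>N::nat. \<forall>\<^sub>F x in nhds p. x \<notin> D \<longrightarrow> \<Theta>1 x \<le> real N * (\<Prod>i\<in>M. ll z i x) \<and> 0 \<le> (\<Prod>i\<in>M. ll z i x)"
proof -
  have "\<exists>N::nat. \<forall>\<^sub>F x in nhds p. \<forall>k\<in>{1..m}. x \<notin> D \<longrightarrow> ln (lg k x) \<le> real N * (\<Prod>i\<in>M. ll z i x) \<and> 0 \<le> (\<Prod>i\<in>M. ll z i x)"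
  proof (rule eventually_finite_nat)
    fix k N N' x
    assume "N \<le> N'" and *: "x \<notin> D \<longrightarrow> ln (lg k x) \<le> real N * (\<Prod>i\<in>M. ll z i x) \<and> 0 \<le> (\<Prod>i\<in>M. ll z i x)"
    show "x \<notin> D \<longrightarrow> ln (lg k x) \<le> real N' * (\<Prod>i\<in>M. ll z i x) \<and> 0 \<le> (\<Prod>i\<in>M. ll z i x)"
    proof
      assume "x \<notin> D"
      with * have 1: "ln (lg k x) \<le> real N * (\<Prod>i\<in>M. ll z i x)" "0 \<le> (\<Prod>i\<in>M. ll z i x)" by auto
      have "real N * (\<Prod>i\<in>M. ll z i x) \<le> real N' * (\<Prod>i\<in>M. ll z i x)"
        using \<open>N \<le> N'\<close> by (intro mult_right_mono 1(2)) auto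
      then show "ln (lg k x) \<le> real N' * (\<Prod>i\<in>M. ll z i x) \<and> 0 \<le> (\<Prod>i\<in>M. ll z i x)" using 1 by linarith
    qed
  qed (use ln_lg_upper[OF ad p] in simp_all)
  then obtain N :: nat where "\<forall>\<^sub>F x in nhds p. \<forall>k\<in>{1..m}. x \<notin> D \<longrightarrow> ln (lg k x) \<le> real N * (\<Prod>i\<in>M. ll z i x) \<and> 0 \<le> (\<Prod>i\<in>M. ll z i x)" by blast
  then have "\<forall>\<^sub>F x in nhds p. x \<notin> D \<longrightarrow> \<Theta>1 x \<le> real (m * N) * (\<Prod>i\<in>M. ll z i x) \<and> 0 \<le> (\<Prod>i\<in>M. ll z i x)"
  proof eventually_elim
    case (elim x)
    show ?case
    proof
      assume x: "x \<notin> D"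
      have "\<Theta>1 x \<le> of_nat (card {1..m}) * (real N * (\<Prod>i\<in>M. ll z i x))"
        unfolding \<Theta>1_def by (rule sum_bounded_above) (use elim x in blast)
      moreover have "0 \<le> (\<Prod>i\<in>M. ll z i x)" using elim x m1 by (metis atLeastAtMost_iff order_refl)
      ultimately show "\<Theta>1 x \<le> real (m * N) * (\<Prod>i\<in>M. ll z i x) \<and> 0 \<le> (\<Prod>i\<in>M. ll z i x)"
        by (simp add: mult.assoc)
    qed
  qed
  then show ?thesis by (rule exI)
qed

text \<open>Together with \<open>\<Theta>1_upper\<close> this shows that near each point of an
  adapted chart \<Theta>1 and the product are bounded, up to constants, by powers of each other.
  Hence the weights \<open>bd\<close> express log-log growth.\<close>

lemma prod_ll_upper:
  assumes ad: "adapted_chart \<A> D (V, z) M" and p: "p \<in> V"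
  shows "\<exists>N::nat. \<forall>\<^sub>F x in nhds p. x \<notin> D \<longrightarrow> 0 \<le> (\<Prod>i\<in>M. ll z i x) \<and> (\<Prod>i\<in>M. ll z i x) \<le> bd N x"
proof -
  obtain N0 :: nat where N0: "\<forall>\<^sub>F x in nhds p. \<forall>i\<in>M. x \<notin> D \<longrightarrow> 0 \<le> ll z i x \<and> 1 \<le> real N0 * ll z i x"
    using ll_lower[OF ad p] by blast
  obtain N :: nat where N: "\<forall>\<^sub>F x in nhds p. \<forall>i\<in>M. x \<notin> D \<longrightarrow> ll z i x \<le> real N * \<Theta>1 x"
    using ll_upper[OF ad p] by blast
  obtain N' where N': "\<forall>x. x \<notin> D \<longrightarrow> real N ^ card M * \<Theta>1 x ^ card M \<le> bd N' x" using bd_dominates by blast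
  have "\<forall>\<^sub>F x in nhds p. x \<notin> D \<longrightarrow> 0 \<le> (\<Prod>i\<in>M. ll z i x) \<and> (\<Prod>i\<in>M. ll z i x) \<le> bd N' x"
    using N0 N
  proof eventually_elim
    case (elim x)
    show ?case
    proof
      assume x: "x \<notin> D"
      have "(\<Prod>i\<in>M. ll z i x) \<le> (\<Prod>i\<in>M. real N * \<Theta>1 x)" by (rule prod_mono) (use elim x in auto)
      also have "\<dots> \<le> bd N' x" using N' x by (simp add: power_mult_distrib)
      finally show "0 \<le> (\<Prod>i\<in>M. ll z i x) \<and> (\<Prod>i\<in>M. ll z i x) \<le> bd N' x"
        using elim(1) x by (auto intro: prod_nonneg)
    qed
  qed
  then show ?thesis by (rule exI)
qed

section \<open>Growth conditions as local jet bounds\<close>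

lemma loglog_coeffD:
  assumes ad: "adapted_chart \<A> D (V, z) M" and p: "p \<in> V" and g: "loglog_coeff \<A> D (V, z) M g"
  shows "\<exists>N::nat. \<forall>\<^sub>F x in nhds p. x \<notin> D \<longrightarrow> norm (g x) \<le> bd N x"
proof -
  note c = adapted_holo[OF ad]
  obtain r where r: "r > 0" "cball (z p) r \<subseteq> z ` V"
    using chart_props(3)[OF c] p open_contains_cball_eq by blast
  \<comment> \<open>Log-log growth is defined on relatively compact sets. The preimage
    \<open>K\<close> of a closed ball is compact, and closed since the space is Hausdorff, so it
    contains the closure of the preimage of the open ball.\<close>
  define K where "K = inv_into V z ` cball (z p) r"
  have cK: "compact K"
    unfolding K_def by (rule compact_continuous_image[OF continuous_on_subset[OF chart_props(5)[OF c] r(2)]]) simp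
  have KV: "K \<subseteq> V" unfolding K_def using r(2) by (auto intro: inv_into_into)
  define V' where "V' = V \<inter> z -` ball (z p) r"
  have oV': "open V'" unfolding V'_def by (rule open_chart_preimage[OF c open_ball])
  have pV': "p \<in> V'" using p r(1) by (simp add: V'_def)
  have "V' \<subseteq> K"
  proof
    fix x assume x: "x \<in> V'"
    then have "x = inv_into V z (z x)" "z x \<in> cball (z p) r" using inv_into_f_f[OF chart_props(2)[OF c], of x] by (auto simp: V'_def)
    then show "x \<in> K" unfolding K_def by (rule image_eqI)
  qed
  then have "closure V' \<subseteq> K" using compact_imp_closed[OF cK] by (rule closure_minimal)
  moreover have "compact (closure V')"
    using compact_Int_closed[OF cK closed_closure, of V'] \<open>closure V' \<subseteq> K\<close> by (simp add: Int_absorb1)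
  ultimately have "compact (closure V') \<and> closure V' \<subseteq> V" using KV by auto
  from mp[OF spec[OF g[unfolded loglog_coeff_def fst_conv snd_conv, THEN conjunct2], of V'] this]
  obtain C n where C: "\<forall>x\<in>V' - D. norm (g x) \<le> C * (\<Prod>i\<in>M. ll z i x ^ n)" by (elim exE)
  obtain N1 :: nat where N1: "\<forall>\<^sub>F x in nhds p. x \<notin> D \<longrightarrow> 0 \<le> (\<Prod>i\<in>M. ll z i x) \<and> (\<Prod>i\<in>M. ll z i x) \<le> bd N1 x"
    using prod_ll_upper[OF ad p] by blast
  obtain N2 where N2: "\<forall>x. x \<notin> D \<longrightarrow> (\<bar>C\<bar> * real N1 ^ n) * \<Theta>1 x ^ (N1 * n) \<le> bd N2 x" using bd_dominates by blast
  have "\<forall>\<^sub>F x in nhds p. x \<notin> D \<longrightarrow> norm (g x) \<le> bd N2 x"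
    using N1 eventually_in_open[OF oV' pV']
  proof eventually_elim
    case (elim x)
    show ?case
    proof
      assume x: "x \<notin> D"
      let ?P = "\<Prod>i\<in>M. ll z i x"
      have P: "0 \<le> ?P" "?P \<le> bd N1 x" using elim(1) x by auto
      have "norm (g x) \<le> C * (\<Prod>i\<in>M. ll z i x ^ n)" using C elim(2) x by blast
      also have "\<dots> = C * ?P ^ n" by (simp add: prod_power_distrib)
      also have "\<dots> \<le> \<bar>C\<bar> * ?P ^ n" using P(1) by (intro mult_right_mono) auto
      also have "\<dots> \<le> \<bar>C\<bar> * bd N1 x ^ n" using P by (intro mult_left_mono power_mono) auto
      also have "\<dots> = (\<bar>C\<bar> * real N1 ^ n) * \<Theta>1 x ^ (N1 * n)" by (simp add: bd_def power_mult_distrib power_mult)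
      also have "\<dots> \<le> bd N2 x" using N2 x by blast
      finally show "norm (g x) \<le> bd N2 x" .
    qed
  qed
  then show ?thesis by (rule exI)
qed

text \<open>Compactness of the closure of \<open>V'\<close> is used twice: for one weight bounding
  \<open>g\<close>, and for one multiple of the product bounding \<Theta>1.\<close>

lemma loglog_coeffI:
  assumes ad: "adapted_chart \<A> D (V, z) M" and sm: "mfd_smooth_on \<A> (V - D) g"
    and g: "\<And>p. p \<in> V \<Longrightarrow> \<exists>N::nat. \<forall>\<^sub>F x in nhds p. x \<notin> D \<longrightarrow> norm (g x) \<le> bd N x"
  shows "loglog_coeff \<A> D (V, z) M g"
  unfolding loglog_coeff_def fst_conv snd_conv
proof (intro conjI allI impI)
  show "mfd_smooth_on \<A> (V - D) g" by (rule sm)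
  fix V' assume V': "compact (closure V') \<and> closure V' \<subseteq> V"
  have "\<exists>N::nat. \<forall>x\<in>closure V'. x \<notin> D \<longrightarrow> norm (g x) \<le> bd N x"
  proof (rule eventually_compact_nat)
    show "compact (closure V')" using V' by blast
    show "\<exists>N::nat. \<forall>\<^sub>F x in nhds p. x \<notin> D \<longrightarrow> norm (g x) \<le> bd N x" if "p \<in> closure V'" for p
      using g V' that by blast
    show "x \<notin> D \<longrightarrow> norm (g x) \<le> bd N' x" if "N \<le> N'" "x \<notin> D \<longrightarrow> norm (g x) \<le> bd N x" for N N' x
      using that bd_mono order_trans by blast
  qed
  then obtain N :: nat where N: "\<forall>x\<in>closure V'. x \<notin> D \<longrightarrow> norm (g x) \<le> bd N x" by blast
  have "\<exists>N::nat. \<forall>x\<in>closure V'. x \<notin> D \<longrightarrow> \<Theta>1 x \<le> real N * (\<Prod>i\<in>M. ll z i x) \<and> 0 \<le> (\<Prod>i\<in>M. ll z i x)"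
  proof (rule eventually_compact_nat)
    show "compact (closure V')" using V' by blast
    show "\<exists>N::nat. \<forall>\<^sub>F x in nhds p. x \<notin> D \<longrightarrow> \<Theta>1 x \<le> real N * (\<Prod>i\<in>M. ll z i x) \<and> 0 \<le> (\<Prod>i\<in>M. ll z i x)" if "p \<in> closure V'" for p
      using \<Theta>1_upper[OF ad] V' that by blast
    show "x \<notin> D \<longrightarrow> \<Theta>1 x \<le> real N' * (\<Prod>i\<in>M. ll z i x) \<and> 0 \<le> (\<Prod>i\<in>M. ll z i x)"
      if n: "N \<le> N'" "x \<notin> D \<longrightarrow> \<Theta>1 x \<le> real N * (\<Prod>i\<in>M. ll z i x) \<and> 0 \<le> (\<Prod>i\<in>M. ll z i x)" for N N' x
    proof
      assume "x \<notin> D"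
      with n(2) have 1: "\<Theta>1 x \<le> real N * (\<Prod>i\<in>M. ll z i x)" "0 \<le> (\<Prod>i\<in>M. ll z i x)" by auto
      have "real N * (\<Prod>i\<in>M. ll z i x) \<le> real N' * (\<Prod>i\<in>M. ll z i x)"
        using n(1) by (intro mult_right_mono 1(2)) auto
      then show "\<Theta>1 x \<le> real N' * (\<Prod>i\<in>M. ll z i x) \<and> 0 \<le> (\<Prod>i\<in>M. ll z i x)" using 1 by linarith
    qed
  qed
  then obtain N' :: nat where N': "\<forall>x\<in>closure V'. x \<notin> D \<longrightarrow> \<Theta>1 x \<le> real N' * (\<Prod>i\<in>M. ll z i x) \<and> 0 \<le> (\<Prod>i\<in>M. ll z i x)" by blast
  show "\<exists>C n. \<forall>x\<in>V' - D. norm (g x) \<le> C * (\<Prod>i\<in>M. ll z i x ^ n)"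
  proof (intro exI ballI)
    fix x assume "x \<in> V' - D"
    then have x: "x \<in> closure V'" "x \<notin> D" using closure_subset[of V'] by auto
    let ?P = "\<Prod>i\<in>M. ll z i x"
    have 1: "\<Theta>1 x \<le> real N' * ?P" using N' x by blast
    have "norm (g x) \<le> bd N x" using N x by blast
    also have "\<dots> \<le> real N * (real N' * ?P) ^ N"
      unfolding bd_def using 1 \<Theta>1_ge_1[OF x(2)] by (intro mult_left_mono power_mono) auto
    also have "\<dots> = (real N * real N' ^ N) * (\<Prod>i\<in>M. ll z i x ^ N)"
      by (simp add: power_mult_distrib prod_power_distrib)
    finally show "norm (g x) \<le> (real N * real N' ^ N) * (\<Prod>i\<in>M. ll z i x ^ N)" .
  qed
qed

lemma poincare_coeffD:
  assumes "p \<in> V" "poincare_coeff \<A> D (V, z) M g"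
  shows "\<exists>N::nat. \<forall>\<^sub>F x in nhds p. x \<notin> D \<longrightarrow> norm (g x) \<le> real N"
proof -
  obtain W C where W: "open W" "p \<in> W" "\<forall>x\<in>W - D. norm (g x) \<le> C"
    using assms unfolding poincare_coeff_def fst_conv by blast
  obtain N :: nat where N: "C \<le> real N" using real_arch_simple by blast
  have "\<forall>\<^sub>F x in nhds p. x \<notin> D \<longrightarrow> norm (g x) \<le> real N"
    by (rule eventually_mono[OF eventually_in_open[OF W(1,2)]]) (use W(3) N in force)
  then show ?thesis by (rule exI)
qed

lemma poincare_coeffI:
  assumes ad: "adapted_chart \<A> D (V, z) M" and sm: "mfd_smooth_on \<A> (V - D) g"
    and g: "\<And>p. p \<in> V \<Longrightarrow> \<exists>N::nat. \<forall>\<^sub>F x in nhds p. x \<notin> D \<longrightarrow> norm (g x) \<le> real N"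
  shows "poincare_coeff \<A> D (V, z) M g"
  unfolding poincare_coeff_def fst_conv
proof (intro conjI ballI)
  show "mfd_smooth_on \<A> (V - D) g" by (rule sm)
  fix p assume p: "p \<in> V"
  obtain N :: nat where "\<forall>\<^sub>F x in nhds p. x \<notin> D \<longrightarrow> norm (g x) \<le> real N" using g[OF p] by blast
  then obtain S where S: "open S" "p \<in> S" "\<forall>x\<in>S. x \<notin> D \<longrightarrow> norm (g x) \<le> real N" unfolding eventually_nhds by blast
  show "\<exists>W C. open W \<and> p \<in> W \<and> W \<subseteq> V \<and> (\<forall>x\<in>W - D. norm (g x) \<le> C)"
  proof (intro exI conjI)
    show "open (S \<inter> V)" using S(1) chart_props(1)[OF adapted_holo[OF ad]] by (rule open_Int)
  qed (use S p in auto)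
qed

lemma log_frame_smooth:
  assumes ad: "adapted_chart \<A> D (V, z) M"
  shows "mfd_smooth_on \<A> (V - D) (\<lambda>x. log_frame M (z x) i)"
proof -
  note c = adapted_holo[OF ad]
  have o: "open (V \<inter> - D)" "V - D = V \<inter> - D" using chart_props(1)[OF c] open_minus_D by (auto simp: Diff_eq)
  note op = open_coords[OF c]
  show ?thesis
  proof (cases "i \<in> M")
    case True
    \<comment> \<open>\<open>ln (1 / |z_i|)\<close> is replaced by
      \<open>- (1/2) ln |z_i|^2\<close>, whose smoothness off the hyperplane is already
      known.\<close>
    have s: "smooth_on (z ` (V \<inter> - D)) (\<lambda>y. y $ i * of_real ((- 1/2) * ln ((norm (y $ i))\<^sup>2)))"
    proof (intro smooth_on_mult[OF op] smooth_on_coord smooth_on_of_real[OF op] smooth_on_const)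
      show "smooth_on (z ` (V \<inter> - D)) (\<lambda>y. ln ((norm (y $ i))\<^sup>2))"
        by (rule smooth_on_subset[OF smooth_on_ln_coord]) (use adapted_props(2)[OF ad _ _ True] in auto)
    qed
    show ?thesis unfolding o(2)
    proof (rule mfd_smooth_on_chartI[OF atlas c o(1) Int_lower1 s])
      fix x assume "x \<in> V \<inter> - D"
      then have n: "norm (z x $ i) > 0" using adapted_props(2)[OF ad _ _ True, of x] by simp
      have "ln ((norm (z x $ i))\<^sup>2) = 2 * ln (norm (z x $ i))" using n by (simp add: ln_realpow)
      then have e: "ln (1 / norm (z x $ i)) = (- 1/2) * ln ((norm (z x $ i))\<^sup>2)" using n by (simp add: ln_div)
      show "log_frame M (z x) i = z x $ i * of_real ((- 1/2) * ln ((norm (z x $ i))\<^sup>2))"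
        unfolding log_frame_def using True by (simp only: if_True e)
    qed
  qed (simp add: log_frame_def)
qed


lemma minus_D_Int: "V - D = V \<inter> - D" by blast

lemma coords_of_real_smooth:
  assumes "mfd_smooth_on \<A> (- D) f" "(V, z) \<in> holo_charts \<A>"
  shows "smooth_on (z ` (V \<inter> - D)) (in_coords (V, z) (\<lambda>x. complex_of_real (f x)))"
  unfolding in_coords_of_real by (rule smooth_on_of_real[OF open_coords[OF assms(2)] smooth_coords[OF assms]])

lemma wirt_pullback_smooth:
  assumes "mfd_smooth_on \<A> (- D) f" "(V, z) \<in> holo_charts \<A>"
  shows "mfd_smooth_on \<A> (V - D) (\<lambda>x. wirt i (in_coords (V, z) (\<lambda>x. complex_of_real (f x))) (z x))"
    and "mfd_smooth_on \<A> (V - D) (\<lambda>x. wirt_bar i (in_coords (V, z) (\<lambda>x. complex_of_real (f x))) (z x))"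
    and "mfd_smooth_on \<A> (V - D) (\<lambda>x. wirt i (wirt_bar j (in_coords (V, z) (\<lambda>x. complex_of_real (f x)))) (z x))"
  unfolding minus_D_Int
  by (intro mfd_smooth_on_pullback[OF atlas assms(2) open_minus_D] smooth_on_wirt[OF open_coords[OF assms(2)]] coords_of_real_smooth[OF assms])+

lemma wirt_bar_coords:
  assumes "mfd_smooth_on \<A> (- D) f" "(V, z) \<in> holo_charts \<A>" "x \<in> V" "x \<notin> D"
  shows "wirt_bar i (in_coords (V, z) (\<lambda>x. complex_of_real (f x))) (z x) = cnj (cj1 (in_coords (V, z) f) (z x) i)"
  unfolding in_coords_of_real
  by (rule wirt_bar_eq_cj1, rule smooth_on_differentiable[OF smooth_coords[OF assms(1,2)]]) (use assms in auto)

lemma cj_coords: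
  "wirt i (in_coords c (\<lambda>x. complex_of_real (f x))) p = cj1 (in_coords c f) p i"
  "wirt i (wirt_bar j (in_coords c (\<lambda>x. complex_of_real (f x)))) p = cj2 (in_coords c f) p i j"
  by (simp_all add: in_coords_of_real cj1_def cj2_def)

text \<open>The weight is kept abstract: it will be \<open>bd\<close> for log-log growth and the
  constant \<open>real N\<close> for Poincare growth.\<close>

lemma jets_leI_eventually:
  assumes w: "\<And>N N' x. x \<notin> D \<Longrightarrow> N \<le> N' \<Longrightarrow> w N x \<le> w N' x"
    and 1: "\<And>i. \<exists>N::nat. \<forall>\<^sub>F x in nhds p. x \<notin> D \<longrightarrow> norm (cj1 (in_coords (V, z) f) (z x) i) * norm (log_frame M (z x) i) \<le> w N x"
    and 2: "\<And>i j. \<exists>N::nat. \<forall>\<^sub>F x in nhds p. x \<notin> D \<longrightarrow> norm (cj2 (in_coords (V, z) f) (z x) i j) * (norm (log_frame M (z x) i) * norm (log_frame M (z x) j)) \<le> w N x"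
  shows "\<exists>N::nat. \<forall>\<^sub>F x in nhds p. x \<notin> D \<longrightarrow> jets_le (V, z) M f x (w N x)"
proof -
  have mono: "x \<notin> D \<longrightarrow> e \<le> w N' x" if "N \<le> N'" "x \<notin> D \<longrightarrow> e \<le> w N x" for N N' :: nat and x and e :: real
    using that w order_trans by blast
  have "\<exists>N::nat. \<forall>\<^sub>F x in nhds p. \<forall>i\<in>UNIV. x \<notin> D \<longrightarrow> norm (cj1 (in_coords (V, z) f) (z x) i) * norm (log_frame M (z x) i) \<le> w N x"
    by (rule eventually_finite_nat[OF finite 1 mono])
  then obtain N1 :: nat where N1: "\<forall>\<^sub>F x in nhds p. \<forall>i\<in>UNIV. x \<notin> D \<longrightarrow> norm (cj1 (in_coords (V, z) f) (z x) i) * norm (log_frame M (z x) i) \<le> w N1 x" by (elim exE)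
  have "\<exists>N::nat. \<forall>\<^sub>F x in nhds p. \<forall>ij\<in>UNIV. x \<notin> D \<longrightarrow> norm (cj2 (in_coords (V, z) f) (z x) (fst ij) (snd ij)) *
      (norm (log_frame M (z x) (fst ij)) * norm (log_frame M (z x) (snd ij))) \<le> w N x"
    by (rule eventually_finite_nat[OF finite 2 mono])
  then obtain N2 :: nat where N2: "\<forall>\<^sub>F x in nhds p. \<forall>ij\<in>UNIV. x \<notin> D \<longrightarrow> norm (cj2 (in_coords (V, z) f) (z x) (fst ij) (snd ij)) *
      (norm (log_frame M (z x) (fst ij)) * norm (log_frame M (z x) (snd ij))) \<le> w N2 x" by (elim exE)
  have "\<forall>\<^sub>F x in nhds p. x \<notin> D \<longrightarrow> jets_le (V, z) M f x (w (N1 + N2) x)"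
    using N1 N2
  proof eventually_elim
    case (elim x)
    show ?case
    proof
      assume x: "x \<notin> D"
      have w': "w N1 x \<le> w (N1 + N2) x" "w N2 x \<le> w (N1 + N2) x" using w[OF x] by simp_all
      show "jets_le (V, z) M f x (w (N1 + N2) x)"
        unfolding jets_le_def fst_conv snd_conv
      proof (intro conjI allI)
        fix i j
        show "norm (cj1 (in_coords (V, z) f) (z x) i) * norm (log_frame M (z x) i) \<le> w (N1 + N2) x"
          using bspec[OF elim(1) UNIV_I, of i] x w'(1) by linarith
        show "norm (cj2 (in_coords (V, z) f) (z x) i j) * (norm (log_frame M (z x) i) * norm (log_frame M (z x) j)) \<le> w (N1 + N2) x"
          using bspec[OF elim(2) UNIV_I, of "(i, j)"] x w'(2) by simp
      qed
    qed
  qed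
  then show ?thesis by (rule exI)
qed

text \<open>Apart from smoothness, pre-log-log functions are from here on handled through this local
  bound and its converse \<open>pre_log_logI\<close>.\<close>

lemma pre_log_logD:
  assumes f: "pre_log_log \<A> D f" and ad: "adapted_chart \<A> D (V, z) M" and p: "p \<in> V"
  shows "\<exists>N::nat. \<forall>\<^sub>F x in nhds p. x \<notin> D \<longrightarrow> \<bar>f x\<bar> \<le> bd N x \<and> jets_le (V, z) M f x (bd N x)"
proof -
  have g0: "loglog_coeff \<A> D (V, z) M (\<lambda>x. complex_of_real (f x))"
    and g1: "\<forall>g\<in>frame_coeffs1 (V, z) M (del (\<lambda>x. complex_of_real (f x))). loglog_coeff \<A> D (V, z) M g"
    and g2: "\<forall>g\<in>frame_coeffs11 (V, z) M (del_delbar (\<lambda>x. complex_of_real (f x))). loglog_coeff \<A> D (V, z) M g"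
    using f ad unfolding pre_log_log_def Let_def loglog_growth0_def loglog_growth1_def loglog_growth11_def by blast+
  have "\<exists>N::nat. \<forall>\<^sub>F x in nhds p. x \<notin> D \<longrightarrow> jets_le (V, z) M f x (bd N x)"
  proof (rule jets_leI_eventually[OF bd_mono])
    show "\<exists>N::nat. \<forall>\<^sub>F x in nhds p. x \<notin> D \<longrightarrow> norm (cj1 (in_coords (V, z) f) (z x) i) * norm (log_frame M (z x) i) \<le> bd N x" for i
    proof -
      have "(\<lambda>x. fst (del (\<lambda>x. complex_of_real (f x)) (V, z) x) $ i * log_frame M (snd (V, z) x) i)
          \<in> frame_coeffs1 (V, z) M (del (\<lambda>x. complex_of_real (f x)))"
        unfolding frame_coeffs1_def by blast
      from loglog_coeffD[OF ad p bspec[OF g1 this]] show ?thesis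
        by (simp add: del_def cj_coords norm_mult)
    qed
    show "\<exists>N::nat. \<forall>\<^sub>F x in nhds p. x \<notin> D \<longrightarrow> norm (cj2 (in_coords (V, z) f) (z x) i j) * (norm (log_frame M (z x) i) * norm (log_frame M (z x) j)) \<le> bd N x" for i j
    proof -
      have "(\<lambda>x. del_delbar (\<lambda>x. complex_of_real (f x)) (V, z) x $ i $ j * log_frame M (snd (V, z) x) i * cnj (log_frame M (snd (V, z) x) j))
          \<in> frame_coeffs11 (V, z) M (del_delbar (\<lambda>x. complex_of_real (f x)))"
        unfolding frame_coeffs11_def by blast
      from loglog_coeffD[OF ad p bspec[OF g2 this]] show ?thesis
        by (simp add: del_delbar_def cj_coords norm_mult mult.assoc)
    qed
  qed
  then obtain N1 :: nat where N1: "\<forall>\<^sub>F x in nhds p. x \<notin> D \<longrightarrow> jets_le (V, z) M f x (bd N1 x)" by (elim exE)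
  obtain N0 :: nat where N0: "\<forall>\<^sub>F x in nhds p. x \<notin> D \<longrightarrow> norm (complex_of_real (f x)) \<le> bd N0 x"
    using loglog_coeffD[OF ad p g0] by (elim exE)
  have "\<forall>\<^sub>F x in nhds p. x \<notin> D \<longrightarrow> \<bar>f x\<bar> \<le> bd (N0 + N1) x \<and> jets_le (V, z) M f x (bd (N0 + N1) x)"
    using N0 N1
  proof eventually_elim
    case (elim x)
    show ?case
    proof
      assume x: "x \<notin> D"
      have "bd N0 x \<le> bd (N0 + N1) x" "bd N1 x \<le> bd (N0 + N1) x" using bd_mono[OF x] by simp_all
      then show "\<bar>f x\<bar> \<le> bd (N0 + N1) x \<and> jets_le (V, z) M f x (bd (N0 + N1) x)"
        using elim x jets_le_mono by auto
    qed
  qed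
  then show ?thesis by (rule exI)
qed

lemma frame_coeffs_smooth:
  assumes f: "mfd_smooth_on \<A> (- D) f" and ad: "adapted_chart \<A> D (V, z) M"
  shows "mfd_smooth_on \<A> (V - D) (\<lambda>x. wirt i (in_coords (V, z) (\<lambda>x. complex_of_real (f x))) (z x) * log_frame M (z x) i)"
    and "mfd_smooth_on \<A> (V - D) (\<lambda>x. wirt_bar i (in_coords (V, z) (\<lambda>x. complex_of_real (f x))) (z x) * cnj (log_frame M (z x) i))"
    and "mfd_smooth_on \<A> (V - D) (\<lambda>x. wirt i (wirt_bar j (in_coords (V, z) (\<lambda>x. complex_of_real (f x)))) (z x) * log_frame M (z x) i * cnj (log_frame M (z x) j))"
proof -
  note c = adapted_holo[OF ad]
  have o: "open (V - D)" unfolding minus_D_Int using chart_props(1)[OF c] open_minus_D by (rule open_Int)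
  note l = log_frame_smooth[OF ad]
  have lc: "mfd_smooth_on \<A> (V - D) (\<lambda>x. cnj (log_frame M (z x) i))" for i
    by (rule mfd_smooth_on_linear[OF o bounded_linear_cnj l])
  show "mfd_smooth_on \<A> (V - D) (\<lambda>x. wirt i (in_coords (V, z) (\<lambda>x. complex_of_real (f x))) (z x) * log_frame M (z x) i)"
    "mfd_smooth_on \<A> (V - D) (\<lambda>x. wirt_bar i (in_coords (V, z) (\<lambda>x. complex_of_real (f x))) (z x) * cnj (log_frame M (z x) i))"
    "mfd_smooth_on \<A> (V - D) (\<lambda>x. wirt i (wirt_bar j (in_coords (V, z) (\<lambda>x. complex_of_real (f x)))) (z x) * log_frame M (z x) i * cnj (log_frame M (z x) j))"
    by (intro mfd_smooth_on_mult[OF o] l lc wirt_pullback_smooth[OF f c])+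
qed

lemma jets_le_D:
  assumes "jets_le (V, z) M f x b"
  shows "norm (cj1 (in_coords (V, z) f) (z x) i) * norm (log_frame M (z x) i) \<le> b"
    and "norm (cj2 (in_coords (V, z) f) (z x) i j) * (norm (log_frame M (z x) i) * norm (log_frame M (z x) j)) \<le> b"
  using assms unfolding jets_le_def by simp_all

lemma jets_le_nonneg: "jets_le (V, z) M f x b \<Longrightarrow> 0 \<le> b"
  using jets_le_D(1)[of V z M f x b undefined] by (meson mult_nonneg_nonneg norm_ge_zero order_trans)

lemma frame_coeffs_bounds:
  assumes f: "mfd_smooth_on \<A> (- D) f" and ad: "adapted_chart \<A> D (V, z) M"
    and x: "x \<in> V" "x \<notin> D" and j: "jets_le (V, z) M f x b"
  shows "norm (wirt i (in_coords (V, z) (\<lambda>x. complex_of_real (f x))) (z x) * log_frame M (z x) i) \<le> b"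
    and "norm (wirt_bar i (in_coords (V, z) (\<lambda>x. complex_of_real (f x))) (z x) * cnj (log_frame M (z x) i)) \<le> b"
    and "norm (wirt i (wirt_bar j (in_coords (V, z) (\<lambda>x. complex_of_real (f x)))) (z x) * log_frame M (z x) i * cnj (log_frame M (z x) j)) \<le> b"
  using jets_le_D[OF j]
  unfolding wirt_bar_coords[OF f adapted_holo[OF ad] x] cj_coords norm_mult complex_mod_cnj mult.assoc by blast+

lemma pre_log_logI:
  assumes sm: "mfd_smooth_on \<A> (- D) f"
    and ex: "\<And>V z M p. adapted_chart \<A> D (V, z) M \<Longrightarrow> p \<in> V \<Longrightarrow>
      \<exists>N::nat. \<forall>\<^sub>F x in nhds p. x \<notin> D \<longrightarrow> \<bar>f x\<bar> \<le> bd N x \<and> jets_le (V, z) M f x (bd N x)"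
  shows "pre_log_log \<A> D f"
proof -
  let ?F = "\<lambda>x. complex_of_real (f x)"
  have main: "loglog_coeff \<A> D (V, z) M g" if ad: "adapted_chart \<A> D (V, z) M" and g: "mfd_smooth_on \<A> (V - D) g"
    "\<And>x b. x \<in> V \<Longrightarrow> x \<notin> D \<Longrightarrow> \<bar>f x\<bar> \<le> b \<Longrightarrow> jets_le (V, z) M f x b \<Longrightarrow> norm (g x) \<le> b" for V z M and g :: "'a \<Rightarrow> complex"
  proof (rule loglog_coeffI[OF ad g(1)])
    fix p assume p: "p \<in> V"
    obtain N :: nat where "\<forall>\<^sub>F x in nhds p. x \<notin> D \<longrightarrow> \<bar>f x\<bar> \<le> bd N x \<and> jets_le (V, z) M f x (bd N x)"
      using ex[OF ad p] by (elim exE)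
    with eventually_in_chart[OF ad p] have "\<forall>\<^sub>F x in nhds p. x \<notin> D \<longrightarrow> norm (g x) \<le> bd N x"
      by eventually_elim (use g(2) in blast)
    then show "\<exists>N::nat. \<forall>\<^sub>F x in nhds p. x \<notin> D \<longrightarrow> norm (g x) \<le> bd N x" by (rule exI)
  qed
  \<comment> \<open>\<open>frame_coeffs1\<close> lists coefficients of both types, so the
    identically zero half of \<open>del\<close> and of \<open>delbar\<close> has to be checked
    too.\<close>
  have zero: "loglog_coeff \<A> D (V, z) M (\<lambda>x. 0)" if ad: "adapted_chart \<A> D (V, z) M" for V z M
    by (rule main[OF ad]) (auto dest: jets_le_nonneg)
  show ?thesis
    unfolding pre_log_log_def Let_def loglog_growth0_def loglog_growth1_def loglog_growth11_def
  proof (intro conjI allI impI ballI)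
    show "mfd_smooth_on \<A> (- D) f" by (rule sm)
  next
    fix c :: "('a, 'n) chart" and M assume ad: "adapted_chart \<A> D c M"
    obtain V z where c: "c = (V, z)" by (cases c)
    note ad = ad[unfolded c]
    have o: "open (V - D)" unfolding minus_D_Int using chart_props(1)[OF adapted_holo[OF ad]] open_minus_D by (rule open_Int)
    have "mfd_smooth_on \<A> (V - D) ?F"
      by (rule mfd_smooth_on_linear[OF o bounded_linear_of_real mfd_smooth_on_subset[OF sm]]) blast
    then show "loglog_coeff \<A> D c M ?F" unfolding c by (rule main[OF ad]) simp
  next
    fix c :: "('a, 'n) chart" and M g assume ad: "adapted_chart \<A> D c M" and g: "g \<in> frame_coeffs1 c M (del ?F)"
    obtain V z where c: "c = (V, z)" by (cases c)
    note ad = ad[unfolded c]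
    from g consider i where "g = (\<lambda>x. fst (del ?F c x) $ i * log_frame M (snd c x) i)"
      | i where "g = (\<lambda>x. snd (del ?F c x) $ i * cnj (log_frame M (snd c x) i))"
      unfolding frame_coeffs1_def by blast
    then show "loglog_coeff \<A> D c M g"
    proof cases
      case (1 i)
      have e: "g = (\<lambda>x. wirt i (in_coords (V, z) ?F) (z x) * log_frame M (z x) i)" by (simp add: 1 c del_def)
      show ?thesis unfolding c e
        by (rule main[OF ad frame_coeffs_smooth(1)[OF sm ad] frame_coeffs_bounds(1)[OF sm ad]])
    next
      case (2 i)
      have e: "g = (\<lambda>x. 0)" by (simp add: 2 c del_def)
      show ?thesis unfolding c e by (rule zero[OF ad])
    qed
  next
    fix c :: "('a, 'n) chart" and M g assume ad: "adapted_chart \<A> D c M" and g: "g \<in> frame_coeffs1 c M (delbar ?F)"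
    obtain V z where c: "c = (V, z)" by (cases c)
    note ad = ad[unfolded c]
    from g consider i where "g = (\<lambda>x. fst (delbar ?F c x) $ i * log_frame M (snd c x) i)"
      | i where "g = (\<lambda>x. snd (delbar ?F c x) $ i * cnj (log_frame M (snd c x) i))"
      unfolding frame_coeffs1_def by blast
    then show "loglog_coeff \<A> D c M g"
    proof cases
      case (2 i)
      have e: "g = (\<lambda>x. wirt_bar i (in_coords (V, z) ?F) (z x) * cnj (log_frame M (z x) i))" by (simp add: 2 c delbar_def)
      show ?thesis unfolding c e
        by (rule main[OF ad frame_coeffs_smooth(2)[OF sm ad] frame_coeffs_bounds(2)[OF sm ad]])
    next
      case (1 i)
      have e: "g = (\<lambda>x. 0)" by (simp add: 1 c delbar_def)
      show ?thesis unfolding c e by (rule zero[OF ad])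
    qed
  next
    fix c :: "('a, 'n) chart" and M g assume ad: "adapted_chart \<A> D c M" and g: "g \<in> frame_coeffs11 c M (del_delbar ?F)"
    obtain V z where c: "c = (V, z)" by (cases c)
    note ad = ad[unfolded c]
    from g obtain i j where "g = (\<lambda>x. del_delbar ?F c x $ i $ j * log_frame M (snd c x) i * cnj (log_frame M (snd c x) j))"
      unfolding frame_coeffs11_def by blast
    then have e: "g = (\<lambda>x. wirt i (wirt_bar j (in_coords (V, z) ?F)) (z x) * log_frame M (z x) i * cnj (log_frame M (z x) j))"
      by (simp add: c del_delbar_def)
    show "loglog_coeff \<A> D c M g" unfolding c e
      by (rule main[OF ad frame_coeffs_smooth(3)[OF sm ad] frame_coeffs_bounds(3)[OF sm ad]])
  qed
qed

lemma P_singularD: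
  assumes f: "P_singular \<A> D f" and ad: "adapted_chart \<A> D (V, z) M" and p: "p \<in> V"
  shows "\<exists>N::nat. \<forall>\<^sub>F x in nhds p. x \<notin> D \<longrightarrow> jets_le (V, z) M f x (real N)"
proof -
  have g1: "\<forall>g\<in>frame_coeffs1 (V, z) M (ext_d (\<lambda>x. complex_of_real (f x))). poincare_coeff \<A> D (V, z) M g"
    and g2: "\<forall>g\<in>frame_coeffs11 (V, z) M (ddc f). poincare_coeff \<A> D (V, z) M g"
    using f ad unfolding P_singular_def poincare_growth1_def poincare_growth11_def by blast+
  show ?thesis
  proof (rule jets_leI_eventually[where w="\<lambda>N x. real N"])
    show "\<exists>N::nat. \<forall>\<^sub>F x in nhds p. x \<notin> D \<longrightarrow> norm (cj1 (in_coords (V, z) f) (z x) i) * norm (log_frame M (z x) i) \<le> real N" for i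
    proof -
      have "(\<lambda>x. fst (ext_d (\<lambda>x. complex_of_real (f x)) (V, z) x) $ i * log_frame M (snd (V, z) x) i)
          \<in> frame_coeffs1 (V, z) M (ext_d (\<lambda>x. complex_of_real (f x)))"
        unfolding frame_coeffs1_def by blast
      from poincare_coeffD[OF p bspec[OF g1 this]] show ?thesis
        by (simp add: ext_d_def del_def delbar_def cj_coords norm_mult)
    qed
    show "\<exists>N::nat. \<forall>\<^sub>F x in nhds p. x \<notin> D \<longrightarrow> norm (cj2 (in_coords (V, z) f) (z x) i j) * (norm (log_frame M (z x) i) * norm (log_frame M (z x) j)) \<le> real N" for i j
    proof -
      have "(\<lambda>x. ddc f (V, z) x $ i $ j * log_frame M (snd (V, z) x) i * cnj (log_frame M (snd (V, z) x) j))
          \<in> frame_coeffs11 (V, z) M (ddc f)"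
        unfolding frame_coeffs11_def by blast
      from poincare_coeffD[OF p bspec[OF g2 this]] obtain N :: nat where
        N: "\<forall>\<^sub>F x in nhds p. x \<notin> D \<longrightarrow> norm (ddc f (V, z) x $ i $ j * log_frame M (snd (V, z) x) i * cnj (log_frame M (snd (V, z) x) j)) \<le> real N"
        by (elim exE)
      \<comment> \<open>\<open>ddc\<close> differs from del delbar by
        \<open>\<i> / (2 * pi)\<close>; undoing this costs the factor \<open>2 * pi\<close>.\<close>
      obtain N' :: nat where N': "2 * pi * real N \<le> real N'" using real_arch_simple by blast
      from N have "\<forall>\<^sub>F x in nhds p. x \<notin> D \<longrightarrow> norm (cj2 (in_coords (V, z) f) (z x) i j) * (norm (log_frame M (z x) i) * norm (log_frame M (z x) j)) \<le> real N'"
      proof eventually_elim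
        case (elim x)
        show ?case
        proof
          assume "x \<notin> D"
          with elim have "norm (cj2 (in_coords (V, z) f) (z x) i j) / (2 * pi) * (norm (log_frame M (z x) i) * norm (log_frame M (z x) j)) \<le> real N"
            by (simp add: ddc_def del_delbar_def cj_coords norm_mult norm_divide mult.assoc)
          then have "norm (cj2 (in_coords (V, z) f) (z x) i j) * (norm (log_frame M (z x) i) * norm (log_frame M (z x) j)) \<le> 2 * pi * real N"
            by (simp add: field_simps)
          then show "norm (cj2 (in_coords (V, z) f) (z x) i j) * (norm (log_frame M (z x) i) * norm (log_frame M (z x) j)) \<le> real N'"
            using N' by linarith
        qed
      qed
      then show ?thesis by (rule exI)
    qed
  qed simp
qed

lemma P_singularI:
  assumes sm: "mfd_smooth_on \<A> (- D) f"
    and ex: "\<And>V z M p. adapted_chart \<A> D (V, z) M \<Longrightarrow> p \<in> V \<Longrightarrow>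
      \<exists>N::nat. \<forall>\<^sub>F x in nhds p. x \<notin> D \<longrightarrow> jets_le (V, z) M f x (real N)"
  shows "P_singular \<A> D f"
proof -
  let ?F = "\<lambda>x. complex_of_real (f x)"
  have main: "poincare_coeff \<A> D (V, z) M g" if ad: "adapted_chart \<A> D (V, z) M" and g: "mfd_smooth_on \<A> (V - D) g"
    "\<And>x b. x \<in> V \<Longrightarrow> x \<notin> D \<Longrightarrow> jets_le (V, z) M f x b \<Longrightarrow> norm (g x) \<le> b" for V z M and g :: "'a \<Rightarrow> complex"
  proof (rule poincare_coeffI[OF ad g(1)])
    fix p assume p: "p \<in> V"
    obtain N :: nat where "\<forall>\<^sub>F x in nhds p. x \<notin> D \<longrightarrow> jets_le (V, z) M f x (real N)"
      using ex[OF ad p] by (elim exE)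
    with eventually_in_chart[OF ad p] have "\<forall>\<^sub>F x in nhds p. x \<notin> D \<longrightarrow> norm (g x) \<le> real N"
      by eventually_elim (use g(2) in blast)
    then show "\<exists>N::nat. \<forall>\<^sub>F x in nhds p. x \<notin> D \<longrightarrow> norm (g x) \<le> real N" by (rule exI)
  qed
  show ?thesis
    unfolding P_singular_def poincare_growth1_def poincare_growth11_def
  proof (intro conjI allI impI ballI)
    show "mfd_smooth_on \<A> (- D) f" by (rule sm)
  next
    fix c :: "('a, 'n) chart" and M g assume ad: "adapted_chart \<A> D c M" and g: "g \<in> frame_coeffs1 c M (ext_d ?F)"
    obtain V z where c: "c = (V, z)" by (cases c)
    note ad = ad[unfolded c]
    from g consider i where "g = (\<lambda>x. fst (ext_d ?F c x) $ i * log_frame M (snd c x) i)"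
      | i where "g = (\<lambda>x. snd (ext_d ?F c x) $ i * cnj (log_frame M (snd c x) i))"
      unfolding frame_coeffs1_def by blast
    then show "poincare_coeff \<A> D c M g"
    proof cases
      case (1 i)
      have e: "g = (\<lambda>x. wirt i (in_coords (V, z) ?F) (z x) * log_frame M (z x) i)" by (simp add: 1 c ext_d_def del_def delbar_def)
      show ?thesis unfolding c e
        by (rule main[OF ad frame_coeffs_smooth(1)[OF sm ad] frame_coeffs_bounds(1)[OF sm ad]])
    next
      case (2 i)
      have e: "g = (\<lambda>x. wirt_bar i (in_coords (V, z) ?F) (z x) * cnj (log_frame M (z x) i))" by (simp add: 2 c ext_d_def del_def delbar_def)
      show ?thesis unfolding c e
        by (rule main[OF ad frame_coeffs_smooth(2)[OF sm ad] frame_coeffs_bounds(2)[OF sm ad]])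
    qed
  next
    fix c :: "('a, 'n) chart" and M g assume ad: "adapted_chart \<A> D c M" and g: "g \<in> frame_coeffs11 c M (ddc f)"
    obtain V z where c: "c = (V, z)" by (cases c)
    note ad = ad[unfolded c]
    have o: "open (V - D)" unfolding minus_D_Int using chart_props(1)[OF adapted_holo[OF ad]] open_minus_D by (rule open_Int)
    from g obtain i j where "g = (\<lambda>x. ddc f c x $ i $ j * log_frame M (snd c x) i * cnj (log_frame M (snd c x) j))"
      unfolding frame_coeffs11_def by blast
    then have e: "g = (\<lambda>x. \<i> / (2 * of_real pi) * (wirt i (wirt_bar j (in_coords (V, z) ?F)) (z x) * log_frame M (z x) i * cnj (log_frame M (z x) j)))"
      by (simp add: c ddc_def del_delbar_def mult.assoc)
    show "poincare_coeff \<A> D c M g" unfolding c e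
    proof (rule main[OF ad mfd_smooth_on_mult[OF o mfd_smooth_on_const frame_coeffs_smooth(3)[OF sm ad]]])
      fix x b assume x: "x \<in> V" "x \<notin> D" and j: "jets_le (V, z) M f x b"
      have "norm (\<i> / (2 * of_real pi) * (wirt i (wirt_bar j (in_coords (V, z) ?F)) (z x) * log_frame M (z x) i * cnj (log_frame M (z x) j)))
          = (1 / (2 * pi)) * norm (wirt i (wirt_bar j (in_coords (V, z) ?F)) (z x) * log_frame M (z x) i * cnj (log_frame M (z x) j))"
        unfolding norm_mult[of "\<i> / (2 * of_real pi)"] by (simp add: norm_divide norm_mult)
      \<comment> \<open>In this direction the factor \<open>1 / (2 * pi)\<close> is at most 1, so
        the jet bound passes to \<open>ddc\<close> unchanged.\<close>
      also have "\<dots> \<le> 1 * b"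
        using pi_ge_two by (intro mult_mono frame_coeffs_bounds(3)[OF sm ad x j]) auto
      finally show "norm (\<i> / (2 * of_real pi) * (wirt i (wirt_bar j (in_coords (V, z) ?F)) (z x) * log_frame M (z x) i * cnj (log_frame M (z x) j))) \<le> b"
        by simp
    qed
  qed
qed

lemma in_coords_point:
  assumes "(V, z) \<in> holo_charts \<A>" "x \<in> V" "x \<notin> D"
  shows "z x \<in> z ` (V \<inter> - D)" "in_coords (V, z) f (z x) = f x"
  using assms by auto

section \<open>Sums and products under the growth conditions\<close>

lemma jets_le_add:
  assumes f: "mfd_smooth_on \<A> (- D) f" and g: "mfd_smooth_on \<A> (- D) g" and c: "(V, z) \<in> holo_charts \<A>"
    and x: "x \<in> V" "x \<notin> D" and j: "jets_le (V, z) M f x a" "jets_le (V, z) M g x b"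
  shows "jets_le (V, z) M (\<lambda>x. f x + g x) x (a + b)"
proof -
  have e: "in_coords (V, z) (\<lambda>x. f x + g x) = (\<lambda>y. in_coords (V, z) f y + in_coords (V, z) g y)"
    by (simp add: in_coords_def o_def)
  note C = cj_add[OF open_coords[OF c] smooth_coords[OF f c] smooth_coords[OF g c] in_coords_point(1)[OF c x]]
  have t: "norm (u + v) * r \<le> a + b" if "norm u * r \<le> a" "norm v * r \<le> b" "0 \<le> r" for u v :: complex and r
  proof -
    have "norm (u + v) * r \<le> (norm u + norm v) * r" by (rule mult_right_mono[OF norm_triangle_ineq that(3)])
    then show ?thesis using that by (simp add: distrib_right)
  qed
  show ?thesis unfolding jets_le_def fst_conv snd_conv e C
    using jets_le_D[OF j(1)] jets_le_D[OF j(2)] by (auto intro!: t)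
qed

text \<open>The second derivative of a product has four terms. Each is bounded by
  \<open>a * b\<close> in the frame, because the frame weights split over the two factors; hence the
  4.\<close>

lemma jets_le_mult:
  assumes f: "mfd_smooth_on \<A> (- D) f" and g: "mfd_smooth_on \<A> (- D) g" and c: "(V, z) \<in> holo_charts \<A>"
    and x: "x \<in> V" "x \<notin> D" and j: "jets_le (V, z) M f x a" "jets_le (V, z) M g x b" "\<bar>f x\<bar> \<le> a" "\<bar>g x\<bar> \<le> b"
  shows "jets_le (V, z) M (\<lambda>x. f x * g x) x (4 * (a * b))"
proof -
  have e: "in_coords (V, z) (\<lambda>x. f x * g x) = (\<lambda>y. in_coords (V, z) f y * in_coords (V, z) g y)"
    by (simp add: in_coords_def o_def)
  note C = cj_mult[OF open_coords[OF c] smooth_coords[OF f c] smooth_coords[OF g c] in_coords_point(1)[OF c x],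
      unfolded in_coords_point(2)[OF c x]]
  have ab: "0 \<le> a" "0 \<le> b" by (rule jets_le_nonneg[OF j(1)], rule jets_le_nonneg[OF j(2)])
  then have ab0: "0 \<le> a * b" by simp
  let ?f1 = "cj1 (in_coords (V, z) f) (z x)" and ?g1 = "cj1 (in_coords (V, z) g) (z x)"
  let ?f2 = "cj2 (in_coords (V, z) f) (z x)" and ?g2 = "cj2 (in_coords (V, z) g) (z x)"
  let ?r = "\<lambda>i. norm (log_frame M (z x) i)"
  have m: "s * t \<le> a * b" if "0 \<le> s" "s \<le> a" "0 \<le> t" "t \<le> b" for s t :: real using that by (intro mult_mono) auto
  note F = jets_le_D[OF j(1)] and G = jets_le_D[OF j(2)]
  have c1: "norm (of_real (f x) * ?g1 i + ?f1 i * of_real (g x)) * ?r i \<le> 4 * (a * b)" for i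
  proof -
    have "norm (of_real (f x) * ?g1 i + ?f1 i * of_real (g x)) * ?r i \<le> (\<bar>f x\<bar> * norm (?g1 i) + norm (?f1 i) * \<bar>g x\<bar>) * ?r i"
      by (intro mult_right_mono order_trans[OF norm_triangle_ineq]) (simp_all add: norm_mult)
    also have "\<dots> = \<bar>f x\<bar> * (norm (?g1 i) * ?r i) + (norm (?f1 i) * ?r i) * \<bar>g x\<bar>" by (simp add: algebra_simps)
    also have "\<dots> \<le> a * b + a * b" by (intro add_mono m F G j(3,4)) simp_all
    finally show ?thesis using ab0 by linarith
  qed
  have c2: "norm (of_real (f x) * ?g2 i k + ?f1 i * cnj (?g1 k) + (cnj (?f1 k) * ?g1 i + ?f2 i k * of_real (g x))) * (?r i * ?r k) \<le> 4 * (a * b)" for i k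
  proof -
    have "norm (of_real (f x) * ?g2 i k + ?f1 i * cnj (?g1 k) + (cnj (?f1 k) * ?g1 i + ?f2 i k * of_real (g x)))
      \<le> norm (of_real (f x) * ?g2 i k + ?f1 i * cnj (?g1 k)) + norm (cnj (?f1 k) * ?g1 i + ?f2 i k * of_real (g x))"
      by (rule norm_triangle_ineq)
    also have "\<dots> \<le> (norm (of_real (f x) * ?g2 i k) + norm (?f1 i * cnj (?g1 k))) + (norm (cnj (?f1 k) * ?g1 i) + norm (?f2 i k * of_real (g x)))"
      by (intro add_mono norm_triangle_ineq)
    finally have "norm (of_real (f x) * ?g2 i k + ?f1 i * cnj (?g1 k) + (cnj (?f1 k) * ?g1 i + ?f2 i k * of_real (g x))) * (?r i * ?r k)
      \<le> ((norm (of_real (f x) * ?g2 i k) + norm (?f1 i * cnj (?g1 k))) + (norm (cnj (?f1 k) * ?g1 i) + norm (?f2 i k * of_real (g x)))) * (?r i * ?r k)"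
      by (intro mult_right_mono) simp_all
    also have "\<dots> = (\<bar>f x\<bar> * (norm (?g2 i k) * (?r i * ?r k)) + (norm (?f1 i) * ?r i) * (norm (?g1 k) * ?r k))
        + ((norm (?f1 k) * ?r k) * (norm (?g1 i) * ?r i) + (norm (?f2 i k) * (?r i * ?r k)) * \<bar>g x\<bar>)"
      by (simp add: norm_mult algebra_simps)
    also have "\<dots> \<le> (a * b + a * b) + (a * b + a * b)" by (intro add_mono m F G j(3,4)) simp_all
    finally show ?thesis by linarith
  qed
  show ?thesis unfolding jets_le_def fst_conv snd_conv e C using c1 c2 by blast
qed

lemma jets_le_const: "jets_le (V, z) M (\<lambda>x. r) x 0"
proof -
  have "in_coords (V, z) (\<lambda>x. r) = (\<lambda>y. r)" by (simp add: in_coords_def o_def)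
  then show ?thesis by (simp add: jets_le_def cj_const)
qed

lemma jets_le_cmult:
  assumes f: "mfd_smooth_on \<A> (- D) f" and c: "(V, z) \<in> holo_charts \<A>" and x: "x \<in> V" "x \<notin> D"
    and j: "jets_le (V, z) M f x a"
  shows "jets_le (V, z) M (\<lambda>x. r * f x) x (\<bar>r\<bar> * a)"
proof -
  have e: "in_coords (V, z) (\<lambda>x. r * f x) = (\<lambda>y. r * in_coords (V, z) f y)" by (simp add: in_coords_def o_def)
  note C = cj_cmult[OF open_coords[OF c] smooth_coords[OF f c] in_coords_point(1)[OF c x]]
  show ?thesis unfolding jets_le_def fst_conv snd_conv e C
    using jets_le_D[OF j] by (auto simp: norm_mult mult.assoc intro!: mult_left_mono)
qed

text \<open>Products of weights are again below a weight, which closes pre-log-log functions under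
  multiplication. For P-singular functions the argument uses sums and scalar multiples.\<close>

lemma bd_dominates2: "\<exists>N'. \<forall>x. x \<notin> D \<longrightarrow> C * (bd N1 x * bd N2 x) \<le> bd N' x"
proof -
  have e: "C * (bd N1 x * bd N2 x) = (C * real N1 * real N2) * \<Theta>1 x ^ (N1 + N2)" for x
    by (simp add: bd_def power_add mult_ac)
  show ?thesis unfolding e by (rule bd_dominates)
qed

lemma bd_dominates1: "\<exists>N'. \<forall>x. x \<notin> D \<longrightarrow> C * bd N x \<le> bd N' x"
  using bd_dominates[of "C * real N" N] by (simp add: bd_def mult.assoc)

lemma pre_log_log_smooth: "pre_log_log \<A> D f \<Longrightarrow> mfd_smooth_on \<A> (- D) f"
  by (simp add: pre_log_log_def Let_def)

lemma P_singular_smooth: "P_singular \<A> D f \<Longrightarrow> mfd_smooth_on \<A> (- D) f"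
  by (simp add: P_singular_def)

lemma pre_log_log_mult:
  assumes f: "pre_log_log \<A> D f" and g: "pre_log_log \<A> D g"
  shows "pre_log_log \<A> D (\<lambda>x. f x * g x)"
proof (rule pre_log_logI)
  note sf = pre_log_log_smooth[OF f] and sg = pre_log_log_smooth[OF g]
  show "mfd_smooth_on \<A> (- D) (\<lambda>x. f x * g x)" by (rule mfd_smooth_on_mult[OF open_minus_D sf sg])
  fix V z M p assume ad: "adapted_chart \<A> D (V, z) M" and p: "p \<in> V"
  obtain N1 N2 :: nat where N1: "\<forall>\<^sub>F x in nhds p. x \<notin> D \<longrightarrow> \<bar>f x\<bar> \<le> bd N1 x \<and> jets_le (V, z) M f x (bd N1 x)"
    and N2: "\<forall>\<^sub>F x in nhds p. x \<notin> D \<longrightarrow> \<bar>g x\<bar> \<le> bd N2 x \<and> jets_le (V, z) M g x (bd N2 x)"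
    using pre_log_logD[OF f ad p] pre_log_logD[OF g ad p] by (elim exE)
  obtain N where N: "\<forall>x. x \<notin> D \<longrightarrow> 4 * (bd N1 x * bd N2 x) \<le> bd N x" using bd_dominates2 by blast
  have "\<forall>\<^sub>F x in nhds p. x \<notin> D \<longrightarrow> \<bar>f x * g x\<bar> \<le> bd N x \<and> jets_le (V, z) M (\<lambda>x. f x * g x) x (bd N x)"
    using N1 N2 eventually_in_chart[OF ad p]
  proof eventually_elim
    case (elim x)
    show ?case
    proof
      assume x: "x \<notin> D"
      have a: "\<bar>f x\<bar> \<le> bd N1 x" "jets_le (V, z) M f x (bd N1 x)" "\<bar>g x\<bar> \<le> bd N2 x" "jets_le (V, z) M g x (bd N2 x)"
        using elim x by auto
      have n: "4 * (bd N1 x * bd N2 x) \<le> bd N x" using N x by blast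
      have "\<bar>f x\<bar> * \<bar>g x\<bar> \<le> bd N1 x * bd N2 x" using a(1,3) bd_nonneg[OF x] by (intro mult_mono) auto
      moreover have "0 \<le> bd N1 x * bd N2 x" using bd_nonneg[OF x] by simp
      ultimately have "\<bar>f x * g x\<bar> \<le> bd N x" using n by (simp add: abs_mult)
      moreover have "jets_le (V, z) M (\<lambda>x. f x * g x) x (bd N x)"
        by (rule jets_le_mono[OF jets_le_mult[OF sf sg adapted_holo[OF ad] elim(3) x a(2,4,1,3)] n])
      ultimately show "\<bar>f x * g x\<bar> \<le> bd N x \<and> jets_le (V, z) M (\<lambda>x. f x * g x) x (bd N x)" ..
    qed
  qed
  then show "\<exists>N::nat. \<forall>\<^sub>F x in nhds p. x \<notin> D \<longrightarrow> \<bar>f x * g x\<bar> \<le> bd N x \<and> jets_le (V, z) M (\<lambda>x. f x * g x) x (bd N x)" by (rule exI)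
qed

lemma pre_log_log_const: "pre_log_log \<A> D (\<lambda>x. r)"
proof (rule pre_log_logI)
  fix V z M p
  obtain N where "\<forall>x. x \<notin> D \<longrightarrow> \<bar>r\<bar> * \<Theta>1 x ^ 0 \<le> bd N x" using bd_dominates by blast
  then have N: "\<bar>r\<bar> \<le> bd N x" if "x \<notin> D" for x using that by simp
  show "\<exists>N::nat. \<forall>\<^sub>F x in nhds p. x \<notin> D \<longrightarrow> \<bar>r\<bar> \<le> bd N x \<and> jets_le (V, z) M (\<lambda>x. r) x (bd N x)"
  proof (rule exI[of _ N], rule always_eventually, intro allI impI conjI)
    fix x assume x: "x \<notin> D"
    show "\<bar>r\<bar> \<le> bd N x" by (rule N[OF x])
    show "jets_le (V, z) M (\<lambda>x. r) x (bd N x)" by (rule jets_le_mono[OF jets_le_const bd_nonneg[OF x]])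
  qed
qed simp

lemma pre_log_log_add:
  assumes f: "pre_log_log \<A> D f" and g: "pre_log_log \<A> D g"
  shows "pre_log_log \<A> D (\<lambda>x. f x + g x)"
proof (rule pre_log_logI)
  note sf = pre_log_log_smooth[OF f] and sg = pre_log_log_smooth[OF g]
  show "mfd_smooth_on \<A> (- D) (\<lambda>x. f x + g x)" by (rule mfd_smooth_on_add[OF open_minus_D sf sg])
  fix V z M p assume ad: "adapted_chart \<A> D (V, z) M" and p: "p \<in> V"
  obtain N1 N2 :: nat where N1: "\<forall>\<^sub>F x in nhds p. x \<notin> D \<longrightarrow> \<bar>f x\<bar> \<le> bd N1 x \<and> jets_le (V, z) M f x (bd N1 x)"
    and N2: "\<forall>\<^sub>F x in nhds p. x \<notin> D \<longrightarrow> \<bar>g x\<bar> \<le> bd N2 x \<and> jets_le (V, z) M g x (bd N2 x)"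
    using pre_log_logD[OF f ad p] pre_log_logD[OF g ad p] by (elim exE)
  obtain N where N: "\<forall>x. x \<notin> D \<longrightarrow> 2 * bd (N1 + N2) x \<le> bd N x" using bd_dominates1 by blast
  have "\<forall>\<^sub>F x in nhds p. x \<notin> D \<longrightarrow> \<bar>f x + g x\<bar> \<le> bd N x \<and> jets_le (V, z) M (\<lambda>x. f x + g x) x (bd N x)"
    using N1 N2 eventually_in_chart[OF ad p]
  proof eventually_elim
    case (elim x)
    show ?case
    proof
      assume x: "x \<notin> D"
      have a: "\<bar>f x\<bar> \<le> bd N1 x" "jets_le (V, z) M f x (bd N1 x)" "\<bar>g x\<bar> \<le> bd N2 x" "jets_le (V, z) M g x (bd N2 x)"
        using elim x by auto
      have "bd N1 x \<le> bd (N1 + N2) x" "bd N2 x \<le> bd (N1 + N2) x" using bd_mono[OF x] by simp_all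
      moreover have "2 * bd (N1 + N2) x \<le> bd N x" using N x by blast
      ultimately have n: "bd N1 x + bd N2 x \<le> bd N x" by linarith
      have "\<bar>f x + g x\<bar> \<le> bd N x" using a(1,3) n by linarith
      moreover have "jets_le (V, z) M (\<lambda>x. f x + g x) x (bd N x)"
        by (rule jets_le_mono[OF jets_le_add[OF sf sg adapted_holo[OF ad] elim(3) x a(2,4)] n])
      ultimately show "\<bar>f x + g x\<bar> \<le> bd N x \<and> jets_le (V, z) M (\<lambda>x. f x + g x) x (bd N x)" ..
    qed
  qed
  then show "\<exists>N::nat. \<forall>\<^sub>F x in nhds p. x \<notin> D \<longrightarrow> \<bar>f x + g x\<bar> \<le> bd N x \<and> jets_le (V, z) M (\<lambda>x. f x + g x) x (bd N x)" by (rule exI)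
qed

lemma P_singular_add:
  assumes f: "P_singular \<A> D f" and g: "P_singular \<A> D g"
  shows "P_singular \<A> D (\<lambda>x. f x + g x)"
proof (rule P_singularI)
  note sf = P_singular_smooth[OF f] and sg = P_singular_smooth[OF g]
  show "mfd_smooth_on \<A> (- D) (\<lambda>x. f x + g x)" by (rule mfd_smooth_on_add[OF open_minus_D sf sg])
  fix V z M p assume ad: "adapted_chart \<A> D (V, z) M" and p: "p \<in> V"
  obtain N1 N2 :: nat where "\<forall>\<^sub>F x in nhds p. x \<notin> D \<longrightarrow> jets_le (V, z) M f x (real N1)"
    and "\<forall>\<^sub>F x in nhds p. x \<notin> D \<longrightarrow> jets_le (V, z) M g x (real N2)"
    using P_singularD[OF f ad p] P_singularD[OF g ad p] by (elim exE)
  then have "\<forall>\<^sub>F x in nhds p. x \<notin> D \<longrightarrow> jets_le (V, z) M (\<lambda>x. f x + g x) x (real (N1 + N2))"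
    using eventually_in_chart[OF ad p]
    by eventually_elim (use jets_le_add[OF sf sg adapted_holo[OF ad]] in simp)
  then show "\<exists>N::nat. \<forall>\<^sub>F x in nhds p. x \<notin> D \<longrightarrow> jets_le (V, z) M (\<lambda>x. f x + g x) x (real N)" by (rule exI)
qed

lemma P_singular_cmult:
  assumes f: "P_singular \<A> D f"
  shows "P_singular \<A> D (\<lambda>x. r * f x)"
proof (rule P_singularI)
  note sf = P_singular_smooth[OF f]
  show "mfd_smooth_on \<A> (- D) (\<lambda>x. r * f x)" by (rule mfd_smooth_on_mult[OF open_minus_D mfd_smooth_on_const sf])
  fix V z M p assume ad: "adapted_chart \<A> D (V, z) M" and p: "p \<in> V"
  obtain N1 :: nat where N1: "\<forall>\<^sub>F x in nhds p. x \<notin> D \<longrightarrow> jets_le (V, z) M f x (real N1)"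
    using P_singularD[OF f ad p] by (elim exE)
  obtain N :: nat where N: "\<bar>r\<bar> * real N1 \<le> real N" using real_arch_simple by blast
  have "\<forall>\<^sub>F x in nhds p. x \<notin> D \<longrightarrow> jets_le (V, z) M (\<lambda>x. r * f x) x (real N)"
    using N1 eventually_in_chart[OF ad p]
    by eventually_elim (use jets_le_mono[OF jets_le_cmult[OF sf adapted_holo[OF ad]] N] in simp)
  then show "\<exists>N::nat. \<forall>\<^sub>F x in nhds p. x \<notin> D \<longrightarrow> jets_le (V, z) M (\<lambda>x. r * f x) x (real N)" by (rule exI)
qed

text \<open>Write \<open>l\<close> for the log norm. The first derivative of \<open>ln l\<close> is
  \<open>del l / l\<close>; in the frame \<open>del l\<close> has size at most a multiple of
  \<open>l\<close>, because its pole contributes only \<open>log 1/|z_i|\<close>. So the quotient is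
  bounded. The second derivatives of \<open>l\<close> are bounded, and the remaining term is a
  product of two such quotients.\<close>

lemma ln_lg_jets:
  assumes ad: "adapted_chart \<A> D (V, z) M" and p: "p \<in> V" and k: "k \<in> {1..m}"
  shows "\<exists>N::nat. \<forall>\<^sub>F x in nhds p. x \<notin> D \<longrightarrow> jets_le (V, z) M (\<lambda>x. ln (lg k x)) x (real N)"
proof -
  note c = adapted_holo[OF ad]
  let ?T = "in_coords (V, z) (lg k)"
  have e: "in_coords (V, z) (\<lambda>x. ln (lg k x)) = (\<lambda>y. ln (?T y))" by (simp add: in_coords_def o_def)
  have sT: "smooth_on (z ` (V \<inter> - D)) ?T"
    by (rule smooth_coords[OF mfd_smooth_on_subset[OF lg_smooth[OF k] minus_D_subset[OF k]] c])
  have T1: "?T y \<ge> 1" if y: "y \<in> z ` (V \<inter> - D)" for y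
  proof -
    from y obtain x where "y = z x" "x \<in> V \<inter> - D" by (rule imageE)
    then show ?thesis using in_coords_at[OF c, of x "lg k"] lg_ge_1[OF k notin_D[OF _ k], of x] by simp
  qed
  have T0: "?T y > 0" if "y \<in> z ` (V \<inter> - D)" for y using T1[OF that] by linarith
  \<comment> \<open>\<open>A\<close> bounds the first derivatives relative to the log norm and
    \<open>N\<close> the second ones. The quadratic term contributes \<open>A^2\<close>, and
    \<open>1 \<le> A\<close> lets the same sum cover the first derivatives.\<close>
  have jets: "jets_le (V, z) M (\<lambda>x. ln (lg k x)) x (real (N + A^2))"
    if x: "x \<in> V" "x \<notin> D" and A: "\<And>j. norm (cj1 ?T (z x) j) * norm (log_frame M (z x) j) \<le> real A * lg k x" "1 \<le> A"
      and N: "\<And>i j. norm (cj2 ?T (z x) i j) \<le> real N" for x N A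
  proof -
    have "cj1 (\<lambda>y. ln (?T y)) (z x) i = cj1 ?T (z x) i / of_real (?T (z x))"
      and "cj2 (\<lambda>y. ln (?T y)) (z x) i j = cj2 ?T (z x) i j / of_real (?T (z x)) - cj1 ?T (z x) i * cnj (cj1 ?T (z x) j) / (of_real (?T (z x)))\<^sup>2"
      for i j
      by (rule cj_ln[OF open_coords[OF c] sT in_coords_point(1)[OF c x]], erule T0)+
    note C = this[unfolded in_coords_point(2)[OF c x]]
    have g: "lg k x \<ge> 1" by (rule lg_ge_1[OF k notin_D[OF x(2) k]])
    then have g0: "lg k x > 0" "\<bar>lg k x\<bar> = lg k x" by simp_all
    let ?r = "\<lambda>i. norm (log_frame M (z x) i)"
    have r: "?r i \<le> 1" "0 \<le> ?r i" for i using norm_log_frame(1)[of "z x" i M] adapted_props[OF ad x] by auto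
    have b1: "norm (cj1 ?T (z x) i / of_real (lg k x)) * ?r i \<le> real A" for i
    proof -
      have "norm (cj1 ?T (z x) i / of_real (lg k x)) * ?r i = (norm (cj1 ?T (z x) i) * ?r i) / lg k x"
        by (simp add: norm_divide g0(2))
      also have "\<dots> \<le> real A" using A(1)[of i] g0 by (simp add: pos_divide_le_eq)
      finally show ?thesis .
    qed
    have b2: "norm (cj2 ?T (z x) i j / of_real (lg k x) - cj1 ?T (z x) i * cnj (cj1 ?T (z x) j) / (of_real (lg k x))\<^sup>2) * (?r i * ?r j) \<le> real (N + A^2)" for i j
    proof -
      have "norm (cj2 ?T (z x) i j / of_real (lg k x) - cj1 ?T (z x) i * cnj (cj1 ?T (z x) j) / (of_real (lg k x))\<^sup>2)
         \<le> norm (cj2 ?T (z x) i j / of_real (lg k x)) + norm (cj1 ?T (z x) i * cnj (cj1 ?T (z x) j) / (of_real (lg k x))\<^sup>2)"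
        by (rule norm_triangle_ineq4)
      then have "norm (cj2 ?T (z x) i j / of_real (lg k x) - cj1 ?T (z x) i * cnj (cj1 ?T (z x) j) / (of_real (lg k x))\<^sup>2) * (?r i * ?r j)
         \<le> (norm (cj2 ?T (z x) i j / of_real (lg k x)) + norm (cj1 ?T (z x) i * cnj (cj1 ?T (z x) j) / (of_real (lg k x))\<^sup>2)) * (?r i * ?r j)"
        using r by (intro mult_right_mono) auto
      also have "\<dots> = norm (cj2 ?T (z x) i j) / lg k x * (?r i * ?r j)
          + (norm (cj1 ?T (z x) i / of_real (lg k x)) * ?r i) * (norm (cj1 ?T (z x) j / of_real (lg k x)) * ?r j)"
        by (simp add: norm_divide norm_mult norm_power g0(2) power2_eq_square algebra_simps)
      also have "\<dots> \<le> real N * 1 + real A * real A"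
      proof (intro add_mono mult_mono b1)
        have "norm (cj2 ?T (z x) i j) / lg k x \<le> norm (cj2 ?T (z x) i j) / 1" using g by (intro divide_left_mono) auto
        then show "norm (cj2 ?T (z x) i j) / lg k x \<le> real N" using N[of i j] by linarith
        show "?r i * ?r j \<le> 1" using mult_mono[OF r(1)[of i] r(1)[of j]] r(2) by simp
      qed (use r g0 in auto)
      finally show ?thesis by (simp add: power2_eq_square)
    qed
    have "A * 1 \<le> A * A" using A(2) by (intro mult_le_mono2)
    then have "real A \<le> real (N + A^2)" unfolding of_nat_le_iff power2_eq_square by linarith
    then have "norm (cj1 ?T (z x) i / of_real (lg k x)) * ?r i \<le> real (N + A^2)" for i
      using b1[of i] by linarith
    then show ?thesis unfolding jets_le_def fst_conv snd_conv e C using b2 by (intro conjI allI)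
  qed
  show ?thesis
  proof (cases "p \<in> Dc k")
    case False
    obtain N :: nat where N: "\<forall>\<^sub>F x in nhds p. lg k x \<le> real N \<and> (\<forall>j. norm (cj1 ?T (z x) j) \<le> real N)
      \<and> (\<forall>i j. norm (cj2 ?T (z x) i j) \<le> real N)"
      using lg_near_off[OF ad p k False] by (elim exE)
    \<comment> \<open>Taking \<open>A = N + 1\<close> instead of \<open>N\<close> secures the
      condition \<open>1 \<le> A\<close>.\<close>
    have "\<forall>\<^sub>F x in nhds p. x \<notin> D \<longrightarrow> jets_le (V, z) M (\<lambda>x. ln (lg k x)) x (real (N + (N + 1)^2))"
      using N eventually_in_chart[OF ad p]
    proof eventually_elim
      case (elim x)
      show ?case
      proof
        assume x: "x \<notin> D"
        have g: "lg k x \<ge> 1" by (rule lg_ge_1[OF k notin_D[OF x k]])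
        show "jets_le (V, z) M (\<lambda>x. ln (lg k x)) x (real (N + (N + 1)^2))"
        proof (rule jets[OF elim(2) x])
          fix j
          have "norm (cj1 ?T (z x) j) * norm (log_frame M (z x) j) \<le> real (N + 1) * 1"
            using elim(1) norm_log_frame(1)[of "z x" j M] adapted_props[OF ad elim(2) x] by (intro mult_mono) (auto intro: order_trans)
          also have "\<dots> \<le> real (N + 1) * lg k x" using g by (intro mult_left_mono) auto
          finally show "norm (cj1 ?T (z x) j) * norm (log_frame M (z x) j) \<le> real (N + 1) * lg k x" .
        qed (use elim(1) in auto)
      qed
    qed
    then show ?thesis by (rule exI)
  next
    case True
    obtain i W0 where i: "i \<in> M" and W0: "open W0" "p \<in> W0" "W0 \<subseteq> V" "\<forall>x\<in>W0. x \<in> Dc k \<longleftrightarrow> z x $ i = 0"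
      using adapted_germs(1)[OF ad p k True] by blast
    obtain N :: nat where N: "\<forall>\<^sub>F x in nhds p. x \<notin> Dc k \<longrightarrow> z x $ i \<noteq> 0 \<and> \<bar>lg k x - 2 * ln (1 / norm (z x $ i))\<bar> \<le> real N
       \<and> (\<forall>j. norm (cj1 ?T (z x) j + (if j = i then 1 / z x $ i else 0)) \<le> real N)
       \<and> (\<forall>a b. norm (cj2 ?T (z x) a b) \<le> real N)"
      using lg_near_on[OF ad p k W0] by (elim exE)
    \<comment> \<open>Here \<open>A = 2 * N + 1\<close>: the bounded part costs \<open>N\<close>,
      and the pole costs \<open>log 1/|z_i|\<close>, which is at most
      \<open>lg k x + N * lg k x\<close>.\<close>
    have "\<forall>\<^sub>F x in nhds p. x \<notin> D \<longrightarrow> jets_le (V, z) M (\<lambda>x. ln (lg k x)) x (real (N + (2 * N + 1)^2))"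
      using N eventually_in_chart[OF ad p]
    proof eventually_elim
      case (elim x)
      show ?case
      proof
        assume x: "x \<notin> D"
        have xk: "x \<notin> Dc k" by (rule notin_D[OF x k])
        have g: "lg k x \<ge> 1" by (rule lg_ge_1[OF k xk])
        have E: "z x $ i \<noteq> 0" "\<bar>lg k x - 2 * ln (1 / norm (z x $ i))\<bar> \<le> real N"
          "\<And>j. norm (cj1 ?T (z x) j + (if j = i then 1 / z x $ i else 0)) \<le> real N" "\<And>a b. norm (cj2 ?T (z x) a b) \<le> real N"
          using elim(1) xk by auto
        show "jets_le (V, z) M (\<lambda>x. ln (lg k x)) x (real (N + (2 * N + 1)^2))"
        proof (rule jets[OF elim(2) x])
          fix j
          let ?d = "if j = i then 1 / z x $ i else 0"
          let ?r = "norm (log_frame M (z x) j)"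
          have r: "?r \<le> 1" using norm_log_frame(1)[of "z x" j M] adapted_props[OF ad elim(2) x] by auto
          have l: "ln (1 / norm (z x $ i)) > 1" by (rule norm_log_frame(4)[OF adapted_props[OF ad elim(2) x] i])
          have d: "norm ?d * ?r \<le> ln (1 / norm (z x $ i))"
          proof (cases "j = i")
            case True
            have "?r = norm (z x $ i) * ln (1 / norm (z x $ i))"
              unfolding True by (rule norm_log_frame(3)[OF adapted_props[OF ad elim(2) x] i])
            then show ?thesis using True E(1) by (simp add: norm_divide)
          qed (use l in simp)
          have Ng: "real N * 1 \<le> real N * lg k x" using g by (intro mult_left_mono) auto
          have "norm (cj1 ?T (z x) j) \<le> norm (cj1 ?T (z x) j + ?d) + norm ?d"
            using norm_triangle_ineq4[of "cj1 ?T (z x) j + ?d" ?d] by simp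
          then have "norm (cj1 ?T (z x) j) * ?r \<le> (norm (cj1 ?T (z x) j + ?d) + norm ?d) * ?r" by (intro mult_right_mono) auto
          also have "\<dots> = norm (cj1 ?T (z x) j + ?d) * ?r + norm ?d * ?r" by (rule distrib_right)
          also have "\<dots> \<le> real N * 1 + ln (1 / norm (z x $ i))" by (intro add_mono d mult_mono E(3) r) auto
          also have "\<dots> \<le> real N * lg k x + (lg k x + real N * lg k x)" using E(2) Ng l by linarith
          also have "\<dots> = real (2 * N + 1) * lg k x" by (simp add: algebra_simps)
          finally show "norm (cj1 ?T (z x) j) * ?r \<le> real (2 * N + 1) * lg k x" .
        qed (use E(4) in auto)
      qed
    qed
    then show ?thesis by (rule exI)
  qed
qed

lemma \<Theta>1_P_singular: "P_singular \<A> D \<Theta>1"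
proof -
  have "P_singular \<A> D (\<lambda>x. \<Sum>k\<in>K. ln (lg k x))" if "K \<subseteq> {1..m}" for K
  proof -
    have "finite K" by (rule finite_subset[OF that]) simp
    then show ?thesis using that
  proof (induction K rule: finite_induct)
    case empty
    show ?case unfolding sum.empty
      by (rule P_singularI) (auto intro!: exI[of _ 0] always_eventually simp: jets_le_const)
  next
    case (insert k K)
    have k: "k \<in> {1..m}" using insert.prems by blast
    have "P_singular \<A> D (\<lambda>x. ln (lg k x))"
      by (rule P_singularI[OF mfd_smooth_on_subset[OF ln_lg_smooth[OF k] minus_D_subset[OF k]] ln_lg_jets[OF _ _ k]])
    from P_singular_add[OF this insert.IH] insert show ?case by simp
  qed
  qed
  then show ?thesis unfolding \<Theta>1_def[abs_def] by blast
qed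

text \<open>Since \<Theta>1 is at least 1, a constant bound on the derivatives is below a weight;
  the function itself is below a weight by construction.\<close>

lemma \<Theta>1_pre_log_log: "pre_log_log \<A> D \<Theta>1"
proof (rule pre_log_logI[OF \<Theta>1_smooth])
  fix V z M p assume ad: "adapted_chart \<A> D (V, z) M" and p: "p \<in> V"
  obtain N :: nat where N: "\<forall>\<^sub>F x in nhds p. x \<notin> D \<longrightarrow> jets_le (V, z) M \<Theta>1 x (real N)"
    using P_singularD[OF \<Theta>1_P_singular ad p] by (elim exE)
  obtain N' where N': "\<forall>x. x \<notin> D \<longrightarrow> (real N + 1) * \<Theta>1 x ^ 1 \<le> bd N' x"
    using bd_dominates[of "real N + 1" 1] by (elim exE)
  have "\<forall>\<^sub>F x in nhds p. x \<notin> D \<longrightarrow> \<bar>\<Theta>1 x\<bar> \<le> bd N' x \<and> jets_le (V, z) M \<Theta>1 x (bd N' x)"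
    using N
  proof eventually_elim
    case (elim x)
    show ?case
    proof
      assume x: "x \<notin> D"
      have t: "\<Theta>1 x \<ge> 1" by (rule \<Theta>1_ge_1[OF x])
      have "real N * 1 \<le> real N * \<Theta>1 x" using t by (intro mult_left_mono) auto
      moreover have "real N * \<Theta>1 x + \<Theta>1 x \<le> bd N' x"
      proof -
        have "(real N + 1) * \<Theta>1 x ^ 1 \<le> bd N' x" using N' x by blast
        then show ?thesis by (simp add: distrib_right)
      qed
      moreover have "0 \<le> real N * \<Theta>1 x" using t by simp
      ultimately have b: "real N \<le> bd N' x" "\<bar>\<Theta>1 x\<bar> \<le> bd N' x" using t by linarith+
      have "jets_le (V, z) M \<Theta>1 x (real N)" using elim x by blast
      then have "jets_le (V, z) M \<Theta>1 x (bd N' x)" by (rule jets_le_mono[OF _ b(1)])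
      with b(2) show "\<bar>\<Theta>1 x\<bar> \<le> bd N' x \<and> jets_le (V, z) M \<Theta>1 x (bd N' x)" by (rule conjI)
    qed
  qed
  then show "\<exists>N::nat. \<forall>\<^sub>F x in nhds p. x \<notin> D \<longrightarrow> \<bar>\<Theta>1 x\<bar> \<le> bd N x \<and> jets_le (V, z) M \<Theta>1 x (bd N x)" by (rule exI)
qed

lemma pre_log_log_power: "pre_log_log \<A> D f \<Longrightarrow> pre_log_log \<A> D (\<lambda>x. f x ^ N)"
  by (induction N) (auto intro: pre_log_log_const pre_log_log_mult)

end

section \<open>The Levi form\<close>

text \<open>After each coordinate is divided by its weight, \<open>2 s t \<le> s^2 + t^2\<close>
  turns every entry into a sum of two squares. Summing over both indices produces the dimension as a
  factor.\<close>

lemma herm_sum_bound: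
  fixes a :: "'n::finite \<Rightarrow> 'n \<Rightarrow> complex" and \<xi> :: "complex^'n"
  assumes "\<And>i. r i > 0" "\<And>i j. norm (a i j) * (r i * r j) \<le> b"
  shows "\<bar>Re (\<Sum>i\<in>UNIV. \<Sum>j\<in>UNIV. a i j * \<xi> $ i * cnj (\<xi> $ j))\<bar> \<le> real CARD('n) * b * (\<Sum>i\<in>UNIV. (norm (\<xi> $ i) / r i)\<^sup>2)"
proof -
  define q where "q = (\<lambda>i. norm (\<xi> $ i) / r i)"
  have q0: "q i \<ge> 0" for i using assms(1)[of i] by (simp add: q_def)
  have b0: "0 \<le> b"
  proof -
    have "0 \<le> norm (a undefined undefined) * (r undefined * r undefined)" using assms(1)[of undefined] by simp
    then show ?thesis using assms(2)[of undefined undefined] by linarith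
  qed
  have trm: "norm (a i j * \<xi> $ i * cnj (\<xi> $ j)) \<le> b * ((q i)\<^sup>2 / 2) + b * ((q j)\<^sup>2 / 2)" for i j
  proof -
    have "norm (a i j * \<xi> $ i * cnj (\<xi> $ j)) = (norm (a i j) * (r i * r j)) * (q i * q j)"
      using assms(1)[of i] assms(1)[of j] by (simp add: q_def norm_mult)
    also have "\<dots> \<le> b * (q i * q j)" by (rule mult_right_mono[OF assms(2)]) (simp add: q0)
    also have "\<dots> \<le> b * ((q i)\<^sup>2 / 2 + (q j)\<^sup>2 / 2)"
    proof (rule mult_left_mono[OF _ b0])
      have "0 \<le> (q i - q j)\<^sup>2" by simp
      then show "q i * q j \<le> (q i)\<^sup>2 / 2 + (q j)\<^sup>2 / 2" by (simp add: power2_diff)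
    qed
    finally show ?thesis by (simp add: distrib_left)
  qed
  have "\<bar>Re (\<Sum>i\<in>UNIV. \<Sum>j\<in>UNIV. a i j * \<xi> $ i * cnj (\<xi> $ j))\<bar> \<le> norm (\<Sum>i\<in>UNIV. \<Sum>j\<in>UNIV. a i j * \<xi> $ i * cnj (\<xi> $ j))"
    by (rule abs_Re_le_cmod)
  also have "\<dots> \<le> (\<Sum>i\<in>UNIV. \<Sum>j\<in>UNIV. b * ((q i)\<^sup>2 / 2) + b * ((q j)\<^sup>2 / 2))"
    by (intro sum_norm_le trm)
  also have "\<dots> = real CARD('n) * (\<Sum>i\<in>UNIV. b * ((q i)\<^sup>2 / 2)) + real CARD('n) * (\<Sum>j\<in>UNIV. b * ((q j)\<^sup>2 / 2))"
    by (simp add: sum.distrib sum_distrib_left)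
  also have "\<dots> = real CARD('n) * b * (\<Sum>i\<in>UNIV. (q i)\<^sup>2)"
    by (simp add: sum_distrib_left[symmetric] sum_divide_distrib[symmetric])
  finally show ?thesis unfolding q_def .
qed

text \<open>Squared Euclidean length in the chart. It collects all bounded error terms, and locally
  a multiple of \<omega> dominates it.\<close>

definition nsum :: "complex^'n::finite \<Rightarrow> real" where
  "nsum \<xi> = (\<Sum>i\<in>UNIV. (norm (\<xi> $ i))\<^sup>2)"

lemma nsum_nonneg: "nsum \<xi> \<ge> 0"
  unfolding nsum_def by (rule sum_nonneg) simp

lemma nsum_norm: "nsum \<xi> = (norm \<xi>)\<^sup>2"
  unfolding nsum_def norm_vec_def L2_set_def by (simp add: sum_nonneg)

lemma le_nsum: "(norm (\<xi> $ i))\<^sup>2 \<le> nsum \<xi>"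
  unfolding nsum_def by (rule member_le_sum) simp_all

text \<open>The square of a linear form is the Hermitian form of the rank-one matrix
  \<open>c i * cnj (c j)\<close>, so \<open>herm_sum_bound\<close> with unit weights
  applies.\<close>

lemma linear_form_sq_bound:
  fixes c :: "'n::finite \<Rightarrow> complex" and \<xi> :: "complex^'n"
  assumes "\<And>i. norm (c i) \<le> N" "0 \<le> N"
  shows "(norm (\<Sum>i\<in>UNIV. c i * \<xi> $ i))\<^sup>2 \<le> real CARD('n) * N\<^sup>2 * nsum \<xi>"
proof -
  have "(norm (\<Sum>i\<in>UNIV. c i * \<xi> $ i))\<^sup>2 = Re (\<Sum>i\<in>UNIV. \<Sum>j\<in>UNIV. (c i * cnj (c j)) * \<xi> $ i * cnj (\<xi> $ j))"
  proof -
    have "complex_of_real ((norm (\<Sum>i\<in>UNIV. c i * \<xi> $ i))\<^sup>2) = (\<Sum>i\<in>UNIV. \<Sum>j\<in>UNIV. (c i * cnj (c j)) * \<xi> $ i * cnj (\<xi> $ j))"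
      unfolding complex_norm_square cnj_sum sum_product by (simp add: mult_ac)
    then show ?thesis by (metis Re_complex_of_real)
  qed
  also have "\<dots> \<le> \<bar>Re (\<Sum>i\<in>UNIV. \<Sum>j\<in>UNIV. (c i * cnj (c j)) * \<xi> $ i * cnj (\<xi> $ j))\<bar>" by (rule abs_ge_self)
  also have "\<dots> \<le> real CARD('n) * N\<^sup>2 * (\<Sum>i\<in>UNIV. (norm (\<xi> $ i) / 1)\<^sup>2)"
  proof (rule herm_sum_bound)
    show "norm (c i * cnj (c j)) * (1 * 1) \<le> N\<^sup>2" for i j
      using mult_mono[OF assms(1)[of i] assms(1)[of j] assms(2) norm_ge_zero] by (simp add: norm_mult power2_eq_square)
  qed simp
  finally show ?thesis by (simp add: nsum_def)
qed

text \<open>The Poincare metric of the adapted chart: the \<open>i\<close>-th summand is the squared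
  modulus of d\<zeta>_i on \<xi>.\<close>

definition pq :: "'n set \<Rightarrow> complex^'n::finite \<Rightarrow> complex^'n \<Rightarrow> real" where
  "pq M y \<xi> = (\<Sum>i\<in>UNIV. (norm (\<xi> $ i) / norm (log_frame M y i))\<^sup>2)"

context snc_pair
begin

lemma levi_upper:
  assumes ad: "adapted_chart \<A> D (V, z) M" and x: "x \<in> V" "x \<notin> D" and j: "jets_le (V, z) M f x b"
  shows "\<bar>levi f (V, z) x \<xi>\<bar> \<le> real CARD('n) * b * pq M (z x) \<xi>"
  unfolding levi_cj2 pq_def
  by (rule herm_sum_bound[OF norm_log_frame(2)[OF adapted_props[OF ad x]] jets_le_D(2)[OF j]])

lemma levi_add:
  assumes f: "mfd_smooth_on \<A> (- D) f" and g: "mfd_smooth_on \<A> (- D) g" and c: "(V, z) \<in> holo_charts \<A>" and x: "x \<in> V" "x \<notin> D"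
  shows "levi (\<lambda>x. f x + g x) (V, z) x \<xi> = levi f (V, z) x \<xi> + levi g (V, z) x \<xi>"
proof -
  have e: "in_coords (V, z) (\<lambda>x. f x + g x) = (\<lambda>y. in_coords (V, z) f y + in_coords (V, z) g y)"
    by (simp add: in_coords_def o_def)
  show ?thesis
    unfolding levi_cj2 e cj_add(2)[OF open_coords[OF c] smooth_coords[OF f c] smooth_coords[OF g c] in_coords_point(1)[OF c x]]
    by (simp only: distrib_right sum.distrib plus_complex.sel)
qed

lemma levi_cmult:
  assumes f: "mfd_smooth_on \<A> (- D) f" and c: "(V, z) \<in> holo_charts \<A>" and x: "x \<in> V" "x \<notin> D"
  shows "levi (\<lambda>x. r * f x) (V, z) x \<xi> = r * levi f (V, z) x \<xi>"
proof -
  have e: "in_coords (V, z) (\<lambda>x. r * f x) = (\<lambda>y. r * in_coords (V, z) f y)"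
    by (simp add: in_coords_def o_def)
  have "levi (\<lambda>x. r * f x) (V, z) x \<xi> = Re (of_real r * (\<Sum>i\<in>UNIV. \<Sum>j\<in>UNIV. cj2 (in_coords (V, z) f) (z x) i j * \<xi> $ i * cnj (\<xi> $ j)))"
    unfolding levi_cj2 e cj_cmult(2)[OF open_coords[OF c] smooth_coords[OF f c] in_coords_point(1)[OF c x]]
    by (simp only: sum_distrib_left mult.assoc)
  also have "\<dots> = r * levi f (V, z) x \<xi>"
  proof -
    have "Re (of_real r * u) = r * Re u" for u by simp
    then show ?thesis unfolding levi_cj2 .
  qed
  finally show ?thesis .
qed

lemma levi_uminus:
  assumes f: "mfd_smooth_on \<A> (- D) f" and c: "(V, z) \<in> holo_charts \<A>" and x: "x \<in> V" "x \<notin> D"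
  shows "levi (\<lambda>x. - f x) (V, z) x \<xi> = - levi f (V, z) x \<xi>"
  using levi_cmult[OF assms, of "-1"] by simp

section \<open>Lower bound for the Levi form of \<open>- \<Theta>1\<close>\<close>

lemma ln_lg_smooth_D: "k \<in> {1..m} \<Longrightarrow> mfd_smooth_on \<A> (- D) (\<lambda>x. ln (lg k x))"
  by (rule mfd_smooth_on_subset[OF ln_lg_smooth minus_D_subset])

lemma levi_neg_\<Theta>1:
  assumes c: "(V, z) \<in> holo_charts \<A>" and x: "x \<in> V" "x \<notin> D"
  shows "levi (\<lambda>x. - \<Theta>1 x) (V, z) x \<xi> = (\<Sum>k=1..m. - levi (\<lambda>x. ln (lg k x)) (V, z) x \<xi>)"
proof -
  have "levi (\<lambda>x. \<Sum>k\<in>K. ln (lg k x)) (V, z) x \<xi> = (\<Sum>k\<in>K. levi (\<lambda>x. ln (lg k x)) (V, z) x \<xi>)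
      \<and> mfd_smooth_on \<A> (- D) (\<lambda>x. \<Sum>k\<in>K. ln (lg k x))" if "finite K" "K \<subseteq> {1..m}" for K
    using that
  proof (induction K rule: finite_induct)
    case empty
    have "in_coords (V, z) (\<lambda>x. 0) = (\<lambda>y. 0::real)" by (simp add: in_coords_def o_def)
    then show ?case by (simp add: levi_cj2 cj_const)
  next
    case (insert k K)
    have k: "k \<in> {1..m}" using insert.prems by blast
    have IH: "levi (\<lambda>x. \<Sum>k\<in>K. ln (lg k x)) (V, z) x \<xi> = (\<Sum>k\<in>K. levi (\<lambda>x. ln (lg k x)) (V, z) x \<xi>)"
      "mfd_smooth_on \<A> (- D) (\<lambda>x. \<Sum>k\<in>K. ln (lg k x))" using insert.IH insert.prems by simp_all
    show ?case
      using levi_add[OF ln_lg_smooth_D[OF k] IH(2) c x] IH(1) mfd_smooth_on_add[OF open_minus_D ln_lg_smooth_D[OF k] IH(2)] insert.hyps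
      by simp
  qed
  from this[of "{1..m}"] have "levi \<Theta>1 (V, z) x \<xi> = (\<Sum>k=1..m. levi (\<lambda>x. ln (lg k x)) (V, z) x \<xi>)"
    unfolding \<Theta>1_def[abs_def] by simp
  then show ?thesis unfolding levi_uminus[OF \<Theta>1_smooth c x] by (simp add: sum_negf)
qed

text \<open>By \<open>cj_ln\<close> the rank-one part of the second derivative sums up to the square
  of one linear form. This square is the source of all positivity below; the other term is treated
  as an error.\<close>

lemma levi_ln_lg:
  fixes z :: "'a \<Rightarrow> complex^'n"
  assumes c: "(V, z) \<in> holo_charts \<A>" and x: "x \<in> V" "x \<notin> D" and k: "k \<in> {1..m}"
  shows "- levi (\<lambda>x. ln (lg k x)) (V, z) x \<xi> =
    (norm (\<Sum>i\<in>UNIV. cj1 (in_coords (V, z) (lg k)) (z x) i * \<xi> $ i))\<^sup>2 / (lg k x)\<^sup>2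
     - Re (\<Sum>i\<in>UNIV. \<Sum>j\<in>UNIV. cj2 (in_coords (V, z) (lg k)) (z x) i j * \<xi> $ i * cnj (\<xi> $ j)) / lg k x"
proof -
  let ?T = "in_coords (V, z) (lg k)" and ?t = "complex_of_real (lg k x)"
  have e: "in_coords (V, z) (\<lambda>x. ln (lg k x)) = (\<lambda>y. ln (?T y))" by (simp add: in_coords_def o_def)
  have sT: "smooth_on (z ` (V \<inter> - D)) ?T"
    by (rule smooth_coords[OF mfd_smooth_on_subset[OF lg_smooth[OF k] minus_D_subset[OF k]] c])
  have T0: "?T y > 0" if y: "y \<in> z ` (V \<inter> - D)" for y
  proof -
    from y obtain q where q: "y = z q" "q \<in> V \<inter> - D" by (rule imageE)
    have "lg k q \<ge> 1" using lg_ge_1[OF k notin_D[OF _ k]] q(2) by simp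
    then show ?thesis using in_coords_at[OF c, of q "lg k"] q by simp
  qed
  have "cj2 (\<lambda>y. ln (?T y)) (z x) i j = cj2 ?T (z x) i j / of_real (?T (z x)) - cj1 ?T (z x) i * cnj (cj1 ?T (z x) j) / (of_real (?T (z x)))\<^sup>2" for i j
    by (rule cj_ln(2)[OF open_coords[OF c] sT in_coords_point(1)[OF c x]], erule T0)
  note C = this[unfolded in_coords_point(2)[OF c x]]
  let ?a = "\<lambda>i j. cj2 ?T (z x) i j" and ?c = "\<lambda>i. cj1 ?T (z x) i"
  let ?H = "\<Sum>i\<in>UNIV. \<Sum>j\<in>UNIV. ?a i j * \<xi> $ i * cnj (\<xi> $ j)"
  have sq: "(\<Sum>i\<in>UNIV. \<Sum>j\<in>UNIV. (?c i * \<xi> $ i) * cnj (?c j * \<xi> $ j)) = of_real ((norm (\<Sum>i\<in>UNIV. ?c i * \<xi> $ i))\<^sup>2)"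
    unfolding complex_norm_square cnj_sum sum_product ..
  have trm: "(?a i j / ?t - ?c i * cnj (?c j) / ?t\<^sup>2) * \<xi> $ i * cnj (\<xi> $ j)
     = ?a i j * \<xi> $ i * cnj (\<xi> $ j) / ?t - (?c i * \<xi> $ i) * cnj (?c j * \<xi> $ j) / ?t\<^sup>2" for i j
  proof -
    have "(u / t - c * d / w) * a * b = u * a * b / t - (c * a) * (d * b) / w" for u t c d w a b :: complex
      by (simp add: algebra_simps)
    then show ?thesis unfolding complex_cnj_mult .
  qed
  have "(\<Sum>i\<in>UNIV. \<Sum>j\<in>UNIV. (?a i j / ?t - ?c i * cnj (?c j) / ?t\<^sup>2) * \<xi> $ i * cnj (\<xi> $ j))
     = ?H / ?t - of_real ((norm (\<Sum>i\<in>UNIV. ?c i * \<xi> $ i))\<^sup>2) / ?t\<^sup>2"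
    unfolding trm sum_subtractf sum_divide_distrib[symmetric] sq ..
  also have "\<dots> = ?H / of_real (lg k x) - of_real ((norm (\<Sum>i\<in>UNIV. ?c i * \<xi> $ i))\<^sup>2 / (lg k x)\<^sup>2)" by simp
  finally have "levi (\<lambda>x. ln (lg k x)) (V, z) x \<xi> = Re (?H / of_real (lg k x) - of_real ((norm (\<Sum>i\<in>UNIV. ?c i * \<xi> $ i))\<^sup>2 / (lg k x)\<^sup>2))"
    unfolding levi_cj2 e C by (rule arg_cong[of _ _ Re])
  also have "\<dots> = Re ?H / lg k x - (norm (\<Sum>i\<in>UNIV. ?c i * \<xi> $ i))\<^sup>2 / (lg k x)\<^sup>2"
    by (simp only: minus_complex.sel Re_complex_of_real Re_divide_of_real)
  finally show ?thesis by simp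
qed

text \<open>The log norm is at least 1, so dividing by it cannot enlarge the error, which the
  Euclidean length then absorbs.\<close>

lemma levi_ln_lg_lower_gen:
  fixes z :: "'a \<Rightarrow> complex^'n"
  assumes c: "(V, z) \<in> holo_charts \<A>" and x: "x \<in> V" "x \<notin> D" and k: "k \<in> {1..m}"
    and N: "\<And>a b. norm (cj2 (in_coords (V, z) (lg k)) (z x) a b) \<le> real N"
  shows "(norm (\<Sum>i\<in>UNIV. cj1 (in_coords (V, z) (lg k)) (z x) i * \<xi> $ i))\<^sup>2 / (lg k x)\<^sup>2
    \<le> - levi (\<lambda>x. ln (lg k x)) (V, z) x \<xi> + real (CARD('n) * N) * nsum \<xi>"
proof -
  let ?R = "Re (\<Sum>i\<in>UNIV. \<Sum>j\<in>UNIV. cj2 (in_coords (V, z) (lg k)) (z x) i j * \<xi> $ i * cnj (\<xi> $ j))"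
  have g: "lg k x \<ge> 1" by (rule lg_ge_1[OF k notin_D[OF x(2) k]])
  have "\<bar>?R\<bar> \<le> real CARD('n) * real N * (\<Sum>i\<in>UNIV. (norm (\<xi> $ i) / 1)\<^sup>2)"
    by (rule herm_sum_bound) (use N in simp_all)
  then have R: "\<bar>?R\<bar> \<le> real (CARD('n) * N) * nsum \<xi>" by (simp add: nsum_def)
  have "?R / lg k x \<le> \<bar>?R\<bar> / 1" using g by (intro frac_le) auto
  then have "?R / lg k x \<le> real (CARD('n) * N) * nsum \<xi>" using R by simp
  then show ?thesis unfolding levi_ln_lg[OF c x k] by simp
qed

lemma lg_near_cj2:
  assumes ad: "adapted_chart \<A> D (V, z) M" and p: "p \<in> V" and k: "k \<in> {1..m}"
  shows "\<exists>N::nat. \<forall>\<^sub>F x in nhds p. x \<notin> D \<longrightarrow> (\<forall>a b. norm (cj2 (in_coords (V, z) (lg k)) (z x) a b) \<le> real N)"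
proof (cases "p \<in> Dc k")
  case False
  obtain N :: nat where "\<forall>\<^sub>F x in nhds p. lg k x \<le> real N \<and> (\<forall>j. norm (cj1 (in_coords (V, z) (lg k)) (z x) j) \<le> real N)
      \<and> (\<forall>i j. norm (cj2 (in_coords (V, z) (lg k)) (z x) i j) \<le> real N)"
    using lg_near_off[OF ad p k False] by (elim exE)
  then have "\<forall>\<^sub>F x in nhds p. x \<notin> D \<longrightarrow> (\<forall>a b. norm (cj2 (in_coords (V, z) (lg k)) (z x) a b) \<le> real N)"
    by (rule eventually_mono) simp
  then show ?thesis by (rule exI)
next
  case True
  obtain i W0 where W0: "open W0" "p \<in> W0" "W0 \<subseteq> V" "\<forall>x\<in>W0. x \<in> Dc k \<longleftrightarrow> z x $ i = 0"
    using adapted_germs(1)[OF ad p k True] by blast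
  obtain N :: nat where "\<forall>\<^sub>F x in nhds p. x \<notin> Dc k \<longrightarrow> z x $ i \<noteq> 0 \<and> \<bar>lg k x - 2 * ln (1 / norm (z x $ i))\<bar> \<le> real N
       \<and> (\<forall>j. norm (cj1 (in_coords (V, z) (lg k)) (z x) j + (if j = i then 1 / z x $ i else 0)) \<le> real N)
       \<and> (\<forall>a b. norm (cj2 (in_coords (V, z) (lg k)) (z x) a b) \<le> real N)"
    using lg_near_on[OF ad p k W0] by (elim exE)
  then have "\<forall>\<^sub>F x in nhds p. x \<notin> D \<longrightarrow> (\<forall>a b. norm (cj2 (in_coords (V, z) (lg k)) (z x) a b) \<le> real N)"
    by (rule eventually_mono) (use notin_D[OF _ k] in simp)
  then show ?thesis by (rule exI)
qed

text \<open>Dropping the square loses nothing for the components that do not supply the direction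
  under consideration: up to a Euclidean error their contribution is nonnegative.\<close>

lemma levi_ln_lg_lower:
  fixes z :: "'a \<Rightarrow> complex^'n"
  assumes ad: "adapted_chart \<A> D (V, z) M" and p: "p \<in> V" and k: "k \<in> {1..m}"
  shows "\<exists>N::nat. \<forall>\<^sub>F x in nhds p. x \<notin> D \<longrightarrow> (\<forall>\<xi>. 0 \<le> - levi (\<lambda>x. ln (lg k x)) (V, z) x \<xi> + real N * nsum \<xi>)"
proof -
  obtain N :: nat where N: "\<forall>\<^sub>F x in nhds p. x \<notin> D \<longrightarrow> (\<forall>a b. norm (cj2 (in_coords (V, z) (lg k)) (z x) a b) \<le> real N)"
    using lg_near_cj2[OF ad p k] by (elim exE)
  have "\<forall>\<^sub>F x in nhds p. x \<notin> D \<longrightarrow> (\<forall>\<xi>. 0 \<le> - levi (\<lambda>x. ln (lg k x)) (V, z) x \<xi> + real (CARD('n) * N) * nsum \<xi>)"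
    using N eventually_in_chart[OF ad p]
  proof eventually_elim
    case (elim x)
    show ?case
    proof (intro impI allI)
      fix \<xi> assume x: "x \<notin> D"
      have "norm (cj2 (in_coords (V, z) (lg k)) (z x) a b) \<le> real N" for a b using elim(1) x by blast
      from levi_ln_lg_lower_gen[OF adapted_holo[OF ad] elim(2) x k this, of \<xi>]
      show "0 \<le> - levi (\<lambda>x. ln (lg k x)) (V, z) x \<xi> + real (CARD('n) * N) * nsum \<xi>"
        by (rule order_trans[rotated]) simp
    qed
  qed
  then show ?thesis by (rule exI)
qed

text \<open>The derivative of the log norm is \<open>- dz_i / z_i\<close> plus a bounded form, so
  the square in the Levi form controls \<open>|\<xi>_i / z_i|^2\<close> up to Euclidean terms. The
  log norm is at most a multiple of \<open>log 1/|z_i|\<close>, so the denominator can be changed to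
  the one of the Poincare metric.\<close>

lemma levi_ln_lg_coord:
  fixes z :: "'a \<Rightarrow> complex^'n"
  assumes ad: "adapted_chart \<A> D (V, z) M" and p: "p \<in> V" and i: "i \<in> M" "z p $ i = 0"
  shows "\<exists>k\<in>{1..m}. \<exists>N::nat. \<forall>\<^sub>F x in nhds p. x \<notin> D \<longrightarrow> (\<forall>\<xi>. (norm (\<xi> $ i) / norm (log_frame M (z x) i))\<^sup>2
     \<le> real N * (- levi (\<lambda>x. ln (lg k x)) (V, z) x \<xi> + real N * nsum \<xi>))"
proof -
  obtain k W0 where k: "k \<in> {1..m}" and W0: "open W0" "p \<in> W0" "W0 \<subseteq> V" "\<forall>x\<in>W0. x \<in> Dc k \<longleftrightarrow> z x $ i = 0"
    using adapted_germs(2)[OF ad p i] by blast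
  obtain N :: nat where N: "\<forall>\<^sub>F x in nhds p. x \<notin> Dc k \<longrightarrow> z x $ i \<noteq> 0 \<and> \<bar>lg k x - 2 * ln (1 / norm (z x $ i))\<bar> \<le> real N
       \<and> (\<forall>j. norm (cj1 (in_coords (V, z) (lg k)) (z x) j + (if j = i then 1 / z x $ i else 0)) \<le> real N)
       \<and> (\<forall>a b. norm (cj2 (in_coords (V, z) (lg k)) (z x) a b) \<le> real N)"
    using lg_near_on[OF ad p k W0] by (elim exE)
  define n where "n = CARD('n)"
  \<comment> \<open>The same \<open>B\<close> serves as outer factor and as Euclidean coefficient.
    Its summands cover the error \<open>n * N\<close> of the Levi bound, the square of the bounded
    part of the derivative, and the factor \<open>2 * (N + 2)^2\<close> from the comparison of the
    log norm with the logarithm.\<close>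
  define B where "B = 2 * (N + 2)^2 * (n * N) + 2 * (n * N^2) + 2 * (N + 2)^2"
  have "\<forall>\<^sub>F x in nhds p. x \<notin> D \<longrightarrow> (\<forall>\<xi>. (norm (\<xi> $ i) / norm (log_frame M (z x) i))\<^sup>2
     \<le> real B * (- levi (\<lambda>x. ln (lg k x)) (V, z) x \<xi> + real B * nsum \<xi>))"
    using N eventually_in_chart[OF ad p]
  proof eventually_elim
    case (elim x)
    show ?case
    proof (intro impI allI)
      fix \<xi> :: "complex^'n" assume x: "x \<notin> D"
      have xk: "x \<notin> Dc k" by (rule notin_D[OF x k])
      have g: "lg k x \<ge> 1" by (rule lg_ge_1[OF k xk])
      let ?c = "cj1 (in_coords (V, z) (lg k)) (z x)"
      let ?l = "ln (1 / norm (z x $ i))" and ?d = "\<lambda>j. if j = i then 1 / z x $ i else 0"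
      let ?lv = "- levi (\<lambda>x. ln (lg k x)) (V, z) x \<xi>"
      have E: "z x $ i \<noteq> 0" "\<bar>lg k x - 2 * ?l\<bar> \<le> real N" "\<And>j. norm (?c j + ?d j) \<le> real N"
        "\<And>a b. norm (cj2 (in_coords (V, z) (lg k)) (z x) a b) \<le> real N"
        using elim(1) xk by blast+
      have l: "?l > 1" by (rule norm_log_frame(4)[OF adapted_props[OF ad elim(2) x] i(1)])
      \<comment> \<open>\<open>a\<close> is the modulus of the derivative of the log norm on \<xi>;
        \<open>b\<close> is what is left of it once the pole \<open>- \<xi>_i / z_i\<close> has been
        removed.\<close>
      define a where "a = norm (\<Sum>j\<in>UNIV. ?c j * \<xi> $ j)"
      define b where "b = norm (\<Sum>j\<in>UNIV. (?c j + ?d j) * \<xi> $ j)"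
      have sum: "(\<Sum>j\<in>UNIV. (?c j + ?d j) * \<xi> $ j) = (\<Sum>j\<in>UNIV. ?c j * \<xi> $ j) + \<xi> $ i / z x $ i"
      proof -
        have "(\<Sum>j\<in>UNIV. ?d j * \<xi> $ j) = (\<Sum>j\<in>UNIV. if j = i then \<xi> $ i / z x $ i else 0)"
          by (rule sum.cong) auto
        then show ?thesis by (simp add: distrib_right sum.distrib)
      qed
      have low: "a\<^sup>2 / (lg k x)\<^sup>2 \<le> ?lv + real (n * N) * nsum \<xi>"
        unfolding a_def n_def by (rule levi_ln_lg_lower_gen[OF adapted_holo[OF ad] elim(2) x k E(4)])
      have b2: "b\<^sup>2 \<le> real (n * N^2) * nsum \<xi>"
        unfolding b_def n_def using linear_form_sq_bound[of "\<lambda>j. ?c j + ?d j" "real N" \<xi>] E(3) by simp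
      have "norm (\<xi> $ i / z x $ i) \<le> a + b"
      proof -
        have "\<xi> $ i / z x $ i = (\<Sum>j\<in>UNIV. (?c j + ?d j) * \<xi> $ j) - (\<Sum>j\<in>UNIV. ?c j * \<xi> $ j)" unfolding sum by simp
        then show ?thesis unfolding a_def b_def using norm_triangle_ineq4[of "\<Sum>j\<in>UNIV. (?c j + ?d j) * \<xi> $ j" "\<Sum>j\<in>UNIV. ?c j * \<xi> $ j"] by simp
      qed
      then have "(norm (\<xi> $ i / z x $ i))\<^sup>2 \<le> (a + b)\<^sup>2" by (intro power_mono) auto
      also have "\<dots> \<le> 2 * a\<^sup>2 + 2 * b\<^sup>2"
      proof -
        have "0 \<le> (a - b)\<^sup>2" by simp
        then show ?thesis by (simp add: power2_sum power2_diff)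
      qed
      finally have ab: "(norm (\<xi> $ i / z x $ i))\<^sup>2 \<le> 2 * a\<^sup>2 + 2 * b\<^sup>2" .
      have "norm (log_frame M (z x) i) = norm (z x $ i) * ?l"
        by (rule norm_log_frame(3)[OF adapted_props[OF ad elim(2) x] i(1)])
      then have "(norm (\<xi> $ i) / norm (log_frame M (z x) i))\<^sup>2 = (norm (\<xi> $ i / z x $ i))\<^sup>2 / ?l\<^sup>2"
        by (simp add: norm_divide power_divide power_mult_distrib)
      also have "\<dots> \<le> (2 * a\<^sup>2 + 2 * b\<^sup>2) / ?l\<^sup>2" by (rule divide_right_mono[OF ab]) simp
      also have "\<dots> = 2 * (a\<^sup>2 / ?l\<^sup>2) + 2 * (b\<^sup>2 / ?l\<^sup>2)" by (simp add: add_divide_distrib)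
      \<comment> \<open>The log norm is at most \<open>2 * ?l + N\<close> with
        \<open>?l > 1\<close>, hence at most \<open>(N + 2) * ?l\<close>, which allows the exchange
        of denominators.\<close>
      also have "\<dots> \<le> 2 * (real ((N + 2)^2) * (a\<^sup>2 / (lg k x)\<^sup>2)) + 2 * b\<^sup>2"
      proof (intro add_mono mult_left_mono)
        have "real N * 1 \<le> real N * ?l" using l by (intro mult_left_mono) auto
        then have "lg k x \<le> real (N + 2) * ?l" using E(2) by (simp add: distrib_right abs_le_iff)
        then have "(lg k x)\<^sup>2 \<le> (real (N + 2) * ?l)\<^sup>2" using g by (intro power_mono) auto
        then have "a\<^sup>2 * (lg k x)\<^sup>2 \<le> a\<^sup>2 * (real (N + 2) * ?l)\<^sup>2" by (rule mult_left_mono) simp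
        then show "a\<^sup>2 / ?l\<^sup>2 \<le> real ((N + 2)^2) * (a\<^sup>2 / (lg k x)\<^sup>2)"
          using l g by (simp add: power_mult_distrib pos_divide_le_eq pos_le_divide_eq mult_ac)
        have "1 \<le> ?l\<^sup>2" using l by (simp add: one_le_power)
        then have "b\<^sup>2 / ?l\<^sup>2 \<le> b\<^sup>2 / 1" by (intro divide_left_mono) auto
        then show "b\<^sup>2 / ?l\<^sup>2 \<le> b\<^sup>2" by simp
      qed simp_all
      also have "\<dots> \<le> 2 * (real ((N + 2)^2) * (?lv + real (n * N) * nsum \<xi>)) + 2 * (real (n * N^2) * nsum \<xi>)"
        by (intro add_mono mult_left_mono low b2) simp_all
      also have "\<dots> \<le> real B * (?lv + real B * nsum \<xi>)"
      proof -
        define y where "y = ?lv + real (n * N) * nsum \<xi>"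
        have y0: "0 \<le> y" unfolding y_def by (rule order_trans[OF _ low]) simp
        have BB: "2 * real ((N + 2)^2) \<le> real B" "1 \<le> real B" "real (n * N) + real (2 * (n * N^2)) \<le> real B"
        proof -
          have q: "4 \<le> (N + 2)^2" by (simp add: power2_eq_square)
          then have "n * N \<le> 2 * (N + 2)^2 * (n * N)" by simp
          then have "n * N + 2 * (n * N^2) \<le> B" unfolding B_def by linarith
          then show "real (n * N) + real (2 * (n * N^2)) \<le> real B" by (simp only: of_nat_add[symmetric] of_nat_le_iff)
          have "2 * (N + 2)^2 \<le> B" unfolding B_def by linarith
          then show "2 * real ((N + 2)^2) \<le> real B" by (metis of_nat_le_iff of_nat_mult of_nat_numeral)
          have "1 \<le> B" using q unfolding B_def by linarith
          then show "1 \<le> real B" by simp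
        qed
        have "2 * (real ((N + 2)^2) * y) \<le> real B * y" using mult_right_mono[OF BB(1) y0] by simp
        moreover have "2 * (real (n * N^2) * nsum \<xi>) \<le> real B * (2 * (real (n * N^2) * nsum \<xi>))"
          using mult_right_mono[OF BB(2), of "2 * (real (n * N^2) * nsum \<xi>)"] nsum_nonneg[of \<xi>] by simp
        moreover have "real B * (y + 2 * (real (n * N^2) * nsum \<xi>)) \<le> real B * (?lv + real B * nsum \<xi>)"
        proof (rule mult_left_mono)
          have "(real (n * N) + real (2 * (n * N^2))) * nsum \<xi> \<le> real B * nsum \<xi>"
            by (rule mult_right_mono[OF BB(3) nsum_nonneg])
          then show "y + 2 * (real (n * N^2) * nsum \<xi>) \<le> ?lv + real B * nsum \<xi>"
            unfolding y_def by (simp add: distrib_right)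
        qed simp
        ultimately show ?thesis unfolding y_def[symmetric] by (simp add: distrib_left)
      qed
      finally show "(norm (\<xi> $ i) / norm (log_frame M (z x) i))\<^sup>2 \<le> real B * (?lv + real B * nsum \<xi>)" .
    qed
  qed
  then show ?thesis using k by blast
qed

text \<open>Away from its hyperplane the frame function is bounded below, so this coordinate of the
  Poincare metric is only Euclidean.\<close>

lemma log_frame_off:
  fixes z :: "'a \<Rightarrow> complex^'n"
  assumes ad: "adapted_chart \<A> D (V, z) M" and p: "p \<in> V" and i: "\<not> (i \<in> M \<and> z p $ i = 0)"
  shows "\<exists>N::nat. \<forall>\<^sub>F x in nhds p. x \<notin> D \<longrightarrow> (\<forall>\<xi>. (norm (\<xi> $ i) / norm (log_frame M (z x) i))\<^sup>2 \<le> real N * nsum \<xi>)"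
proof (cases "i \<in> M")
  case False
  have "\<forall>\<^sub>F x in nhds p. x \<notin> D \<longrightarrow> (\<forall>\<xi>. (norm (\<xi> $ i) / norm (log_frame M (z x) i))\<^sup>2 \<le> real 1 * nsum \<xi>)"
    by (rule always_eventually) (simp add: log_frame_def False le_nsum)
  then show ?thesis by (rule exI)
next
  case True
  note c = adapted_holo[OF ad]
  have nz: "norm (z p $ i) > 0" using i True by simp
  define r where "r = norm (z p $ i) / 2"
  have r: "0 < r" "r < norm (z p $ i)" using nz by (simp_all add: r_def)
  obtain N :: nat where N: "1 / r\<^sup>2 \<le> real N" using real_arch_simple by blast
  have "isCont (\<lambda>x. norm (z x $ i)) p"
    using chart_props(1,4)[OF c] p by (intro continuous_intros) (simp add: continuous_on_eq_continuous_at)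
  then have "((\<lambda>x. norm (z x $ i)) \<longlongrightarrow> norm (z p $ i)) (at p)" by (simp add: isCont_def)
  then have "\<forall>\<^sub>F x in at p. r < norm (z x $ i)" using r(2) by (rule order_tendstoD(1))
  then have "\<forall>\<^sub>F x in nhds p. r < norm (z x $ i)" using r(2) by (simp add: eventually_nhds_conv_at)
  with eventually_in_chart[OF ad p]
  have "\<forall>\<^sub>F x in nhds p. x \<notin> D \<longrightarrow> (\<forall>\<xi>. (norm (\<xi> $ i) / norm (log_frame M (z x) i))\<^sup>2 \<le> real N * nsum \<xi>)"
  proof eventually_elim
    case (elim x)
    show ?case
    proof (intro impI allI)
      fix \<xi> :: "complex^'n" assume x: "x \<notin> D"
      have l: "ln (1 / norm (z x $ i)) > 1" by (rule norm_log_frame(4)[OF adapted_props[OF ad elim(1) x] True])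
      have "r * 1 \<le> norm (z x $ i) * ln (1 / norm (z x $ i))" using elim(2) l r by (intro mult_mono) auto
      then have f: "r \<le> norm (log_frame M (z x) i)"
        using norm_log_frame(3)[OF adapted_props[OF ad elim(1) x] True] by simp
      have "norm (\<xi> $ i) / norm (log_frame M (z x) i) \<le> norm (\<xi> $ i) / r" using f r(1) by (intro divide_left_mono mult_pos_pos) auto
      then have "(norm (\<xi> $ i) / norm (log_frame M (z x) i))\<^sup>2 \<le> (norm (\<xi> $ i) / r)\<^sup>2" by (intro power_mono) auto
      also have "\<dots> = (1 / r\<^sup>2) * (norm (\<xi> $ i))\<^sup>2" by (simp add: power_divide)
      also have "\<dots> \<le> real N * nsum \<xi>" by (intro mult_mono N le_nsum) auto
      finally show "(norm (\<xi> $ i) / norm (log_frame M (z x) i))\<^sup>2 \<le> real N * nsum \<xi>" .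
    qed
  qed
  then show ?thesis by (rule exI)
qed

text \<open>Direction by direction: if \<open>z_i\<close> belongs to \<open>M\<close> and vanishes
  at \<open>p\<close>, one component supplies the Poincare length of \<open>\<xi>_i\<close> and the
  others are nonnegative up to Euclidean errors; in all other directions the Euclidean term alone
  suffices. A single constant then serves the finitely many directions.\<close>

lemma levi_neg_\<Theta>1_lower:
  fixes z :: "'a \<Rightarrow> complex^'n"
  assumes ad: "adapted_chart \<A> D (V, z) M" and p: "p \<in> V"
  shows "\<exists>N::nat. \<forall>\<^sub>F x in nhds p. x \<notin> D \<longrightarrow> (\<forall>\<xi>. 0 \<le> levi (\<lambda>x. - \<Theta>1 x) (V, z) x \<xi> + real N * nsum \<xi>
    \<and> pq M (z x) \<xi> \<le> real N * (levi (\<lambda>x. - \<Theta>1 x) (V, z) x \<xi> + real N * nsum \<xi>))"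
proof -
  let ?L = "\<lambda>k x \<xi>. - levi (\<lambda>x. ln (lg k x)) (V, z) x \<xi>"
  let ?T = "\<lambda>x \<xi>. levi (\<lambda>x. - \<Theta>1 x) (V, z) x \<xi>"
  have "\<exists>N::nat. \<forall>\<^sub>F x in nhds p. \<forall>k\<in>{1..m}. x \<notin> D \<longrightarrow> (\<forall>\<xi>. 0 \<le> ?L k x \<xi> + real N * nsum \<xi>)"
  proof (rule eventually_finite_nat)
    show "\<exists>N::nat. \<forall>\<^sub>F x in nhds p. x \<notin> D \<longrightarrow> (\<forall>\<xi>. 0 \<le> ?L k x \<xi> + real N * nsum \<xi>)" if "k \<in> {1..m}" for k
      by (rule levi_ln_lg_lower[OF ad p that])
    fix k N N' x
    assume le: "N \<le> N'" and *: "x \<notin> D \<longrightarrow> (\<forall>\<xi>. 0 \<le> ?L k x \<xi> + real N * nsum \<xi>)"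
    show "x \<notin> D \<longrightarrow> (\<forall>\<xi>. 0 \<le> ?L k x \<xi> + real N' * nsum \<xi>)"
    proof (intro impI allI)
      fix \<xi> assume "x \<notin> D"
      then have "0 \<le> ?L k x \<xi> + real N * nsum \<xi>" using * by blast
      moreover have "real N * nsum \<xi> \<le> real N' * nsum \<xi>" using le by (intro mult_right_mono nsum_nonneg) simp
      ultimately show "0 \<le> ?L k x \<xi> + real N' * nsum \<xi>" by linarith
    qed
  qed simp
  then obtain N1 :: nat where N1: "\<forall>\<^sub>F x in nhds p. \<forall>k\<in>{1..m}. x \<notin> D \<longrightarrow> (\<forall>\<xi>. 0 \<le> ?L k x \<xi> + real N1 * nsum \<xi>)" by (elim exE)
  have Tsum: "?T x \<xi> + real (m * N) * nsum \<xi> = (\<Sum>k=1..m. ?L k x \<xi> + real N * nsum \<xi>)" if "x \<in> V" "x \<notin> D" for x \<xi> N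
    unfolding levi_neg_\<Theta>1[OF adapted_holo[OF ad] that] sum.distrib by simp
  \<comment> \<open>Once each summand is made nonnegative by its Euclidean correction, any single
    summand is at most the total.\<close>
  have low: "0 \<le> ?T x \<xi> + real N * nsum \<xi> \<and> (\<forall>k\<in>{1..m}. ?L k x \<xi> + real N1 * nsum \<xi> \<le> ?T x \<xi> + real N * nsum \<xi>)"
    if x: "x \<in> V" "x \<notin> D" and L: "\<forall>k\<in>{1..m}. 0 \<le> ?L k x \<xi> + real N1 * nsum \<xi>" and N: "m * N1 \<le> N" for x \<xi> N
  proof -
    have "real (m * N1) * nsum \<xi> \<le> real N * nsum \<xi>" using N by (intro mult_right_mono nsum_nonneg) (simp only: of_nat_le_iff)
    moreover have "0 \<le> (\<Sum>k=1..m. ?L k x \<xi> + real N1 * nsum \<xi>)" by (rule sum_nonneg) (use L in blast)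
    moreover have "?L k x \<xi> + real N1 * nsum \<xi> \<le> (\<Sum>k=1..m. ?L k x \<xi> + real N1 * nsum \<xi>)" if "k \<in> {1..m}" for k
      by (rule member_le_sum[OF that]) (use L in auto)
    ultimately show ?thesis unfolding Tsum[OF x, symmetric] by (meson add_left_mono order_trans)
  qed
  have "\<exists>N::nat. \<forall>\<^sub>F x in nhds p. \<forall>i\<in>UNIV. x \<notin> D \<longrightarrow> (\<forall>\<xi>. 0 \<le> ?T x \<xi> + real N * nsum \<xi>
      \<and> (norm (\<xi> $ i) / norm (log_frame M (z x) i))\<^sup>2 \<le> real N * (?T x \<xi> + real N * nsum \<xi>))"
  proof (rule eventually_finite_nat)
    fix i :: 'n
    show "\<exists>N::nat. \<forall>\<^sub>F x in nhds p. x \<notin> D \<longrightarrow> (\<forall>\<xi>. 0 \<le> ?T x \<xi> + real N * nsum \<xi>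
      \<and> (norm (\<xi> $ i) / norm (log_frame M (z x) i))\<^sup>2 \<le> real N * (?T x \<xi> + real N * nsum \<xi>))"
    proof (cases "i \<in> M \<and> z p $ i = 0")
      case True
      then obtain k and N2 :: nat where k: "k \<in> {1..m}" and N2: "\<forall>\<^sub>F x in nhds p. x \<notin> D \<longrightarrow> (\<forall>\<xi>. (norm (\<xi> $ i) / norm (log_frame M (z x) i))\<^sup>2
          \<le> real N2 * (?L k x \<xi> + real N2 * nsum \<xi>))"
        using levi_ln_lg_coord[OF ad p, of i] by blast
      define N where "N = m * N1 + N2"
      have "\<forall>\<^sub>F x in nhds p. x \<notin> D \<longrightarrow> (\<forall>\<xi>. 0 \<le> ?T x \<xi> + real N * nsum \<xi>
        \<and> (norm (\<xi> $ i) / norm (log_frame M (z x) i))\<^sup>2 \<le> real N * (?T x \<xi> + real N * nsum \<xi>))"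
        using N1 N2 eventually_in_chart[OF ad p]
      proof eventually_elim
        case (elim x)
        show ?case
        proof (intro impI allI)
          fix \<xi> :: "complex^'n" assume x: "x \<notin> D"
          have L: "\<forall>k\<in>{1..m}. 0 \<le> ?L k x \<xi> + real N1 * nsum \<xi>" using elim(1) x by blast
          have l: "0 \<le> ?T x \<xi> + real (m * N1) * nsum \<xi>" "?L k x \<xi> + real N1 * nsum \<xi> \<le> ?T x \<xi> + real (m * N1) * nsum \<xi>"
            using low[OF elim(3) x L order_refl] k by blast+
          have s: "0 \<le> real N1 * nsum \<xi>" "0 \<le> real N2 * nsum \<xi>" using nsum_nonneg[of \<xi>] by simp_all
          have N: "real N * nsum \<xi> = real (m * N1) * nsum \<xi> + real N2 * nsum \<xi>" by (simp add: N_def distrib_right)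
          have 1: "0 \<le> ?T x \<xi> + real N * nsum \<xi>" unfolding N using l(1) s by linarith
          have "(norm (\<xi> $ i) / norm (log_frame M (z x) i))\<^sup>2 \<le> real N2 * (?L k x \<xi> + real N2 * nsum \<xi>)" using elim(2) x by blast
          also have "\<dots> \<le> real N2 * (?T x \<xi> + real N * nsum \<xi>)"
            by (rule mult_left_mono) (use l(2) s N in linarith, simp)
          also have "\<dots> \<le> real N * (?T x \<xi> + real N * nsum \<xi>)"
            by (rule mult_right_mono[OF _ 1]) (simp add: N_def)
          finally show "0 \<le> ?T x \<xi> + real N * nsum \<xi> \<and> (norm (\<xi> $ i) / norm (log_frame M (z x) i))\<^sup>2 \<le> real N * (?T x \<xi> + real N * nsum \<xi>)"
            using 1 by blast
        qed
      qed
      then show ?thesis by (rule exI)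
    next
      case False
      obtain N2 :: nat where N2: "\<forall>\<^sub>F x in nhds p. x \<notin> D \<longrightarrow> (\<forall>\<xi>. (norm (\<xi> $ i) / norm (log_frame M (z x) i))\<^sup>2 \<le> real N2 * nsum \<xi>)"
        using log_frame_off[OF ad p False] by (elim exE)
      \<comment> \<open>The final 1 leaves a full Euclidean length on the right-hand side, which
        dominates the Euclidean bound of this direction.\<close>
      define N where "N = m * N1 + N2 + 1"
      have "\<forall>\<^sub>F x in nhds p. x \<notin> D \<longrightarrow> (\<forall>\<xi>. 0 \<le> ?T x \<xi> + real N * nsum \<xi>
        \<and> (norm (\<xi> $ i) / norm (log_frame M (z x) i))\<^sup>2 \<le> real N * (?T x \<xi> + real N * nsum \<xi>))"
        using N1 N2 eventually_in_chart[OF ad p]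
      proof eventually_elim
        case (elim x)
        show ?case
        proof (intro impI allI)
          fix \<xi> :: "complex^'n" assume x: "x \<notin> D"
          have L: "\<forall>k\<in>{1..m}. 0 \<le> ?L k x \<xi> + real N1 * nsum \<xi>" using elim(1) x by blast
          have l: "0 \<le> ?T x \<xi> + real (m * N1) * nsum \<xi>" using low[OF elim(3) x L order_refl] by blast
          have s: "0 \<le> nsum \<xi>" "0 \<le> real N2 * nsum \<xi>" using nsum_nonneg[of \<xi>] by simp_all
          have N: "real N * nsum \<xi> = real (m * N1) * nsum \<xi> + real N2 * nsum \<xi> + nsum \<xi>" by (simp add: N_def distrib_right)
          have 1: "nsum \<xi> \<le> ?T x \<xi> + real N * nsum \<xi>" unfolding N using l s by linarith
          have "(norm (\<xi> $ i) / norm (log_frame M (z x) i))\<^sup>2 \<le> real N2 * nsum \<xi>" using elim(2) x by blast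
          also have "\<dots> \<le> real N * (?T x \<xi> + real N * nsum \<xi>)"
            by (rule mult_mono[OF _ 1]) (use s in \<open>simp_all add: N_def\<close>)
          finally show "0 \<le> ?T x \<xi> + real N * nsum \<xi> \<and> (norm (\<xi> $ i) / norm (log_frame M (z x) i))\<^sup>2 \<le> real N * (?T x \<xi> + real N * nsum \<xi>)"
            using 1 s by linarith
        qed
      qed
      then show ?thesis by (rule exI)
    qed
  next
    fix i :: 'n and N N' x
    assume le: "N \<le> N'" and *: "x \<notin> D \<longrightarrow> (\<forall>\<xi>. 0 \<le> ?T x \<xi> + real N * nsum \<xi>
      \<and> (norm (\<xi> $ i) / norm (log_frame M (z x) i))\<^sup>2 \<le> real N * (?T x \<xi> + real N * nsum \<xi>))"
    show "x \<notin> D \<longrightarrow> (\<forall>\<xi>. 0 \<le> ?T x \<xi> + real N' * nsum \<xi>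
      \<and> (norm (\<xi> $ i) / norm (log_frame M (z x) i))\<^sup>2 \<le> real N' * (?T x \<xi> + real N' * nsum \<xi>))"
    proof (intro impI allI)
      fix \<xi> :: "complex^'n" assume "x \<notin> D"
      then have 1: "0 \<le> ?T x \<xi> + real N * nsum \<xi>" "(norm (\<xi> $ i) / norm (log_frame M (z x) i))\<^sup>2 \<le> real N * (?T x \<xi> + real N * nsum \<xi>)"
        using * by blast+
      have "real N * nsum \<xi> \<le> real N' * nsum \<xi>" using le by (intro mult_right_mono nsum_nonneg) simp
      then have 2: "?T x \<xi> + real N * nsum \<xi> \<le> ?T x \<xi> + real N' * nsum \<xi>" by linarith
      have "real N * (?T x \<xi> + real N * nsum \<xi>) \<le> real N' * (?T x \<xi> + real N' * nsum \<xi>)"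
        by (rule mult_mono[OF _ 2 _ 1(1)]) (use le in simp_all)
      then show "0 \<le> ?T x \<xi> + real N' * nsum \<xi> \<and> (norm (\<xi> $ i) / norm (log_frame M (z x) i))\<^sup>2 \<le> real N' * (?T x \<xi> + real N' * nsum \<xi>)"
        using 1 2 by linarith
    qed
  qed simp
  then obtain N :: nat where N: "\<forall>\<^sub>F x in nhds p. \<forall>i\<in>UNIV. x \<notin> D \<longrightarrow> (\<forall>\<xi>. 0 \<le> ?T x \<xi> + real N * nsum \<xi>
      \<and> (norm (\<xi> $ i) / norm (log_frame M (z x) i))\<^sup>2 \<le> real N * (?T x \<xi> + real N * nsum \<xi>))" by (elim exE)
  \<comment> \<open>Summing the coordinates multiplies the constant by \<open>n\<close>; enlarging
    it also inside the bracket is harmless because \<open>1 \<le> n\<close>.\<close>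
  define n where "n = CARD('n)"
  have n1: "1 \<le> n" unfolding n_def by (simp add: Suc_leI)
  have "\<forall>\<^sub>F x in nhds p. x \<notin> D \<longrightarrow> (\<forall>\<xi>. 0 \<le> ?T x \<xi> + real (n * N) * nsum \<xi>
    \<and> pq M (z x) \<xi> \<le> real (n * N) * (?T x \<xi> + real (n * N) * nsum \<xi>))"
    using N
  proof eventually_elim
    case (elim x)
    show ?case
    proof (intro impI allI)
      fix \<xi> :: "complex^'n" assume x: "x \<notin> D"
      have 1: "0 \<le> ?T x \<xi> + real N * nsum \<xi>" "\<And>i. (norm (\<xi> $ i) / norm (log_frame M (z x) i))\<^sup>2 \<le> real N * (?T x \<xi> + real N * nsum \<xi>)"
        using elim x by blast+
      have "N \<le> n * N" using mult_le_mono1[OF n1, of N] by simp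
      then have "real N * nsum \<xi> \<le> real (n * N) * nsum \<xi>" by (intro mult_right_mono nsum_nonneg) (simp only: of_nat_le_iff)
      then have 2: "?T x \<xi> + real N * nsum \<xi> \<le> ?T x \<xi> + real (n * N) * nsum \<xi>" by linarith
      have "pq M (z x) \<xi> \<le> real (card (UNIV :: 'n set)) * (real N * (?T x \<xi> + real N * nsum \<xi>))"
        unfolding pq_def by (rule sum_bounded_above) (rule 1(2))
      also have "\<dots> = real (n * N) * (?T x \<xi> + real N * nsum \<xi>)" by (simp add: n_def)
      also have "\<dots> \<le> real (n * N) * (?T x \<xi> + real (n * N) * nsum \<xi>)" by (rule mult_left_mono[OF 2]) simp
      finally show "0 \<le> ?T x \<xi> + real (n * N) * nsum \<xi> \<and> pq M (z x) \<xi> \<le> real (n * N) * (?T x \<xi> + real (n * N) * nsum \<xi>)"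
        using 1(1) 2 by linarith
    qed
  qed
  then show ?thesis by (rule exI)
qed

end

section \<open>Size of functions near the divisor\<close>

lemma herm_value_scale_vec: "herm_value a (r *\<^sub>R \<xi>) = of_real (r\<^sup>2) * herm_value a \<xi>"
  unfolding herm_value_def sum_distrib_left
  by (intro sum.cong refl) (simp add: scaleR_conv_of_real[where 'a=complex] power2_eq_square mult_ac)

lemma herm_value_zero: "herm_value a 0 = 0"
  by (simp add: herm_value_def)

context snc_pair
begin

text \<open>An snc chart at \<open>p\<close> is translated to the origin and cut down to coordinates
  below \<open>1/e\<close>. Only the components through \<open>p\<close> contribute to
  \<open>M\<close>. The centring serves the radial estimate, which moves points inside a polydisc
  about the origin.\<close>

lemma centered_adapted_chart:
  obtains V z M where "adapted_chart \<A> D (V, z) M" "p \<in> V" "z p = 0"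
proof -
  obtain V0 w \<iota> where c0: "(V0, w) \<in> holo_charts \<A>" and p0: "p \<in> V0"
    and D1: "\<And>k. k \<in> {1..m} \<Longrightarrow> p \<in> Dc k \<Longrightarrow> Dc k \<inter> V0 = {x\<in>V0. w x $ \<iota> k = 0}"
    and D0: "\<And>k. k \<in> {1..m} \<Longrightarrow> p \<notin> Dc k \<Longrightarrow> Dc k \<inter> V0 = {}"
    by (rule snc_chart[of p]) blast
  define z where "z = (\<lambda>x. w x - w p)"
  have c1: "(V0, z) \<in> holo_charts \<A>" unfolding z_def by (rule holo_charts_translate[OF c0 atlas])
  define V where "V = V0 \<inter> z -` ball 0 (1 / exp 1)"
  have oV: "open V" unfolding V_def by (rule open_chart_preimage[OF c1 open_ball])
  have c: "(V, z) \<in> holo_charts \<A>" by (rule holo_charts_restrict[OF c1 atlas oV]) (simp add: V_def)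
  have zp: "z p = 0" by (simp add: z_def)
  have pV: "p \<in> V" using p0 zp by (simp add: V_def)
  define M where "M = \<iota> ` {k\<in>{1..m}. p \<in> Dc k}"
  have z\<iota>: "z x $ \<iota> k = w x $ \<iota> k" if "k \<in> {1..m}" "p \<in> Dc k" for x k
  proof -
    have "p \<in> Dc k \<inter> V0" using that p0 by blast
    then have "w p $ \<iota> k = 0" unfolding D1[OF that] by blast
    then show ?thesis by (simp add: z_def)
  qed
  have "D \<inter> V = {x\<in>V. \<exists>i\<in>M. z x $ i = 0}"
  proof (intro equalityI subsetI)
    fix x assume x: "x \<in> D \<inter> V"
    then obtain k where k: "k \<in> {1..m}" "x \<in> Dc k" unfolding D_eq by blast
    have xV0: "x \<in> V0" using x by (simp add: V_def)
    have pk: "p \<in> Dc k" using D0[OF k(1)] k(2) xV0 by blast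
    have "x \<in> Dc k \<inter> V0" using k xV0 by blast
    then have "z x $ \<iota> k = 0" unfolding D1[OF k(1) pk] z\<iota>[OF k(1) pk] by blast
    moreover have "\<iota> k \<in> M" unfolding M_def using k(1) pk by blast
    ultimately show "x \<in> {x\<in>V. \<exists>i\<in>M. z x $ i = 0}" using x by blast
  next
    fix x assume "x \<in> {x\<in>V. \<exists>i\<in>M. z x $ i = 0}"
    then obtain k where x: "x \<in> V" and k: "k \<in> {1..m}" "p \<in> Dc k" and zk: "z x $ \<iota> k = 0" unfolding M_def by blast
    have "x \<in> {x\<in>V0. w x $ \<iota> k = 0}" using x zk z\<iota>[OF k] by (simp add: V_def)
    then have "x \<in> Dc k" unfolding D1[OF k, symmetric] by blast
    then show "x \<in> D \<inter> V" using x k(1) unfolding D_eq by blast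
  qed
  moreover have "norm (z x $ i) < 1 / exp 1" if "x \<in> V" for x i
  proof -
    have "norm (z x) < 1 / exp 1" using that by (simp add: V_def)
    then show ?thesis using Finite_Cartesian_Product.norm_nth_le[of "z x" i] by linarith
  qed
  ultimately have "adapted_chart \<A> D (V, z) M" using c by (simp add: adapted_chart_def)
  then show ?thesis using pV zp by (rule that)
qed

text \<open>For real \<open>F\<close> the differential is twice the real part of its (1,0)
  part.\<close>

lemma abs_derivative_le_jets:
  assumes "F differentiable at p"
  shows "\<bar>frechet_derivative F (at p) v\<bar> \<le> (\<Sum>k\<in>UNIV. 2 * (norm (cj1 F p k) * norm (v $ k)))"
proof -
  have d: "(\<lambda>y. complex_of_real (F y)) differentiable at p" by (rule differentiable_of_real[OF assms])
  have "frechet_derivative (\<lambda>y. complex_of_real (F y)) (at p) v = complex_of_real (frechet_derivative F (at p) v)"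
    by (rule frechet_derivativeI[OF bounded_linear.has_derivative[OF bounded_linear_of_real differentiable_frechet[OF assms]]])
  then have "complex_of_real (frechet_derivative F (at p) v) = (\<Sum>k\<in>UNIV. cj1 F p k * v $ k + cnj (cj1 F p k) * cnj (v $ k))"
    unfolding wirt_expand[OF d] wirt_bar_eq_cj1[OF assms] by (simp add: cj1_def)
  then have "\<bar>frechet_derivative F (at p) v\<bar> = norm (\<Sum>k\<in>UNIV. cj1 F p k * v $ k + cnj (cj1 F p k) * cnj (v $ k))"
    by (metis norm_of_real real_norm_def)
  also have "\<dots> \<le> (\<Sum>k\<in>UNIV. 2 * (norm (cj1 F p k) * norm (v $ k)))"
  proof (rule sum_norm_le)
    fix k
    show "norm (cj1 F p k * v $ k + cnj (cj1 F p k) * cnj (v $ k)) \<le> 2 * (norm (cj1 F p k) * norm (v $ k))"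
    proof -
      have "norm (cj1 F p k * v $ k) = norm (cj1 F p k) * norm (v $ k)"
        "norm (cnj (cj1 F p k) * cnj (v $ k)) = norm (cj1 F p k) * norm (v $ k)" by (simp_all add: norm_mult)
      then show ?thesis
        using norm_triangle_ineq[of "cj1 F p k * v $ k" "cnj (cj1 F p k) * cnj (v $ k)"] by linarith
    qed
  qed
  finally show ?thesis .
qed

text \<open>Along the radial path on which \<open>log log 1/\<bar>z\<^sub>i\<bar>\<close> is affine in the parameter, the velocity has constant
  length in the Poincare metric, so a bounded \<open>df\<close> integrates to a \<open>log log\<close> bound for \<open>f\<close>.\<close>

lemma P_singular_near:
  fixes z :: "'a \<Rightarrow> complex^'n"
  assumes f: "P_singular \<A> D f" and ad: "adapted_chart \<A> D (V, z) M" and p: "p \<in> V" and zp: "z p = 0"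
  shows "\<exists>N::nat. \<forall>\<^sub>F x in nhds p. x \<notin> D \<longrightarrow> \<bar>f x\<bar> \<le> real N * \<Theta>1 x"
proof -
  note c = adapted_holo[OF ad] and sf = P_singular_smooth[OF f]
  have DV: "D \<inter> V = {x\<in>V. \<exists>i\<in>M. z x $ i = 0}" using ad by (simp add: adapted_chart_def)
  obtain N0 :: nat where "\<forall>\<^sub>F x in nhds p. x \<notin> D \<longrightarrow> jets_le (V, z) M f x (real N0)"
    using P_singularD[OF f ad p] by (elim exE)
  then obtain S0 where S0: "open S0" "p \<in> S0" "\<forall>x\<in>S0. x \<notin> D \<longrightarrow> jets_le (V, z) M f x (real N0)"
    unfolding eventually_nhds by blast
  define U where "U = S0 \<inter> V"
  have U: "open U" "p \<in> U" "U \<subseteq> V" using S0 chart_props(1)[OF c] p by (auto simp: U_def)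
  have "open (z ` U)" by (rule open_chart_image_subset[OF c U(1,3)])
  moreover have "0 \<in> z ` U" using U(2) zp by (metis image_eqI)
  ultimately obtain e where e: "e > 0" "ball 0 e \<subseteq> z ` U" using open_contains_ball by blast
  define n where "n = real CARD('n)"
  have n: "n > 0" by (simp add: n_def)
  \<comment> \<open>Points of the closed polydisc \<open>P\<close> have norm at most
    \<open>n * r < e\<close>, so \<open>P\<close> stays inside the image of \<open>U\<close>. In
    addition \<open>r < 1 / exp 1\<close>, so that \<open>b = ln (ln (1 / r))\<close> is
    positive.\<close>
  define r where "r = min (1 / (2 * exp 1)) (e / (2 * n))"
  have r0: "r > 0" using e(1) n by (simp add: r_def)
  have r1: "r < 1 / exp 1"
  proof -
    have "r \<le> 1 / (2 * exp 1)" by (simp add: r_def)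
    also have "\<dots> < 1 / exp 1" by (simp add: field_simps)
    finally show ?thesis .
  qed
  have r2: "n * r < e"
  proof -
    have "n * r \<le> n * (e / (2 * n))" using n by (intro mult_left_mono) (simp_all add: r_def)
    also have "\<dots> < e" using n e(1) by simp
    finally show ?thesis .
  qed
  have "exp 1 < 1 / r" using r1 r0 by (simp add: field_simps)
  then have "ln (exp 1) < ln (1 / r)" using r0 by (subst ln_less_cancel_iff) auto
  then have lr: "ln (1 / r) > 1" by simp
  define b where "b = ln (ln (1 / r))"
  have b0: "b > 0" using lr by (simp add: b_def)
  have eb: "exp b = ln (1 / r)" using lr by (simp add: b_def)
  have er: "exp (- ln (1 / r)) = r" using r0 by (simp add: ln_div)
  define P where "P = {y::complex^'n. \<forall>i. norm (y $ i) \<le> r}"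
  have Pball: "P \<subseteq> ball 0 e"
  proof
    fix y assume y: "y \<in> P"
    have "norm y \<le> (\<Sum>i\<in>UNIV. norm (y $ i))" unfolding norm_vec_def by (rule L2_set_le_sum) simp
    also have "\<dots> \<le> real (card (UNIV :: 'n set)) * r" by (rule sum_bounded_above) (use y in \<open>simp add: P_def\<close>)
    finally show "y \<in> ball 0 e" using r2 by (simp add: n_def)
  qed
  have inU: "\<exists>x. x \<in> U \<and> x \<notin> D \<and> y = z x" if "y \<in> P" "\<forall>i\<in>M. y $ i \<noteq> 0" for y
  proof -
    have "y \<in> z ` U" using that(1) Pball e(2) by blast
    then obtain x where x: "y = z x" "x \<in> U" by (rule imageE)
    have "x \<notin> D" using DV U(3) x that(2) by blast
    then show ?thesis using x by blast
  qed
  define F where "F = in_coords (V, z) f"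
  define S where "S = z ` (V \<inter> - D)"
  have oS: "open S" unfolding S_def by (rule open_coords[OF c])
  have sF: "smooth_on S F" unfolding S_def F_def by (rule smooth_coords[OF sf c])
  have dF: "F differentiable at y" if "y \<in> S" for y by (rule smooth_on_differentiable[OF sF that])
  have inS: "y \<in> S" if "y \<in> P" "\<forall>i\<in>M. y $ i \<noteq> 0" for y
    using inU[OF that] U(3) unfolding S_def by blast
  \<comment> \<open>The endpoints of the radial paths: in the coordinates cutting out
    \<open>D\<close> the modulus is exactly \<open>r\<close>. This set is compact and avoids the
    divisor, so \<open>F\<close> is bounded on it.\<close>
  define Kc where "Kc = {y::complex^'n. \<forall>i. norm (y $ i) \<le> r \<and> (i \<in> M \<longrightarrow> norm (y $ i) = r)}"
  have KP: "Kc \<subseteq> P" by (auto simp: Kc_def P_def)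
  have "closed Kc"
  proof -
    have "closed {y::complex^'n. norm (y $ i) \<le> r \<and> (i \<in> M \<longrightarrow> norm (y $ i) = r)}" for i
    proof (cases "i \<in> M")
      case True
      have "{y::complex^'n. norm (y $ i) \<le> r \<and> (i \<in> M \<longrightarrow> norm (y $ i) = r)} = {y. norm (y $ i) = r}" using True by auto
      moreover have "closed {y::complex^'n. norm (y $ i) = r}" by (intro closed_Collect_eq continuous_intros)
      ultimately show ?thesis by simp
    next
      case False
      have "{y::complex^'n. norm (y $ i) \<le> r \<and> (i \<in> M \<longrightarrow> norm (y $ i) = r)} = {y. norm (y $ i) \<le> r}" using False by auto
      moreover have "closed {y::complex^'n. norm (y $ i) \<le> r}" by (intro closed_Collect_le continuous_intros)
      ultimately show ?thesis by simp
    qed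
    then show ?thesis unfolding Kc_def by (rule closed_Collect_all)
  qed
  moreover have "bounded Kc" using KP Pball bounded_subset[OF bounded_ball] by (meson subset_trans)
  ultimately have cK: "compact Kc" by (simp add: compact_eq_bounded_closed)
  have KS: "Kc \<subseteq> S"
  proof
    fix y assume y: "y \<in> Kc"
    have "norm (y $ i) = r" if "i \<in> M" for i using y that by (simp add: Kc_def)
    then have "y $ i \<noteq> 0" if "i \<in> M" for i using that r0 by (metis norm_zero order_less_irrefl)
    then show "y \<in> S" using y KP by (intro inS) blast+
  qed
  have "compact (F ` Kc)" by (rule compact_continuous_image[OF continuous_on_subset[OF smooth_on_continuous_on[OF sF] KS] cK])
  then obtain B where B: "\<And>y. y \<in> Kc \<Longrightarrow> \<bar>F y\<bar> \<le> B"
    using compact_imp_bounded bounded_iff by (metis imageI real_norm_def)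
  have path: "\<bar>F y\<bar> \<le> \<bar>B\<bar> + 2 * real N0 * (\<Sum>k\<in>M. ln (ln (1 / norm (y $ k))))"
    if y: "y \<in> P" "\<forall>i\<in>M. y $ i \<noteq> 0" for y
  proof -
    define a where "a = (\<lambda>i. ln (ln (1 / norm (y $ i))))"
    have ypos: "norm (y $ i) > 0" "norm (y $ i) \<le> r" if "i \<in> M" for i using y that by (simp_all add: P_def)
    have ly: "ln (1 / norm (y $ i)) \<ge> ln (1 / r)" if "i \<in> M" for i
    proof -
      have "1 / r \<le> 1 / norm (y $ i)" using ypos[OF that] r0 by (intro divide_left_mono mult_pos_pos) auto
      then show ?thesis using ypos[OF that] r0 by (subst ln_le_cancel_iff) auto
    qed
    have ab: "b \<le> a i" if "i \<in> M" for i
      unfolding a_def b_def using ly[OF that] lr by (subst ln_le_cancel_iff) auto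
    \<comment> \<open>\<open>ex i s\<close> is the value of \<open>log 1/|z_i|\<close> along the
      path; its logarithm runs linearly from \<open>a i\<close> to \<open>b\<close>. The arguments
      of the coordinates, and the coordinates outside \<open>M\<close>, stay fixed.\<close>
    define ex where "ex = (\<lambda>i s. exp ((1 - s) * a i + s * b))"
    define g where "g = (\<lambda>i s. exp (- ex i s))"
    define \<gamma> where "\<gamma> = (\<lambda>s. \<chi> i. if i \<in> M then sgn (y $ i) * complex_of_real (g i s) else y $ i)"
    define v where "v = (\<lambda>s. \<chi> i. if i \<in> M then sgn (y $ i) * complex_of_real (g i s * (ex i s * (a i - b))) else 0)"
    have g0: "g i s > 0" for i s by (simp add: g_def)
    have ex1: "ln (1 / r) \<le> ex i s" if "i \<in> M" "0 \<le> s" "s \<le> 1" for i s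
    proof -
      have "b = (1 - s) * b + s * b" by (simp add: algebra_simps)
      also have "\<dots> \<le> (1 - s) * a i + s * b" using that ab[OF that(1)] by (intro add_mono mult_left_mono) auto
      finally have "exp b \<le> ex i s" unfolding ex_def by simp
      then show ?thesis by (simp only: eb)
    qed
    have gr: "g i s \<le> r" if "i \<in> M" "0 \<le> s" "s \<le> 1" for i s
    proof -
      have "g i s \<le> exp (- ln (1 / r))" unfolding g_def using ex1[OF that] by simp
      then show ?thesis by (simp only: er)
    qed
    have n\<gamma>: "norm (\<gamma> s $ i) = g i s" if "i \<in> M" for i s
      using ypos(1)[OF that] g0[of i s] that by (simp add: \<gamma>_def norm_mult norm_sgn)
    have \<gamma>P: "\<gamma> s \<in> P" if "0 \<le> s" "s \<le> 1" for s
    proof -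
      have "norm (\<gamma> s $ i) \<le> r" for i
      proof (cases "i \<in> M")
        case True
        then show ?thesis using gr[OF True that] n\<gamma>[OF True] by simp
      next
        case False
        then show ?thesis using y(1) by (simp add: \<gamma>_def P_def)
      qed
      then show ?thesis by (simp add: P_def)
    qed
    have \<gamma>n: "\<forall>i\<in>M. \<gamma> s $ i \<noteq> 0" for s using n\<gamma> g0 by (metis norm_zero order_less_irrefl)
    have ex0: "ex i 0 = ln (1 / norm (y $ i))" if "i \<in> M" for i
    proof -
      have "ln (1 / norm (y $ i)) > 0" using ly[OF that] lr by linarith
      then show ?thesis by (simp add: ex_def a_def)
    qed
    have \<gamma>0: "\<gamma> 0 = y"
    proof -
      have "\<gamma> 0 $ i = y $ i" for i
      proof (cases "i \<in> M")
        case True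
        have "g i 0 = norm (y $ i)" using ypos(1)[OF True] by (simp add: g_def ex0[OF True] ln_div)
        then show ?thesis using True ypos(1)[OF True] by (simp add: \<gamma>_def sgn_div_norm scaleR_conv_of_real field_simps)
      qed (simp add: \<gamma>_def)
      then show ?thesis by (simp add: vec_eq_iff)
    qed
    have \<gamma>1: "\<gamma> 1 \<in> Kc"
    proof -
      have "g i 1 = r" for i by (simp add: g_def ex_def eb er)
      then have "norm (\<gamma> 1 $ i) = r" if "i \<in> M" for i using n\<gamma>[OF that] by simp
      then show ?thesis using \<gamma>P[of 1] by (simp add: Kc_def P_def)
    qed
    have dex: "(ex i has_real_derivative ex i s * (b - a i)) (at s)" for i s
      unfolding ex_def by (auto intro!: derivative_eq_intros simp: algebra_simps)
    have dg: "(g i has_real_derivative g i s * (ex i s * (a i - b))) (at s)" for i s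
      unfolding g_def by (rule derivative_eq_intros dex refl)+ (simp add: algebra_simps)
    have d\<gamma>i: "((\<lambda>s. \<gamma> s $ i) has_derivative (\<lambda>h. h *\<^sub>R (v s $ i))) (at s)" for i s
    proof (cases "i \<in> M")
      case True
      have "((\<lambda>s. sgn (y $ i) * complex_of_real (g i s)) has_derivative (\<lambda>h. sgn (y $ i) * complex_of_real (g i s * (ex i s * (a i - b)) * h))) (at s)"
        by (rule has_derivative_mult_right[OF bounded_linear.has_derivative[OF bounded_linear_of_real dg[unfolded has_field_derivative_def]]])
      then show ?thesis using True by (simp add: \<gamma>_def v_def scaleR_conv_of_real mult_ac)
    next
      case False
      then show ?thesis by (simp add: \<gamma>_def v_def)
    qed
    have d\<gamma>: "(\<gamma> has_derivative (\<lambda>h. h *\<^sub>R v s)) (at s)" for s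
    proof -
      have "(\<gamma> has_derivative (\<lambda>h. \<chi> k. frechet_derivative (\<lambda>s. \<gamma> s $ k) (at s) h)) (at s)"
        by (rule has_derivative_cvec) (use d\<gamma>i in \<open>auto simp: differentiable_def\<close>)
      moreover have "(\<chi> k. frechet_derivative (\<lambda>s. \<gamma> s $ k) (at s) h) = h *\<^sub>R v s" for h
        by (simp add: vec_eq_iff frechet_derivativeI[OF d\<gamma>i])
      ultimately show ?thesis by simp
    qed
    have dF\<gamma>: "((\<lambda>s. F (\<gamma> s)) has_real_derivative frechet_derivative F (at (\<gamma> s)) (v s)) (at s)" if "0 \<le> s" "s \<le> 1" for s
    proof -
      have D: "(F has_derivative frechet_derivative F (at (\<gamma> s))) (at (\<gamma> s))"
        by (rule differentiable_frechet[OF dF[OF inS[OF \<gamma>P[OF that] \<gamma>n]]])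
      have "((\<lambda>s. F (\<gamma> s)) has_derivative (\<lambda>h. frechet_derivative F (at (\<gamma> s)) (h *\<^sub>R v s))) (at s)"
        using diff_chain_at[OF d\<gamma> D] by (simp add: o_def)
      then show ?thesis
        unfolding linear_scale[OF bounded_linear.linear[OF has_derivative_bounded_linear[OF D]]]
        by (simp add: has_field_derivative_def mult_commute_abs)
    qed
    have bound: "\<bar>frechet_derivative F (at (\<gamma> s)) (v s)\<bar> \<le> 2 * real N0 * (\<Sum>k\<in>M. a k)" if s: "0 \<le> s" "s \<le> 1" for s
    proof -
      obtain x where x: "x \<in> U" "x \<notin> D" "\<gamma> s = z x" using inU[OF \<gamma>P[OF s] \<gamma>n] by blast
      have "jets_le (V, z) M f x (real N0)" using S0(3) x(1,2) by (simp add: U_def)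
      from jets_le_D(1)[OF this] have J: "norm (cj1 F (\<gamma> s) k) * norm (log_frame M (\<gamma> s) k) \<le> real N0" for k
        by (simp add: F_def x(3))
      have "\<bar>frechet_derivative F (at (\<gamma> s)) (v s)\<bar> \<le> (\<Sum>k\<in>UNIV. 2 * (norm (cj1 F (\<gamma> s) k) * norm (v s $ k)))"
        by (rule abs_derivative_le_jets[OF dF[OF inS[OF \<gamma>P[OF s] \<gamma>n]]])
      also have "\<dots> = (\<Sum>k\<in>M. 2 * (norm (cj1 F (\<gamma> s) k) * norm (v s $ k)))"
        by (rule sum.mono_neutral_right) (auto simp: v_def)
      also have "\<dots> \<le> (\<Sum>k\<in>M. 2 * (real N0 * a k))"
      proof (rule sum_mono)
        fix k assume k: "k \<in> M"
        have exk: "ex k s > 0" by (simp add: ex_def)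
        have "ln (1 / norm (\<gamma> s $ k)) = ex k s" unfolding n\<gamma>[OF k] by (simp add: g_def ln_div)
        then have "norm (log_frame M (\<gamma> s) k) = g k s * ex k s"
          using k exk n\<gamma>[OF k, of s] by (simp add: log_frame_def norm_mult)
        \<comment> \<open>The factor \<open>g k s * ex k s\<close> is the modulus of the frame
          function at this point, so it cancels against the frame weight in the jet bound.\<close>
        moreover have "norm (v s $ k) = g k s * ex k s * (a k - b)"
        proof -
          have "norm (v s $ k) = \<bar>g k s * (ex k s * (a k - b))\<bar>"
            using k ypos(1)[OF k] by (simp add: v_def norm_mult norm_sgn abs_mult del: of_real_diff)
          also have "\<dots> = g k s * (ex k s * (a k - b))"
            by (rule abs_of_nonneg) (use ab[OF k] exk g0[of k s] in simp)
          finally show ?thesis by (simp only: mult.assoc)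
        qed
        ultimately have "norm (cj1 F (\<gamma> s) k) * norm (v s $ k) = (norm (cj1 F (\<gamma> s) k) * norm (log_frame M (\<gamma> s) k)) * (a k - b)"
          by simp
        also have "\<dots> \<le> real N0 * (a k - b)" by (rule mult_right_mono[OF J]) (use ab[OF k] in simp)
        also have "\<dots> \<le> real N0 * a k" using b0 by (intro mult_left_mono) auto
        finally show "2 * (norm (cj1 F (\<gamma> s) k) * norm (v s $ k)) \<le> 2 * (real N0 * a k)" by simp
      qed
      also have "\<dots> = 2 * real N0 * (\<Sum>k\<in>M. a k)" by (simp add: sum_distrib_left mult.assoc)
      finally show ?thesis .
    qed
    have "\<exists>s>0. s < 1 \<and> F (\<gamma> 1) - F (\<gamma> 0) = (1 - 0) * frechet_derivative F (at (\<gamma> s)) (v s)"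
      by (rule MVT2) (use dF\<gamma> in auto)
    then obtain s where s: "0 < s" "s < 1" "F (\<gamma> 1) - F y = frechet_derivative F (at (\<gamma> s)) (v s)" using \<gamma>0 by auto
    have "\<bar>F (\<gamma> 1) - F y\<bar> \<le> 2 * real N0 * (\<Sum>k\<in>M. a k)" unfolding s(3) by (rule bound) (use s in auto)
    then show ?thesis using B[OF \<gamma>1] unfolding a_def by linarith
  qed
  obtain N1 :: nat where N1: "\<forall>\<^sub>F x in nhds p. \<forall>i\<in>M. x \<notin> D \<longrightarrow> ll z i x \<le> real N1 * \<Theta>1 x"
    using ll_upper[OF ad p] by (elim exE)
  \<comment> \<open>The bound \<open>B\<close> from the endpoints can be absorbed into the multiple
    since \<Theta>1 is at least 1; each iterated logarithm contributes at most
    \<open>real N1 * \<Theta>1 x\<close>.\<close>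
  obtain N :: nat where N: "\<bar>B\<bar> + 2 * real N0 * (real (card M) * real N1) \<le> real N" using real_arch_simple by blast
  have oW: "open (V \<inter> z -` ball 0 r)" by (rule open_chart_preimage[OF c open_ball])
  have pW: "p \<in> V \<inter> z -` ball 0 r" using p zp r0 by simp
  have "\<forall>\<^sub>F x in nhds p. x \<notin> D \<longrightarrow> \<bar>f x\<bar> \<le> real N * \<Theta>1 x"
    using N1 eventually_in_open[OF oW pW]
  proof eventually_elim
    case (elim x)
    show ?case
    proof
      assume x: "x \<notin> D"
      have xV: "x \<in> V" and nz: "norm (z x) < r" using elim(2) by simp_all
      have "norm (z x $ i) \<le> r" for i using Finite_Cartesian_Product.norm_nth_le[of "z x" i] nz by linarith
      then have zP: "z x \<in> P" by (simp add: P_def)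
      have zn: "\<forall>i\<in>M. z x $ i \<noteq> 0" using DV x xV by blast
      have "\<bar>f x\<bar> \<le> \<bar>B\<bar> + 2 * real N0 * (\<Sum>k\<in>M. ll z k x)"
        using path[OF zP zn] in_coords_at[OF c xV, of f] unfolding F_def by simp
      also have "\<dots> \<le> \<bar>B\<bar> * \<Theta>1 x + 2 * real N0 * (real (card M) * (real N1 * \<Theta>1 x))"
      proof (rule add_mono)
        have "\<bar>B\<bar> * 1 \<le> \<bar>B\<bar> * \<Theta>1 x" using \<Theta>1_ge_1[OF x] by (intro mult_left_mono) auto
        then show "\<bar>B\<bar> \<le> \<bar>B\<bar> * \<Theta>1 x" by simp
        show "2 * real N0 * (\<Sum>k\<in>M. ll z k x) \<le> 2 * real N0 * (real (card M) * (real N1 * \<Theta>1 x))"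
          by (intro mult_left_mono sum_bounded_above) (use elim(1) x in auto)
      qed
      also have "\<dots> = (\<bar>B\<bar> + 2 * real N0 * (real (card M) * real N1)) * \<Theta>1 x" by (simp add: algebra_simps)
      also have "\<dots> \<le> real N * \<Theta>1 x" using N \<Theta>1_ge_1[OF x] by (intro mult_right_mono) auto
      finally show "\<bar>f x\<bar> \<le> real N * \<Theta>1 x" .
    qed
  qed
  then show ?thesis by (rule exI)
qed

lemma P_singular_bound:
  assumes f: "P_singular \<A> D f"
  shows "\<exists>N::nat. \<forall>x. x \<notin> D \<longrightarrow> \<bar>f x\<bar> \<le> real N * \<Theta>1 x"
proof -
  have "\<exists>N::nat. \<forall>x\<in>UNIV. x \<notin> D \<longrightarrow> \<bar>f x\<bar> \<le> real N * \<Theta>1 x"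
  proof (rule eventually_compact_nat[OF compact_X])
    fix p
    obtain V z M where "adapted_chart \<A> D (V, z) M" "p \<in> V" "z p = 0" by (rule centered_adapted_chart)
    then show "\<exists>N::nat. \<forall>\<^sub>F x in nhds p. x \<notin> D \<longrightarrow> \<bar>f x\<bar> \<le> real N * \<Theta>1 x" by (rule P_singular_near[OF f])
  next
    fix N N' :: nat and x
    assume le: "N \<le> N'" and *: "x \<notin> D \<longrightarrow> \<bar>f x\<bar> \<le> real N * \<Theta>1 x"
    show "x \<notin> D \<longrightarrow> \<bar>f x\<bar> \<le> real N' * \<Theta>1 x"
    proof
      assume x: "x \<notin> D"
      have "real N * \<Theta>1 x \<le> real N' * \<Theta>1 x" using le \<Theta>1_ge_1[OF x] by (intro mult_right_mono) auto
      then show "\<bar>f x\<bar> \<le> real N' * \<Theta>1 x" using * x by linarith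
    qed
  qed
  then show ?thesis by simp
qed

lemma pre_log_log_bound:
  assumes f: "pre_log_log \<A> D f"
  shows "\<exists>N::nat. \<forall>x. x \<notin> D \<longrightarrow> \<bar>f x\<bar> \<le> bd N x"
proof -
  have "\<exists>N::nat. \<forall>x\<in>UNIV. x \<notin> D \<longrightarrow> \<bar>f x\<bar> \<le> bd N x"
  proof (rule eventually_compact_nat[OF compact_X])
    fix p
    obtain V z M where ad: "adapted_chart \<A> D (V, z) M" and p: "p \<in> V" by (rule centered_adapted_chart)
    obtain N :: nat where "\<forall>\<^sub>F x in nhds p. x \<notin> D \<longrightarrow> \<bar>f x\<bar> \<le> bd N x \<and> jets_le (V, z) M f x (bd N x)"
      using pre_log_logD[OF f ad p] by (elim exE)
    then have "\<forall>\<^sub>F x in nhds p. x \<notin> D \<longrightarrow> \<bar>f x\<bar> \<le> bd N x" by (rule eventually_mono) simp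
    then show "\<exists>N::nat. \<forall>\<^sub>F x in nhds p. x \<notin> D \<longrightarrow> \<bar>f x\<bar> \<le> bd N x" by (rule exI)
  next
    fix N N' :: nat and x
    assume "N \<le> N'" "x \<notin> D \<longrightarrow> \<bar>f x\<bar> \<le> bd N x"
    then show "x \<notin> D \<longrightarrow> \<bar>f x\<bar> \<le> bd N' x" using bd_mono[of x N N'] by linarith
  qed
  then show ?thesis by simp
qed

end

section \<open>The decomposition\<close>

locale snc_pair_form = snc_pair \<A> m Dc D L s h
  for \<A> :: "('a::t2_space, 'n::finite) chart set" and m Dc D L s h +
  fixes \<omega> :: "('a, 'n) form11"
  assumes smooth_\<omega>: "smooth_form11 \<A> \<omega>" and positive_\<omega>: "positive_form11 \<A> \<omega>"
begin

section \<open>The reference form and the global domination of \<open>ddc\<close>\<close>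

definition hw :: "('a, 'n) chart \<Rightarrow> 'a \<Rightarrow> complex^'n \<Rightarrow> real" where
  "hw c x \<xi> = Re (herm_value (\<omega> c x) \<xi>)"

definition hg :: "('a \<Rightarrow> real) \<Rightarrow> ('a, 'n) chart \<Rightarrow> 'a \<Rightarrow> complex^'n \<Rightarrow> real" where
  "hg g c x \<xi> = Re (herm_value (ddc g c x) \<xi>)"

text \<open>The value on \<xi> of the form \<open>dd^c(-\<Theta>1) + A \<omega>\<close>, against
  which everything is measured. \<open>A\<close> is a natural number so that local choices can be
  merged by compactness.\<close>

definition Kf :: "nat \<Rightarrow> ('a, 'n) chart \<Rightarrow> 'a \<Rightarrow> complex^'n \<Rightarrow> real" where
  "Kf A c x \<xi> = hg (\<lambda>y. - \<Theta>1 y) c x \<xi> + real A * hw c x \<xi>"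

lemma neg_\<Theta>1_smooth: "mfd_smooth_on \<A> (- D) (\<lambda>x. - \<Theta>1 x)"
  by (rule mfd_smooth_on_linear[OF open_minus_D bounded_linear_minus[OF bounded_linear_ident] \<Theta>1_smooth])

lemma \<omega>_pos:
  assumes "(V, z) \<in> holo_charts \<A>" "x \<in> V" "\<xi> \<noteq> 0"
  shows "herm_value (\<omega> (V, z) x) \<xi> \<in> \<real>" "hw (V, z) x \<xi> > 0"
  using bspec[OF positive_\<omega>[unfolded positive_form11_def] assms(1)] assms(2,3) unfolding hw_def by auto

lemma \<omega>_nonneg:
  assumes "(V, z) \<in> holo_charts \<A>" "x \<in> V"
  shows "herm_value (\<omega> (V, z) x) \<xi> \<in> \<real>" "hw (V, z) x \<xi> \<ge> 0"
  using \<omega>_pos[OF assms, of \<xi>] by (cases "\<xi> = 0"; simp add: hw_def herm_value_zero)+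

lemma hg_levi:
  assumes "mfd_smooth_on \<A> (- D) g" "(V, z) \<in> holo_charts \<A>" "x \<in> V" "x \<notin> D"
  shows "herm_value (ddc g (V, z) x) \<xi> \<in> \<real>" "hg g (V, z) x \<xi> = levi g (V, z) x \<xi> / (2 * pi)"
  unfolding hg_def using herm_value_ddc[OF assms(2) open_minus_D assms(1,3), of \<xi>] assms(4) by simp_all

lemma hg_jac:
  assumes "mfd_smooth_on \<A> (- D) g" "(V, z) \<in> holo_charts \<A>" "(W, w) \<in> holo_charts \<A>" "x \<in> V" "x \<in> W" "x \<notin> D"
  shows "hg g (V, z) x \<xi> = hg g (W, w) x (jac (V, z) (W, w) x \<xi>)"
  unfolding hg_def using herm_value_ddc_jac[OF atlas assms(2,3) open_minus_D assms(1,4,5), of \<xi>] assms(6) by simp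

lemma hw_jac:
  assumes "(V, z) \<in> holo_charts \<A>" "(W, w) \<in> holo_charts \<A>" "x \<in> V" "x \<in> W"
  shows "hw (V, z) x \<xi> = hw (W, w) x (jac (V, z) (W, w) x \<xi>)"
proof -
  have "herm_value (\<omega> (V, z) x) \<xi> = herm_value (\<omega> (W, w) x) (jac (V, z) (W, w) x \<xi>)"
  proof (rule herm_value_jac)
    fix i j
    have "\<forall>x\<in>V \<inter> W. \<forall>i j. \<omega> (V, z) x $ i $ j =
          (\<Sum>k\<in>UNIV. \<Sum>l\<in>UNIV. \<omega> (W, w) x $ k $ l
             * wirt i (in_coords (V, z) (\<lambda>y. w y $ k)) (z x)
             * cnj (wirt j (in_coords (V, z) (\<lambda>y. w y $ l)) (z x)))"
      using bspec[OF bspec[OF smooth_\<omega>[unfolded smooth_form11_def, THEN conjunct2] assms(1), unfolded prod.case] assms(2)] by simp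
    then show "\<omega> (V, z) x $ i $ j = (\<Sum>k\<in>UNIV. \<Sum>l\<in>UNIV. \<omega> (W, w) x $ k $ l
             * wirt i (in_coords (V, z) (\<lambda>y. snd (W, w) y $ k)) (snd (V, z) x)
             * cnj (wirt j (in_coords (V, z) (\<lambda>y. snd (W, w) y $ l)) (snd (V, z) x)))"
      unfolding snd_conv using assms(3,4) by blast
  qed
  then show ?thesis by (simp add: hw_def)
qed

text \<open>By homogeneity only unit vectors matter. On the compact product of a closed ball in the
  chart and the unit sphere, the positive continuous function given by \<omega> has a positive
  minimum.\<close>

lemma \<omega>_lower:
  assumes c: "(V, z) \<in> holo_charts \<A>" and p: "p \<in> V"
  shows "\<exists>N::nat. \<forall>\<^sub>F x in nhds p. \<forall>\<xi>. nsum \<xi> \<le> real N * hw (V, z) x \<xi>"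
proof -
  obtain r where r: "r > 0" "cball (z p) r \<subseteq> z ` V"
    using chart_props(3)[OF c] p open_contains_cball_eq by blast
  define a where "a = (\<lambda>i j. in_coords (V, z) (\<lambda>x. \<omega> (V, z) x $ i $ j))"
  have ca: "continuous_on (z ` V) (a i j)" for i j
  proof (rule smooth_on_continuous_on)
    show "smooth_on (z ` V) (a i j)"
      unfolding a_def using bspec[OF smooth_\<omega>[unfolded smooth_form11_def, THEN conjunct1] c] by simp
  qed
  define H where "H = (\<lambda>q::(complex^'n) \<times> (complex^'n). Re (\<Sum>i\<in>UNIV. \<Sum>j\<in>UNIV. (a i j (fst q) / \<i>) * snd q $ i * cnj (snd q $ j)))"
  define Q where "Q = cball (z p) r \<times> sphere (0::complex^'n) 1"
  have Hx: "H (z x, \<xi>) = hw (V, z) x \<xi>" if "x \<in> V" for x \<xi>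
  proof -
    have e: "in_coords (V, z) (\<lambda>x. \<omega> (V, z) x $ i $ j) (z x) = \<omega> (V, z) x $ i $ j" for i j
      by (rule in_coords_at[OF c that])
    show ?thesis unfolding H_def hw_def herm_value_def a_def fst_conv snd_conv e ..
  qed
  have cQ: "compact Q" unfolding Q_def by (intro compact_Times compact_cball compact_sphere)
  have Qn: "Q \<noteq> {}"
  proof -
    have "(z p, axis undefined 1) \<in> Q" using r(1) by (simp add: Q_def norm_axis_complex)
    then show ?thesis by blast
  qed
  have caq: "continuous_on Q (\<lambda>q. a i j (fst q))" for i j
    by (rule continuous_on_compose2[OF ca continuous_on_fst[OF continuous_on_id]]) (use r(2) in \<open>auto simp: Q_def\<close>)
  have "continuous_on Q H"
    unfolding H_def
    by (intro continuous_intros caq) simp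
  then obtain q where q: "q \<in> Q" "\<And>q'. q' \<in> Q \<Longrightarrow> H q \<le> H q'"
    using continuous_attains_inf[OF cQ Qn] by blast
  obtain x0 where x0: "x0 \<in> V" "fst q = z x0" using q(1) r(2) by (auto simp: Q_def)
  have "snd q \<noteq> 0" using q(1) by (auto simp: Q_def)
  then have Hq: "H q > 0" using \<omega>_pos(2)[OF c x0(1), of "snd q"] Hx[OF x0(1), of "snd q"] x0(2) by (metis prod.collapse)
  obtain N :: nat where N: "1 / H q \<le> real N" using real_arch_simple by blast
  have oW: "open (V \<inter> z -` ball (z p) r)" by (rule open_chart_preimage[OF c open_ball])
  have pW: "p \<in> V \<inter> z -` ball (z p) r" using p r(1) by simp
  have "\<forall>\<^sub>F x in nhds p. \<forall>\<xi>. nsum \<xi> \<le> real N * hw (V, z) x \<xi>"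
    using eventually_in_open[OF oW pW]
  proof eventually_elim
    case (elim x)
    show ?case
    proof
      fix \<xi> :: "complex^'n"
      show "nsum \<xi> \<le> real N * hw (V, z) x \<xi>"
      proof (cases "\<xi> = 0")
        case True
        then show ?thesis by (simp add: nsum_norm hw_def herm_value_zero)
      next
        case False
        define t where "t = norm \<xi>"
        have t: "t > 0" using False by (simp add: t_def)
        define \<eta> where "\<eta> = (1 / t) *\<^sub>R \<xi>"
        have \<xi>: "\<xi> = t *\<^sub>R \<eta>" using t by (simp add: \<eta>_def)
        have "(z x, \<eta>) \<in> Q" using elim t by (simp add: Q_def \<eta>_def t_def)
        then have "H q \<le> hw (V, z) x \<eta>" using q(2) Hx[of x \<eta>] elim by fastforce
        moreover have "1 \<le> real N * H q" using N Hq by (simp add: field_simps)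
        moreover have "real N * H q \<le> real N * hw (V, z) x \<eta>" using calculation(1) by (intro mult_left_mono) auto
        ultimately have "1 \<le> real N * hw (V, z) x \<eta>" by linarith
        then have "t\<^sup>2 * 1 \<le> t\<^sup>2 * (real N * hw (V, z) x \<eta>)" by (intro mult_left_mono) auto
        moreover have "hw (V, z) x \<xi> = t\<^sup>2 * hw (V, z) x \<eta>"
        proof -
          have "herm_value (\<omega> (V, z) x) \<xi> = of_real (t\<^sup>2) * herm_value (\<omega> (V, z) x) \<eta>"
            unfolding \<xi> by (rule herm_value_scale_vec)
          then show ?thesis unfolding hw_def by (simp del: of_real_power)
        qed
        ultimately show ?thesis by (simp add: nsum_norm t_def mult_ac)
      qed
    qed
  qed
  then show ?thesis by (rule exI)
qed

lemma Kf_mono: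
  assumes "(V, z) \<in> holo_charts \<A>" "x \<in> V" "A \<le> A'"
  shows "Kf A (V, z) x \<xi> \<le> Kf A' (V, z) x \<xi>"
  unfolding Kf_def using assms(3) by (intro add_left_mono mult_right_mono \<omega>_nonneg(2)[OF assms(1,2)]) simp

text \<open>The lower bound for the Levi form of \<open>- \<Theta>1\<close> has a Euclidean error,
  and a multiple of \<omega> dominates the Euclidean metric near \<open>p\<close>.\<close>

lemma Kf_near:
  assumes ad: "adapted_chart \<A> D (V, z) M" and p: "p \<in> V"
  shows "\<exists>A::nat. \<forall>\<^sub>F x in nhds p. x \<notin> D \<longrightarrow> (\<forall>\<xi>. 0 \<le> Kf A (V, z) x \<xi> \<and> pq M (z x) \<xi> \<le> real A * Kf A (V, z) x \<xi>)"
proof -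
  note c = adapted_holo[OF ad]
  obtain N :: nat where N: "\<forall>\<^sub>F x in nhds p. x \<notin> D \<longrightarrow> (\<forall>\<xi>. 0 \<le> levi (\<lambda>x. - \<Theta>1 x) (V, z) x \<xi> + real N * nsum \<xi>
    \<and> pq M (z x) \<xi> \<le> real N * (levi (\<lambda>x. - \<Theta>1 x) (V, z) x \<xi> + real N * nsum \<xi>))"
    using levi_neg_\<Theta>1_lower[OF ad p] by (elim exE)
  obtain N' :: nat where N': "\<forall>\<^sub>F x in nhds p. \<forall>\<xi>. nsum \<xi> \<le> real N' * hw (V, z) x \<xi>" using \<omega>_lower[OF c p] by (elim exE)
  \<comment> \<open>\<open>N * N'\<close> turns the Euclidean error into a multiple of \<omega>;
    \<open>8 * N\<close> makes up for the factor \<open>2 * pi \<le> 8\<close> between the Levi form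
    and \<open>ddc\<close>.\<close>
  define A where "A = N * N' + 8 * N"
  have "\<forall>\<^sub>F x in nhds p. x \<notin> D \<longrightarrow> (\<forall>\<xi>. 0 \<le> Kf A (V, z) x \<xi> \<and> pq M (z x) \<xi> \<le> real A * Kf A (V, z) x \<xi>)"
    using N N' eventually_in_chart[OF ad p]
  proof eventually_elim
    case (elim x)
    show ?case
    proof (intro impI allI)
      fix \<xi> assume x: "x \<notin> D"
      define T where "T = levi (\<lambda>x. - \<Theta>1 x) (V, z) x \<xi>"
      define W where "W = hw (V, z) x \<xi>"
      define Y where "Y = T + real N * nsum \<xi>"
      have Y: "0 \<le> Y" "pq M (z x) \<xi> \<le> real N * Y" using elim(1) x unfolding Y_def T_def by blast+
      have W0: "0 \<le> W" unfolding W_def by (rule \<omega>_nonneg(2)[OF c elim(3)])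
      have K: "Kf A (V, z) x \<xi> = T / (2 * pi) + real A * W"
        unfolding Kf_def T_def W_def hg_levi(2)[OF neg_\<Theta>1_smooth c elim(3) x] ..
      have pi2: "1 \<le> 2 * pi" "2 * pi \<le> 8" using pi_ge_two pi_less_4 by linarith+
      have AW: "0 \<le> real A * W" using W0 by simp
      have "real N * nsum \<xi> \<le> real N * (real N' * W)" using elim(2) unfolding W_def by (intro mult_left_mono) auto
      also have "\<dots> = real (N * N') * W" by simp
      also have "\<dots> \<le> real A * W" by (rule mult_right_mono[OF _ W0]) (simp only: A_def of_nat_le_iff le_add1)
      also have "\<dots> \<le> (2 * pi) * (real A * W)" using mult_right_mono[OF pi2(1) AW] by simp
      finally have "Y \<le> T + (2 * pi) * (real A * W)" unfolding Y_def by linarith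
      also have "\<dots> = (2 * pi) * Kf A (V, z) x \<xi>" unfolding K using pi_gt_zero by (simp add: distrib_left)
      finally have YK: "Y \<le> (2 * pi) * Kf A (V, z) x \<xi>" .
      have K0: "0 \<le> Kf A (V, z) x \<xi>"
      proof -
        have "0 \<le> 2 * pi * Kf A (V, z) x \<xi>" using Y(1) YK by linarith
        then show ?thesis using pi_gt_zero by (simp only: zero_le_mult_iff) linarith
      qed
      have "real N * Y \<le> real N * ((2 * pi) * Kf A (V, z) x \<xi>)" by (rule mult_left_mono[OF YK]) simp
      also have "\<dots> \<le> real N * (8 * Kf A (V, z) x \<xi>)" by (rule mult_left_mono[OF mult_right_mono[OF pi2(2) K0]]) simp
      also have "\<dots> = real (8 * N) * Kf A (V, z) x \<xi>" by simp
      also have "\<dots> \<le> real A * Kf A (V, z) x \<xi>" by (rule mult_right_mono[OF _ K0]) (simp only: A_def of_nat_le_iff le_add2)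
      finally show "0 \<le> Kf A (V, z) x \<xi> \<and> pq M (z x) \<xi> \<le> real A * Kf A (V, z) x \<xi>" using K0 Y(2) by linarith
    qed
  qed
  then show ?thesis by (rule exI)
qed

text \<open>In an adapted chart the jets bound \<open>ddc g\<close> by the Poincare metric, and the
  reference form bounds the Poincare metric. \<open>jac\<close> carries the resulting inequality to
  every chart at the same point, and compactness makes the constant global. The weight
  \<open>w\<close> is \<open>bd\<close> for pre-log-log functions and \<open>real N\<close> for
  P-singular ones.\<close>

lemma ddc_dominated:
  assumes sm: "mfd_smooth_on \<A> (- D) g"
    and w0: "\<And>N x. x \<notin> D \<Longrightarrow> 0 \<le> w N x" and wm: "\<And>N N' x. x \<notin> D \<Longrightarrow> N \<le> N' \<Longrightarrow> w N x \<le> w N' x"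
    and ex: "\<And>V z M p. adapted_chart \<A> D (V, z) M \<Longrightarrow> p \<in> V \<Longrightarrow>
      \<exists>N::nat. \<forall>\<^sub>F x in nhds p. x \<notin> D \<longrightarrow> jets_le (V, z) M g x (w N x)"
  shows "\<exists>A::nat. \<forall>x V z \<xi>. x \<notin> D \<longrightarrow> (V, z) \<in> holo_charts \<A> \<longrightarrow> x \<in> V \<longrightarrow>
    0 \<le> Kf A (V, z) x \<xi> \<and> \<bar>hg g (V, z) x \<xi>\<bar> \<le> real A * w A x * Kf A (V, z) x \<xi>"
proof -
  let ?Q = "\<lambda>A x. x \<notin> D \<longrightarrow> (\<forall>V z \<xi>. (V, z) \<in> holo_charts \<A> \<longrightarrow> x \<in> V \<longrightarrow>
    0 \<le> Kf A (V, z) x \<xi> \<and> \<bar>hg g (V, z) x \<xi>\<bar> \<le> real A * w A x * Kf A (V, z) x \<xi>)"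
  have "\<exists>A::nat. \<forall>x\<in>UNIV. ?Q A x"
  proof (rule eventually_compact_nat[OF compact_X])
    fix p
    obtain V z M where ad: "adapted_chart \<A> D (V, z) M" and p: "p \<in> V" by (rule centered_adapted_chart)
    note c = adapted_holo[OF ad]
    obtain N :: nat where N: "\<forall>\<^sub>F x in nhds p. x \<notin> D \<longrightarrow> jets_le (V, z) M g x (w N x)" using ex[OF ad p] by (elim exE)
    obtain A0 :: nat where A0: "\<forall>\<^sub>F x in nhds p. x \<notin> D \<longrightarrow> (\<forall>\<xi>. 0 \<le> Kf A0 (V, z) x \<xi> \<and> pq M (z x) \<xi> \<le> real A0 * Kf A0 (V, z) x \<xi>)"
      using Kf_near[OF ad p] by (elim exE)
    define n where "n = CARD('n)"
    define A where "A = n * A0 + N + A0"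
    have "\<forall>\<^sub>F x in nhds p. ?Q A x"
      using N A0 eventually_in_chart[OF ad p]
    proof eventually_elim
      case (elim x)
      show ?case
      proof (intro impI allI)
        fix W y \<xi> assume x: "x \<notin> D" and d: "(W, y) \<in> holo_charts \<A>" and xW: "x \<in> W"
        \<comment> \<open>The given vector, rewritten in the adapted chart in which the local
          estimates hold.\<close>
        define \<eta> where "\<eta> = jac (W, y) (V, z) x \<xi>"
        have J: "jets_le (V, z) M g x (w N x)" by (rule mp[OF elim(1) x])
        note K0 = spec[OF mp[OF elim(2) x], of \<eta>]
        note K = conjunct1[OF K0] conjunct2[OF K0]
        have KA: "Kf A0 (V, z) x \<eta> \<le> Kf A (V, z) x \<eta>" by (rule Kf_mono[OF c elim(3)]) (simp add: A_def)
        have wA: "w N x \<le> w A x" by (rule wm[OF x]) (simp add: A_def)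
        have e: "Kf A (W, y) x \<xi> = Kf A (V, z) x \<eta>" "hg g (W, y) x \<xi> = hg g (V, z) x \<eta>"
          unfolding Kf_def \<eta>_def hg_jac[OF neg_\<Theta>1_smooth d c xW elim(3) x] hw_jac[OF d c xW elim(3)] hg_jac[OF sm d c xW elim(3) x] by simp_all
        have "\<bar>hg g (V, z) x \<eta>\<bar> = \<bar>levi g (V, z) x \<eta>\<bar> / (2 * pi)"
          unfolding hg_levi(2)[OF sm c elim(3) x] by simp
        also have "\<dots> \<le> \<bar>levi g (V, z) x \<eta>\<bar> / 1" using pi_ge_two by (intro divide_left_mono) auto
        also have "\<dots> \<le> real n * w N x * pq M (z x) \<eta>"
          using levi_upper[OF ad elim(3) x J, of \<eta>] by (simp add: n_def)
        also have "\<dots> \<le> real n * w N x * (real A0 * Kf A0 (V, z) x \<eta>)"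
          by (rule mult_left_mono[OF K(2)]) (use w0[OF x] in simp)
        also have "\<dots> = (real (n * A0) * w N x) * Kf A0 (V, z) x \<eta>" by simp
        also have "\<dots> \<le> (real A * w A x) * Kf A (V, z) x \<eta>"
        proof (rule mult_mono[OF mult_mono[OF _ wA] KA])
          have "n * A0 \<le> A" by (simp add: A_def)
          then show "real (n * A0) \<le> real A" by (simp only: of_nat_le_iff)
        qed (use w0[OF x] K(1) in simp_all)
        finally show "0 \<le> Kf A (W, y) x \<xi> \<and> \<bar>hg g (W, y) x \<xi>\<bar> \<le> real A * w A x * Kf A (W, y) x \<xi>"
          unfolding e using K(1) KA by linarith
      qed
    qed
    then show "\<exists>A::nat. \<forall>\<^sub>F x in nhds p. ?Q A x" by (rule exI)
  next
    fix A A' :: nat and x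
    assume le: "A \<le> A'" and Q: "?Q A x"
    show "?Q A' x"
    proof (intro impI allI)
      fix V z \<xi> assume x: "x \<notin> D" and c: "(V, z) \<in> holo_charts \<A>" and xV: "x \<in> V"
      note 10 = mp[OF mp[OF spec[OF spec[OF spec[OF mp[OF Q x], of V], of z], of \<xi>] c] xV]
      note 1 = conjunct1[OF 10] conjunct2[OF 10]
      have K: "Kf A (V, z) x \<xi> \<le> Kf A' (V, z) x \<xi>" by (rule Kf_mono[OF c xV le])
      have "real A * w A x * Kf A (V, z) x \<xi> \<le> real A' * w A' x * Kf A' (V, z) x \<xi>"
        by (rule mult_mono[OF mult_mono[OF _ wm[OF x le]] K]) (use w0[OF x] 1(1) le in simp_all)
      then show "0 \<le> Kf A' (V, z) x \<xi> \<and> \<bar>hg g (V, z) x \<xi>\<bar> \<le> real A' * w A' x * Kf A' (V, z) x \<xi>" using 1 K by linarith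
    qed
  qed
  then obtain A where A: "\<forall>x\<in>UNIV. ?Q A x" by (elim exE)
  show ?thesis
  proof (rule exI[of _ A], intro allI impI)
    fix x V z \<xi> assume x: "x \<notin> D" and c: "(V, z) \<in> holo_charts \<A>" and xV: "x \<in> V"
    show "0 \<le> Kf A (V, z) x \<xi> \<and> \<bar>hg g (V, z) x \<xi>\<bar> \<le> real A * w A x * Kf A (V, z) x \<xi>"
      by (rule mp[OF mp[OF spec[OF spec[OF spec[OF mp[OF bspec[OF A UNIV_I] x], of V], of z], of \<xi>] c] xV])
  qed
qed

lemma hg_add:
  assumes f: "mfd_smooth_on \<A> (- D) f" and g: "mfd_smooth_on \<A> (- D) g" and c: "(V, z) \<in> holo_charts \<A>" and x: "x \<in> V" "x \<notin> D"
  shows "hg (\<lambda>x. f x + g x) (V, z) x \<xi> = hg f (V, z) x \<xi> + hg g (V, z) x \<xi>"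
  unfolding hg_levi(2)[OF f c x] hg_levi(2)[OF g c x] hg_levi(2)[OF mfd_smooth_on_add[OF open_minus_D f g] c x] levi_add[OF f g c x]
  by (rule add_divide_distrib)

lemma hg_cmult:
  assumes f: "mfd_smooth_on \<A> (- D) f" and c: "(V, z) \<in> holo_charts \<A>" and x: "x \<in> V" "x \<notin> D"
  shows "hg (\<lambda>x. r * f x) (V, z) x \<xi> = r * hg f (V, z) x \<xi>"
  unfolding hg_levi(2)[OF f c x] hg_levi(2)[OF mfd_smooth_on_mult[OF open_minus_D mfd_smooth_on_const f] c x] levi_cmult[OF f c x]
  by simp

text \<open>The values of \<open>ddc\<close> and of \<omega> are already known to be real, so only a
  real inequality remains to be supplied.\<close>

lemma nonneg_form11_onI:
  assumes g: "mfd_smooth_on \<A> (- D) g"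
    and ge: "\<And>V z x \<xi>. (V, z) \<in> holo_charts \<A> \<Longrightarrow> x \<in> V \<Longrightarrow> x \<notin> D \<Longrightarrow>
      0 \<le> hg g (V, z) x \<xi> + t x * (hg (\<lambda>y. - \<Theta>1 y) (V, z) x \<xi> + a * hw (V, z) x \<xi>)"
  shows "nonneg_form11_on \<A> (- D) (\<lambda>c x. ddc g c x + t x *\<^sub>R (ddc (\<lambda>y. - \<Theta>1 y) c x + a *\<^sub>R \<omega> c x))"
  unfolding nonneg_form11_on_def
proof (intro ballI, clarify)
  fix V z x \<xi> assume c: "(V, z) \<in> holo_charts \<A>" and x: "x \<in> V" "x \<notin> D"
  have e: "herm_value (ddc g (V, z) x + t x *\<^sub>R (ddc (\<lambda>y. - \<Theta>1 y) (V, z) x + a *\<^sub>R \<omega> (V, z) x)) \<xi>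
    = herm_value (ddc g (V, z) x) \<xi> + of_real (t x) * (herm_value (ddc (\<lambda>y. - \<Theta>1 y) (V, z) x) \<xi> + of_real a * herm_value (\<omega> (V, z) x) \<xi>)"
    unfolding herm_value_add herm_value_scaleR ..
  show "herm_value (ddc g (V, z) x + t x *\<^sub>R (ddc (\<lambda>y. - \<Theta>1 y) (V, z) x + a *\<^sub>R \<omega> (V, z) x)) \<xi> \<in> \<real> \<and>
    0 \<le> Re (herm_value (ddc g (V, z) x + t x *\<^sub>R (ddc (\<lambda>y. - \<Theta>1 y) (V, z) x + a *\<^sub>R \<omega> (V, z) x)) \<xi>)"
    unfolding e
  proof
    show "herm_value (ddc g (V, z) x) \<xi> + of_real (t x) * (herm_value (ddc (\<lambda>y. - \<Theta>1 y) (V, z) x) \<xi> + of_real a * herm_value (\<omega> (V, z) x) \<xi>) \<in> \<real>"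
      by (intro Reals_add Reals_mult Reals_of_real hg_levi(1)[OF g c x] hg_levi(1)[OF neg_\<Theta>1_smooth c x] \<omega>_nonneg(1)[OF c x(1)])
    show "0 \<le> Re (herm_value (ddc g (V, z) x) \<xi> + of_real (t x) * (herm_value (ddc (\<lambda>y. - \<Theta>1 y) (V, z) x) \<xi> + of_real a * herm_value (\<omega> (V, z) x) \<xi>))"
      using ge[OF c x, of \<xi>] unfolding hg_def hw_def by simp
  qed
qed

lemma nonneg_form11_onI':
  assumes g: "mfd_smooth_on \<A> (- D) g"
    and ge: "\<And>V z x \<xi>. (V, z) \<in> holo_charts \<A> \<Longrightarrow> x \<in> V \<Longrightarrow> x \<notin> D \<Longrightarrow> 0 \<le> hg g (V, z) x \<xi> + a * hw (V, z) x \<xi>"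
  shows "nonneg_form11_on \<A> (- D) (\<lambda>c x. ddc g c x + a *\<^sub>R \<omega> c x)"
  unfolding nonneg_form11_on_def
proof (intro ballI, clarify)
  fix V z x \<xi> assume c: "(V, z) \<in> holo_charts \<A>" and x: "x \<in> V" "x \<notin> D"
  have e: "herm_value (ddc g (V, z) x + a *\<^sub>R \<omega> (V, z) x) \<xi> = herm_value (ddc g (V, z) x) \<xi> + of_real a * herm_value (\<omega> (V, z) x) \<xi>"
    unfolding herm_value_add herm_value_scaleR ..
  show "herm_value (ddc g (V, z) x + a *\<^sub>R \<omega> (V, z) x) \<xi> \<in> \<real> \<and> 0 \<le> Re (herm_value (ddc g (V, z) x + a *\<^sub>R \<omega> (V, z) x) \<xi>)"
    unfolding e
  proof
    show "herm_value (ddc g (V, z) x) \<xi> + of_real a * herm_value (\<omega> (V, z) x) \<xi> \<in> \<real>"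
      by (intro Reals_add Reals_mult Reals_of_real hg_levi(1)[OF g c x] \<omega>_nonneg(1)[OF c x(1)])
    show "0 \<le> Re (herm_value (ddc g (V, z) x) \<xi> + of_real a * herm_value (\<omega> (V, z) x) \<xi>)"
      using ge[OF c x, of \<xi>] unfolding hg_def hw_def by simp
  qed
qed

section \<open>Choice of the two functions and of the constants\<close>

definition \<Theta> :: "nat \<Rightarrow> 'a \<Rightarrow> real" where
  "\<Theta> N x = (\<Sum>k=1..m. ln (lg k x) ^ N)"

lemma \<Theta>_one: "\<Theta> 1 = \<Theta>1"
  by (simp add: fun_eq_iff \<Theta>_def \<Theta>1_def)

lemma \<Theta>_zero: "\<Theta> 0 x = real m"
  by (simp add: \<Theta>_def)

text \<open>The largest of the iterated logarithms controls both sides: \<Theta>1 is at most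
  \<open>m\<close> times it, and its \<open>N\<close>-th power is one of the nonnegative summands of
  \<open>\<Theta> N\<close>.\<close>

lemma \<Theta>1_power_le:
  assumes x: "x \<notin> D"
  shows "\<Theta>1 x ^ N \<le> real m ^ N * \<Theta> N x"
proof -
  have u: "ln (lg k x) \<ge> 1" if "k \<in> {1..m}" for k by (rule ln_lg_ge_1[OF that notin_D[OF x that]])
  define Mx where "Mx = Max ((\<lambda>k. ln (lg k x)) ` {1..m})"
  have ne: "{1..m} \<noteq> {}" using m1 by simp
  have "Mx \<in> (\<lambda>k. ln (lg k x)) ` {1..m}" unfolding Mx_def using ne by (intro Max_in) auto
  then obtain k where k: "k \<in> {1..m}" "Mx = ln (lg k x)" by (rule imageE)
  have "ln (lg j x) \<le> Mx" if "j \<in> {1..m}" for j unfolding Mx_def using that by (intro Max_ge) auto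
  then have "\<Theta>1 x \<le> real (card {1..m}) * Mx" unfolding \<Theta>1_def by (rule sum_bounded_above)
  then have "\<Theta>1 x ^ N \<le> (real m * Mx) ^ N" using \<Theta>1_ge_1[OF x] by (intro power_mono) auto
  also have "\<dots> = real m ^ N * ln (lg k x) ^ N" by (simp add: power_mult_distrib k(2))
  also have "\<dots> \<le> real m ^ N * \<Theta> N x"
  proof (rule mult_left_mono)
    show "ln (lg k x) ^ N \<le> \<Theta> N x"
      unfolding \<Theta>_def
    proof (rule member_le_sum[OF k(1)])
      fix j assume "j \<in> {1..m} - {k}"
      then have "1 \<le> ln (lg j x)" using u by blast
      then show "0 \<le> ln (lg j x) ^ N" by simp
    qed simp
  qed simp
  finally show ?thesis .
qed

text \<open>One set of witnesses must meet all clauses, including \<open>N = 0\<close> for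
  P-singular \<open>f\<close>, so the construction splits on P-singularity. In both branches \<psi>
  is a function of \<Theta>1, large enough to make \<open>f + \<psi>\<close> nonnegative.\<close>

lemma decomposition:
  assumes f: "pre_log_log \<A> D f"
  shows "\<exists>(\<phi> :: 'a \<Rightarrow> real) (\<psi> :: 'a \<Rightarrow> real) (A :: real) (B :: real) (N :: nat).
    pre_log_log \<A> D \<phi> \<and> pre_log_log \<A> D \<psi> \<and>
    (\<forall>x\<in>- D. \<phi> x \<ge> 0 \<and> \<psi> x \<ge> 0) \<and> A \<ge> 0 \<and> B \<ge> 0 \<and>
    (\<forall>x\<in>- D. f x = \<phi> x - \<psi> x) \<and>
    nonneg_form11_on \<A> (- D) (\<lambda>c x. ddc (\<lambda>y. - \<phi> y) c x
      + (B * \<Theta> N x) *\<^sub>R (ddc (\<lambda>y. - \<Theta> 1 y) c x + A *\<^sub>R \<omega> c x)) \<and>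
    nonneg_form11_on \<A> (- D) (\<lambda>c x. ddc (\<lambda>y. - \<psi> y) c x
      + (B * \<Theta> N x) *\<^sub>R (ddc (\<lambda>y. - \<Theta> 1 y) c x + A *\<^sub>R \<omega> c x)) \<and>
    (P_singular \<A> D f \<longrightarrow> N = 0 \<and> P_singular \<A> D \<phi> \<and> P_singular \<A> D \<psi> \<and>
      nonneg_form11_on \<A> (- D) (\<lambda>c x. ddc (\<lambda>y. - \<phi> y) c x + A *\<^sub>R \<omega> c x) \<and>
      nonneg_form11_on \<A> (- D) (\<lambda>c x. ddc (\<lambda>y. - \<psi> y) c x + A *\<^sub>R \<omega> c x))"
proof (cases "P_singular \<A> D f")
  case False
  obtain N0 where N0: "\<forall>x. x \<notin> D \<longrightarrow> \<bar>f x\<bar> \<le> bd N0 x" using pre_log_log_bound[OF f] by (elim exE)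
  \<comment> \<open>This is \<open>bd N0\<close>, the weight that bounds the absolute value of
    \<open>f\<close>.\<close>
  define \<psi> where "\<psi> = (\<lambda>x. real N0 * \<Theta>1 x ^ N0)"
  define \<phi> where "\<phi> = (\<lambda>x. f x + \<psi> x)"
  have p\<psi>: "pre_log_log \<A> D \<psi>"
    unfolding \<psi>_def by (rule pre_log_log_mult[OF pre_log_log_const pre_log_log_power[OF \<Theta>1_pre_log_log]])
  have p\<phi>: "pre_log_log \<A> D \<phi>" unfolding \<phi>_def by (rule pre_log_log_add[OF f p\<psi>])
  have main: "\<exists>A::nat. \<forall>x V z \<xi>. x \<notin> D \<longrightarrow> (V, z) \<in> holo_charts \<A> \<longrightarrow> x \<in> V \<longrightarrow>
    0 \<le> Kf A (V, z) x \<xi> \<and> \<bar>hg (\<lambda>y. - g y) (V, z) x \<xi>\<bar> \<le> real A * bd A x * Kf A (V, z) x \<xi>"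
    if g: "pre_log_log \<A> D g" for g
  proof -
    have n: "pre_log_log \<A> D (\<lambda>y. - g y)"
      using pre_log_log_mult[OF pre_log_log_const[of "-1"] g] by simp
    show ?thesis
    proof (rule ddc_dominated[OF pre_log_log_smooth[OF n] bd_nonneg bd_mono])
      fix V z M p assume ad: "adapted_chart \<A> D (V, z) M" and p: "p \<in> V"
      obtain N :: nat where "\<forall>\<^sub>F x in nhds p. x \<notin> D \<longrightarrow> \<bar>- g x\<bar> \<le> bd N x \<and> jets_le (V, z) M (\<lambda>y. - g y) x (bd N x)"
        using pre_log_logD[OF n ad p] by (elim exE)
      then have "\<forall>\<^sub>F x in nhds p. x \<notin> D \<longrightarrow> jets_le (V, z) M (\<lambda>y. - g y) x (bd N x)" by (rule eventually_mono) simp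
      then show "\<exists>N::nat. \<forall>\<^sub>F x in nhds p. x \<notin> D \<longrightarrow> jets_le (V, z) M (\<lambda>y. - g y) x (bd N x)" by (rule exI)
    qed
  qed
  obtain A1 :: nat where A1: "\<forall>x V z \<xi>. x \<notin> D \<longrightarrow> (V, z) \<in> holo_charts \<A> \<longrightarrow> x \<in> V \<longrightarrow>
    0 \<le> Kf A1 (V, z) x \<xi> \<and> \<bar>hg (\<lambda>y. - \<phi> y) (V, z) x \<xi>\<bar> \<le> real A1 * bd A1 x * Kf A1 (V, z) x \<xi>"
    using main[OF p\<phi>] by (elim exE)
  obtain A2 :: nat where A2: "\<forall>x V z \<xi>. x \<notin> D \<longrightarrow> (V, z) \<in> holo_charts \<A> \<longrightarrow> x \<in> V \<longrightarrow>
    0 \<le> Kf A2 (V, z) x \<xi> \<and> \<bar>hg (\<lambda>y. - \<psi> y) (V, z) x \<xi>\<bar> \<le> real A2 * bd A2 x * Kf A2 (V, z) x \<xi>"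
    using main[OF p\<psi>] by (elim exE)
  \<comment> \<open>The same number becomes the coefficient of \<omega>, the exponent
    \<open>N\<close> of the conclusion and part of \<open>B\<close>: \<open>real A * bd A x\<close>
    equals \<open>A^2 * \<Theta>1^A\<close>, and the factor \<open>m^A\<close> passes from there to
    \<open>\<Theta> A\<close>.\<close>
  define A where "A = A1 + A2"
  define B where "B = real A * real A * real m ^ A"
  have B0: "B \<ge> 0" by (simp add: B_def)
  have step: "0 \<le> e + (B * \<Theta> A x) * (hg (\<lambda>y. - \<Theta>1 y) (V, z) x \<xi> + real A * hw (V, z) x \<xi>)"
    if c: "(V, z) \<in> holo_charts \<A>" and x: "x \<in> V" "x \<notin> D" and A': "A' \<le> A"
      and K: "0 \<le> Kf A' (V, z) x \<xi>" "\<bar>e\<bar> \<le> real A' * bd A' x * Kf A' (V, z) x \<xi>" for V z x \<xi> A' e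
  proof -
    have KA: "Kf A' (V, z) x \<xi> \<le> Kf A (V, z) x \<xi>" by (rule Kf_mono[OF c x(1) A'])
    have "\<bar>e\<bar> \<le> real A' * bd A' x * Kf A' (V, z) x \<xi>" by (rule K(2))
    also have "\<dots> \<le> real A * bd A x * Kf A (V, z) x \<xi>"
      by (rule mult_mono[OF mult_mono[OF _ bd_mono[OF x(2) A']] KA]) (use bd_nonneg[OF x(2)] K(1) A' in simp_all)
    also have "\<dots> \<le> (B * \<Theta> A x) * Kf A (V, z) x \<xi>"
    proof (rule mult_right_mono)
      have "real A * bd A x = (real A * real A) * \<Theta>1 x ^ A" by (simp add: bd_def)
      also have "\<dots> \<le> (real A * real A) * (real m ^ A * \<Theta> A x)" by (rule mult_left_mono[OF \<Theta>1_power_le[OF x(2)]]) simp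
      finally show "real A * bd A x \<le> B * \<Theta> A x" by (simp add: B_def mult.assoc)
      show "0 \<le> Kf A (V, z) x \<xi>" using K(1) KA by linarith
    qed
    finally show ?thesis unfolding Kf_def by linarith
  qed
  have n\<phi>: "mfd_smooth_on \<A> (- D) (\<lambda>y. - \<phi> y)" and n\<psi>: "mfd_smooth_on \<A> (- D) (\<lambda>y. - \<psi> y)"
    by (rule mfd_smooth_on_linear[OF open_minus_D bounded_linear_minus[OF bounded_linear_ident] pre_log_log_smooth[OF p\<phi>]],
        rule mfd_smooth_on_linear[OF open_minus_D bounded_linear_minus[OF bounded_linear_ident] pre_log_log_smooth[OF p\<psi>]])
  have pos: "\<phi> x \<ge> 0 \<and> \<psi> x \<ge> 0" if "x \<in> - D" for x
  proof -
    have "\<bar>f x\<bar> \<le> bd N0 x" "0 \<le> bd N0 x" using N0 bd_nonneg that by blast+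
    then show ?thesis unfolding \<phi>_def \<psi>_def bd_def by linarith
  qed
  have q1: "nonneg_form11_on \<A> (- D) (\<lambda>c x. ddc (\<lambda>y. - \<phi> y) c x + (B * \<Theta> A x) *\<^sub>R (ddc (\<lambda>y. - \<Theta> 1 y) c x + real A *\<^sub>R \<omega> c x))"
    unfolding \<Theta>_one
  proof (rule nonneg_form11_onI[OF n\<phi>])
    fix V z x \<xi> assume c: "(V, z) \<in> holo_charts \<A>" and x: "x \<in> V" "x \<notin> D"
    show "0 \<le> hg (\<lambda>y. - \<phi> y) (V, z) x \<xi> + (B * \<Theta> A x) * (hg (\<lambda>y. - \<Theta>1 y) (V, z) x \<xi> + real A * hw (V, z) x \<xi>)"
      by (rule step[OF c x, of A1]) (use A1 c x in \<open>simp_all add: A_def\<close>)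
  qed
  have q2: "nonneg_form11_on \<A> (- D) (\<lambda>c x. ddc (\<lambda>y. - \<psi> y) c x + (B * \<Theta> A x) *\<^sub>R (ddc (\<lambda>y. - \<Theta> 1 y) c x + real A *\<^sub>R \<omega> c x))"
    unfolding \<Theta>_one
  proof (rule nonneg_form11_onI[OF n\<psi>])
    fix V z x \<xi> assume c: "(V, z) \<in> holo_charts \<A>" and x: "x \<in> V" "x \<notin> D"
    show "0 \<le> hg (\<lambda>y. - \<psi> y) (V, z) x \<xi> + (B * \<Theta> A x) * (hg (\<lambda>y. - \<Theta>1 y) (V, z) x \<xi> + real A * hw (V, z) x \<xi>)"
      by (rule step[OF c x, of A2]) (use A2 c x in \<open>simp_all add: A_def\<close>)
  qed
  show ?thesis
  proof (rule exI[of _ \<phi>], rule exI[of _ \<psi>], rule exI[of _ "real A"], rule exI[of _ B], rule exI[of _ A], intro conjI)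
    show "\<forall>x\<in>- D. 0 \<le> \<phi> x \<and> 0 \<le> \<psi> x" using pos by (rule ballI)
    show "\<forall>x\<in>- D. f x = \<phi> x - \<psi> x" by (simp add: \<phi>_def)
    show "0 \<le> real A" by simp
  qed (rule p\<phi> p\<psi> B0 q1 q2 | rule impI, erule notE[OF False])+
next
  case P: True
  have sf: "mfd_smooth_on \<A> (- D) f" by (rule P_singular_smooth[OF P])
  have P': "P_singular \<A> D (\<lambda>y. - f y)" using P_singular_cmult[OF P, of "-1"] by simp
  obtain N1 :: nat where N1: "\<forall>x. x \<notin> D \<longrightarrow> \<bar>f x\<bar> \<le> real N1 * \<Theta>1 x" using P_singular_bound[OF P] by (elim exE)
  have "\<exists>A::nat. \<forall>x V z \<xi>. x \<notin> D \<longrightarrow> (V, z) \<in> holo_charts \<A> \<longrightarrow> x \<in> V \<longrightarrow>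
    0 \<le> Kf A (V, z) x \<xi> \<and> \<bar>hg (\<lambda>y. - f y) (V, z) x \<xi>\<bar> \<le> real A * real A * Kf A (V, z) x \<xi>"
    by (rule ddc_dominated[where w="\<lambda>N x. real N", OF P_singular_smooth[OF P'] _ _ P_singularD[OF P']]) simp_all
  then obtain A1 :: nat where A1: "\<forall>x V z \<xi>. x \<notin> D \<longrightarrow> (V, z) \<in> holo_charts \<A> \<longrightarrow> x \<in> V \<longrightarrow>
    0 \<le> Kf A1 (V, z) x \<xi> \<and> \<bar>hg (\<lambda>y. - f y) (V, z) x \<xi>\<bar> \<le> real A1 * real A1 * Kf A1 (V, z) x \<xi>" by (elim exE)
  \<comment> \<open>\<open>A1 * A1\<close> bounds the \<open>ddc\<close> of \<open>f\<close> in
    units of the reference form, and \<open>N1\<close> bounds \<open>f\<close> in units of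
    \<Theta>1; \<open>C\<close> meets both requirements on \<psi>.\<close>
  define C where "C = real A1 * real A1 + real N1"
  have C: "0 \<le> C" "real A1 * real A1 \<le> C" "real N1 \<le> C" by (simp_all add: C_def)
  define \<psi> where "\<psi> = (\<lambda>x. C * \<Theta>1 x)"
  define \<phi> where "\<phi> = (\<lambda>x. f x + \<psi> x)"
  have p\<psi>: "pre_log_log \<A> D \<psi>" unfolding \<psi>_def by (rule pre_log_log_mult[OF pre_log_log_const \<Theta>1_pre_log_log])
  have p\<phi>: "pre_log_log \<A> D \<phi>" unfolding \<phi>_def by (rule pre_log_log_add[OF f p\<psi>])
  have s\<psi>: "P_singular \<A> D \<psi>" unfolding \<psi>_def by (rule P_singular_cmult[OF \<Theta>1_P_singular])
  have s\<phi>: "P_singular \<A> D \<phi>" unfolding \<phi>_def by (rule P_singular_add[OF P s\<psi>])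
  \<comment> \<open>\<open>C\<close> times the reference form contains \<open>C * A1\<close> copies
    of \<omega>, as much as (iii) asks for. The additional \<open>A1\<close> keeps the reference
    form in (ii) nonnegative with those copies to spare.\<close>
  define A where "A = real A1 + C * real A1"
  have A0: "A \<ge> 0" using C(1) by (simp add: A_def)
  have pos: "\<phi> x \<ge> 0 \<and> \<psi> x \<ge> 0" if "x \<in> - D" for x
  proof -
    have t: "\<Theta>1 x \<ge> 1" using \<Theta>1_ge_1 that by blast
    have "\<bar>f x\<bar> \<le> real N1 * \<Theta>1 x" using N1 that by blast
    moreover have "real N1 * \<Theta>1 x \<le> C * \<Theta>1 x" using C(3) t by (intro mult_right_mono) auto
    moreover have "0 \<le> C * \<Theta>1 x" using C(1) t by simp
    ultimately show ?thesis unfolding \<phi>_def \<psi>_def by linarith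
  qed
  have n\<phi>: "mfd_smooth_on \<A> (- D) (\<lambda>y. - \<phi> y)" and n\<psi>: "mfd_smooth_on \<A> (- D) (\<lambda>y. - \<psi> y)"
    by (rule mfd_smooth_on_linear[OF open_minus_D bounded_linear_minus[OF bounded_linear_ident] pre_log_log_smooth[OF p\<phi>]],
        rule mfd_smooth_on_linear[OF open_minus_D bounded_linear_minus[OF bounded_linear_ident] pre_log_log_smooth[OF p\<psi>]])
  \<comment> \<open>Since \<psi> is linear in \<Theta>1, no growing weight appears: adding
    \<open>C * A1\<close> copies of \<omega> to \<open>dd^c(-\<psi>)\<close> gives exactly
    \<open>C\<close> times the nonnegative reference form, and this multiple also outweighs
    \<open>dd^c(-f)\<close>.\<close>
  have key: "0 \<le> hg (\<lambda>y. - \<phi> y) (V, z) x \<xi> + C * real A1 * hw (V, z) x \<xi>"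
      "0 \<le> hg (\<lambda>y. - \<psi> y) (V, z) x \<xi> + C * real A1 * hw (V, z) x \<xi>"
      "0 \<le> Kf A1 (V, z) x \<xi>" "0 \<le> hw (V, z) x \<xi>"
    if c: "(V, z) \<in> holo_charts \<A>" and x: "x \<in> V" "x \<notin> D" for V z x \<xi>
  proof -
    have K: "0 \<le> Kf A1 (V, z) x \<xi>" "\<bar>hg (\<lambda>y. - f y) (V, z) x \<xi>\<bar> \<le> real A1 * real A1 * Kf A1 (V, z) x \<xi>" using A1 c x by blast+
    then show "0 \<le> Kf A1 (V, z) x \<xi>" by blast
    show "0 \<le> hw (V, z) x \<xi>" by (rule \<omega>_nonneg(2)[OF c x(1)])
    have e\<psi>: "(\<lambda>y. - \<psi> y) = (\<lambda>y. C * (- \<Theta>1 y))" by (simp add: \<psi>_def)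
    have h\<psi>: "hg (\<lambda>y. - \<psi> y) (V, z) x \<xi> = C * hg (\<lambda>y. - \<Theta>1 y) (V, z) x \<xi>"
      unfolding e\<psi> by (rule hg_cmult[OF neg_\<Theta>1_smooth c x])
    have CK: "C * Kf A1 (V, z) x \<xi> = C * hg (\<lambda>y. - \<Theta>1 y) (V, z) x \<xi> + C * real A1 * hw (V, z) x \<xi>"
      by (simp add: Kf_def distrib_left mult.assoc)
    have CK0: "0 \<le> C * Kf A1 (V, z) x \<xi>" using C(1) K(1) by simp
    then show "0 \<le> hg (\<lambda>y. - \<psi> y) (V, z) x \<xi> + C * real A1 * hw (V, z) x \<xi>" unfolding h\<psi> CK .
    have e\<phi>: "(\<lambda>y. - \<phi> y) = (\<lambda>y. - f y + - \<psi> y)" by (simp add: \<phi>_def)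
    have h\<phi>: "hg (\<lambda>y. - \<phi> y) (V, z) x \<xi> = hg (\<lambda>y. - f y) (V, z) x \<xi> + C * hg (\<lambda>y. - \<Theta>1 y) (V, z) x \<xi>"
      unfolding e\<phi> hg_add[OF P_singular_smooth[OF P'] n\<psi> c x] h\<psi> ..
    have "real A1 * real A1 * Kf A1 (V, z) x \<xi> \<le> C * Kf A1 (V, z) x \<xi>" by (rule mult_right_mono[OF C(2) K(1)])
    then show "0 \<le> hg (\<lambda>y. - \<phi> y) (V, z) x \<xi> + C * real A1 * hw (V, z) x \<xi>" unfolding h\<phi> using K(2) CK by linarith
  qed
  have up: "C * real A1 * hw (V, z) x \<xi> \<le> A * hw (V, z) x \<xi>"
    if c: "(V, z) \<in> holo_charts \<A>" and x: "x \<in> V" "x \<notin> D" for V z x \<xi>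
    by (rule mult_right_mono[OF _ key(4)[OF c x]]) (simp add: A_def)
  \<comment> \<open>With \<open>N = 0\<close> the weight \<open>\<Theta> 0\<close> is the constant
    \<open>m\<close>, which is at least 1, so \<open>B = 1\<close> suffices.\<close>
  have up2: "C * real A1 * hw (V, z) x \<xi> \<le> (1 * \<Theta> 0 x) * (hg (\<lambda>y. - \<Theta>1 y) (V, z) x \<xi> + A * hw (V, z) x \<xi>)"
    if c: "(V, z) \<in> holo_charts \<A>" and x: "x \<in> V" "x \<notin> D" for V z x \<xi>
  proof -
    have e: "hg (\<lambda>y. - \<Theta>1 y) (V, z) x \<xi> + A * hw (V, z) x \<xi> = Kf A1 (V, z) x \<xi> + C * real A1 * hw (V, z) x \<xi>"
      by (simp add: Kf_def A_def distrib_right)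
    have nn: "0 \<le> C * real A1 * hw (V, z) x \<xi>" using C(1) key(4)[OF c x, of \<xi>] by simp
    have "1 * (Kf A1 (V, z) x \<xi> + C * real A1 * hw (V, z) x \<xi>) \<le> real m * (Kf A1 (V, z) x \<xi> + C * real A1 * hw (V, z) x \<xi>)"
      by (rule mult_right_mono) (use m1 key(3)[OF c x, of \<xi>] nn in simp_all)
    then show ?thesis unfolding e \<Theta>_zero mult_1 using key(3)[OF c x, of \<xi>] by linarith
  qed
  have q1: "nonneg_form11_on \<A> (- D) (\<lambda>c x. ddc (\<lambda>y. - \<phi> y) c x + (1 * \<Theta> 0 x) *\<^sub>R (ddc (\<lambda>y. - \<Theta> 1 y) c x + A *\<^sub>R \<omega> c x))"
    unfolding \<Theta>_one by (rule nonneg_form11_onI[OF n\<phi>]) (rule order_trans[OF key(1) add_left_mono[OF up2]])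
  have q2: "nonneg_form11_on \<A> (- D) (\<lambda>c x. ddc (\<lambda>y. - \<psi> y) c x + (1 * \<Theta> 0 x) *\<^sub>R (ddc (\<lambda>y. - \<Theta> 1 y) c x + A *\<^sub>R \<omega> c x))"
    unfolding \<Theta>_one by (rule nonneg_form11_onI[OF n\<psi>]) (rule order_trans[OF key(2) add_left_mono[OF up2]])
  have q3: "nonneg_form11_on \<A> (- D) (\<lambda>c x. ddc (\<lambda>y. - \<phi> y) c x + A *\<^sub>R \<omega> c x)"
    by (rule nonneg_form11_onI'[OF n\<phi>]) (rule order_trans[OF key(1) add_left_mono[OF up]])
  have q4: "nonneg_form11_on \<A> (- D) (\<lambda>c x. ddc (\<lambda>y. - \<psi> y) c x + A *\<^sub>R \<omega> c x)"
    by (rule nonneg_form11_onI'[OF n\<psi>]) (rule order_trans[OF key(2) add_left_mono[OF up]])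
  have fe: "\<forall>x\<in>- D. f x = \<phi> x - \<psi> x" by (simp add: \<phi>_def)
  have b1: "(1::real) \<ge> 0" by simp
  show ?thesis
  proof (rule exI[of _ \<phi>], rule exI[of _ \<psi>], rule exI[of _ A], rule exI[of _ 1], rule exI[of _ 0], intro conjI impI)
    show "\<forall>x\<in>- D. 0 \<le> \<phi> x \<and> 0 \<le> \<psi> x" using pos by (rule ballI)
  qed (rule p\<phi> p\<psi> A0 b1 fe q1 q2 q3 q4 s\<phi> s\<psi> refl)+
qed

end

theorem theorem4p3:
  fixes \<A> :: "('a::t2_space, 'n::finite) chart set"
    and m :: nat and Dc :: "nat \<Rightarrow> 'a set" and D :: "'a set"
    and L :: "nat \<Rightarrow> 'a line_bundle"
    and s :: "nat \<Rightarrow> 'a set \<Rightarrow> 'a \<Rightarrow> complex"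
    and h :: "nat \<Rightarrow> 'a set \<Rightarrow> 'a \<Rightarrow> real"
    and \<Theta> :: "nat \<Rightarrow> 'a \<Rightarrow> real"
    and \<omega> :: "('a, 'n) form11"
    and f :: "'a \<Rightarrow> real"
  assumes "compact (UNIV :: 'a set)" and "complex_atlas \<A>"
    and "m \<ge> 1" and "snc_divisor \<A> m Dc" and "D = (\<Union>k\<in>{1..m}. Dc k)"
    and "\<And>k. k \<in> {1..m} \<Longrightarrow> is_O_of \<A> (L k) (Dc k)"
    and "\<And>k. k \<in> {1..m} \<Longrightarrow> holo_section \<A> (L k) (s k)"
    and "\<And>k. k \<in> {1..m} \<Longrightarrow> section_divisor \<A> (L k) (s k) (Dc k)"
    and "\<And>k. k \<in> {1..m} \<Longrightarrow> smooth_metric \<A> (L k) (h k)"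
    and "\<And>k x. k \<in> {1..m} \<Longrightarrow> section_norm_sq (L k) (h k) (s k) x \<le> exp (- exp 1)"
    and "\<And>N x. \<Theta> N x = (\<Sum>k=1..m. ln (ln (1 / section_norm_sq (L k) (h k) (s k) x)) ^ N)"
    and "smooth_form11 \<A> \<omega>" and "positive_form11 \<A> \<omega>"
    and "pre_log_log \<A> D f"
  shows "\<exists>(\<phi> :: 'a \<Rightarrow> real) (\<psi> :: 'a \<Rightarrow> real) (A :: real) (B :: real) (N :: nat).
    pre_log_log \<A> D \<phi> \<and> pre_log_log \<A> D \<psi> \<and>
    (\<forall>x\<in>- D. \<phi> x \<ge> 0 \<and> \<psi> x \<ge> 0) \<and> A \<ge> 0 \<and> B \<ge> 0 \<and>
    (\<forall>x\<in>- D. f x = \<phi> x - \<psi> x) \<and>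
    nonneg_form11_on \<A> (- D) (\<lambda>c x. ddc (\<lambda>y. - \<phi> y) c x
      + (B * \<Theta> N x) *\<^sub>R (ddc (\<lambda>y. - \<Theta> 1 y) c x + A *\<^sub>R \<omega> c x)) \<and>
    nonneg_form11_on \<A> (- D) (\<lambda>c x. ddc (\<lambda>y. - \<psi> y) c x
      + (B * \<Theta> N x) *\<^sub>R (ddc (\<lambda>y. - \<Theta> 1 y) c x + A *\<^sub>R \<omega> c x)) \<and>
    (P_singular \<A> D f \<longrightarrow> N = 0 \<and> P_singular \<A> D \<phi> \<and> P_singular \<A> D \<psi> \<and>
      nonneg_form11_on \<A> (- D) (\<lambda>c x. ddc (\<lambda>y. - \<phi> y) c x + A *\<^sub>R \<omega> c x) \<and>
      nonneg_form11_on \<A> (- D) (\<lambda>c x. ddc (\<lambda>y. - \<psi> y) c x + A *\<^sub>R \<omega> c x))"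
proof -
  interpret F: snc_pair_form \<A> m Dc D L s h \<omega>
  proof unfold_locales
    show "holo_line_bundle \<A> (L k)" if "k \<in> {1..m}" for k using assms(6)[OF that] by (simp add: is_O_of_def)
  qed (fact assms)+
  have "\<Theta> = F.\<Theta>" by (simp add: fun_eq_iff assms(11) F.\<Theta>_def F.lg_def)
  show ?thesis unfolding \<open>\<Theta> = F.\<Theta>\<close> by (rule F.decomposition[OF assms(14)])
qed

end
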